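(* Let $p$ be an odd prime, let $\Gamma$ be the $p$-Sylow subgroup of $\mathbb{Z}_p^\times$ (so $\Gamma \cong \mathbb{Z}_p$), and let $\mathcal{O}$ be the ring of integers of a finite extension of $\mathbb{Q}_p$. Let $G$ be a compact $p$-adic Lie group and let $H$ be a closed normal subgroup of $G$ such that $G/H$ is isomorphic to $\Gamma$. Let $M$ be a (left) $\Lambda_{\mathcal{O}}(G)$-module which is finitely generated over $\Lambda_{\mathcal{O}}(H)$. Then there exists a continuous character $\rho:\Gamma\to\mathbb{Z}_p^\times$ such that the largest $U$-coinvariant quotient $M(\rho)_U$ of $M(\rho)$ is finite for every open normal subgroup $U$ of $G$.
   Context: For a compact $p$-adic Lie group $G$, $\Lambda_{\mathcal{O}}(G)=\mathcal{O}[[G]]$ denotes the Iwasawa algebra (completed group ring) of $G$ with coefficients in $\mathcal{O}$. For a continuous character $\rho:\Gamma\to\mathbb{Z}_p^\times$, $\mathbb{Z}_p(\rho)$ is a free $\mathbb{Z}_p$-module of rank one on which $G$ acts through $G\twoheadrightarrow G/H\cong\Gamma\xrightarrow{\rho}\mathbb{Z}_p^\times$, and $M(\rho)=M\otimes_{\mathbb{Z}_p}\mathbb{Z}_p(\rho)$ with the diagonal $G$-action. For a subgroup $U$, $M(\rho)_U$ denotes the largest quotient of $M(\rho)$ on which $U$ acts trivially. *)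

theory Defs
  imports
    "HOL-Analysis.Abstract_Metric_Spaces"
    "HOL-Analysis.Function_Topology"
    "HOL-Algebra.Algebra"
begin

section \<open>The p-adic numbers\<close>

text \<open>The field of p-adic numbers is the completion of the rationals for the p-adic absolute value:
  Cauchy sequences modulo null sequences.\<close>

definition padic_abs :: "nat \<Rightarrow> rat \<Rightarrow> real" where
  "padic_abs p r = (if r = 0 then 0 else
     real p powi (int (multiplicity (int p) (snd (quotient_of r)))
                - int (multiplicity (int p) (fst (quotient_of r)))))"

definition padic_Cauchy_ring :: "nat \<Rightarrow> (nat \<Rightarrow> rat) ring" where
  "padic_Cauchy_ring p =
     \<lparr>carrier = {x. \<forall>e>0. \<exists>N. \<forall>m\<ge>N. \<forall>n\<ge>N. padic_abs p (x m - x n) < e},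
      monoid.mult = (\<lambda>x y n. x n * y n), one = (\<lambda>n. 1),
      ring.zero = (\<lambda>n. 0), add = (\<lambda>x y n. x n + y n)\<rparr>"

definition padic_null_ideal :: "nat \<Rightarrow> (nat \<Rightarrow> rat) set" where
  "padic_null_ideal p = {x. (\<lambda>n. padic_abs p (x n)) \<longlonglongrightarrow> 0}"

type_synonym padic = "(nat \<Rightarrow> rat) set"

definition Qp :: "nat \<Rightarrow> padic ring" where
  "Qp p = padic_Cauchy_ring p Quot padic_null_ideal p"

text \<open>The limit does not depend on the representing sequence.\<close>

definition Qp_norm :: "nat \<Rightarrow> padic \<Rightarrow> real" where
  "Qp_norm p a = lim (\<lambda>n. padic_abs p ((SOME x. x \<in> a) n))"

text \<open>The library's locale for metric spaces demands symmetry and nonnegativity also off the carrier,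
  whence the value 0 there.\<close>

definition Qp_dist :: "nat \<Rightarrow> padic \<Rightarrow> padic \<Rightarrow> real" where
  "Qp_dist p x y =
     (if x \<in> carrier (Qp p) \<and> y \<in> carrier (Qp p) then Qp_norm p (x \<ominus>\<^bsub>Qp p\<^esub> y) else 0)"

definition Qp_top :: "nat \<Rightarrow> padic topology" where
  "Qp_top p = Metric_space.mtopology (carrier (Qp p)) (Qp_dist p)"

definition Zp :: "nat \<Rightarrow> padic ring" where
  "Zp p = (Qp p)\<lparr>carrier := {x \<in> carrier (Qp p). Qp_norm p x \<le> 1}\<rparr>"

abbreviation Zp_units :: "nat \<Rightarrow> padic monoid" where
  "Zp_units p \<equiv> units_of (Zp p)"

definition Zp_units_top :: "nat \<Rightarrow> padic topology" where
  "Zp_units_top p = subtopology (Qp_top p) (carrier (Zp_units p))"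

section \<open>Finite extensions and their rings of integers\<close>

definition Qp_finite_extension ::
    "nat \<Rightarrow> ('k, 'x) ring_scheme \<Rightarrow> (padic \<Rightarrow> 'k) \<Rightarrow> bool" where
  "Qp_finite_extension p K \<iota> \<longleftrightarrow>
     field K \<and> \<iota> \<in> ring_hom (Qp p) K \<and>
     ring.finite_dimension K (\<iota> ` carrier (Qp p)) (carrier K)"

text \<open>The integral closure of the p-adic integers in \<open>K\<close>; polynomials are coefficient lists with the
  leading coefficient first.\<close>

definition ring_of_integers ::
    "nat \<Rightarrow> ('k, 'x) ring_scheme \<Rightarrow> (padic \<Rightarrow> 'k) \<Rightarrow> ('k, 'x) ring_scheme" where
  "ring_of_integers p K \<iota> =
     K\<lparr>carrier := {x \<in> carrier K. \<exists>f. f \<noteq> [] \<and> hd f = \<one>\<^bsub>K\<^esub> \<and>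
        set f \<subseteq> \<iota> ` carrier (Zp p) \<and> ring.eval K f x = \<zero>\<^bsub>K\<^esub>}\<rparr>"

section \<open>Topological groups\<close>

definition topological_group :: "('g, 'y) monoid_scheme \<Rightarrow> 'g topology \<Rightarrow> bool" where
  "topological_group G T \<longleftrightarrow>
     group G \<and> topspace T = carrier G \<and>
     continuous_map (prod_topology T T) T (\<lambda>(x, y). x \<otimes>\<^bsub>G\<^esub> y) \<and>
     continuous_map T T (\<lambda>x. inv\<^bsub>G\<^esub> x)"

definition open_normal :: "('g, 'y) monoid_scheme \<Rightarrow> 'g topology \<Rightarrow> 'g set set" where
  "open_normal G T = {U. U \<lhd> G \<and> openin T U}"

definition quotient_group_top :: "('g, 'y) monoid_scheme \<Rightarrow> 'g topology \<Rightarrow> 'g set \<Rightarrow> 'g set topology"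
  where "quotient_group_top G T H =
    topology (\<lambda>W. W \<subseteq> carrier (G Mod H) \<and> openin T {g \<in> carrier G. H #>\<^bsub>G\<^esub> g \<in> W})"

definition top_group_iso ::
    "('a, 'x) monoid_scheme \<Rightarrow> 'a topology \<Rightarrow> ('b, 'y) monoid_scheme \<Rightarrow> 'b topology \<Rightarrow> ('a \<Rightarrow> 'b) \<Rightarrow> bool"
  where "top_group_iso A S B T f \<longleftrightarrow> f \<in> iso A B \<and> homeomorphic_map S T f"

text \<open>A p-Sylow subgroup \<open>P\<close> of a profinite group: a closed pro-p subgroup of index prime to p.
  Orders and indices are supernatural numbers, the least common multiples of the orders of
  \<open>P / (P \<inter> U)\<close> and of the indices of \<open>P U\<close> for \<open>U\<close> open normal, so the two
  conditions are tested at every \<open>U\<close>.\<close>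

definition profinite_Sylow ::
    "nat \<Rightarrow> ('g, 'y) monoid_scheme \<Rightarrow> 'g topology \<Rightarrow> 'g set \<Rightarrow> bool" where
  "profinite_Sylow p G T P \<longleftrightarrow>
     subgroup P G \<and> closedin T P \<and>
     (\<forall>U \<in> open_normal G T.
        (\<exists>k. card (rcosets\<^bsub>G\<lparr>carrier := P\<rparr>\<^esub> (P \<inter> U)) = p ^ k) \<and>
        coprime p (card (rcosets\<^bsub>G\<^esub> (P <#>\<^bsub>G\<^esub> U))))"

text \<open>Continuous characters of a group of p-adic units with values in the p-adic units.\<close>

definition continuous_character :: "nat \<Rightarrow> padic set \<Rightarrow> (padic \<Rightarrow> padic) \<Rightarrow> bool" where
  "continuous_character p \<Gamma> \<rho> \<longleftrightarrow>
     \<rho> \<in> hom ((Zp_units p)\<lparr>carrier := \<Gamma>\<rparr>) (Zp_units p) \<and>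
     continuous_map (subtopology (Zp_units_top p) \<Gamma>) (Zp_units_top p) \<rho>"

section \<open>p-adic Lie groups\<close>

text \<open>Points of n-dimensional p-adic space are functions extensional on \<open>{..<n}\<close>.\<close>

definition Qp_space :: "nat \<Rightarrow> nat \<Rightarrow> (nat \<Rightarrow> padic) topology" where
  "Qp_space p n = product_topology (\<lambda>i. Qp_top p) {..<n}"

definition vec_fst :: "nat \<Rightarrow> (nat \<Rightarrow> 'a) \<Rightarrow> nat \<Rightarrow> 'a" where
  "vec_fst n z = (\<lambda>i\<in>{..<n}. z i)"

definition vec_snd :: "nat \<Rightarrow> (nat \<Rightarrow> 'a) \<Rightarrow> nat \<Rightarrow> 'a" where
  "vec_snd n z = (\<lambda>i\<in>{..<n}. z (n + i))"

definition multi_indices :: "nat \<Rightarrow> (nat \<Rightarrow> nat) set" where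
  "multi_indices n = {\<alpha>. \<forall>i\<ge>n. \<alpha> i = 0}"

definition padic_monomial :: "nat \<Rightarrow> nat \<Rightarrow> (nat \<Rightarrow> nat) \<Rightarrow> (nat \<Rightarrow> padic) \<Rightarrow> padic" where
  "padic_monomial p n \<alpha> x = (\<Otimes>\<^bsub>Qp p\<^esub>i\<in>{..<n}. x i [^]\<^bsub>Qp p\<^esub> \<alpha> i)"

text \<open>Local representability by convergent power series around every point of \<open>D\<close>, which is
  meant to be an open subset of \<open>Qp_space p n\<close>.\<close>

definition padic_analytic ::
    "nat \<Rightarrow> nat \<Rightarrow> (nat \<Rightarrow> padic) set \<Rightarrow> ((nat \<Rightarrow> padic) \<Rightarrow> padic) \<Rightarrow> bool" where
  "padic_analytic p n D f \<longleftrightarrow>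
     (\<forall>a\<in>D. \<exists>r>0. \<exists>c. (\<forall>\<alpha>\<in>multi_indices n. c \<alpha> \<in> carrier (Qp p)) \<and>
        (\<forall>x\<in>D. (\<forall>i<n. Qp_dist p (x i) (a i) < r) \<longrightarrow>
           limitin (Qp_top p)
             (\<lambda>F. \<Oplus>\<^bsub>Qp p\<^esub>\<alpha>\<in>F. c \<alpha> \<otimes>\<^bsub>Qp p\<^esub> padic_monomial p n \<alpha> (\<lambda>i. x i \<ominus>\<^bsub>Qp p\<^esub> a i))
             (f x) (finite_subsets_at_top (multi_indices n))))"

definition padic_analytic_map ::
    "nat \<Rightarrow> nat \<Rightarrow> nat \<Rightarrow> (nat \<Rightarrow> padic) set \<Rightarrow> ((nat \<Rightarrow> padic) \<Rightarrow> nat \<Rightarrow> padic) \<Rightarrow> bool" where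
  "padic_analytic_map p n m D F \<longleftrightarrow> (\<forall>j<m. padic_analytic p n D (\<lambda>x. F x j))"

definition padic_chart ::
    "nat \<Rightarrow> nat \<Rightarrow> 'g topology \<Rightarrow> 'g set \<Rightarrow> ('g \<Rightarrow> nat \<Rightarrow> padic) \<Rightarrow> bool" where
  "padic_chart p n T W \<phi> \<longleftrightarrow>
     openin T W \<and> openin (Qp_space p n) (\<phi> ` W) \<and>
     homeomorphic_map (subtopology T W) (subtopology (Qp_space p n) (\<phi> ` W)) \<phi>"

definition padic_atlas ::
    "nat \<Rightarrow> nat \<Rightarrow> 'g topology \<Rightarrow> ('g set \<times> ('g \<Rightarrow> nat \<Rightarrow> padic)) set \<Rightarrow> bool" where
  "padic_atlas p n T \<A> \<longleftrightarrow>
     (\<forall>(W, \<phi>)\<in>\<A>. padic_chart p n T W \<phi>) \<and>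
     topspace T = (\<Union>(W, \<phi>)\<in>\<A>. W) \<and>
     (\<forall>(W, \<phi>)\<in>\<A>. \<forall>(W', \<phi>')\<in>\<A>.
        padic_analytic_map p n n (\<phi> ` (W \<inter> W')) (\<lambda>x. \<phi>' (inv_into W \<phi> x)))"

text \<open>Multiplication and inversion are analytic when read in the charts; a pair of points of
  n-dimensional space is a point of 2n-dimensional space.\<close>

definition padic_Lie_group :: "nat \<Rightarrow> ('g, 'y) monoid_scheme \<Rightarrow> 'g topology \<Rightarrow> bool" where
  "padic_Lie_group p G T \<longleftrightarrow>
     topological_group G T \<and> Hausdorff_space T \<and>
     (\<exists>n \<A>. padic_atlas p n T \<A> \<and>
        (\<forall>(W1, \<phi>1)\<in>\<A>. \<forall>(W2, \<phi>2)\<in>\<A>. \<forall>(W3, \<phi>3)\<in>\<A>.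
           let m = (\<lambda>z. inv_into W1 \<phi>1 (vec_fst n z) \<otimes>\<^bsub>G\<^esub> inv_into W2 \<phi>2 (vec_snd n z))
           in padic_analytic_map p (2 * n) n
                {z \<in> topspace (Qp_space p (2 * n)).
                   vec_fst n z \<in> \<phi>1 ` W1 \<and> vec_snd n z \<in> \<phi>2 ` W2 \<and> m z \<in> W3}
                (\<lambda>z. \<phi>3 (m z))) \<and>
        (\<forall>(W1, \<phi>1)\<in>\<A>. \<forall>(W2, \<phi>2)\<in>\<A>.
           let m = (\<lambda>x. inv\<^bsub>G\<^esub> (inv_into W1 \<phi>1 x))
           in padic_analytic_map p n n {x \<in> \<phi>1 ` W1. m x \<in> W2} (\<lambda>x. \<phi>2 (m x))))"

section \<open>Group rings and Iwasawa algebras\<close>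

definition group_ring ::
    "('k, 'x) ring_scheme \<Rightarrow> ('q, 'y) monoid_scheme \<Rightarrow> ('q \<Rightarrow> 'k) ring" where
  "group_ring R Q =
     \<lparr>carrier = {f. (\<forall>x\<in>carrier Q. f x \<in> carrier R) \<and> (\<forall>x. x \<notin> carrier Q \<longrightarrow> f x = \<zero>\<^bsub>R\<^esub>) \<and>
                    finite {x. f x \<noteq> \<zero>\<^bsub>R\<^esub>}},
      monoid.mult = (\<lambda>f g x. if x \<in> carrier Q
         then \<Oplus>\<^bsub>R\<^esub>y\<in>{y \<in> carrier Q. f y \<noteq> \<zero>\<^bsub>R\<^esub>}. f y \<otimes>\<^bsub>R\<^esub> g (inv\<^bsub>Q\<^esub> y \<otimes>\<^bsub>Q\<^esub> x) else \<zero>\<^bsub>R\<^esub>),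
      one = (\<lambda>x. if x = \<one>\<^bsub>Q\<^esub> then \<one>\<^bsub>R\<^esub> else \<zero>\<^bsub>R\<^esub>),
      ring.zero = (\<lambda>x. \<zero>\<^bsub>R\<^esub>),
      add = (\<lambda>f g x. f x \<oplus>\<^bsub>R\<^esub> g x)\<rparr>"

text \<open>The map of group rings induced by a group homomorphism \<open>h\<close> with domain \<open>Q\<close>.\<close>

definition group_ring_map ::
    "('k, 'x) ring_scheme \<Rightarrow> ('q, 'y) monoid_scheme \<Rightarrow> ('q \<Rightarrow> 'r) \<Rightarrow> ('q \<Rightarrow> 'k) \<Rightarrow> 'r \<Rightarrow> 'k" where
  "group_ring_map R Q h f = (\<lambda>y. \<Oplus>\<^bsub>R\<^esub>x\<in>{x \<in> carrier Q. f x \<noteq> \<zero>\<^bsub>R\<^esub> \<and> h x = y}. f x)"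

text \<open>The projective limit of the group rings \<open>R[G/U]\<close> over the open normal subgroups \<open>U\<close>.
  For \<open>U \<subseteq> V\<close> the projection \<open>G/U \<rightarrow> G/V\<close> is \<open>A \<mapsto> A V\<close>.\<close>

definition Iwasawa_algebra ::
    "('k, 'x) ring_scheme \<Rightarrow> ('g, 'y) monoid_scheme \<Rightarrow> 'g topology \<Rightarrow> ('g set \<Rightarrow> 'g set \<Rightarrow> 'k) ring"
  where
  "Iwasawa_algebra R G T =
     \<lparr>carrier = {l \<in> (\<Pi>\<^sub>E U\<in>open_normal G T. carrier (group_ring R (G Mod U))).
        \<forall>U\<in>open_normal G T. \<forall>V\<in>open_normal G T. U \<subseteq> V \<longrightarrow>
          group_ring_map R (G Mod U) (\<lambda>A. A <#>\<^bsub>G\<^esub> V) (l U) = l V},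
      monoid.mult = (\<lambda>k l. \<lambda>U\<in>open_normal G T. k U \<otimes>\<^bsub>group_ring R (G Mod U)\<^esub> l U),
      one = (\<lambda>U\<in>open_normal G T. \<one>\<^bsub>group_ring R (G Mod U)\<^esub>),
      ring.zero = (\<lambda>U\<in>open_normal G T. \<zero>\<^bsub>group_ring R (G Mod U)\<^esub>),
      add = (\<lambda>k l. \<lambda>U\<in>open_normal G T. k U \<oplus>\<^bsub>group_ring R (G Mod U)\<^esub> l U)\<rparr>"

text \<open>The canonical maps into the Iwasawa algebra of \<open>G\<close>: from \<open>G\<close>, from \<open>R\<close>, and
  from the Iwasawa algebra of a closed subgroup \<open>H\<close> (the last one is induced by
  \<open>H/(H \<inter> U) \<rightarrow> G/U\<close>).\<close>

definition Iwasawa_of_elem ::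
    "('k, 'x) ring_scheme \<Rightarrow> ('g, 'y) monoid_scheme \<Rightarrow> 'g topology \<Rightarrow> 'g \<Rightarrow> 'g set \<Rightarrow> 'g set \<Rightarrow> 'k"
  where "Iwasawa_of_elem R G T g =
    (\<lambda>U\<in>open_normal G T. \<lambda>A. if A = U #>\<^bsub>G\<^esub> g then \<one>\<^bsub>R\<^esub> else \<zero>\<^bsub>R\<^esub>)"

definition Iwasawa_of_scalar ::
    "('k, 'x) ring_scheme \<Rightarrow> ('g, 'y) monoid_scheme \<Rightarrow> 'g topology \<Rightarrow> 'k \<Rightarrow> 'g set \<Rightarrow> 'g set \<Rightarrow> 'k"
  where "Iwasawa_of_scalar R G T c =
    (\<lambda>U\<in>open_normal G T. \<lambda>A. if A = \<one>\<^bsub>G Mod U\<^esub> then c else \<zero>\<^bsub>R\<^esub>)"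

definition Iwasawa_of_subgroup ::
    "('k, 'x) ring_scheme \<Rightarrow> ('g, 'y) monoid_scheme \<Rightarrow> 'g topology \<Rightarrow> 'g set \<Rightarrow>
     ('g set \<Rightarrow> 'g set \<Rightarrow> 'k) \<Rightarrow> 'g set \<Rightarrow> 'g set \<Rightarrow> 'k"
  where "Iwasawa_of_subgroup R G T H l =
    (\<lambda>U\<in>open_normal G T.
       group_ring_map R (G\<lparr>carrier := H\<rparr> Mod (H \<inter> U)) (\<lambda>A. A <#>\<^bsub>G\<^esub> U) (l (H \<inter> U)))"

section \<open>Modules\<close>

text \<open>The library's locale \<open>module\<close> is restricted to commutative rings of scalars. The ring axioms
  for the scalars are not repeated as assumptions here; all rings of scalars below are concrete.\<close>

locale left_module = M?: abelian_group M
  for R :: "('a, 'x) ring_scheme" and M :: "('a, 'm, 'y) module_scheme" +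
  assumes smult_closed:
      "\<lbrakk>a \<in> carrier R; x \<in> carrier M\<rbrakk> \<Longrightarrow> a \<odot>\<^bsub>M\<^esub> x \<in> carrier M"
    and smult_l_distr:
      "\<lbrakk>a \<in> carrier R; b \<in> carrier R; x \<in> carrier M\<rbrakk> \<Longrightarrow>
        (a \<oplus>\<^bsub>R\<^esub> b) \<odot>\<^bsub>M\<^esub> x = a \<odot>\<^bsub>M\<^esub> x \<oplus>\<^bsub>M\<^esub> b \<odot>\<^bsub>M\<^esub> x"
    and smult_r_distr:
      "\<lbrakk>a \<in> carrier R; x \<in> carrier M; y \<in> carrier M\<rbrakk> \<Longrightarrow>
        a \<odot>\<^bsub>M\<^esub> (x \<oplus>\<^bsub>M\<^esub> y) = a \<odot>\<^bsub>M\<^esub> x \<oplus>\<^bsub>M\<^esub> a \<odot>\<^bsub>M\<^esub> y"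
    and smult_assoc:
      "\<lbrakk>a \<in> carrier R; b \<in> carrier R; x \<in> carrier M\<rbrakk> \<Longrightarrow>
        (a \<otimes>\<^bsub>R\<^esub> b) \<odot>\<^bsub>M\<^esub> x = a \<odot>\<^bsub>M\<^esub> (b \<odot>\<^bsub>M\<^esub> x)"
    and smult_one: "x \<in> carrier M \<Longrightarrow> \<one>\<^bsub>R\<^esub> \<odot>\<^bsub>M\<^esub> x = x"

definition restrict_scalars ::
    "('b \<Rightarrow> 'a) \<Rightarrow> ('a, 'm, 'y) module_scheme \<Rightarrow> ('b, 'm) module" where
  "restrict_scalars f M =
     \<lparr>carrier = carrier M, monoid.mult = monoid.mult M, one = one M,
      ring.zero = ring.zero M, add = add M,
      smult = (\<lambda>b x. f b \<odot>\<^bsub>M\<^esub> x)\<rparr>"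

definition finitely_generated_module ::
    "('a, 'x) ring_scheme \<Rightarrow> ('a, 'm, 'y) module_scheme \<Rightarrow> bool" where
  "finitely_generated_module R M \<longleftrightarrow>
     (\<exists>S. finite S \<and> S \<subseteq> carrier M \<and>
        (\<forall>x\<in>carrier M. \<exists>c\<in>S \<rightarrow> carrier R. x = (\<Oplus>\<^bsub>M\<^esub>s\<in>S. c s \<odot>\<^bsub>M\<^esub> s)))"

definition regular_module :: "('a, 'x) ring_scheme \<Rightarrow> ('a, 'a) module" where
  "regular_module R =
     \<lparr>carrier = carrier R, monoid.mult = monoid.mult R, one = one R,
      ring.zero = ring.zero R, add = add R, smult = monoid.mult R\<rparr>"

text \<open>The tensor product of two modules over a commutative ring, as an abelian group (written
  multiplicatively): the free abelian group on pairs modulo the bilinearity relations.\<close>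

definition tensor_relations ::
    "('a, 'x) ring_scheme \<Rightarrow> ('a, 'm, 'y) module_scheme \<Rightarrow> ('a, 'n, 'z) module_scheme \<Rightarrow>
     ('m \<times> 'n \<Rightarrow>\<^sub>0 int) set" where
  "tensor_relations R M N =
     generate (free_Abelian_group (carrier M \<times> carrier N))
      ({frag_of (x \<oplus>\<^bsub>M\<^esub> x', y) - frag_of (x, y) - frag_of (x', y) | x x' y.
          x \<in> carrier M \<and> x' \<in> carrier M \<and> y \<in> carrier N} \<union>
       {frag_of (x, y \<oplus>\<^bsub>N\<^esub> y') - frag_of (x, y) - frag_of (x, y') | x y y'.
          x \<in> carrier M \<and> y \<in> carrier N \<and> y' \<in> carrier N} \<union>
       {frag_of (a \<odot>\<^bsub>M\<^esub> x, y) - frag_of (x, a \<odot>\<^bsub>N\<^esub> y) | a x y.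
          a \<in> carrier R \<and> x \<in> carrier M \<and> y \<in> carrier N})"

definition tensor_product ::
    "('a, 'x) ring_scheme \<Rightarrow> ('a, 'm, 'y) module_scheme \<Rightarrow> ('a, 'n, 'z) module_scheme \<Rightarrow>
     ('m \<times> 'n \<Rightarrow>\<^sub>0 int) set monoid" where
  "tensor_product R M N =
     free_Abelian_group (carrier M \<times> carrier N) Mod tensor_relations R M N"

text \<open>The endomorphism \<open>f \<otimes> g\<close> of the tensor product, computed on cosets of the relations.\<close>

definition tensor_map ::
    "('a, 'x) ring_scheme \<Rightarrow> ('a, 'm, 'y) module_scheme \<Rightarrow> ('a, 'n, 'z) module_scheme \<Rightarrow>
     ('m \<Rightarrow> 'm) \<Rightarrow> ('n \<Rightarrow> 'n) \<Rightarrow> ('m \<times> 'n \<Rightarrow>\<^sub>0 int) set \<Rightarrow> ('m \<times> 'n \<Rightarrow>\<^sub>0 int) set" where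
  "tensor_map R M N f g t =
     tensor_relations R M N <#>\<^bsub>free_Abelian_group (carrier M \<times> carrier N)\<^esub>
       frag_extend (\<lambda>(x, y). frag_of (f x, g y)) ` t"

section \<open>Twists and coinvariants\<close>

text \<open>\<open>M(\<rho>) = M \<otimes> Zp(\<rho>)\<close> for a character \<open>\<psi>\<close> of \<open>G\<close> with values in the p-adic units
  (to be the composite of \<open>G \<rightarrow> G/H \<cong> \<Gamma>\<close> with \<open>\<rho>\<close>): the tensor product is over the p-adic
  integers, which act on \<open>M\<close> through \<open>Zp \<rightarrow> R \<rightarrow> R[[G]]\<close>; the rank one module is
  \<open>Zp\<close> itself, on which \<open>g\<close> acts as multiplication by \<open>\<psi> g\<close>.\<close>

definition Zp_scalars ::
    "('k, 'x) ring_scheme \<Rightarrow> (padic \<Rightarrow> 'k) \<Rightarrow> ('g, 'y) monoid_scheme \<Rightarrow> 'g topology \<Rightarrow>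
     ('g set \<Rightarrow> 'g set \<Rightarrow> 'k, 'm) module \<Rightarrow> (padic, 'm) module" where
  "Zp_scalars R \<iota> G T M = restrict_scalars (\<lambda>a. Iwasawa_of_scalar R G T (\<iota> a)) M"

definition twist ::
    "nat \<Rightarrow> ('k, 'x) ring_scheme \<Rightarrow> (padic \<Rightarrow> 'k) \<Rightarrow> ('g, 'y) monoid_scheme \<Rightarrow> 'g topology \<Rightarrow>
     ('g set \<Rightarrow> 'g set \<Rightarrow> 'k, 'm) module \<Rightarrow> ('m \<times> padic \<Rightarrow>\<^sub>0 int) set monoid" where
  "twist p R \<iota> G T M = tensor_product (Zp p) (Zp_scalars R \<iota> G T M) (regular_module (Zp p))"

definition twist_action ::
    "nat \<Rightarrow> ('k, 'x) ring_scheme \<Rightarrow> (padic \<Rightarrow> 'k) \<Rightarrow> ('g, 'y) monoid_scheme \<Rightarrow> 'g topology \<Rightarrow>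
     ('g set \<Rightarrow> 'g set \<Rightarrow> 'k, 'm) module \<Rightarrow> ('g \<Rightarrow> padic) \<Rightarrow>
     'g \<Rightarrow> ('m \<times> padic \<Rightarrow>\<^sub>0 int) set \<Rightarrow> ('m \<times> padic \<Rightarrow>\<^sub>0 int) set" where
  "twist_action p R \<iota> G T M \<psi> g =
     tensor_map (Zp p) (Zp_scalars R \<iota> G T M) (regular_module (Zp p))
       (\<lambda>x. Iwasawa_of_elem R G T g \<odot>\<^bsub>M\<^esub> x) (\<lambda>a. \<psi> g \<otimes>\<^bsub>Zp p\<^esub> a)"

text \<open>The largest quotient, on which \<open>U\<close> acts trivially, of an abelian group \<open>A\<close> (written
  multiplicatively) with an action of \<open>G\<close>: the quotient by the smallest \<open>G\<close>-stable subgroup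
  modulo which \<open>U\<close> acts trivially. For \<open>U\<close> normal in \<open>G\<close> that subgroup is generated
  by the elements \<open>act u x / x\<close>, so it is stable under every endomorphism of \<open>A\<close> that commutes
  with \<open>U\<close>, such as scalars.\<close>

definition coinvariants ::
    "('g, 'y) monoid_scheme \<Rightarrow> ('a, 'z) monoid_scheme \<Rightarrow> ('g \<Rightarrow> 'a \<Rightarrow> 'a) \<Rightarrow> 'g set \<Rightarrow> 'a set monoid"
  where "coinvariants G A act U =
    A Mod \<Inter>{N. subgroup N A \<and> (\<forall>g\<in>carrier G. \<forall>x\<in>N. act g x \<in> N) \<and>
              (\<forall>u\<in>U. \<forall>x\<in>carrier A. act u x \<otimes>\<^bsub>A\<^esub> inv\<^bsub>A\<^esub> x \<in> N)}"

end

theory Submission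
  imports Defs "HOL-Number_Theory.Residues"
begin

text \<open>
  In a chart around the identity the \<open>p\<close>-th power map is approximately multiplication by \<open>p\<close>. Hence
  \<open>H\<close> contains, close to the identity, a finite set \<open>S\<close> whose \<open>p^j\<close>-th powers represent the successive
  quotients of a filtration of \<open>H\<close>, and every element of the Iwasawa algebra of \<open>H\<close> is a combination of
  finitely many group elements plus a sum \<open>\<Sum>s\<in>S. (s - 1) D s\<close>. So \<open>M\<close> is finitely generated over the
  p-adic integers modulo the span of the elements \<open>(v - 1) m\<close> with \<open>v \<in> H \<inter> U\<close>. Take \<open>u \<in> U\<close> outside
  \<open>H\<close>. By noetherianity each generator satisfies a monic relation in the powers of \<open>u\<close> modulo that span.
  In the coinvariants of \<open>M(\<rho>)\<close> the element \<open>u\<close> acts on \<open>M\<close> as a scalar determined by \<open>\<rho>\<close>, so unless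
  this scalar is a root of the monic polynomial, a nonzero p-adic integer kills the generator. Thus for
  each \<open>U\<close> only finitely many values of \<open>\<rho>\<close> at \<open>u\<close> are bad. The open normal subgroups have a countable
  cofinal family, while the characters \<open>x \<mapsto> x^s\<close>, \<open>s\<close> a p-adic integer, are uncountably many and each
  is determined by its value at any single element other than 1; so some \<open>\<rho>\<close> avoids all bad values.
\<close>

section \<open>The field of p-adic numbers\<close>

locale padic =
 fixes p :: nat
 assumes prime_p: "Factorial_Ring.prime p"
begin

definition q :: real where "q = 1 / real p"

lemma p_ge2: "p \<ge> 2" using prime_p by (rule prime_ge_2_nat)
lemma q_pos: "q > 0" and q_less1: "q < 1" using p_ge2 by (auto simp: q_def)
lemma q_pow_pos [simp]: "q ^ k > 0" using q_pos by simp
lemma q_pow_le1 [simp]: "q ^ k \<le> 1" using q_pos q_less1 by (simp add: power_le_one)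
lemma q_pow_mono: "i \<le> j ==> q ^ j \<le> q ^ i" using q_pos q_less1 by (simp add: power_decreasing)
lemma q_pow_less_iff: "q ^ i < q ^ j \<longleftrightarrow> j < i" using q_pos q_less1 by (simp add: power_strict_decreasing_iff)
lemma q_pow_le_iff: "q ^ i \<le> q ^ j \<longleftrightarrow> j \<le> i" using q_pos q_less1 by (simp add: power_decreasing_iff)
lemma q_pow_small: "e > 0 ==> \<exists>k. q ^ k < e" using q_less1 q_pos by (simp add: real_arch_pow_inv)

lemma prime_int_p: "Factorial_Ring.prime (int p)" using prime_p by simp

lemma pabs_frac:
 assumes "a \<noteq> 0" "b \<noteq> 0"
 shows "padic_abs p (of_int a / of_int b) = real p powi (int (multiplicity (int p) b) - int (multiplicity (int p) a))"
proof -
 define r :: rat where "r = of_int a / of_int b"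
 obtain c d where cd: "quotient_of r = (c, d)" by force
 have d: "d > 0" using quotient_of_denom_pos[OF cd] .
 have rcd: "r = of_int c / of_int d" using quotient_of_div[OF cd] .
 have r0: "r \<noteq> 0" using assms by (simp add: r_def)
 hence c: "c \<noteq> 0" using rcd by auto
 have "of_int (a * d) = (of_int (c * b) :: rat)"
  using rcd assms d unfolding r_def by (simp add: field_simps)
 hence "a * d = c * b" using of_int_eq_iff by blast
 hence "multiplicity (int p) (a * d) = multiplicity (int p) (c * b)" by simp
 hence "multiplicity (int p) a + multiplicity (int p) d = multiplicity (int p) c + multiplicity (int p) b"
  using assms c d prime_int_p by (simp add: prime_elem_multiplicity_mult_distrib)
 hence "int (multiplicity (int p) d) - int (multiplicity (int p) c) = int (multiplicity (int p) b) - int (multiplicity (int p) a)"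
  by linarith
 thus ?thesis using r0 cd by (simp add: padic_abs_def r_def[symmetric])
qed

lemma pabs_0 [simp]: "padic_abs p 0 = 0" by (simp add: padic_abs_def)

lemma rat_frac: obtains a b where "b \<noteq> 0" "(r::rat) = of_int a / of_int b"
proof -
 obtain c d where cd: "quotient_of r = (c, d)" by force
 have "d > 0" using quotient_of_denom_pos[OF cd] .
 thus ?thesis using that[of d c] quotient_of_div[OF cd] by auto
qed

lemma pabs_powi: "x \<noteq> 0 ==> \<exists>k. padic_abs p x = real p powi k"
 by (auto simp: padic_abs_def)

lemma pabs_nonneg [simp]: "padic_abs p x \<ge> 0" by (simp add: padic_abs_def)

lemma pabs_eq_0 [simp]: "padic_abs p x = 0 \<longleftrightarrow> x = 0"
 using p_ge2 by (simp add: padic_abs_def)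

lemma pabs_mult: "padic_abs p (x * y) = padic_abs p x * padic_abs p y"
proof (cases "x = 0 \<or> y = 0")
 case False
 obtain a b where ab: "b \<noteq> 0" "x = of_int a / of_int b" by (rule rat_frac)
 obtain c d where cd: "d \<noteq> 0" "y = of_int c / of_int d" by (rule rat_frac)
 have nz: "a \<noteq> 0" "c \<noteq> 0" using False ab cd by auto
 have xy: "x * y = of_int (a * c) / of_int (b * d)" using ab cd by simp
 have "padic_abs p (x * y) = real p powi ((int (multiplicity (int p) b) - int (multiplicity (int p) a))
   + (int (multiplicity (int p) d) - int (multiplicity (int p) c)))"
  unfolding xy using nz ab(1) cd(1) prime_int_p
  by (subst pabs_frac) (auto simp: prime_elem_multiplicity_mult_distrib algebra_simps)
 also have "\<dots> = padic_abs p x * padic_abs p y"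
  using nz ab cd p_ge2 by (simp add: pabs_frac power_int_add)
 finally show ?thesis .
qed auto

lemma pabs_1 [simp]: "padic_abs p 1 = 1"
 using pabs_frac[of 1 1] by simp

lemma pabs_minus [simp]: "padic_abs p (- x) = padic_abs p x"
proof -
 have "multiplicity (int p) (-1) = 0" using prime_int_p
  by (intro not_dvd_imp_multiplicity_0) (auto simp: not_prime_unit)
 hence "padic_abs p (-1) = 1" using pabs_frac[of "-1" 1] by simp
 thus ?thesis using pabs_mult[of "-1" x] by simp
qed

lemma pabs_of_int_le1: "padic_abs p (of_int a) \<le> 1"
proof (cases "a = 0")
 case False
 have "padic_abs p (of_int a) = real p powi (- int (multiplicity (int p) a))"
  using pabs_frac[of a 1] False by simp
 also have "\<dots> = q ^ multiplicity (int p) a" by (simp add: q_def power_int_minus power_one_over inverse_eq_divide)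
 finally show ?thesis by simp
qed auto

lemma pabs_of_int: "a \<noteq> 0 ==> padic_abs p (of_int a) = q ^ multiplicity (int p) a"
 using pabs_frac[of a 1] by (simp add: q_def power_int_minus power_one_over inverse_eq_divide)

lemma pabs_of_int_le_iff: "padic_abs p (of_int a) \<le> q ^ k \<longleftrightarrow> int p ^ k dvd a"
proof (cases "a = 0")
 case False
 have "int p ^ k dvd a \<longleftrightarrow> k \<le> multiplicity (int p) a"
  using False prime_int_p by (intro power_dvd_iff_le_multiplicity) (auto simp: prime_gt_1_int)
 thus ?thesis using pabs_of_int[OF False] q_pow_le_iff by simp
qed (simp add: less_imp_le)

lemma pabs_p: "padic_abs p (of_nat p) = q"
proof -
 have "padic_abs p (of_int (int p)) = q ^ multiplicity (int p) (int p)" using p_ge2 by (intro pabs_of_int) auto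
 thus ?thesis using prime_int_p by (simp add: multiplicity_prime)
qed

lemma pabs_add: "padic_abs p (x + y) \<le> max (padic_abs p x) (padic_abs p y)"
proof -
 have aux: "padic_abs p (x + y) \<le> max (padic_abs p x) (padic_abs p y)"
  if le: "padic_abs p x \<le> padic_abs p y" for x y
 proof (cases "y = 0")
  case True thus ?thesis using le by (metis add.right_neutral max.cobounded1)
 next
  case y: False
  obtain a b where ab: "b \<noteq> 0" "x / y = of_int a / of_int b" by (rule rat_frac)
  have xy: "padic_abs p x = padic_abs p (x / y) * padic_abs p y" using y pabs_mult[of "x/y" y] by simp
  have yp: "padic_abs p y > 0" using y pabs_eq_0 pabs_nonneg less_eq_real_def by metis
  have l1: "padic_abs p (x / y) \<le> 1" using le yp unfolding xy by (simp add: mult_le_cancel_right1 field_simps)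
  have "padic_abs p (x / y + 1) \<le> 1"
  proof (cases "x / y = 0 \<or> x / y + 1 = 0")
   case True thus ?thesis by auto
  next
   case False
   have nz: "a \<noteq> 0" "a + b \<noteq> 0"
    using False ab by (auto simp: divide_simps simp flip: of_int_add)
   define va where "va = multiplicity (int p) a"
   define vb where "vb = multiplicity (int p) b"
   have "real p powi (int vb - int va) \<le> real p powi 0"
    using l1 nz ab by (simp add: pabs_frac va_def vb_def)
   hence "int vb - int va \<le> 0" using p_ge2
    by (metis not_less power_int_strict_increasing of_nat_1 of_nat_less_iff one_less_numeral_iff less_le_trans semiring_norm(76) numeral_2_eq_2 lessI One_nat_def)
   hence "vb \<le> va" by simp
   hence "int p ^ vb dvd a" "int p ^ vb dvd b" unfolding va_def vb_def
    by (auto simp: multiplicity_dvd multiplicity_dvd')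
   hence "int p ^ vb dvd a + b" by simp
   hence "vb \<le> multiplicity (int p) (a + b)" using nz p_ge2 prime_int_p
    by (subst (asm) power_dvd_iff_le_multiplicity) auto
   moreover have "x / y + 1 = of_int (a + b) / of_int b" using ab by (simp add: field_simps)
   ultimately have "padic_abs p (x / y + 1) = real p powi (int vb - int (multiplicity (int p) (a+b)))"
    and "int vb - int (multiplicity (int p) (a+b)) \<le> 0"
    using pabs_frac[OF nz(2) ab(1)] unfolding vb_def by (metis, linarith)
   moreover have "real p powi (int vb - int (multiplicity (int p) (a+b))) \<le> real p powi 0"
    using calculation(2) p_ge2 by (intro power_int_increasing) auto
   ultimately show ?thesis by simp
  qed
  moreover have "x + y = (x / y + 1) * y" using y by (simp add: field_simps)
  ultimately show ?thesis using pabs_mult[of "x / y + 1" y] yp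
   by (metis le max.absorb2 mult_left_le_one_le pabs_nonneg mult.commute mult_cancel_right1 mult_right_le_one_le)
 qed
 show ?thesis
  using aux[of x y] aux[of y x] by (cases "padic_abs p x \<le> padic_abs p y") (auto simp: add.commute max.commute)
qed

lemma pabs_diff: "padic_abs p (x - y) \<le> max (padic_abs p x) (padic_abs p y)"
 using pabs_add[of x "- y"] by simp

lemma pabs_commute: "padic_abs p (x - y) = padic_abs p (y - x)"
 using pabs_minus[of "x - y"] by simp

lemma pabs_add_eq: assumes "padic_abs p y < padic_abs p x" shows "padic_abs p (x + y) = padic_abs p x"
proof -
 have "padic_abs p x \<le> max (padic_abs p (x + y)) (padic_abs p y)"
  using pabs_diff[of "x + y" y] by simp
 thus ?thesis using pabs_add[of x y] assms by auto
qed

lemma pabs_triangle: "\<bar>padic_abs p x - padic_abs p y\<bar> \<le> padic_abs p (x - y)"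
proof (cases "padic_abs p x = padic_abs p y")
 case False
 have a: "padic_abs p x \<le> max (padic_abs p (x - y)) (padic_abs p y)"
  using pabs_add[of "x - y" y] by simp
 have b: "padic_abs p y \<le> max (padic_abs p (x - y)) (padic_abs p x)"
  using pabs_add[of "y - x" x] pabs_commute by simp
 show ?thesis using a b False pabs_nonneg[of x] pabs_nonneg[of y] by linarith
qed auto

abbreviation CC where "CC \<equiv> padic_Cauchy_ring p"
abbreviation NI where "NI \<equiv> padic_null_ideal p"

lemma CC_carrier: "x \<in> carrier CC \<longleftrightarrow> (\<forall>e>0. \<exists>N. \<forall>m\<ge>N. \<forall>n\<ge>N. padic_abs p (x m - x n) < e)"
 by (simp add: padic_Cauchy_ring_def)
lemma CC_simps [simp]: "x \<otimes>\<^bsub>CC\<^esub> y = (\<lambda>n. x n * y n)" "\<one>\<^bsub>CC\<^esub> = (\<lambda>n. 1)" "\<zero>\<^bsub>CC\<^esub> = (\<lambda>n. 0)"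
 "x \<oplus>\<^bsub>CC\<^esub> y = (\<lambda>n. x n + y n)"
 by (simp_all add: padic_Cauchy_ring_def)

lemma CC_conv: assumes "x \<in> carrier CC" shows "convergent (\<lambda>n. padic_abs p (x n))"
proof (intro Cauchy_convergent CauchyI)
 fix e :: real assume "e > 0"
 then obtain N where "\<forall>m\<ge>N. \<forall>n\<ge>N. padic_abs p (x m - x n) < e" using assms by (auto simp: CC_carrier)
 hence "\<forall>m\<ge>N. \<forall>n\<ge>N. norm (padic_abs p (x m) - padic_abs p (x n)) < e"
  using pabs_triangle by (metis le_less_trans real_norm_def)
 thus "\<exists>M. \<forall>m\<ge>M. \<forall>n\<ge>M. norm (padic_abs p (x m) - padic_abs p (x n)) < e" by blast
qed

lemma CC_bounded: assumes "x \<in> carrier CC" shows "\<exists>B>0. \<forall>n. padic_abs p (x n) \<le> B"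
proof -
 have "Bseq (\<lambda>n. padic_abs p (x n))" using CC_conv[OF assms] by (rule convergent_imp_Bseq)
 then obtain B where "B > 0" "\<forall>n. norm (padic_abs p (x n)) \<le> B" by (auto simp: Bseq_def)
 thus ?thesis by (intro exI[of _ B]) (auto simp: abs_le_iff)
qed

lemma CC_add: assumes "x \<in> carrier CC" "y \<in> carrier CC" shows "(\<lambda>n. x n + y n) \<in> carrier CC"
 unfolding CC_carrier
proof (intro allI impI)
 fix e :: real assume e: "e > 0"
 obtain N where N: "\<forall>m\<ge>N. \<forall>n\<ge>N. padic_abs p (x m - x n) < e" using assms e by (auto simp: CC_carrier)
 obtain N' where N': "\<forall>m\<ge>N'. \<forall>n\<ge>N'. padic_abs p (y m - y n) < e" using assms e by (auto simp: CC_carrier)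
 show "\<exists>N. \<forall>m\<ge>N. \<forall>n\<ge>N. padic_abs p (x m + y m - (x n + y n)) < e"
 proof (intro exI[of _ "max N N'"] allI impI)
  fix m n assume "m \<ge> max N N'" "n \<ge> max N N'"
  hence "padic_abs p (x m - x n) < e" "padic_abs p (y m - y n) < e" using N N' by auto
  thus "padic_abs p (x m + y m - (x n + y n)) < e"
   using pabs_add[of "x m - x n" "y m - y n"] by (simp add: algebra_simps)
 qed
qed

lemma CC_minus: assumes "x \<in> carrier CC" shows "(\<lambda>n. - x n) \<in> carrier CC"
 using assms unfolding CC_carrier by (metis pabs_commute minus_diff_minus pabs_minus)

lemma CC_mult: assumes "x \<in> carrier CC" "y \<in> carrier CC" shows "(\<lambda>n. x n * y n) \<in> carrier CC"
 unfolding CC_carrier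
proof (intro allI impI)
 fix e :: real assume e: "e > 0"
 obtain B where B: "B > 0" "\<forall>n. padic_abs p (x n) \<le> B" using CC_bounded assms by blast
 obtain B' where B': "B' > 0" "\<forall>n. padic_abs p (y n) \<le> B'" using CC_bounded assms by blast
 have "e / B > 0" "e / B' > 0" using e B B' by auto
 obtain N where N: "\<forall>m\<ge>N. \<forall>n\<ge>N. padic_abs p (x m - x n) < e / B'" using assms \<open>e / B' > 0\<close> unfolding CC_carrier by blast
 obtain N' where N': "\<forall>m\<ge>N'. \<forall>n\<ge>N'. padic_abs p (y m - y n) < e / B" using assms \<open>e / B > 0\<close> unfolding CC_carrier by blast
 show "\<exists>N. \<forall>m\<ge>N. \<forall>n\<ge>N. padic_abs p (x m * y m - x n * y n) < e"
 proof (intro exI[of _ "max N N'"] allI impI)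
  fix m n assume mn: "m \<ge> max N N'" "n \<ge> max N N'"
  have "padic_abs p ((x m - x n) * y m) < e"
  proof -
   have "padic_abs p ((x m - x n) * y m) \<le> padic_abs p (x m - x n) * B'"
    using B' by (simp add: pabs_mult mult_left_mono)
   also have "\<dots> < e" using N mn B' by (simp add: pos_less_divide_eq)
   finally show ?thesis .
  qed
  moreover have "padic_abs p (x n * (y m - y n)) < e"
  proof -
   have "padic_abs p (x n * (y m - y n)) \<le> B * padic_abs p (y m - y n)"
    using B by (simp add: pabs_mult mult_right_mono)
   also have "\<dots> < e" using N' mn B by (simp add: pos_less_divide_eq mult.commute)
   finally show ?thesis .
  qed
  ultimately show "padic_abs p (x m * y m - x n * y n) < e"
   using pabs_add[of "(x m - x n) * y m" "x n * (y m - y n)"] by (simp add: algebra_simps)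
 qed
qed

lemma CC_const: "(\<lambda>n. r) \<in> carrier CC" by (simp add: CC_carrier)

sublocale CC: cring CC
proof (intro cringI abelian_groupI comm_monoidI)
 fix x assume "x \<in> carrier CC"
 thus "\<exists>y\<in>carrier CC. y \<oplus>\<^bsub>CC\<^esub> x = \<zero>\<^bsub>CC\<^esub>" by (intro bexI[of _ "\<lambda>n. - x n"]) (auto simp: CC_minus)
qed (auto simp: CC_add CC_mult CC_const[of 0] CC_const[of 1] algebra_simps intro: CC_const)

lemma CC_uminus: assumes "x \<in> carrier CC" shows "\<ominus>\<^bsub>CC\<^esub> x = (\<lambda>n. - x n)"
 using CC.minus_equality[of "\<lambda>n. - x n" x] assms CC_minus by simp

lemma NI_iff: "(x :: nat => rat) \<in> NI \<longleftrightarrow> (\<lambda>n. padic_abs p (x n)) \<longlonglongrightarrow> 0" by (simp add: padic_null_ideal_def)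

lemma NI_sub: "NI \<subseteq> carrier CC"
proof
 fix x assume "x \<in> NI"
 show "x \<in> carrier CC" unfolding CC_carrier
 proof (intro allI impI)
  fix e :: real assume "e > 0"
  then obtain N where N: "\<And>n. n \<ge> N ==> padic_abs p (x n) < e"
   using \<open>x \<in> NI\<close> unfolding NI_iff LIMSEQ_iff by fastforce
  show "\<exists>N. \<forall>m\<ge>N. \<forall>n\<ge>N. padic_abs p (x m - x n) < e"
   using N pabs_diff by (intro exI[of _ N]) (meson le_less_trans max_less_iff_conj)
 qed
qed

lemma NI_squeeze: assumes "y \<in> NI" "\<And>n. padic_abs p (x n) \<le> B * padic_abs p (y n)" shows "x \<in> NI"
proof -
 have "(\<lambda>n. B * padic_abs p (y n)) \<longlonglongrightarrow> B * 0" using assms(1) unfolding NI_iff by (intro tendsto_mult) auto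
 thus ?thesis unfolding NI_iff using assms(2) by (auto intro: tendsto_sandwich[of "\<lambda>n. 0" _ _ "\<lambda>n. B * padic_abs p (y n)"])
qed

lemma NI_add: assumes "x \<in> NI" "y \<in> NI" shows "(\<lambda>n. x n + y n) \<in> NI"
proof -
 have l: "(\<lambda>n. padic_abs p (x n) + padic_abs p (y n)) \<longlonglongrightarrow> 0 + 0" using assms unfolding NI_iff by (intro tendsto_add) auto
 have le: "padic_abs p (x n + y n) \<le> padic_abs p (x n) + padic_abs p (y n)" for n
  using pabs_add[of "x n" "y n"] pabs_nonneg[of "x n"] pabs_nonneg[of "y n"] by linarith
 show ?thesis unfolding NI_iff
  by (rule tendsto_sandwich[of "\<lambda>n. 0" _ _ "\<lambda>n. padic_abs p (x n) + padic_abs p (y n)"])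
    (use le l in \<open>auto simp: always_eventually\<close>)
qed

sublocale NI: ideal NI CC
proof (rule idealI[OF CC.ring_axioms])
 show "subgroup NI (add_monoid CC)"
 proof (unfold_locales, goal_cases)
  case 1 thus ?case using NI_sub by simp
 next
  case (2 x y) thus ?case using NI_add by simp
 next
  case 3 thus ?case by (simp add: NI_iff)
 next
  case (4 x)
  hence "inv\<^bsub>add_monoid CC\<^esub> x = (\<lambda>n. - x n)" using CC_uminus[of x] NI_sub by (auto simp: a_inv_def)
  thus ?case using 4 by (simp add: NI_iff)
 qed
next
 fix a x assume a: "a \<in> NI" "x \<in> carrier CC"
 obtain B where B: "B > 0" "\<forall>n. padic_abs p (x n) \<le> B" using CC_bounded a by blast
 have le: "padic_abs p (x n * a n) \<le> B * padic_abs p (a n)" for n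
  using B by (simp add: pabs_mult mult_right_mono)
 thus "x \<otimes>\<^bsub>CC\<^esub> a \<in> NI" "a \<otimes>\<^bsub>CC\<^esub> x \<in> NI" using NI_squeeze[OF a(1), of "\<lambda>n. x n * a n" B]
  by (simp_all add: mult.commute)
qed

abbreviation Q where "Q \<equiv> Qp p"

abbreviation Q_minus (infixl "\<^bold>-" 65) where "x \<^bold>- y \<equiv> x \<ominus>\<^bsub>Q\<^esub> y"
abbreviation Q_uminus ("\<^bold>- _" [81] 80) where "\<^bold>- x \<equiv> \<ominus>\<^bsub>Q\<^esub> x"
abbreviation Q_plus (infixl "\<^bold>+" 65) where "x \<^bold>+ y \<equiv> x \<oplus>\<^bsub>Q\<^esub> y"
abbreviation Q_times (infixl "\<^bold>*" 70) where "x \<^bold>* y \<equiv> x \<otimes>\<^bsub>Q\<^esub> y"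
abbreviation Q_one ("\<^bold>1") where "\<^bold>1 \<equiv> \<one>\<^bsub>Q\<^esub>"
abbreviation Q_zero ("\<^bold>0") where "\<^bold>0 \<equiv> \<zero>\<^bsub>Q\<^esub>"

lemma Q_cring: "cring Q" unfolding Qp_def by (rule NI.quotient_is_cring[OF CC.is_cring])

definition qc :: "(nat => rat) => padic" where "qc x = NI +>\<^bsub>CC\<^esub> x"

lemma qc_hom: "qc \<in> ring_hom CC Q" using NI.rcos_ring_hom unfolding Qp_def qc_def[abs_def] .

lemma Q_cases: assumes "W \<in> carrier Q" obtains x where "x \<in> carrier CC" "W = qc x"
 using assms unfolding Qp_def FactRing_def A_RCOSETS_def RCOSETS_def qc_def a_r_coset_def by auto

lemma qc_closed: "x \<in> carrier CC ==> qc x \<in> carrier Q" using qc_hom by (rule ring_hom_closed)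
lemma qc_add: "x \<in> carrier CC ==> y \<in> carrier CC ==> qc (\<lambda>n. x n + y n) = qc x \<^bold>+ qc y"
 using ring_hom_add[OF qc_hom] by simp
lemma qc_mult: "x \<in> carrier CC ==> y \<in> carrier CC ==> qc (\<lambda>n. x n * y n) = qc x \<^bold>* qc y"
 using ring_hom_mult[OF qc_hom] by simp
lemma qc_one: "qc (\<lambda>n. 1) = \<^bold>1" using ring_hom_one[OF qc_hom] by simp
lemma qc_zero: "qc (\<lambda>n. 0) = \<^bold>0" using ring_hom_zero[OF qc_hom CC.ring_axioms] Q_cring
 by (simp add: cring_def)

lemma qc_mem: assumes "x \<in> carrier CC" shows "y \<in> qc x \<longleftrightarrow> (\<lambda>n. y n - x n) \<in> NI"
proof
 assume "y \<in> qc x"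
 then obtain i where "i \<in> NI" "y = (\<lambda>n. i n + x n)" by (auto simp: qc_def a_r_coset_def')
 thus "(\<lambda>n. y n - x n) \<in> NI" by simp
next
 assume "(\<lambda>n. y n - x n) \<in> NI"
 thus "y \<in> qc x" unfolding qc_def a_r_coset_def' by (auto intro!: bexI[of _ "\<lambda>n. y n - x n"])
qed

lemma qc_eq_iff: assumes "x \<in> carrier CC" "y \<in> carrier CC" shows "qc x = qc y \<longleftrightarrow> (\<lambda>n. x n - y n) \<in> NI"
proof
 assume "qc x = qc y"
 moreover have "x \<in> qc x" using qc_mem[OF assms(1)] by (simp add: NI_iff)
 ultimately show "(\<lambda>n. x n - y n) \<in> NI" using qc_mem[OF assms(2)] by simp
next
 assume "(\<lambda>n. x n - y n) \<in> NI"
 hence "x \<in> qc y" using qc_mem assms by simp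
 thus "qc x = qc y" using CC.a_repr_independence[of x NI y] assms(2) NI.a_subgroup
  by (simp add: qc_def additive_subgroup.a_subgroup)
qed

abbreviation nrm where "nrm \<equiv> Qp_norm p"

lemma nrm_qc: assumes "x \<in> carrier CC" shows "(\<lambda>n. padic_abs p (x n)) \<longlonglongrightarrow> nrm (qc x)"
proof -
 define y where "y = (SOME y. y \<in> qc x)"
 have "x \<in> qc x" using qc_mem[OF assms] by (simp add: NI_iff)
 hence "y \<in> qc x" unfolding y_def by (rule someI[of "\<lambda>y. y \<in> qc x"])
 hence n: "(\<lambda>n. y n - x n) \<in> NI" using qc_mem[OF assms] by simp
 obtain L where L: "(\<lambda>n. padic_abs p (x n)) \<longlonglongrightarrow> L" using CC_conv[OF assms] by (auto simp: convergent_def)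
 have "(\<lambda>n. padic_abs p (y n) - padic_abs p (x n)) \<longlonglongrightarrow> 0"
  by (rule Lim_null_comparison[OF _ n[unfolded NI_iff]]) (use pabs_triangle in auto)
 hence "(\<lambda>n. padic_abs p (y n) - padic_abs p (x n) + padic_abs p (x n)) \<longlonglongrightarrow> 0 + L"
  using L by (intro tendsto_add)
 hence "(\<lambda>n. padic_abs p (y n)) \<longlonglongrightarrow> L" by simp
 hence "nrm (qc x) = L" unfolding Qp_norm_def y_def[symmetric] by (rule limI)
 thus ?thesis using L by simp
qed

sublocale Q: cring Q by (rule Q_cring)

lemma nrm_nonneg: assumes "W \<in> carrier Q" shows "nrm W \<ge> 0"
proof -
 obtain x where x: "x \<in> carrier CC" "W = qc x" using Q_cases[OF assms] .
 show ?thesis using nrm_qc[OF x(1)] unfolding x by (rule LIMSEQ_le_const) auto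
qed

lemma nrm_mult: assumes "W \<in> carrier Q" "Y \<in> carrier Q" shows "nrm (W \<^bold>* Y) = nrm W * nrm Y"
proof -
 obtain x where x: "x \<in> carrier CC" "W = qc x" using Q_cases[OF assms(1)] .
 obtain y where y: "y \<in> carrier CC" "Y = qc y" using Q_cases[OF assms(2)] .
 have "(\<lambda>n. padic_abs p (x n * y n)) \<longlonglongrightarrow> nrm W * nrm Y"
  unfolding pabs_mult x y using nrm_qc x y by (intro tendsto_mult) auto
 moreover have "(\<lambda>n. padic_abs p (x n * y n)) \<longlonglongrightarrow> nrm (W \<^bold>* Y)"
  unfolding x y using nrm_qc[OF CC_mult[OF x(1) y(1)]] qc_mult x y by simp
 ultimately show ?thesis using LIMSEQ_unique by blast
qed

lemma nrm_add: assumes "W \<in> carrier Q" "Y \<in> carrier Q" shows "nrm (W \<^bold>+ Y) \<le> max (nrm W) (nrm Y)"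
proof -
 obtain x where x: "x \<in> carrier CC" "W = qc x" using Q_cases[OF assms(1)] .
 obtain y where y: "y \<in> carrier CC" "Y = qc y" using Q_cases[OF assms(2)] .
 have a: "(\<lambda>n. max (padic_abs p (x n)) (padic_abs p (y n))) \<longlonglongrightarrow> max (nrm W) (nrm Y)"
  unfolding x y using nrm_qc x y by (intro tendsto_max) auto
 have b: "(\<lambda>n. padic_abs p (x n + y n)) \<longlonglongrightarrow> nrm (W \<^bold>+ Y)"
  unfolding x y using nrm_qc[OF CC_add[OF x(1) y(1)]] qc_add x y by simp
 show ?thesis using b a by (rule LIMSEQ_le) (auto simp: pabs_add)
qed

lemma nrm_const: "nrm (qc (\<lambda>n. r)) = padic_abs p r"
 using nrm_qc[OF CC_const] LIMSEQ_unique tendsto_const by blast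

lemma nrm_zero [simp]: "nrm \<^bold>0 = 0" using nrm_const[of 0] qc_zero by simp
lemma nrm_one [simp]: "nrm \<^bold>1 = 1" using nrm_const[of 1] qc_one by simp

lemma nrm_eq_0: assumes "W \<in> carrier Q" shows "nrm W = 0 \<longleftrightarrow> W = \<^bold>0"
proof
 assume "nrm W = 0"
 obtain x where x: "x \<in> carrier CC" "W = qc x" using Q_cases[OF assms(1)] .
 have "x \<in> NI" using nrm_qc[OF x(1)] \<open>nrm W = 0\<close> x by (simp add: NI_iff)
 hence "qc x = qc (\<lambda>n. 0)" using qc_eq_iff[OF x(1) CC_const[of 0]] by simp
 thus "W = \<^bold>0" using x qc_zero by simp
qed auto

lemma nrm_eventually: assumes "x \<in> carrier CC" "qc x \<noteq> \<^bold>0"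
 shows "\<exists>N. \<forall>n\<ge>N. padic_abs p (x n) = nrm (qc x)"
proof -
 define L where "L = nrm (qc x)"
 have L: "L > 0" using nrm_nonneg[OF qc_closed[OF assms(1)]] nrm_eq_0[OF qc_closed[OF assms(1)]] assms unfolding L_def by linarith
 obtain N where N: "\<forall>n\<ge>N. padic_abs p (x n) > L / 2"
  using order_tendstoD(1)[OF nrm_qc[OF assms(1)], of "L/2"] L unfolding L_def eventually_sequentially by auto
 obtain N' where N': "\<forall>m\<ge>N'. \<forall>n\<ge>N'. padic_abs p (x m - x n) < L / 2"
  using assms(1)[unfolded CC_carrier, rule_format, of "L / 2"] L by auto
 have c: "padic_abs p (x n) = padic_abs p (x (max N N'))" if "n \<ge> max N N'" for n
 proof -
  have "padic_abs p (x n - x (max N N')) < padic_abs p (x (max N N'))"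
  proof -
   have "padic_abs p (x n - x (max N N')) < L / 2" using N' that by auto
   also have "\<dots> < padic_abs p (x (max N N'))" using N by auto
   finally show ?thesis .
  qed
  thus ?thesis using pabs_add_eq[of "x n - x (max N N')" "x (max N N')"] by simp
 qed
 have "(\<lambda>n. padic_abs p (x n)) \<longlonglongrightarrow> padic_abs p (x (max N N'))"
  by (rule tendsto_eventually, unfold eventually_sequentially, intro exI allI impI, erule c)
 hence "padic_abs p (x (max N N')) = L" using nrm_qc[OF assms(1)] LIMSEQ_unique unfolding L_def by blast
 hence "padic_abs p (x n) = L" if "n \<ge> max N N'" for n by (rule trans[OF c[OF that]])
 thus ?thesis unfolding L_def by blast
qed

lemma nrm_powi: assumes "W \<in> carrier Q" "W \<noteq> \<^bold>0" shows "\<exists>k. nrm W = real p powi k"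
proof -
 obtain x where x: "x \<in> carrier CC" "W = qc x" using Q_cases[OF assms(1)] .
 obtain N where N: "padic_abs p (x N) = nrm W" using nrm_eventually[OF x(1)] assms(2) unfolding x by blast
 have "x N \<noteq> 0" using N nrm_eq_0[OF assms(1)] assms(2) pabs_0 by metis
 thus ?thesis using pabs_powi N by metis
qed

lemma Q_field: "field Q"
proof (intro Q.cring_fieldI2)
 show "\<^bold>0 \<noteq> \<^bold>1" using nrm_zero nrm_one by force
next
 fix W assume W: "W \<in> carrier Q" "W \<noteq> \<^bold>0"
 obtain x where x: "x \<in> carrier CC" "W = qc x" using Q_cases[OF W(1)] .
 define L where "L = nrm W"
 obtain N where N: "\<forall>n\<ge>N. padic_abs p (x n) = L" using nrm_eventually[OF x(1)] W(2) unfolding L_def x by blast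
 have L: "L > 0" using nrm_nonneg[OF W(1)] nrm_eq_0[OF W(1)] W unfolding L_def by linarith
 define y where "y n = inverse (x (max n N))" for n
 have xn: "x (max n N) \<noteq> 0" "padic_abs p (x (max n N)) = L" for n
 proof -
  show "padic_abs p (x (max n N)) = L" using N by simp
  thus "x (max n N) \<noteq> 0" using L by auto
 qed
 have "y \<in> carrier CC" unfolding CC_carrier
 proof (intro allI impI)
  fix e :: real assume "e > 0"
  hence "e * L * L > 0" using L by simp
  then obtain M where M: "\<forall>m\<ge>M. \<forall>n\<ge>M. padic_abs p (x m - x n) < e * L * L" using x(1) unfolding CC_carrier by blast
  show "\<exists>N. \<forall>m\<ge>N. \<forall>n\<ge>N. padic_abs p (y m - y n) < e"
  proof (intro exI[of _ M] allI impI)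
   fix m n assume mn: "m \<ge> M" "n \<ge> M"
   have "(y m - y n) * x (max m N) * x (max n N) = x (max n N) - x (max m N)"
    using xn by (simp add: y_def field_simps)
   hence "padic_abs p (y m - y n) * L * L = padic_abs p (x (max n N) - x (max m N))"
    using xn(2) by (metis pabs_mult)
   also have "\<dots> < e * L * L" using M mn by simp
   finally show "padic_abs p (y m - y n) < e" using L by simp
  qed
 qed
 moreover have "qc x \<^bold>* qc y = \<^bold>1"
 proof -
  have "qc (\<lambda>n. x n * y n) = qc (\<lambda>n. 1)"
  proof (subst qc_eq_iff)
   show "(\<lambda>n. x n * y n - 1) \<in> NI" unfolding NI_iff
   proof (rule tendsto_eventually, unfold eventually_sequentially, intro exI[of _ N] allI impI)
    fix n assume "n \<ge> N"
    thus "padic_abs p (x n * y n - 1) = 0" using xn(1)[of n] by (simp add: y_def max_absorb1)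
   qed
  qed (use CC_mult x \<open>y \<in> carrier CC\<close> CC_const in auto)
  thus ?thesis using qc_mult x \<open>y \<in> carrier CC\<close> qc_one by simp
 qed
 ultimately show "\<exists>b\<in>carrier Q. W \<^bold>* b = \<^bold>1" using x qc_closed by blast
qed

sublocale Q: field Q by (rule Q_field)

definition rc :: "rat => padic" where "rc r = qc (\<lambda>n. r)"

lemma rc_closed [simp]: "rc r \<in> carrier Q" by (simp add: rc_def qc_closed CC_const)
lemma rc_add: "rc (r + s) = rc r \<^bold>+ rc s" unfolding rc_def by (rule qc_add) (rule CC_const)+
lemma rc_mult: "rc (r * s) = rc r \<^bold>* rc s" unfolding rc_def by (rule qc_mult) (rule CC_const)+
lemma rc_0: "rc 0 = \<^bold>0" and rc_1: "rc 1 = \<^bold>1" by (simp_all add: rc_def qc_zero qc_one)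
lemma rc_uminus: "rc (- r) = \<^bold>- rc r"
 using rc_add[of "-r" r] rc_0 by (intro Q.minus_equality[symmetric]) auto
lemma rc_diff: "rc (r - s) = rc r \<^bold>- rc s"
 using rc_add[of r "- s"] rc_uminus by (simp add: a_minus_def)
lemma nrm_rc [simp]: "nrm (rc r) = padic_abs p r" by (simp add: rc_def nrm_const)

lemma nrm_uminus [simp]: assumes "W \<in> carrier Q" shows "nrm (\<^bold>- W) = nrm W"
proof -
 have "\<^bold>- W = rc (-1) \<^bold>* W" using assms rc_uminus[of 1] rc_1 by (simp add: Q.l_minus)
 thus ?thesis using assms by (simp add: nrm_mult)
qed
lemma nrm_diff: assumes "W \<in> carrier Q" "Y \<in> carrier Q" shows "nrm (W \<^bold>- Y) \<le> max (nrm W) (nrm Y)"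
 using nrm_add[of W "\<^bold>- Y"] assms by (simp add: a_minus_def)
lemma nrm_commute: assumes "W \<in> carrier Q" "Y \<in> carrier Q" shows "nrm (W \<^bold>- Y) = nrm (Y \<^bold>- W)"
 using nrm_uminus[of "W \<^bold>- Y"] assms by (simp add: a_minus_def Q.minus_add Q.a_comm)

lemma density: assumes "W \<in> carrier Q" "e > 0" shows "\<exists>r. nrm (W \<^bold>- rc r) \<le> e"
proof -
 obtain x where x: "x \<in> carrier CC" "W = qc x" using Q_cases[OF assms(1)] .
 obtain N where N: "\<forall>m\<ge>N. \<forall>n\<ge>N. padic_abs p (x m - x n) < e" using x(1) assms(2) by (auto simp: CC_carrier)
 have "W = qc (\<lambda>n. x n - x N) \<^bold>+ rc (x N)"
  unfolding rc_def using qc_add[of "\<lambda>n. x n - x N" "\<lambda>n. x N"] x CC_add[OF x(1) CC_const[of "- x N"]] CC_const by simp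
 hence *: "W \<^bold>- rc (x N) = qc (\<lambda>n. x n - x N)"
  using qc_closed CC_add[OF x(1) CC_const[of "- x N"]] by (simp add: a_minus_def Q.a_assoc Q.r_neg)
 have "(\<lambda>n. padic_abs p (x n - x N)) \<longlonglongrightarrow> nrm (W \<^bold>- rc (x N))" unfolding *
  using nrm_qc[of "\<lambda>n. x n - x N"] CC_add[OF x(1) CC_const[of "- x N"]] by simp
 hence "nrm (W \<^bold>- rc (x N)) \<le> e"
  by (rule LIMSEQ_le_const2) (use N less_imp_le in blast)
 thus ?thesis by blast
qed

lemma Q_telescope: "[|W \<in> carrier Q; Y \<in> carrier Q; Z \<in> carrier Q|] ==> W \<^bold>- Z = (W \<^bold>- Y) \<^bold>+ (Y \<^bold>- Z)"
 by (simp add: a_minus_def Q.a_assoc Q.r_neg1)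

lemma nrm_ultra3: assumes "W \<in> carrier Q" "Y \<in> carrier Q" "Z \<in> carrier Q"
 shows "nrm (W \<^bold>- Z) \<le> max (nrm (W \<^bold>- Y)) (nrm (Y \<^bold>- Z))"
 using Q_telescope[OF assms] nrm_add assms by simp

theorem Q_complete:
 fixes W :: "nat => padic"
 assumes W: "\<And>n. W n \<in> carrier Q"
  and C: "\<And>e. e > 0 ==> \<exists>N. \<forall>m\<ge>N. \<forall>n\<ge>N. nrm (W m \<^bold>- W n) < e"
 shows "\<exists>L\<in>carrier Q. \<forall>e>0. \<exists>N. \<forall>n\<ge>N. nrm (W n \<^bold>- L) < e"
proof -
 have "\<exists>r. nrm (W n \<^bold>- rc r) \<le> q ^ n" for n :: nat using density W by simp
 then obtain r where r: "\<And>n. nrm (W n \<^bold>- rc (r n)) \<le> q ^ n" by metis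
 have rsmall: "\<exists>N. \<forall>n\<ge>N. nrm (W n \<^bold>- rc (r n)) < e" if "e > 0" for e
 proof -
  obtain N where "q ^ N < e" using q_pow_small \<open>e > 0\<close> by blast
  hence "nrm (W n \<^bold>- rc (r n)) < e" if "n \<ge> N" for n :: nat
   using r[of n] q_pow_mono[OF that] by linarith
  thus ?thesis by blast
 qed
 have rC: "r \<in> carrier CC" unfolding CC_carrier
 proof (intro allI impI)
  fix e :: real assume e: "e > 0"
  obtain N1 where N1: "\<forall>n\<ge>N1. nrm (W n \<^bold>- rc (r n)) < e" using rsmall e by blast
  obtain N2 where N2: "\<forall>m\<ge>N2. \<forall>n\<ge>N2. nrm (W m \<^bold>- W n) < e" using C e by blast
  show "\<exists>N. \<forall>m\<ge>N. \<forall>n\<ge>N. padic_abs p (r m - r n) < e"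
  proof (intro exI[of _ "max N1 N2"] allI impI)
   fix m n assume mn: "m \<ge> max N1 N2" "n \<ge> max N1 N2"
   have "nrm (rc (r m) \<^bold>- rc (r n)) < e"
    using nrm_ultra3[of "rc (r m)" "W m" "rc (r n)"] nrm_ultra3[of "W m" "W n" "rc (r n)"]
     nrm_commute[of "rc (r m)" "W m"] N1[rule_format, of m] N1[rule_format, of n] N2[rule_format, of m n] mn W[of m] W[of n]
    by auto
   thus "padic_abs p (r m - r n) < e" by (metis rc_diff nrm_rc)
  qed
 qed
 show ?thesis
 proof (intro bexI[of _ "qc r"] allI impI)
  fix e :: real assume e: "e > 0"
  obtain N1 where N1: "\<forall>n\<ge>N1. nrm (W n \<^bold>- rc (r n)) < e" using rsmall e by blast
  have "e/2 > 0" using e by simp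
  then obtain N2 where N2: "\<forall>m\<ge>N2. \<forall>n\<ge>N2. padic_abs p (r m - r n) < e/2" using rC unfolding CC_carrier by blast
  show "\<exists>N. \<forall>n\<ge>N. nrm (W n \<^bold>- qc r) < e"
  proof (intro exI[of _ "max N1 N2"] allI impI)
   fix n assume n: "n \<ge> max N1 N2"
   have c: "(\<lambda>k. r n - r k) \<in> carrier CC" using CC_add[OF CC_const[of "r n"] CC_minus[OF rC]] by simp
   have "rc (r n) = qc (\<lambda>k. r n - r k) \<^bold>+ qc r"
    unfolding rc_def using qc_add[OF c rC] by simp
   hence *: "rc (r n) \<^bold>- qc r = qc (\<lambda>k. r n - r k)"
    using qc_closed c rC by (simp add: a_minus_def Q.a_assoc Q.r_neg)
   have "nrm (qc (\<lambda>k. r n - r k)) \<le> e/2"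
    by (rule LIMSEQ_le_const2[OF nrm_qc[OF c]]) (use N2 n less_imp_le in \<open>metis max.bounded_iff\<close>)
   hence "nrm (rc (r n) \<^bold>- qc r) < e" using * e by simp
   thus "nrm (W n \<^bold>- qc r) < e"
    using nrm_ultra3[of "W n" "rc (r n)" "qc r"] W[of n] qc_closed[OF rC] N1[rule_format, of n] n by auto
  qed
 qed (rule qc_closed[OF rC])
qed

lemma residue:
 assumes "W \<in> carrier Q" "nrm W \<le> 1" shows "\<exists>j<p. nrm (W \<^bold>- rc (of_nat j)) \<le> q"
proof -
 obtain r where r: "nrm (W \<^bold>- rc r) \<le> q" using density[OF assms(1)] q_pos by blast
 have "rc r = W \<^bold>- (W \<^bold>- rc r)" using assms
  by (simp add: a_minus_def Q.minus_add Q.r_neg2)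
 hence "nrm (rc r) \<le> max (nrm W) (nrm (W \<^bold>- rc r))" using nrm_diff assms by (metis Q.minus_closed rc_closed)
 hence r1: "padic_abs p r \<le> 1" using r assms q_less1 by simp
 obtain a b where ab: "quotient_of r = (a, b)" by force
 have b: "b > 0" and rab: "r = of_int a / of_int b" and cop: "coprime a b"
  using quotient_of_denom_pos[OF ab] quotient_of_div[OF ab] quotient_of_coprime[OF ab] by auto
 have "\<not> int p dvd b"
 proof
  assume pb: "int p dvd b"
  hence "\<not> int p dvd a" using cop prime_int_p by (meson coprime_common_divisor not_prime_unit)
  hence a0: "a \<noteq> 0" and "multiplicity (int p) a = 0" by (auto simp: not_dvd_imp_multiplicity_0)
  moreover have "multiplicity (int p) b \<ge> 1" using pb b prime_int_p
   by (intro multiplicity_geI) (auto dest: prime_gt_1_int)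
  ultimately have "padic_abs p r = real p ^ multiplicity (int p) b" using rab b pabs_frac[of a b] by simp
  moreover have "real p ^ multiplicity (int p) b > 1" using \<open>multiplicity (int p) b \<ge> 1\<close> p_ge2 by (intro one_less_power) auto
  ultimately show False using r1 by simp
 qed
 hence "coprime (int p) b" using prime_int_p by (simp add: prime_imp_coprime)
 then obtain u v where uv: "u * int p + v * b = 1" by (metis bezout_int coprime_imp_gcd_eq_1)
 define j where "j = nat ((a * v) mod int p)"
 have jp: "j < p" using p_ge2 unfolding j_def by (simp add: nat_less_iff)
 have "int j = (a * v) mod int p" using p_ge2 unfolding j_def by simp
 hence "int p dvd (a * v - int j)" by (simp add: mod_eq_dvd_iff)
 then obtain t where t: "a * v - int j = int p * t" by blast
 have "a - int j * b = a * (u * int p + v * b) - int j * b" by (simp add: uv)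
 also have "\<dots> = a * u * int p + (a * v - int j) * b" by (simp add: algebra_simps)
 also have "\<dots> = int p * (a * u + t * b)" unfolding t by (simp add: algebra_simps)
 finally have dv: "int p ^ 1 dvd a - int j * b" by simp
 have "(r - of_nat j) * of_int b = of_int (a - int j * b)" using rab b by (simp add: field_simps)
 hence "padic_abs p (r - of_nat j) * padic_abs p (of_int b) \<le> q"
  using dv pabs_of_int_le_iff[of "a - int j * b" 1] by (metis pabs_mult power_one_right)
 moreover have "padic_abs p (of_int b) = 1" using pabs_of_int[of b] b \<open>\<not> int p dvd b\<close>
  by (simp add: not_dvd_imp_multiplicity_0)
 ultimately have "nrm (rc r \<^bold>- rc (of_nat j)) \<le> q" by (metis mult.right_neutral rc_diff nrm_rc)
 thus ?thesis using jp r nrm_ultra3[of W "rc r" "rc (of_nat j)"] assms(1) by (intro exI[of _ j]) auto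
qed

end

section \<open>The p-adic integers and their units\<close>

context padic begin

lemma Q_minus_self [simp]: "x \<in> carrier Q ==> x \<^bold>- x = \<^bold>0"
 by (simp add: a_minus_def Q.r_neg)

lemma q_simps [simp]: "0 < q" "0 \<le> q" "q < 1" "q \<le> 1"
 using q_pos q_less1 by auto

lemma nrm_discrete: assumes "x \<in> carrier Q" "nrm x < q ^ k" shows "nrm x \<le> q ^ Suc k"
proof (cases "x = \<^bold>0")
 case False
 then obtain n where n: "nrm x = real p powi n" using nrm_powi assms by blast
 have qk: "q ^ k = real p powi (- int k)" for k
  by (simp add: q_def power_int_minus power_one_over inverse_eq_divide)
 have "real p powi n < real p powi (- int k)" using n assms qk by simp
 moreover have "real p powi (- int k) \<le> real p powi n" if "- int k \<le> n"
  using that p_ge2 by (intro power_int_increasing) auto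
 ultimately have "n < - int k" by (meson not_less)
 hence "n \<le> - int (Suc k)" by simp
 hence "real p powi n \<le> real p powi (- int (Suc k))" using p_ge2 by (intro power_int_increasing) auto
 thus ?thesis using n qk[of "Suc k"] by simp
qed (use q_pos in auto)

lemma nrm_discrete1: "x \<in> carrier Q ==> nrm x < 1 ==> nrm x \<le> q" using nrm_discrete[of x 0] by simp

lemma nrm_pow: "x \<in> carrier Q ==> nrm (x [^]\<^bsub>Q\<^esub> (n::nat)) = nrm x ^ n"
 by (induct n) (simp_all add: nrm_mult)

lemma nrm_add_le: "[|x \<in> carrier Q; y \<in> carrier Q; nrm x \<le> r; nrm y \<le> r|] ==> nrm (x \<^bold>+ y) \<le> r"
 using nrm_add[of x y] by linarith
lemma nrm_diff_le: "[|x \<in> carrier Q; y \<in> carrier Q; nrm x \<le> r; nrm y \<le> r|] ==> nrm (x \<^bold>- y) \<le> r"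
 using nrm_diff[of x y] by linarith
lemma nrm_trans_le: "[|x \<in> carrier Q; y \<in> carrier Q; z \<in> carrier Q; nrm (x \<^bold>- y) \<le> r; nrm (y \<^bold>- z) \<le> r|] ==> nrm (x \<^bold>- z) \<le> r"
 using nrm_ultra3[of x y z] by linarith
lemma nrm_trans_less: "[|x \<in> carrier Q; y \<in> carrier Q; z \<in> carrier Q; nrm (x \<^bold>- y) < r; nrm (y \<^bold>- z) < r|] ==> nrm (x \<^bold>- z) < r"
 using nrm_ultra3[of x y z] by linarith

lemma nrm_add_eq: assumes "x \<in> carrier Q" "y \<in> carrier Q" "nrm y < nrm x" shows "nrm (x \<^bold>+ y) = nrm x"
proof -
 have "x = (x \<^bold>+ y) \<^bold>- y" using assms(1,2) by algebra
 hence "nrm x \<le> max (nrm (x \<^bold>+ y)) (nrm y)" using nrm_diff[of "x \<^bold>+ y" y] assms by simp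
 thus ?thesis using nrm_add[of x y] assms by auto
qed

lemma nrm_close_eq: assumes "x \<in> carrier Q" "y \<in> carrier Q" "nrm (y \<^bold>- x) < nrm x" shows "nrm y = nrm x"
proof -
 have "y = x \<^bold>+ (y \<^bold>- x)" using assms(1,2) by algebra
 thus ?thesis using nrm_add_eq[of x "y \<^bold>- x"] assms by simp
qed

sublocale QM: Metric_space "carrier Q" "Qp_dist p"
proof
 fix x y z
 show "0 \<le> Qp_dist p x y" by (simp add: Qp_dist_def nrm_nonneg)
 show "Qp_dist p x y = Qp_dist p y x" by (simp add: Qp_dist_def nrm_commute)
 show "Qp_dist p x y = 0 \<longleftrightarrow> x = y" if "x \<in> carrier Q" "y \<in> carrier Q"
  using that by (simp add: Qp_dist_def nrm_eq_0)
 show "Qp_dist p x z \<le> Qp_dist p x y + Qp_dist p y z"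
  if "x \<in> carrier Q" "y \<in> carrier Q" "z \<in> carrier Q"
  using that nrm_ultra3[of x y z] nrm_nonneg[of "x \<^bold>- y"] nrm_nonneg[of "y \<^bold>- z"]
  by (simp add: Qp_dist_def)
qed

lemma topspace_Qp_top [simp]: "topspace (Qp_top p) = carrier Q" by (simp add: Qp_top_def)

lemma openin_Qp_top:
 "openin (Qp_top p) S \<longleftrightarrow> S \<subseteq> carrier Q \<and> (\<forall>x\<in>S. \<exists>k. \<forall>y\<in>carrier Q. nrm (y \<^bold>- x) \<le> q ^ k --> y \<in> S)"
proof -
 have "(\<exists>r>0. QM.mball x r \<subseteq> S) \<longleftrightarrow> (\<exists>k. \<forall>y\<in>carrier Q. nrm (y \<^bold>- x) \<le> q ^ k --> y \<in> S)"
  if x: "x \<in> carrier Q" for x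
 proof
  assume "\<exists>r>0. QM.mball x r \<subseteq> S"
  then obtain r where r: "r > 0" "QM.mball x r \<subseteq> S" by blast
  obtain k where k: "q ^ k < r" using q_pow_small r by blast
  have "y \<in> S" if "y \<in> carrier Q" "nrm (y \<^bold>- x) \<le> q ^ k" for y
   using r(2) x k that nrm_commute[of x y] by (auto simp: Qp_dist_def)
  thus "\<exists>k. \<forall>y\<in>carrier Q. nrm (y \<^bold>- x) \<le> q ^ k --> y \<in> S" by blast
 next
  assume "\<exists>k. \<forall>y\<in>carrier Q. nrm (y \<^bold>- x) \<le> q ^ k --> y \<in> S"
  then obtain k where k: "\<forall>y\<in>carrier Q. nrm (y \<^bold>- x) \<le> q ^ k --> y \<in> S" by blast
  have "QM.mball x (q ^ k) \<subseteq> S" using x k nrm_commute by (auto simp: Qp_dist_def)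
  thus "\<exists>r>0. QM.mball x r \<subseteq> S" using q_pow_pos by blast
 qed
 thus ?thesis unfolding Qp_top_def QM.openin_mtopology by blast
qed

lemma openin_ball: assumes "a \<in> carrier Q" shows "openin (Qp_top p) {x \<in> carrier Q. nrm (x \<^bold>- a) \<le> q ^ k}"
 unfolding openin_Qp_top
proof (intro conjI ballI)
 fix x assume x: "x \<in> {x \<in> carrier Q. nrm (x \<^bold>- a) \<le> q ^ k}"
 show "\<exists>k'. \<forall>y\<in>carrier Q. nrm (y \<^bold>- x) \<le> q ^ k' --> y \<in> {x \<in> carrier Q. nrm (x \<^bold>- a) \<le> q ^ k}"
  using x assms nrm_trans_le[of _ x a "q^k"] by (intro exI[of _ k]) auto
qed auto

abbreviation Z where "Z \<equiv> Zp p"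

lemma Z_simps [simp]: "\<one>\<^bsub>Z\<^esub> = \<^bold>1" "\<zero>\<^bsub>Z\<^esub> = \<^bold>0" "x \<otimes>\<^bsub>Z\<^esub> y = x \<^bold>* y" "x \<oplus>\<^bsub>Z\<^esub> y = x \<^bold>+ y"
 by (simp_all add: Zp_def)

lemma Z_carrier: "x \<in> carrier Z \<longleftrightarrow> x \<in> carrier Q \<and> nrm x \<le> 1" by (simp add: Zp_def)
lemma Z_closed [dest]: "x \<in> carrier Z ==> x \<in> carrier Q" by (simp add: Z_carrier)

lemma Z_subring: "subring (carrier Z) Q"
 by (rule Q.subringI) (auto simp: Z_carrier nrm_mult nrm_nonneg mult_le_one intro: nrm_add_le)

lemma Z_eq: "Z = Q\<lparr>carrier := carrier Z\<rparr>" unfolding Zp_def by simp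

lemma Z_domain: "domain Z" using Q.subring_is_domain[OF Z_subring] by (rule subst[where P = domain, OF Z_eq[symmetric]])

sublocale Z: domain Z by (rule Z_domain)

lemma Z_uminus [simp]: assumes "x \<in> carrier Z" shows "\<ominus>\<^bsub>Z\<^esub> x = \<^bold>- x"
proof -
 have "\<^bold>- x \<in> carrier Z" using assms by (simp add: Z_carrier)
 thus ?thesis using assms Z.minus_equality[of "\<^bold>- x" x] Z_closed by (simp add: Q.l_neg)
qed

lemma Z_minus: "x \<in> carrier Z ==> y \<in> carrier Z ==> x \<ominus>\<^bsub>Z\<^esub> y = x \<^bold>- y" by (simp add: a_minus_def)

lemma Z_pow [simp]: "x [^]\<^bsub>Z\<^esub> (n::nat) = x [^]\<^bsub>Q\<^esub> n"
 by (induct n) (simp_all add: nat_pow_def)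

lemma rc_of_int_Z [simp]: "rc (of_int j) \<in> carrier Z" "rc (of_nat j) \<in> carrier Z"
 using pabs_of_int_le1[of j] pabs_of_int_le1[of "int j"] by (simp_all add: Z_carrier)

lemma nrm_inv: assumes "x \<in> carrier Q" "x \<noteq> \<^bold>0" shows "inv\<^bsub>Q\<^esub> x \<in> carrier Q" "x \<^bold>* inv\<^bsub>Q\<^esub> x = \<^bold>1" "nrm (inv\<^bsub>Q\<^esub> x) = inverse (nrm x)"
proof -
 have u: "x \<in> Units Q" using assms Q.field_Units by simp
 show i: "inv\<^bsub>Q\<^esub> x \<in> carrier Q" "x \<^bold>* inv\<^bsub>Q\<^esub> x = \<^bold>1" using u by simp_all
 hence "nrm x * nrm (inv\<^bsub>Q\<^esub> x) = 1" using assms nrm_mult nrm_one by metis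
 thus "nrm (inv\<^bsub>Q\<^esub> x) = inverse (nrm x)" by (simp add: inverse_unique)
qed

abbreviation UU where "UU \<equiv> Zp_units p"

lemma UU_simps [simp]: "\<one>\<^bsub>UU\<^esub> = \<^bold>1" "x \<otimes>\<^bsub>UU\<^esub> y = x \<^bold>* y"
 by (simp_all add: units_of_def)

lemma UU_carrier: "x \<in> carrier UU \<longleftrightarrow> x \<in> carrier Q \<and> nrm x = 1"
proof -
 have "x \<in> Units Z \<longleftrightarrow> x \<in> carrier Q \<and> nrm x = 1"
 proof
  assume "x \<in> Units Z"
  then obtain y where y: "x \<in> carrier Z" "y \<in> carrier Z" "x \<^bold>* y = \<^bold>1" by (auto simp: Units_def)
  have "nrm x * nrm y = 1" using y nrm_mult[of x y] Z_closed by simp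
  moreover have "nrm x * nrm y \<le> nrm x * 1" using y nrm_nonneg[of x] by (intro mult_left_mono) (auto simp: Z_carrier)
  ultimately show "x \<in> carrier Q \<and> nrm x = 1" using y by (auto simp: Z_carrier)
 next
  assume x: "x \<in> carrier Q \<and> nrm x = 1"
  hence "x \<noteq> \<^bold>0" by auto
  thus "x \<in> Units Z" unfolding Units_def using nrm_inv[of x] x Q.m_comm[of x "inv\<^bsub>Q\<^esub> x"]
   by (auto simp: Z_carrier intro!: bexI[of _ "inv\<^bsub>Q\<^esub> x"])
 qed
 thus ?thesis by (simp add: units_of_def)
qed

sublocale UU: comm_group UU by (rule Z.units_comm_group)

lemma UU_closed [dest]: "x \<in> carrier UU ==> x \<in> carrier Q" by (simp add: UU_carrier)

lemma UU_pow [simp]: "x [^]\<^bsub>UU\<^esub> (n::nat) = x [^]\<^bsub>Q\<^esub> n"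
 by (induct n) (simp_all add: nat_pow_def)

lemma topspace_UU [simp]: "topspace (Zp_units_top p) = carrier UU"
 by (auto simp: Zp_units_top_def UU_carrier)

lemma openin_UU: "openin (Zp_units_top p) S \<longleftrightarrow>
  S \<subseteq> carrier UU \<and> (\<forall>x\<in>S. \<exists>k. \<forall>y\<in>carrier UU. nrm (y \<^bold>- x) \<le> q ^ k --> y \<in> S)"
proof
 assume "openin (Zp_units_top p) S"
 then obtain V where V: "openin (Qp_top p) V" "S = V \<inter> carrier UU"
  unfolding Zp_units_top_def openin_subtopology by blast
 show "S \<subseteq> carrier UU \<and> (\<forall>x\<in>S. \<exists>k. \<forall>y\<in>carrier UU. nrm (y \<^bold>- x) \<le> q ^ k --> y \<in> S)"
 proof (intro conjI ballI)
  fix x assume "x \<in> S"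
  then obtain k where "\<forall>y\<in>carrier Q. nrm (y \<^bold>- x) \<le> q ^ k --> y \<in> V" using V unfolding openin_Qp_top by blast
  thus "\<exists>k. \<forall>y\<in>carrier UU. nrm (y \<^bold>- x) \<le> q ^ k --> y \<in> S" using V by auto
 qed (use V in auto)
next
 assume S: "S \<subseteq> carrier UU \<and> (\<forall>x\<in>S. \<exists>k. \<forall>y\<in>carrier UU. nrm (y \<^bold>- x) \<le> q ^ k --> y \<in> S)"
 have SQ: "S \<subseteq> carrier Q" using S UU_closed by blast
 have "openin (Qp_top p) S" unfolding openin_Qp_top
 proof (intro conjI ballI)
  show "S \<subseteq> carrier Q" by (rule SQ)
  fix x assume x: "x \<in> S"
  then obtain k where k: "\<forall>y\<in>carrier UU. nrm (y \<^bold>- x) \<le> q ^ k --> y \<in> S" using S by blast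
  show "\<exists>k. \<forall>y\<in>carrier Q. nrm (y \<^bold>- x) \<le> q ^ k --> y \<in> S"
  proof (intro exI[of _ "Suc k"] ballI impI)
   fix y assume y: "y \<in> carrier Q" "nrm (y \<^bold>- x) \<le> q ^ Suc k"
   have "nrm x = 1" "x \<in> carrier Q" using x S UU_carrier by auto
   moreover have "q ^ Suc k \<le> q ^ k" "q ^ Suc k < q ^ 0" by (rule q_pow_mono, simp) (rule q_pow_less_iff[THEN iffD2], simp)
   ultimately have "nrm y = 1" using nrm_close_eq[of x y] y by simp
   moreover have "nrm (y \<^bold>- x) \<le> q ^ k" using y(2) \<open>q ^ Suc k \<le> q ^ k\<close> by (rule order.trans)
   ultimately show "y \<in> S" using k y(1) UU_carrier by blast
  qed
 qed
 moreover have "S = S \<inter> carrier UU" using S by blast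
 ultimately show "openin (Zp_units_top p) S" unfolding Zp_units_top_def openin_subtopology by blast
qed

definition UK :: "nat => padic set" where "UK k = {x \<in> carrier Q. nrm (x \<^bold>- \<^bold>1) \<le> q ^ Suc k}"

lemma UK_unit: "x \<in> UK k ==> x \<in> carrier UU"
proof -
 assume x: "x \<in> UK k"
 have "q ^ Suc k < q ^ 0" using q_pow_less_iff by blast
 thus ?thesis using x nrm_close_eq[of "\<^bold>1" x] by (simp add: UK_def UU_carrier)
qed

lemma nrm_mult_diff:
 assumes "x \<in> carrier Z" "y \<in> carrier Z" "x' \<in> carrier Z" "y' \<in> carrier Z"
  "nrm (x \<^bold>- x') \<le> r" "nrm (y \<^bold>- y') \<le> r"
 shows "nrm (x \<^bold>* y \<^bold>- x' \<^bold>* y') \<le> r"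
proof -
 have c: "x \<in> carrier Q" "y \<in> carrier Q" "x' \<in> carrier Q" "y' \<in> carrier Q" using assms by auto
 have e: "x \<^bold>* y \<^bold>- x' \<^bold>* y' = x \<^bold>* (y \<^bold>- y') \<^bold>+ (x \<^bold>- x') \<^bold>* y'"
  using c by algebra
 have "nrm x * nrm (y \<^bold>- y') \<le> 1 * r" using assms c nrm_nonneg by (intro mult_mono) (auto simp: Z_carrier)
 moreover have "nrm (x \<^bold>- x') * nrm y' \<le> r * 1" using assms c nrm_nonneg[of "x \<^bold>- x'"] nrm_nonneg[of y']
  by (intro mult_mono) (auto simp: Z_carrier)
 ultimately show ?thesis unfolding e using c by (intro nrm_add_le) (auto simp: nrm_mult)
qed

lemma nrm_pow_diff: assumes "x \<in> carrier Z" "y \<in> carrier Z"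
 shows "nrm (x [^]\<^bsub>Q\<^esub> n \<^bold>- y [^]\<^bsub>Q\<^esub> (n::nat)) \<le> nrm (x \<^bold>- y)"
proof (induct n)
 case 0 show ?case using assms nrm_nonneg[of "x \<^bold>- y"] Z_closed by simp
next
 case (Suc n)
 have "x [^]\<^bsub>Z\<^esub> n \<in> carrier Z" "y [^]\<^bsub>Z\<^esub> n \<in> carrier Z" using assms by blast+
 thus ?case using Suc nrm_mult_diff[of "x [^]\<^bsub>Q\<^esub> n" x "y [^]\<^bsub>Q\<^esub> n" y "nrm (x \<^bold>- y)"] assms by simp
qed

lemma UU_Z: "x \<in> carrier UU ==> x \<in> carrier Z" by (simp add: UU_carrier Z_carrier)

lemma UK_subgroup: "subgroup (UK k) UU"
proof
 show "UK k \<subseteq> carrier UU" using UK_unit by blast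
 show "\<one>\<^bsub>UU\<^esub> \<in> UK k" by (simp add: UK_def less_imp_le)
next
 fix x y assume xy: "x \<in> UK k" "y \<in> UK k"
 have "nrm (x \<^bold>* y \<^bold>- \<^bold>1 \<^bold>* \<^bold>1) \<le> q ^ Suc k"
  using xy UK_unit UU_Z by (intro nrm_mult_diff) (auto simp: UK_def Z_carrier)
 thus "x \<otimes>\<^bsub>UU\<^esub> y \<in> UK k" using xy by (simp add: UK_def)
next
 fix x assume x: "x \<in> UK k"
 define y where "y = inv\<^bsub>UU\<^esub> x"
 have y: "y \<in> carrier UU" "x \<^bold>* y = \<^bold>1" unfolding y_def using UU.r_inv[OF UK_unit[OF x]] UK_unit[OF x] by auto
 have xQ: "x \<in> carrier Q" using x by (simp add: UK_def)
 have "y \<^bold>- \<^bold>1 = y \<^bold>* (\<^bold>1 \<^bold>- x)" using y xQ Q.m_comm[of x y] UU_closed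
  by (simp add: a_minus_def Q.r_distr Q.r_minus)
 hence "nrm (y \<^bold>- \<^bold>1) = nrm (x \<^bold>- \<^bold>1)" using y xQ nrm_commute[of x "\<^bold>1"] by (simp add: nrm_mult UU_carrier)
 thus "inv\<^bsub>UU\<^esub> x \<in> UK k" using x y UU_closed by (simp add: UK_def y_def)
qed

lemma UK_open_normal: "UK k \<in> open_normal UU (Zp_units_top p)"
 unfolding open_normal_def mem_Collect_eq
proof
 show "UK k \<lhd> UU" using UK_subgroup by (rule UU.subgroup_imp_normal)
 show "openin (Zp_units_top p) (UK k)" unfolding openin_UU
 proof (intro conjI ballI)
  fix x assume x: "x \<in> UK k"
  show "\<exists>k'. \<forall>y\<in>carrier UU. nrm (y \<^bold>- x) \<le> q ^ k' --> y \<in> UK k"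
   using x nrm_trans_le[of _ x "\<^bold>1" "q ^ Suc k"] by (intro exI[of _ "Suc k"]) (auto simp: UK_def)
 qed (use UK_unit in blast)
qed

lemma UU_quotient_pow:
 assumes N: "subgroup N UU" and A: "subgroup A UU" and NA: "N \<subseteq> A" and x: "x \<in> A"
 shows "x [^]\<^bsub>Q\<^esub> card (rcosets\<^bsub>UU\<lparr>carrier := A\<rparr>\<^esub> N) \<in> N"
proof -
 let ?G = "UU\<lparr>carrier := A\<rparr>"
 interpret G: comm_group ?G
  using UU.subgroup_imp_group[OF A] by (rule group.group_comm_groupI) (use subgroup.subset[OF A] UU.m_comm in auto)
 have sN: "subgroup N ?G" using N A NA by (metis UU.subgroup_incl)
 hence "N \<lhd> ?G" by (rule G.subgroup_imp_normal)
 then interpret N: normal N ?G .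
 interpret F: group "?G Mod N" by (rule N.factorgroup_is_group)
 have c: "N #>\<^bsub>?G\<^esub> x \<in> carrier (?G Mod N)" using x by (auto simp: FactGroup_def RCOSETS_def)
 have "(N #>\<^bsub>?G\<^esub> x) [^]\<^bsub>?G Mod N\<^esub> order (?G Mod N) = \<one>\<^bsub>?G Mod N\<^esub>" using F.pow_order_eq_1[OF c] .
 moreover have "(N #>\<^bsub>?G\<^esub> x) [^]\<^bsub>?G Mod N\<^esub> (n::nat) = N #>\<^bsub>?G\<^esub> (x [^]\<^bsub>?G\<^esub> n)" for n
 proof (induct n)
  case (Suc n)
  have "x [^]\<^bsub>?G\<^esub> n \<in> carrier ?G" using x by (intro G.nat_pow_closed) simp
  thus ?case using Suc x N.rcos_sum[of "x [^]\<^bsub>?G\<^esub> n" x] by simp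
 qed (use UU.coset_mult_one[OF subgroup.subset[OF N]] in simp)
 ultimately have "N #>\<^bsub>?G\<^esub> (x [^]\<^bsub>?G\<^esub> order (?G Mod N)) = N" by simp
 hence "x [^]\<^bsub>?G\<^esub> order (?G Mod N) \<in> N" using G.coset_join1[OF _ _ sN] x G.nat_pow_closed N.subset by simp
 moreover have "x [^]\<^bsub>?G\<^esub> (n::nat) = x [^]\<^bsub>Q\<^esub> n" for n by (induct n) (simp_all add: nat_pow_def)
 ultimately show ?thesis by (simp add: order_def FactGroup_def)
qed

lemma rc_pow: "rc r [^]\<^bsub>Q\<^esub> (n::nat) = rc (r ^ n)"
 by (induct n) (simp_all add: rc_1 rc_mult Q.m_comm)

lemma fermat_pow: "[j ^ (p ^ m) = j] (mod p)"
proof (induct m)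
 case (Suc m)
 have "[(j ^ (p ^ m)) ^ p = j ^ (p ^ m)] (mod p)" for j
 proof (cases "p dvd j ^ (p^m)")
  case True
  hence "p dvd (j ^ (p^m)) ^ p" using p_ge2 by (meson dvd_power dvd_trans less_le_trans pos2 zero_less_numeral)
  thus ?thesis using True by (simp add: cong_def mod_eq_0_iff_dvd)
 next
  case False
  have "[(j ^ (p^m)) ^ (p - 1) = 1] (mod p)" using fermat_theorem[OF prime_p False] .
  hence "[(j ^ (p^m)) ^ (p - 1) * j ^ (p^m) = 1 * j ^ (p^m)] (mod p)" by (rule cong_scalar_right)
  moreover have "(j ^ (p^m)) ^ (p - 1) * j ^ (p^m) = (j ^ (p^m)) ^ p" using p_ge2
   by (metis One_nat_def Suc_pred' mult.commute not_gr_zero not_numeral_le_zero power_Suc)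
  ultimately show ?thesis by simp
 qed
 from cong_trans[OF this Suc] show ?case by (simp add: power_mult[symmetric] mult.commute)
qed simp

lemma cong_nrm: assumes "[i = j] (mod p)" shows "nrm (rc (of_nat i) \<^bold>- rc (of_nat j)) \<le> q"
proof -
 have "int p ^ 1 dvd int i - int j" using assms by (metis cong_iff_dvd_diff cong_int_iff power_one_right)
 hence "padic_abs p (of_int (int i - int j)) \<le> q" using pabs_of_int_le_iff[of "int i - int j" 1] by simp
 thus ?thesis by (simp flip: rc_diff)
qed

lemma pow_p_close: assumes x: "x \<in> carrier Z" and n: "nrm (x [^]\<^bsub>Q\<^esub> (p ^ m) \<^bold>- \<^bold>1) \<le> q"
 shows "nrm (x \<^bold>- \<^bold>1) \<le> q"
proof -
 obtain j where j: "nrm (x \<^bold>- rc (of_nat j)) \<le> q" using residue x by (auto simp: Z_carrier)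
 have xQ: "x \<in> carrier Q" using x by (rule Z_closed)
 have "nrm (x [^]\<^bsub>Q\<^esub> (p^m) \<^bold>- rc (of_nat j) [^]\<^bsub>Q\<^esub> (p ^ m)) \<le> q"
  using nrm_pow_diff[OF x, of "rc (of_nat j)" "p^m"] j by simp
 moreover have "nrm (rc (of_nat j) [^]\<^bsub>Q\<^esub> (p ^ m) \<^bold>- rc (of_nat j)) \<le> q"
  using cong_nrm[OF fermat_pow[of j m]] by (simp add: rc_pow)
 ultimately have "nrm (x [^]\<^bsub>Q\<^esub> (p^m) \<^bold>- rc (of_nat j)) \<le> q" using xQ by - (rule nrm_trans_le[of "x [^]\<^bsub>Q\<^esub> (p^m)" "rc (of_nat j) [^]\<^bsub>Q\<^esub> (p ^ m)"], auto)
 moreover have "nrm (rc (of_nat j) \<^bold>- x) \<le> q" using j nrm_commute[of x "rc (of_nat j)"] xQ by simp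
 ultimately have "nrm (x [^]\<^bsub>Q\<^esub> (p^m) \<^bold>- x) \<le> q" using xQ by - (rule nrm_trans_le[of _ "rc (of_nat j)"], auto)
 hence "nrm (x \<^bold>- x [^]\<^bsub>Q\<^esub> (p^m)) \<le> q" using xQ nrm_commute[of x "x [^]\<^bsub>Q\<^esub> (p^m)"] by simp
 thus ?thesis using n xQ by - (rule nrm_trans_le[of x "x [^]\<^bsub>Q\<^esub> (p^m)"], auto)
qed

text \<open>Writing \<open>x = 1 + y\<close>, one has \<open>x\<^sup>p - 1 = y S\<close> with \<open>S = \<Sum>i<p. x ^ i\<close>, and modulo \<open>y\<^sup>2\<close> the sum \<open>S\<close> is
 \<open>p + y p (p - 1) / 2\<close>; this is where \<open>p\<close> has to be odd.\<close>

lemma nrm_pow_p: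
 assumes "odd p" and x: "x \<in> carrier Q" "nrm (x \<^bold>- \<^bold>1) \<le> q"
 shows "nrm (x [^]\<^bsub>Q\<^esub> p \<^bold>- \<^bold>1) = q * nrm (x \<^bold>- \<^bold>1)"
proof -
 define y where "y = x \<^bold>- \<^bold>1"
 define r where "r = nrm y * nrm y"
 have y: "y \<in> carrier Q" "nrm y \<le> q" using x by (auto simp: y_def)
 have xy: "x = \<^bold>1 \<^bold>+ y" unfolding y_def using x(1) by algebra
 have r: "0 \<le> r" "r \<le> q * q" using y nrm_nonneg[of y] q_pos by (auto simp: r_def intro: mult_mono)
 have x1: "nrm x \<le> 1" unfolding xy using y q_less1 by (intro nrm_add_le) (auto intro: order.trans[of _ q])
 have n: "nrm (rc (of_nat i)) \<le> 1" for i using rc_of_int_Z(2)[of i] by (simp only: Z_carrier)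
 have pw: "nrm (x [^]\<^bsub>Q\<^esub> i \<^bold>- (\<^bold>1 \<^bold>+ rc (of_nat i) \<^bold>* y)) \<le> r" for i :: nat
 proof (induct i)
  case 0 show ?case using y r by (simp add: rc_0)
 next
  case (Suc i)
  define c where "c = rc (of_nat i)"
  define w where "w = x [^]\<^bsub>Q\<^esub> i"
  have cw: "c \<in> carrier Q" "w \<in> carrier Q" using x by (auto simp: c_def w_def)
  have cS: "rc (of_nat (Suc i)) = \<^bold>1 \<^bold>+ c" by (simp add: c_def flip: rc_1 rc_add)
  have e: "x [^]\<^bsub>Q\<^esub> Suc i \<^bold>- (\<^bold>1 \<^bold>+ rc (of_nat (Suc i)) \<^bold>* y)
    = x \<^bold>* (w \<^bold>- (\<^bold>1 \<^bold>+ c \<^bold>* y)) \<^bold>+ c \<^bold>* (y \<^bold>* y)"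
  proof -
   have "w \<^bold>* (\<^bold>1 \<^bold>+ y) \<^bold>- (\<^bold>1 \<^bold>+ (\<^bold>1 \<^bold>+ c) \<^bold>* y)
    = (\<^bold>1 \<^bold>+ y) \<^bold>* (w \<^bold>- (\<^bold>1 \<^bold>+ c \<^bold>* y)) \<^bold>+ c \<^bold>* (y \<^bold>* y)"
    using cw y(1) by algebra
   thus ?thesis unfolding cS w_def[symmetric] Q.nat_pow_Suc xy[symmetric] .
  qed
  have "nrm x * nrm (w \<^bold>- (\<^bold>1 \<^bold>+ c \<^bold>* y)) \<le> 1 * r"
   using Suc x1 cw y nrm_nonneg x(1) by (intro mult_mono) (auto simp: c_def w_def)
  moreover have "nrm c * r \<le> 1 * r" using n[of i] r by (intro mult_right_mono) (auto simp: c_def)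
  ultimately show ?case unfolding e using cw x y by (intro nrm_add_le) (auto simp: nrm_mult r_def)
 qed
 define S where "S m = (\<Oplus>\<^bsub>Q\<^esub>i\<in>{..<m}. x [^]\<^bsub>Q\<^esub> i)" for m :: nat
 have SQ: "S m \<in> carrier Q" for m unfolding S_def using x by (intro Q.finsum_closed) auto
 have S_Suc: "S (Suc m) = x [^]\<^bsub>Q\<^esub> m \<^bold>+ S m" for m
  unfolding S_def lessThan_Suc using x by (subst Q.finsum_insert) auto
 have tel: "x [^]\<^bsub>Q\<^esub> m \<^bold>- \<^bold>1 = y \<^bold>* S m" for m
 proof (induct m)
  case 0 show ?case using y by (simp add: S_def)
 next
  case (Suc m)
  define w where "w = x [^]\<^bsub>Q\<^esub> m"
  have w: "w \<in> carrier Q" using x by (simp add: w_def)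
  have "w \<^bold>* (\<^bold>1 \<^bold>+ y) \<^bold>- \<^bold>1 = y \<^bold>* w \<^bold>+ (w \<^bold>- \<^bold>1)" using w y(1) by algebra
  thus ?case using Suc y w SQ unfolding S_Suc by (simp add: w_def[symmetric] xy[symmetric] Q.r_distr)
 qed
 define t where "t m = rc (of_nat (m * (m - 1) div 2))" for m
 have SS: "nrm (S m \<^bold>- (rc (of_nat m) \<^bold>+ t m \<^bold>* y)) \<le> r" for m
 proof (induct m)
  case 0 show ?case using y r by (simp add: S_def t_def rc_0)
 next
  case (Suc m)
  have "Suc m * (Suc m - 1) = m * (m - 1) + 2 * m" by (cases m) auto
  hence "Suc m * (Suc m - 1) div 2 = m * (m - 1) div 2 + m" by simp
  hence tS: "t (Suc m) = t m \<^bold>+ rc (of_nat m)" by (simp add: t_def flip: rc_add)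
  have mS: "rc (of_nat (Suc m)) = \<^bold>1 \<^bold>+ rc (of_nat m)" by (simp flip: rc_1 rc_add)
  define c where "c = rc (of_nat m)"
  define w where "w = x [^]\<^bsub>Q\<^esub> m"
  have cw: "c \<in> carrier Q" "w \<in> carrier Q" "t m \<in> carrier Q" "S m \<in> carrier Q" using x SQ by (auto simp: c_def w_def t_def)
  have e: "S (Suc m) \<^bold>- (rc (of_nat (Suc m)) \<^bold>+ t (Suc m) \<^bold>* y)
   = (w \<^bold>- (\<^bold>1 \<^bold>+ c \<^bold>* y)) \<^bold>+ (S m \<^bold>- (c \<^bold>+ t m \<^bold>* y))"
   unfolding S_Suc tS mS w_def[symmetric] c_def[symmetric] using cw y(1) by algebra
  show ?case unfolding e using cw y Suc pw[of m] by (intro nrm_add_le) (auto simp: c_def w_def)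
 qed
 have "p * (p - 1) div 2 = p * ((p - 1) div 2)" using assms(1) by (intro div_mult_swap[symmetric]) (auto simp: even_diff_nat)
 hence "t p = rc (of_nat p) \<^bold>* rc (of_nat ((p - 1) div 2))" by (simp add: t_def flip: rc_mult)
 hence "nrm (t p) \<le> q * 1" using n[of "(p-1) div 2"] q_pos pabs_p by (simp add: nrm_mult)
 hence ty: "nrm (t p \<^bold>* y) \<le> q * q" using y nrm_nonneg[of y] q_pos by (simp add: t_def nrm_mult mult_mono nrm_nonneg)
 have tc: "t p \<in> carrier Q" by (simp add: t_def)
 have e: "S p \<^bold>- rc (of_nat p) = (S p \<^bold>- (rc (of_nat p) \<^bold>+ t p \<^bold>* y)) \<^bold>+ t p \<^bold>* y"
  using SQ[of p] tc y(1) rc_closed[of "of_nat p"] by algebra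
 have "nrm (S p \<^bold>- rc (of_nat p)) \<le> q * q"
  unfolding e using SQ[of p] tc y SS[of p] r ty by (intro nrm_add_le) auto
 also have "\<dots> < q" using q_pos q_less1 by simp
 finally have "nrm (S p) = q" using nrm_close_eq[of "rc (of_nat p)" "S p"] SQ[of p] pabs_p by simp
 thus ?thesis unfolding tel using y SQ[of p] by (simp add: nrm_mult y_def[symmetric])
qed

lemma nrm_pow_pp:
 assumes "odd p" and x: "x \<in> carrier Q" "nrm (x \<^bold>- \<^bold>1) \<le> q"
 shows "nrm (x [^]\<^bsub>Q\<^esub> (p ^ i) \<^bold>- \<^bold>1) = q ^ i * nrm (x \<^bold>- \<^bold>1)"
proof (induct i)
 case (Suc i)
 have "q ^ i * nrm (x \<^bold>- \<^bold>1) \<le> 1 * q" using x nrm_nonneg by (intro mult_mono) auto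
 hence "nrm ((x [^]\<^bsub>Q\<^esub> (p ^ i)) [^]\<^bsub>Q\<^esub> p \<^bold>- \<^bold>1) = q * nrm (x [^]\<^bsub>Q\<^esub> (p ^ i) \<^bold>- \<^bold>1)"
  using x Suc by (intro nrm_pow_p assms(1)) auto
 thus ?case using Suc x by (simp add: Q.nat_pow_pow mult.commute)
qed (use x in simp)

end

section \<open>The Sylow subgroup of the units and its characters\<close>

context padic begin

lemma Sylow_close:
 assumes "profinite_Sylow p UU (Zp_units_top p) \<Gamma>" "x \<in> \<Gamma>"
 shows "nrm (x \<^bold>- \<^bold>1) \<le> q"
proof -
 have sub: "subgroup \<Gamma> UU" using assms by (simp add: profinite_Sylow_def)
 obtain m where m: "card (rcosets\<^bsub>UU\<lparr>carrier := \<Gamma>\<rparr>\<^esub> (\<Gamma> \<inter> UK 0)) = p ^ m"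
  using assms UK_open_normal unfolding profinite_Sylow_def by blast
 have s: "subgroup (\<Gamma> \<inter> UK 0) UU" using sub UK_subgroup by (rule UU.subgroups_Inter_pair)
 have "x [^]\<^bsub>Q\<^esub> (p ^ m) \<in> \<Gamma> \<inter> UK 0" using UU_quotient_pow[OF s sub _ assms(2)] unfolding m by blast
 hence "nrm (x [^]\<^bsub>Q\<^esub> (p ^ m) \<^bold>- \<^bold>1) \<le> q" by (simp add: UK_def)
 moreover have "x \<in> carrier Z" using subgroup.subset[OF sub] assms(2) UU_Z by blast
 ultimately show ?thesis using pow_p_close by blast
qed

text \<open>Since the index is prime to \<open>p\<close>, the \<open>p\<close>-element \<open>1 + p^(k+1)\<close> of \<open>UU / UK (k + 1)\<close> lies in the image of \<open>\<Gamma>\<close>.\<close>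

lemma Sylow_accumulates:
 assumes "odd p" and "profinite_Sylow p UU (Zp_units_top p) \<Gamma>"
 shows "\<exists>g\<in>\<Gamma>. g \<noteq> \<^bold>1 \<and> nrm (g \<^bold>- \<^bold>1) \<le> q ^ Suc k"
proof -
 have sub: "subgroup \<Gamma> UU" using assms by (simp add: profinite_Sylow_def)
 define N where "N = \<Gamma> <#>\<^bsub>UU\<^esub> UK (Suc k)"
 define m where "m = card (rcosets\<^bsub>UU\<^esub> N)"
 have cop: "coprime p m" using assms(2) UK_open_normal unfolding profinite_Sylow_def N_def m_def by blast
 have sN: "subgroup N UU" unfolding N_def by (rule UU.mult_subgroups[OF sub UK_subgroup])
 define x where "x = rc (1 + of_nat p ^ Suc k)"
 have x1: "x \<^bold>- \<^bold>1 = rc (of_nat p ^ Suc k)" unfolding x_def by (simp flip: rc_1 rc_diff)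
 have "rc (of_nat p ^ Suc k) = rc (of_nat p) [^]\<^bsub>Q\<^esub> Suc k" by (rule rc_pow[symmetric])
 hence nx: "nrm (x \<^bold>- \<^bold>1) = q ^ Suc k" unfolding x1 using nrm_pow[OF rc_closed, of "of_nat p" "Suc k"] pabs_p by (simp only: nrm_rc)
 have xQ: "x \<in> carrier Q" by (simp add: x_def)
 have xU: "x \<in> UK k" using nx xQ by (simp add: UK_def)
 have xUU: "x \<in> carrier UU" using UK_unit xU .
 have "q ^ Suc k \<le> q ^ 1" by (rule q_pow_mono) simp
 hence "nrm (x [^]\<^bsub>Q\<^esub> p \<^bold>- \<^bold>1) = q ^ Suc (Suc k)" using nrm_pow_p[OF assms(1) xQ] nx by simp
 hence xp: "x [^]\<^bsub>Q\<^esub> p \<in> UK (Suc k)" using xQ by (simp add: UK_def)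
 have UN: "UK (Suc k) \<subseteq> N" unfolding N_def set_mult_def using subgroup.one_closed[OF sub] UK_unit
  by (auto simp: UU_carrier intro!: bexI[of _ "\<^bold>1"])
 have xm: "x [^]\<^bsub>Q\<^esub> m \<in> N" using UU_quotient_pow[OF sN UU.subgroup_self subgroup.subset[OF sN] xUU]
  by (simp add: m_def)
 obtain a where "[m * a = Suc 0] (mod p)" using cong_solve_coprime_nat[of m p] cop by (auto simp: coprime_commute)
 hence "m * a mod p = 1" using p_ge2 by (simp add: cong_def)
 then obtain b where ab: "m * a = p * b + 1" by (metis mult_div_mod_eq)
 have pw: "y [^]\<^bsub>Q\<^esub> (n::nat) \<in> N" if "y \<in> N" for y n
  using subgroup.one_closed[OF sN] subgroup.m_closed[OF sN _ that] by (induct n) simp_all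
 define z where "z = x [^]\<^bsub>Q\<^esub> (p * b)"
 have zN: "z \<in> N" using pw[of "x [^]\<^bsub>Q\<^esub> p" b] UN xp xQ by (auto simp: z_def Q.nat_pow_pow)
 have "z \<^bold>* x = x [^]\<^bsub>Q\<^esub> (m * a)" using xQ by (simp add: ab z_def)
 also have "\<dots> \<in> N" using pw[OF xm, of a] xQ by (simp add: Q.nat_pow_pow)
 finally have "inv\<^bsub>UU\<^esub> z \<otimes>\<^bsub>UU\<^esub> (z \<otimes>\<^bsub>UU\<^esub> x) \<in> N" using subgroup.m_closed[OF sN subgroup.m_inv_closed[OF sN zN]] by simp
 moreover have "inv\<^bsub>UU\<^esub> z \<otimes>\<^bsub>UU\<^esub> (z \<otimes>\<^bsub>UU\<^esub> x) = x"
  using UU.m_assoc[of "inv\<^bsub>UU\<^esub> z" z x, symmetric] subgroup.subset[OF sN] zN xUU UU.l_inv[of z] UU.l_one[of x] by auto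
 ultimately have "x \<in> N" by simp
 then obtain g u where gu: "g \<in> \<Gamma>" "u \<in> UK (Suc k)" "x = g \<^bold>* u" by (auto simp: N_def set_mult_def)
 have g: "g \<in> carrier UU" using subgroup.subset[OF sub] gu by blast
 have gQ: "g \<in> carrier Q" "nrm g = 1" and uQ: "u \<in> carrier Q" using g gu by (auto simp: UU_carrier UK_def)
 have "x \<^bold>- g = g \<^bold>* (u \<^bold>- \<^bold>1)" unfolding gu using gQ(1) uQ by (simp add: a_minus_def Q.r_distr Q.r_minus)
 hence xg: "nrm (x \<^bold>- g) \<le> q ^ Suc (Suc k)" using gQ uQ gu by (simp add: nrm_mult UK_def)
 have lt: "q ^ Suc (Suc k) < q ^ Suc k" using q_pow_less_iff by blast
 have "(g \<^bold>- \<^bold>1) \<^bold>- (x \<^bold>- \<^bold>1) = g \<^bold>- x" using gQ(1) xQ by algebra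
 hence "nrm (g \<^bold>- \<^bold>1) = q ^ Suc k"
  using nrm_close_eq[of "x \<^bold>- \<^bold>1" "g \<^bold>- \<^bold>1"] gQ xQ nx le_less_trans[OF xg lt] nrm_commute[of x g] by simp
 moreover have "q ^ Suc k > 0" by (rule q_pow_pos)
 ultimately have "nrm (g \<^bold>- \<^bold>1) \<noteq> 0" by linarith
 hence "g \<noteq> \<^bold>1" by auto
 thus ?thesis using gu(1) \<open>nrm (g \<^bold>- \<^bold>1) = q ^ Suc k\<close> by (intro bexI[of _ g] conjI) simp_all
qed

definition Qlim :: "(nat => padic) => padic => bool" where
 "Qlim f L \<longleftrightarrow> L \<in> carrier Q \<and> (\<forall>n. f n \<in> carrier Q) \<and> (\<forall>e>0. \<exists>N. \<forall>n\<ge>N. nrm (f n \<^bold>- L) < e)"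

lemma Qlim_bound:
 assumes "Qlim f L" "Qlim g M" "\<And>n. nrm (f n \<^bold>- g n) \<le> r" shows "nrm (L \<^bold>- M) \<le> r"
proof (rule field_le_epsilon)
 fix e :: real assume e: "e > 0"
 obtain N where N: "\<forall>n\<ge>N. nrm (f n \<^bold>- L) < e" using assms(1) e by (auto simp: Qlim_def)
 obtain N' where N': "\<forall>n\<ge>N'. nrm (g n \<^bold>- M) < e" using assms(2) e by (auto simp: Qlim_def)
 define n where "n = max N N'"
 have c: "L \<in> carrier Q" "M \<in> carrier Q" "f n \<in> carrier Q" "g n \<in> carrier Q" using assms by (auto simp: Qlim_def)
 have r: "r \<ge> 0" using assms(3)[of n] nrm_nonneg[of "f n \<^bold>- g n"] c by simp
 have 1: "nrm (L \<^bold>- f n) \<le> r + e" using N[rule_format, of n] c nrm_commute[of L "f n"] r by (simp add: n_def)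
 have 2: "nrm (f n \<^bold>- g n) \<le> r + e" using assms(3)[of n] e by simp
 have 3: "nrm (g n \<^bold>- M) \<le> r + e" using N'[rule_format, of n] r by (simp add: n_def)
 show "nrm (L \<^bold>- M) \<le> r + e"
  using nrm_trans_le[OF c(1) c(3) c(4) 1 2] 3 c by - (rule nrm_trans_le[of L "g n"], auto)
qed

lemma Qlim_const: "c \<in> carrier Q ==> Qlim (\<lambda>n. c) c" by (simp add: Qlim_def)

lemma Qlim_unique: assumes "Qlim f L" "Qlim f M" shows "L = M"
proof -
 have c: "L \<in> carrier Q" "M \<in> carrier Q" using assms by (auto simp: Qlim_def)
 have "nrm (L \<^bold>- M) \<le> 0" using assms by (rule Qlim_bound) (use assms in \<open>auto simp: Qlim_def\<close>)
 hence "L \<^bold>- M = \<^bold>0" using nrm_eq_0[of "L \<^bold>- M"] nrm_nonneg[of "L \<^bold>- M"] c by simp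
 thus ?thesis using c by simp
qed

lemma Qlim_mult: assumes "Qlim f L" "Qlim g M" "\<And>n. nrm (f n) \<le> 1" "\<And>n. nrm (g n) \<le> 1"
 shows "Qlim (\<lambda>n. f n \<^bold>* g n) (L \<^bold>* M)"
 unfolding Qlim_def
proof (intro conjI allI impI)
 have c: "L \<in> carrier Q" "M \<in> carrier Q" "f n \<in> carrier Q" "g n \<in> carrier Q" for n using assms by (auto simp: Qlim_def)
 show "L \<^bold>* M \<in> carrier Q" "f n \<^bold>* g n \<in> carrier Q" for n using c by auto
 fix e :: real assume e: "e > 0"
 have M: "nrm M \<le> 1" using Qlim_bound[OF assms(2) Qlim_const[of "\<^bold>0"], of 1] c assms(4) by (simp add: a_minus_def)
 obtain N where N: "\<forall>n\<ge>N. nrm (f n \<^bold>- L) < e" using assms(1) e by (auto simp: Qlim_def)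
 obtain N' where N': "\<forall>n\<ge>N'. nrm (g n \<^bold>- M) < e" using assms(2) e by (auto simp: Qlim_def)
 show "\<exists>N. \<forall>n\<ge>N. nrm (f n \<^bold>* g n \<^bold>- L \<^bold>* M) < e"
 proof (intro exI[of _ "max N N'"] allI impI)
  fix n assume n: "n \<ge> max N N'"
  have id: "f n \<^bold>* g n \<^bold>- L \<^bold>* M = f n \<^bold>* (g n \<^bold>- M) \<^bold>+ (f n \<^bold>- L) \<^bold>* M"
   using c(1,2) c(3,4)[of n] by algebra
  have "nrm (f n) * nrm (g n \<^bold>- M) \<le> 1 * nrm (g n \<^bold>- M)" using assms(3)[of n] nrm_nonneg c by (intro mult_right_mono) auto
  moreover have "nrm (f n \<^bold>- L) * nrm M \<le> nrm (f n \<^bold>- L) * 1" using M nrm_nonneg c by (intro mult_left_mono) auto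
  ultimately have "nrm (f n \<^bold>* (g n \<^bold>- M)) < e" "nrm ((f n \<^bold>- L) \<^bold>* M) < e"
   using N[rule_format, of n] N'[rule_format, of n] n c by (auto simp: nrm_mult)
  thus "nrm (f n \<^bold>* g n \<^bold>- L \<^bold>* M) < e" unfolding id
   using nrm_add[of "f n \<^bold>* (g n \<^bold>- M)" "(f n \<^bold>- L) \<^bold>* M"] c by simp
 qed
qed

lemma Qlim_exists:
 assumes f: "\<And>n. f n \<in> carrier Q" and C: "\<And>n. nrm (f (Suc n) \<^bold>- f n) \<le> q ^ n"
 shows "\<exists>L. Qlim f L"
proof -
 have step: "nrm (f (n + k) \<^bold>- f n) \<le> q ^ n" for n k
 proof (induct k)
  case (Suc k)
  have "nrm (f (Suc (n + k)) \<^bold>- f (n + k)) \<le> q ^ n" using C[of "n+k"] q_pow_mono[of n "n+k"] by linarith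
  thus ?case using Suc f by - (rule nrm_trans_le[of _ "f (n + k)"], auto)
 qed (use f in \<open>simp add: less_imp_le\<close>)
 have "\<exists>L\<in>carrier Q. \<forall>e>0. \<exists>N. \<forall>n\<ge>N. nrm (f n \<^bold>- L) < e"
 proof (rule Q_complete[OF f])
  fix e :: real assume "e > 0"
  then obtain N where N: "q ^ N < e" using q_pow_small by blast
  show "\<exists>N. \<forall>m\<ge>N. \<forall>n\<ge>N. nrm (f m \<^bold>- f n) < e"
  proof (intro exI[of _ N] allI impI)
   fix m n assume "m \<ge> N" "n \<ge> N"
   hence "nrm (f m \<^bold>- f N) \<le> q ^ N" "nrm (f n \<^bold>- f N) \<le> q ^ N"
    using step[of N "m - N"] step[of N "n - N"] by auto
   hence "nrm (f m \<^bold>- f n) \<le> q ^ N" using f nrm_commute[of "f n" "f N"] nrm_trans_le[of "f m" "f N" "f n" "q ^ N"] by simp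
   thus "nrm (f m \<^bold>- f n) < e" using N by simp
  qed
 qed
 thus ?thesis unfolding Qlim_def using f by blast
qed

text \<open>\<open>chr A x\<close> is \<open>x ^ s\<close> for the p-adic integer \<open>s = \<Sum>i\<in>A. p ^ i\<close>.\<close>

definition chr_exp :: "nat set => nat => nat" where "chr_exp A n = (\<Sum>i\<in>A \<inter> {..<n}. p ^ i)"

definition chr :: "nat set => padic => padic" where "chr A x = (SOME L. Qlim (\<lambda>n. x [^]\<^bsub>Q\<^esub> chr_exp A n) L)"

lemma chr_exp_Suc: "chr_exp A (Suc n) = chr_exp A n + (if n \<in> A then p ^ n else 0)"
proof -
 have "A \<inter> {..<Suc n} = (if n \<in> A then insert n (A \<inter> {..<n}) else A \<inter> {..<n})" by (auto simp: less_Suc_eq)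
 thus ?thesis by (simp add: chr_exp_def)
qed

lemma UK0_pow_close:
 assumes "odd p" "x \<in> UK 0" "p ^ i dvd n" shows "nrm (x [^]\<^bsub>Q\<^esub> n \<^bold>- \<^bold>1) \<le> q ^ i * nrm (x \<^bold>- \<^bold>1)"
proof -
 obtain m where m: "n = p ^ i * m" using assms(3) by blast
 have x: "x \<in> carrier Q" "nrm (x \<^bold>- \<^bold>1) \<le> q" using assms(2) by (auto simp: UK_def)
 have xZ: "x \<in> carrier Z" using UK_unit UU_Z assms(2) by blast
 have "x [^]\<^bsub>Z\<^esub> (p ^ i) \<in> carrier Z" using xZ by (rule Z.nat_pow_closed)
 hence "nrm ((x [^]\<^bsub>Q\<^esub> (p ^ i)) [^]\<^bsub>Q\<^esub> m \<^bold>- \<^bold>1 [^]\<^bsub>Q\<^esub> m) \<le> nrm (x [^]\<^bsub>Q\<^esub> (p ^ i) \<^bold>- \<^bold>1)"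
  by (intro nrm_pow_diff) (auto simp: Z_carrier)
 thus ?thesis using nrm_pow_pp[OF assms(1) x, of i] x by (simp add: m Q.nat_pow_pow)
qed

lemma nrm_pow_unit_diff: assumes "x \<in> carrier UU"
 shows "nrm (x [^]\<^bsub>Q\<^esub> (m + n) \<^bold>- x [^]\<^bsub>Q\<^esub> (m::nat)) = nrm (x [^]\<^bsub>Q\<^esub> (n::nat) \<^bold>- \<^bold>1)"
proof -
 have x: "x \<in> carrier Q" "nrm x = 1" using assms by (auto simp: UU_carrier)
 define a where "a = x [^]\<^bsub>Q\<^esub> m" define b where "b = x [^]\<^bsub>Q\<^esub> n"
 have ab: "a \<in> carrier Q" "b \<in> carrier Q" "nrm a = 1" using x by (auto simp: a_def b_def nrm_pow)
 have "a \<^bold>* b \<^bold>- a = a \<^bold>* (b \<^bold>- \<^bold>1)" using ab(1,2) by (simp add: a_minus_def Q.r_distr Q.r_minus)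
 moreover have "x [^]\<^bsub>Q\<^esub> (m + n) = a \<^bold>* b" using x by (simp add: a_def b_def Q.nat_pow_mult)
 ultimately show ?thesis using ab by (simp add: nrm_mult a_def[symmetric] b_def[symmetric])
qed

lemma chr_lim: assumes "odd p" "x \<in> UK 0" shows "Qlim (\<lambda>n. x [^]\<^bsub>Q\<^esub> chr_exp A n) (chr A x)"
proof -
 have x: "x \<in> carrier Q" "nrm (x \<^bold>- \<^bold>1) \<le> 1" using assms(2) order.trans[of _ q 1] by (auto simp: UK_def)
 have "\<exists>L. Qlim (\<lambda>n. x [^]\<^bsub>Q\<^esub> chr_exp A n) L"
 proof (rule Qlim_exists)
  fix n
  have "q ^ n * nrm (x \<^bold>- \<^bold>1) \<le> q ^ n * 1" using x by (intro mult_left_mono) auto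
  hence "nrm (x [^]\<^bsub>Q\<^esub> (p ^ n) \<^bold>- \<^bold>1) \<le> q ^ n" using UK0_pow_close[OF assms dvd_refl, of n] by linarith
  thus "nrm (x [^]\<^bsub>Q\<^esub> chr_exp A (Suc n) \<^bold>- x [^]\<^bsub>Q\<^esub> chr_exp A n) \<le> q ^ n"
   using nrm_pow_unit_diff[OF UK_unit[OF assms(2)], of "chr_exp A n" "p ^ n"] x by (auto simp: chr_exp_Suc less_imp_le)
 qed (use x in simp)
 thus ?thesis unfolding chr_def by (rule someI_ex)
qed

lemma chr_closed: "odd p ==> x \<in> UK 0 ==> chr A x \<in> carrier Q" using chr_lim by (auto simp: Qlim_def)

lemma chr_UK: assumes "odd p" "x \<in> UK 0" shows "chr A x \<in> UK 0"
proof -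
 have x: "x \<in> carrier Q" "nrm (x \<^bold>- \<^bold>1) \<le> q" using assms(2) by (auto simp: UK_def)
 have "nrm (chr A x \<^bold>- \<^bold>1) \<le> q"
 proof (rule Qlim_bound[OF chr_lim[OF assms] Qlim_const])
  fix n show "nrm (x [^]\<^bsub>Q\<^esub> chr_exp A n \<^bold>- \<^bold>1) \<le> q"
   using UK0_pow_close[OF assms, of 0 "chr_exp A n"] x by simp
 qed simp
 thus ?thesis using chr_closed[OF assms] by (simp add: UK_def)
qed

lemma nrm_pow_le1: "x \<in> UK 0 ==> nrm (x [^]\<^bsub>Q\<^esub> (n::nat)) \<le> 1"
 using UK_unit[of x 0] by (simp add: nrm_pow UU_carrier)

lemma chr_mult: assumes "odd p" "x \<in> UK 0" "y \<in> UK 0" shows "chr A (x \<^bold>* y) = chr A x \<^bold>* chr A y"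
proof -
 have c: "x \<in> carrier Q" "y \<in> carrier Q" using assms by (auto simp: UK_def)
 have xy: "x \<^bold>* y \<in> UK 0" using subgroup.m_closed[OF UK_subgroup assms(2,3)] by simp
 have "Qlim (\<lambda>n. x [^]\<^bsub>Q\<^esub> chr_exp A n \<^bold>* y [^]\<^bsub>Q\<^esub> chr_exp A n) (chr A x \<^bold>* chr A y)"
  using chr_lim assms nrm_pow_le1 by (intro Qlim_mult) auto
 moreover have "x [^]\<^bsub>Q\<^esub> n \<^bold>* y [^]\<^bsub>Q\<^esub> n = (x \<^bold>* y) [^]\<^bsub>Q\<^esub> (n::nat)" for n using c by (simp add: Q.nat_pow_distrib)
 ultimately have "Qlim (\<lambda>n. (x \<^bold>* y) [^]\<^bsub>Q\<^esub> chr_exp A n) (chr A x \<^bold>* chr A y)" by simp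
 thus ?thesis using chr_lim[OF assms(1) xy] Qlim_unique by blast
qed

lemma chr_Lipschitz: assumes "odd p" "x \<in> UK 0" "y \<in> UK 0" shows "nrm (chr A x \<^bold>- chr A y) \<le> nrm (x \<^bold>- y)"
 using chr_lim[OF assms(1,2)] chr_lim[OF assms(1,3)] nrm_pow_diff[OF UU_Z[OF UK_unit[OF assms(2)]] UU_Z[OF UK_unit[OF assms(3)]]]
 by (rule Qlim_bound)

lemma chr_continuous:
 assumes "odd p" and "profinite_Sylow p UU (Zp_units_top p) \<Gamma>"
 shows "continuous_character p \<Gamma> (chr A)"
proof -
 have sub: "subgroup \<Gamma> UU" using assms by (simp add: profinite_Sylow_def)
 have GU: "x \<in> UK 0" if "x \<in> \<Gamma>" for x
  using Sylow_close[OF assms(2) that] subgroup.subset[OF sub] that by (auto simp: UK_def)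
 have h: "chr A \<in> hom (UU\<lparr>carrier := \<Gamma>\<rparr>) UU"
  using UK_unit[OF chr_UK[OF assms(1) GU]] chr_mult[OF assms(1) GU GU] by (auto simp: hom_def)
 have t: "topspace (subtopology (Zp_units_top p) \<Gamma>) = \<Gamma>" using subgroup.subset[OF sub] by auto
 have "continuous_map (subtopology (Zp_units_top p) \<Gamma>) (Zp_units_top p) (chr A)"
  unfolding continuous_map
 proof (intro conjI allI impI)
  show "chr A ` topspace (subtopology (Zp_units_top p) \<Gamma>) \<subseteq> topspace (Zp_units_top p)"
   unfolding t using GU chr_UK[OF assms(1)] UK_unit by fastforce
  fix V assume V: "openin (Zp_units_top p) V"
  have "openin (Zp_units_top p) {x \<in> UK 0. chr A x \<in> V}" unfolding openin_UU
  proof (intro conjI ballI)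
   fix x assume x: "x \<in> {x \<in> UK 0. chr A x \<in> V}"
   then obtain k where k: "\<forall>y\<in>carrier UU. nrm (y \<^bold>- chr A x) \<le> q ^ k --> y \<in> V"
    using V unfolding openin_UU by blast
   show "\<exists>k. \<forall>y\<in>carrier UU. nrm (y \<^bold>- x) \<le> q ^ k --> y \<in> {x \<in> UK 0. chr A x \<in> V}"
   proof (intro exI[of _ "Suc k"] ballI impI)
    fix y assume y: "y \<in> carrier UU" "nrm (y \<^bold>- x) \<le> q ^ Suc k"
    have "q ^ Suc k \<le> q ^ 1" "q ^ Suc k \<le> q ^ k" by (rule q_pow_mono, simp)+
    moreover have "nrm (y \<^bold>- x) \<le> q" using y(2) calculation(1) by (simp only: power_one_right)
    ultimately have "nrm (y \<^bold>- \<^bold>1) \<le> q" using x UU_closed[OF y(1)]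
     by - (rule nrm_trans_le[of y x], auto simp: UK_def)
    hence yU: "y \<in> UK 0" using UU_closed[OF y(1)] by (simp add: UK_def)
    hence "nrm (chr A y \<^bold>- chr A x) \<le> q ^ k" using chr_Lipschitz[OF assms(1) yU, of x A] x order.trans[OF y(2) \<open>q ^ Suc k \<le> q ^ k\<close>] by auto
    thus "y \<in> {x \<in> UK 0. chr A x \<in> V}" using k yU chr_UK[OF assms(1)] UK_unit by blast
   qed
  qed (use UK_unit in auto)
  hence "openin (subtopology (Zp_units_top p) \<Gamma>) ({x \<in> UK 0. chr A x \<in> V} \<inter> \<Gamma>)"
   unfolding openin_subtopology by blast
  moreover have "{x \<in> UK 0. chr A x \<in> V} \<inter> \<Gamma> = {x \<in> topspace (subtopology (Zp_units_top p) \<Gamma>). chr A x \<in> V}"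
   unfolding t using GU by auto
  ultimately show "openin (subtopology (Zp_units_top p) \<Gamma>) {x \<in> topspace (subtopology (Zp_units_top p) \<Gamma>). chr A x \<in> V}" by simp
 qed
 thus ?thesis using h by (simp add: continuous_character_def)
qed

lemma chr_inj:
 assumes "odd p" "x \<in> UK 0" "x \<noteq> \<^bold>1" and "chr A x = chr B x" shows "A = B"
proof (rule ccontr)
 have aux: False if AB: "i \<in> A" "i \<notin> B" "A \<inter> {..<i} = B \<inter> {..<i}" and eq: "chr A x = chr B x" for A B i
 proof -
  define r where "r = nrm (x \<^bold>- \<^bold>1)"
  have x: "x \<in> carrier Q" "r \<le> q" using assms(2) by (auto simp: UK_def r_def)
  have "x \<^bold>- \<^bold>1 \<noteq> \<^bold>0" using assms(3) x by simp
  hence r: "r > 0" using nrm_nonneg[of "x \<^bold>- \<^bold>1"] nrm_eq_0[of "x \<^bold>- \<^bold>1"] x unfolding r_def by simp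
  have xU: "x \<in> carrier UU" using UK_unit assms(2) by blast
  define s where "s = chr_exp A i"
  have sB: "chr_exp B i = s" unfolding s_def chr_exp_def AB(3) ..
  have tail: "\<exists>m. chr_exp C (Suc i + n) = chr_exp C (Suc i) + p ^ Suc i * m" for C n
  proof (induct n)
   case (Suc n)
   then obtain m where m: "chr_exp C (Suc i + n) = chr_exp C (Suc i) + p ^ Suc i * m" by blast
   show ?case
   proof (cases "Suc i + n \<in> C")
    case True
    have "chr_exp C (Suc i + Suc n) = chr_exp C (Suc i) + p ^ Suc i * (m + p ^ n)"
     using m True by (simp add: chr_exp_Suc power_add algebra_simps)
    thus ?thesis by blast
   qed (use m in \<open>auto simp: chr_exp_Suc\<close>)
  qed (auto intro: exI[of _ 0])
  have far: "nrm (x [^]\<^bsub>Q\<^esub> chr_exp A (Suc i + n) \<^bold>- x [^]\<^bsub>Q\<^esub> chr_exp B (Suc i + n)) = q ^ i * r" for n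
  proof -
   obtain a where a: "chr_exp A (Suc i + n) = s + (p ^ i + p ^ Suc i * a)" using tail[of A n] AB(1) unfolding chr_exp_Suc[of A i] s_def by (auto simp: add.assoc)
   obtain b where b: "chr_exp B (Suc i + n) = s + p ^ Suc i * b" using tail[of B n] AB(2) sB unfolding chr_exp_Suc[of B i] by auto
   define u where "u = x [^]\<^bsub>Q\<^esub> s"
   define v where "v = x [^]\<^bsub>Q\<^esub> (p ^ i)"
   define w where "w = x [^]\<^bsub>Q\<^esub> (p ^ Suc i * a)"
   define z where "z = x [^]\<^bsub>Q\<^esub> (p ^ Suc i * b)"
   have c: "u \<in> carrier Q" "v \<in> carrier Q" "w \<in> carrier Q" "z \<in> carrier Q" "nrm u = 1" "nrm v = 1"
    using x xU by (auto simp: u_def v_def w_def z_def nrm_pow UU_carrier)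
   have v: "nrm (v \<^bold>- \<^bold>1) = q ^ i * r" using nrm_pow_pp[OF assms(1) x(1)] x(2) by (simp add: v_def r_def)
   have w: "nrm (w \<^bold>- \<^bold>1) \<le> q ^ Suc i * r" "nrm (z \<^bold>- \<^bold>1) \<le> q ^ Suc i * r"
    unfolding w_def z_def r_def by (rule UK0_pow_close[OF assms(1,2)], simp)+
   have lt: "q ^ Suc i * r < q ^ i * r" using r q_less1 q_pow_pos[of i] by simp
   have "nrm (v \<^bold>* (w \<^bold>- \<^bold>1) \<^bold>+ (\<^bold>1 \<^bold>- z)) \<le> q ^ Suc i * r"
    using c w nrm_commute[of z "\<^bold>1"] by (intro nrm_add_le) (auto simp: nrm_mult)
   hence "nrm ((v \<^bold>- \<^bold>1) \<^bold>+ (v \<^bold>* (w \<^bold>- \<^bold>1) \<^bold>+ (\<^bold>1 \<^bold>- z))) = q ^ i * r"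
    using nrm_add_eq[of "v \<^bold>- \<^bold>1" "v \<^bold>* (w \<^bold>- \<^bold>1) \<^bold>+ (\<^bold>1 \<^bold>- z)"] c v le_less_trans[OF _ lt] by simp
   moreover have "u \<^bold>* (v \<^bold>* w) \<^bold>- u \<^bold>* z = u \<^bold>* ((v \<^bold>- \<^bold>1) \<^bold>+ (v \<^bold>* (w \<^bold>- \<^bold>1) \<^bold>+ (\<^bold>1 \<^bold>- z)))"
    using c(1-4) by algebra
   moreover have "x [^]\<^bsub>Q\<^esub> chr_exp A (Suc i + n) = u \<^bold>* (v \<^bold>* w)" "x [^]\<^bsub>Q\<^esub> chr_exp B (Suc i + n) = u \<^bold>* z"
    unfolding a b u_def v_def w_def z_def using x(1) by (simp_all only: Q.nat_pow_mult)
   ultimately show ?thesis using c by (simp add: nrm_mult)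
  qed
  have e: "q ^ i * r > 0" using r by simp
  obtain N where N: "\<forall>n\<ge>N. nrm (x [^]\<^bsub>Q\<^esub> chr_exp A n \<^bold>- chr A x) < q ^ i * r"
   using chr_lim[OF assms(1,2), of A] e by (auto simp: Qlim_def)
  obtain N' where N': "\<forall>n\<ge>N'. nrm (x [^]\<^bsub>Q\<^esub> chr_exp B n \<^bold>- chr B x) < q ^ i * r"
   using chr_lim[OF assms(1,2), of B] e by (auto simp: Qlim_def)
  define n where "n = Suc i + (N + N')"
  have "nrm (x [^]\<^bsub>Q\<^esub> chr_exp A n \<^bold>- x [^]\<^bsub>Q\<^esub> chr_exp B n) < q ^ i * r"
   using N[rule_format, of n] N'[rule_format, of n] eq x chr_closed[OF assms(1,2)]
    nrm_commute[of "x [^]\<^bsub>Q\<^esub> chr_exp B n" "chr B x"]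
    nrm_trans_less[of "x [^]\<^bsub>Q\<^esub> chr_exp A n" "chr A x" "x [^]\<^bsub>Q\<^esub> chr_exp B n" "q ^ i * r"]
   by (simp add: n_def)
  thus False using far[of "N + N'"] by (simp add: n_def)
 qed
 assume "A \<noteq> B"
 define i where "i = (LEAST i. i \<in> A \<longleftrightarrow> i \<notin> B)"
 have ex: "\<exists>i. i \<in> A \<longleftrightarrow> i \<notin> B" using \<open>A \<noteq> B\<close> by blast
 have i: "i \<in> A \<longleftrightarrow> i \<notin> B" unfolding i_def by (rule LeastI_ex[OF ex])
 have "j \<in> A \<longleftrightarrow> j \<in> B" if "j < i" for j using not_less_Least[of j] that unfolding i_def by blast
 hence "A \<inter> {..<i} = B \<inter> {..<i}" by auto
 thus False using aux[of i A B] aux[of i B A] i assms(4) by metis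
qed

end

section \<open>Modules over the p-adic integers\<close>

locale zmod = padic p + module "Zp p" M for p and M (structure)
begin

lemma Z_closed_simps [simp]: "\<^bold>1 \<in> carrier Z" "\<^bold>0 \<in> carrier Z"
 "a \<in> carrier Z ==> b \<in> carrier Z ==> a \<^bold>* b \<in> carrier Z"
 "a \<in> carrier Z ==> b \<in> carrier Z ==> a \<^bold>+ b \<in> carrier Z"
 "a \<in> carrier Z ==> a [^]\<^bsub>Q\<^esub> (n::nat) \<in> carrier Z"
 using Z.one_closed Z.zero_closed Z.m_closed[of a b] Z.a_closed[of a b] Z.nat_pow_closed[of a n] by simp_all

lemma smult_one_Q [simp]: "x \<in> carrier M ==> \<^bold>1 \<odot> x = x" "x \<in> carrier M ==> \<^bold>0 \<odot> x = \<zero>"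
 using smult_one[of x] smult_l_null[of x] by simp_all

lemma smult_assoc_Q: "[|a \<in> carrier Z; b \<in> carrier Z; x \<in> carrier M|] ==> (a \<^bold>* b) \<odot> x = a \<odot> (b \<odot> x)"
 "[|a \<in> carrier Z; b \<in> carrier Z; x \<in> carrier M|] ==> (a \<^bold>+ b) \<odot> x = a \<odot> x \<oplus> b \<odot> x"
 using smult_assoc1[of a b x] smult_l_distr[of a b x] by simp_all

inductive_set zspan :: "'a set => 'a set" for Y where
 zspan_zero: "\<zero> \<in> zspan Y"
| zspan_step: "[|a \<in> carrier Z; x \<in> Y; x \<in> carrier M; y \<in> zspan Y|] ==> a \<odot> x \<oplus> y \<in> zspan Y"

lemma zspan_carrier: "y \<in> zspan Y ==> y \<in> carrier M"
 by (induct rule: zspan.induct) auto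

lemma zspan_add: "[|x \<in> zspan Y; y \<in> zspan Y|] ==> x \<oplus> y \<in> zspan Y"
proof (induct rule: zspan.induct)
 case (zspan_step a x z)
 thus ?case using zspan.zspan_step[OF zspan_step(1-3), of "z \<oplus> y"] zspan_carrier by (simp add: M.a_assoc)
qed (simp add: zspan_carrier)

lemma zspan_smult: "y \<in> zspan Y ==> c \<in> carrier Z ==> c \<odot> y \<in> zspan Y"
proof (induct rule: zspan.induct)
 case (zspan_step a x y)
 have "(c \<^bold>* a) \<odot> x \<oplus> c \<odot> y \<in> zspan Y"
  using zspan_step by (intro zspan.zspan_step) auto
 thus ?case using zspan_step zspan_carrier by (simp add: smult_r_distr smult_assoc_Q)
qed (simp add: zspan_zero)

lemma zspan_incl: assumes "x \<in> Y" "x \<in> carrier M" shows "x \<in> zspan Y"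
 using zspan_step[OF Z.one_closed assms zspan_zero] assms by simp

lemma zspan_least:
 assumes "y \<in> zspan Y" "\<zero> \<in> N" "\<And>a x. [|a \<in> carrier Z; x \<in> Y; x \<in> carrier M|] ==> a \<odot> x \<in> N"
  "\<And>x y. [|x \<in> N; y \<in> N|] ==> x \<oplus> y \<in> N"
 shows "y \<in> N"
 using assms(1) by (induct rule: zspan.induct) (auto intro: assms)

lemma zspan_zspan: assumes "y \<in> zspan Y" "\<And>x. [|x \<in> Y; x \<in> carrier M|] ==> x \<in> zspan Y'" shows "y \<in> zspan Y'"
 using assms(1) by (rule zspan_least) (auto intro: assms zspan_zero zspan_add zspan_smult)

lemma zspan_mono: "Y \<subseteq> Y' ==> y \<in> zspan Y ==> y \<in> zspan Y'"
 by (erule zspan_zspan) (auto intro: zspan_incl)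

lemma zspan_uminus: assumes "y \<in> zspan Y" shows "\<ominus> y \<in> zspan Y"
proof -
 have "(\<ominus>\<^bsub>Z\<^esub> \<one>\<^bsub>Z\<^esub>) \<odot> y = \<ominus> y"
  using smult_l_minus[OF Z.one_closed, of y] smult_one[of y] assms zspan_carrier by simp
 thus ?thesis using zspan_smult[OF assms, of "\<ominus>\<^bsub>Z\<^esub> \<one>\<^bsub>Z\<^esub>"] Z.a_inv_closed[OF Z.one_closed] by simp
qed

lemma zspan_diff: "x \<in> zspan Y ==> y \<in> zspan Y ==> x \<ominus> y \<in> zspan Y"
 unfolding a_minus_def by (intro zspan_add zspan_uminus)

lemma zspan_insertE:
 assumes "y \<in> zspan (insert e Y)" "e \<in> carrier M"
 shows "\<exists>a\<in>carrier Z. \<exists>y'\<in>zspan Y. y = a \<odot> e \<oplus> y'"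
 using assms(1)
proof (induct rule: zspan.induct)
 case zspan_zero
 show ?case using assms(2) smult_l_null[of e]
  by (intro bexI[of _ "\<zero>\<^bsub>Z\<^esub>"] bexI[of _ "\<zero>"] Z.zero_closed zspan.zspan_zero) simp
next
 case (zspan_step a x y)
 then obtain b y' where b: "b \<in> carrier Z" "y' \<in> zspan Y" "y = b \<odot> e \<oplus> y'" by blast
 have y': "y' \<in> carrier M" using b zspan_carrier by blast
 show ?case
 proof (cases "x = e")
  case True
  have "a \<odot> x \<oplus> y = (a \<oplus>\<^bsub>Z\<^esub> b) \<odot> e \<oplus> y'"
   unfolding b(3) True using b zspan_step assms(2) y' by (simp add: smult_l_distr M.a_assoc del: Z_simps)
  thus ?thesis using b zspan_step Z.a_closed by blast
 next
  case False
  hence "a \<odot> x \<oplus> y' \<in> zspan Y" using zspan_step b by (intro zspan.zspan_step) auto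
  moreover have "a \<odot> x \<oplus> y = b \<odot> e \<oplus> (a \<odot> x \<oplus> y')"
   unfolding b(3) using b zspan_step assms(2) y' by (simp add: M.a_lcomm)
  ultimately show ?thesis using b by blast
 qed
qed

lemma Z_dvd: assumes "a \<in> carrier Z" "b \<in> carrier Z" "nrm a \<le> nrm b" shows "\<exists>c\<in>carrier Z. a = c \<otimes>\<^bsub>Z\<^esub> b"
proof (cases "b = \<^bold>0")
 case True
 hence "nrm a = 0" using assms nrm_nonneg[of a] by (auto simp: Z_carrier)
 hence "a = \<^bold>0" using assms nrm_eq_0 Z_closed by blast
 thus ?thesis using True by (intro bexI[of _ "\<^bold>0"]) (auto simp: Z_carrier)
next
 case False
 have b: "b \<in> carrier Q" "a \<in> carrier Q" using assms by (auto simp: Z_carrier)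
 have nb: "nrm b > 0" using nrm_nonneg[OF b(1)] nrm_eq_0[OF b(1)] False by linarith
 note i = nrm_inv[OF b(1) False]
 have "nrm (a \<^bold>* inv\<^bsub>Q\<^esub> b) = nrm a * inverse (nrm b)" using nrm_mult[OF b(2) i(1)] i(3) by simp
 also have "\<dots> \<le> nrm b * inverse (nrm b)" using assms(3) nb by (intro mult_right_mono) auto
 also have "\<dots> = 1" using nb by simp
 finally have "nrm (a \<^bold>* inv\<^bsub>Q\<^esub> b) \<le> 1" .
 moreover have "a = a \<^bold>* inv\<^bsub>Q\<^esub> b \<^bold>* b" using i b by (simp add: Q.m_assoc Q.m_comm[of "inv\<^bsub>Q\<^esub> b" b])
 ultimately show ?thesis using b i by (intro bexI[of _ "a \<^bold>* inv\<^bsub>Q\<^esub> b"]) (auto simp: Z_carrier)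
qed

lemma Z_max_norm:
 assumes "\<And>i. z i \<in> carrier Z" shows "\<exists>m. \<forall>i::nat. nrm (z i) \<le> nrm (z m)"
proof (cases "\<exists>i. z i \<noteq> \<^bold>0")
 case False thus ?thesis by (intro exI[of _ 0]) simp
next
 case True
 then obtain i0 where i0: "z i0 \<noteq> \<^bold>0" by blast
 have zQ: "z i \<in> carrier Q" "nrm (z i) \<le> 1" for i using assms[of i] by (auto simp: Z_carrier)
 have "\<exists>k. q ^ k \<le> nrm (z i0)" using q_pow_small[of "nrm (z i0)"] nrm_nonneg[OF zQ(1)] nrm_eq_0[OF zQ(1)] i0 less_imp_le
  by (metis less_eq_real_def)
 hence ex: "\<exists>k. \<exists>i. q ^ k \<le> nrm (z i)" by blast
 define k where "k = (LEAST k. \<exists>i. q ^ k \<le> nrm (z i))"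
 obtain m where m: "q ^ k \<le> nrm (z m)" using LeastI_ex[OF ex] unfolding k_def by blast
 have "nrm (z i) \<le> q ^ k" for i
 proof (rule ccontr)
  assume gt: "\<not> nrm (z i) \<le> q ^ k"
  show False
  proof (cases k)
   case 0 thus ?thesis using gt zQ(2)[of i] by simp
  next
   case (Suc k')
   have "\<not> nrm (z i) < q ^ k'" using nrm_discrete[OF zQ(1), of i k'] gt Suc by auto
   hence "\<exists>i. q ^ k' \<le> nrm (z i)" using not_less by blast
   hence "k \<le> k'" unfolding k_def by (rule Least_le)
   thus False using Suc by simp
  qed
 qed
 thus ?thesis using m order.trans by blast
qed

lemma zspan_minus_in: "[|x \<ominus> y \<in> zspan Y; y \<in> zspan Y; x \<in> carrier M|] ==> x \<in> zspan Y"
 using zspan_add[of "x \<ominus> y" Y y] zspan_carrier[of y Y] by (simp add: a_minus_def M.a_assoc M.l_neg)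

theorem zspan_noetherian:
 assumes "finite E" "E \<subseteq> carrier M" "F \<subseteq> carrier M" "\<And>i::nat. x i \<in> zspan (E \<union> F)"
 shows "\<exists>d. x d \<in> zspan (x ` {..<d} \<union> F)"
 using assms
proof (induct E arbitrary: x rule: finite_induct)
 case empty
 hence "x 0 \<in> zspan F" by simp
 thus ?case by (intro exI[of _ 0]) simp
next
 case (insert e E)
 have e: "e \<in> carrier M" using insert by blast
 have "\<forall>i. \<exists>a. a \<in> carrier Z \<and> (\<exists>y'\<in>zspan (E \<union> F). x i = a \<odot> e \<oplus> y')"
  using zspan_insertE[OF _ e, of _ "E \<union> F"] insert(6) by (metis Un_insert_left)
 then obtain z where z: "\<And>i. z i \<in> carrier Z" and "\<forall>i. \<exists>y'\<in>zspan (E \<union> F). x i = z i \<odot> e \<oplus> y'" by metis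
 then obtain y where y: "\<And>i. y i \<in> zspan (E \<union> F)" and xy: "\<And>i. x i = z i \<odot> e \<oplus> y i" by metis
 have yM: "y i \<in> carrier M" for i using y zspan_carrier by blast
 have xM: "x i \<in> carrier M" for i using insert(6) zspan_carrier by blast
 obtain m where m: "\<And>i. nrm (z i) \<le> nrm (z m)" using Z_max_norm[of z] z by blast
 have "\<forall>i. \<exists>c. c \<in> carrier Z \<and> z i = c \<otimes>\<^bsub>Z\<^esub> z m" using Z_dvd[OF z z m] by blast
 then obtain c where c: "\<And>i. c i \<in> carrier Z" and zc: "\<And>i. z i = c i \<otimes>\<^bsub>Z\<^esub> z m" by metis
 define x' where "x' i = x (Suc m + i) \<ominus> c (Suc m + i) \<odot> x m" for i
 have x'y: "x' i = y (Suc m + i) \<ominus> c (Suc m + i) \<odot> y m" for i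
 proof -
  let ?c = "c (Suc m + i)" and ?y = "y (Suc m + i)"
  define t where "t = (?c \<otimes>\<^bsub>Z\<^esub> z m) \<odot> e"
  define u where "u = ?c \<odot> y m"
  have tu: "t \<in> carrier M" "u \<in> carrier M" using c z e yM Z.m_closed by (auto simp: t_def u_def simp del: Z_simps)
  have "?c \<odot> x m = t \<oplus> u" unfolding xy[of m] t_def u_def using c z e yM by (simp add: smult_r_distr smult_assoc1 del: Z_simps)
  moreover have "x (Suc m + i) = t \<oplus> ?y" unfolding xy[of "Suc m + i"] t_def by (simp only: zc[of "Suc m + i", symmetric])
  ultimately have "x' i = (t \<oplus> ?y) \<ominus> (t \<oplus> u)" by (simp add: x'_def)
  also have "\<dots> = ?y \<oplus> (t \<oplus> (\<ominus> t \<oplus> \<ominus> u))"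
   using tu yM by (simp add: a_minus_def M.minus_add M.a_ac)
  also have "\<dots> = ?y \<ominus> u" using tu yM by (simp add: a_minus_def M.r_neg2 M.r_neg1)
  finally show ?thesis by (simp add: u_def)
 qed
 have "x' i \<in> zspan (E \<union> F)" for i unfolding x'y using y c by (intro zspan_diff zspan_smult)
 then obtain d where d: "x' d \<in> zspan (x' ` {..<d} \<union> F)" using insert by blast
 have sub: "x' i \<in> zspan (x ` {..<Suc m + d} \<union> F)" if "i < d" for i
  unfolding x'_def using that xM c by (intro zspan_diff zspan_smult zspan_incl) auto
 have "x' d \<in> zspan (x ` {..<Suc m + d} \<union> F)"
  using d by (rule zspan_zspan) (use sub in \<open>auto intro: zspan_incl\<close>)
 moreover have "c (Suc m + d) \<odot> x m \<in> zspan (x ` {..<Suc m + d} \<union> F)"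
  using xM c by (intro zspan_smult zspan_incl) auto
 ultimately have "x (Suc m + d) \<in> zspan (x ` {..<Suc m + d} \<union> F)"
  unfolding x'_def using xM by (rule zspan_minus_in)
 thus ?case by blast
qed

abbreviation pp where "pp \<equiv> rc (of_nat p)"

lemma pp_closed [simp]: "pp \<in> carrier Z" and pp_pow_closed: "pp [^]\<^bsub>Z\<^esub> (n::nat) \<in> carrier Z"
 by simp_all

lemma nrm_pp_pow: "nrm (pp [^]\<^bsub>Z\<^esub> (n::nat)) = q ^ n"
 using nrm_pow[OF rc_closed, of "of_nat p" n] pabs_p by simp

definition ppow :: "nat => 'a => 'a" where "ppow n x = (pp [^]\<^bsub>Z\<^esub> n) \<odot> x"

lemma ppow_closed [simp]: "x \<in> carrier M ==> ppow n x \<in> carrier M"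
 unfolding ppow_def by (rule smult_closed[OF pp_pow_closed])
lemma ppow_0 [simp]: "x \<in> carrier M ==> ppow 0 x = x" unfolding ppow_def using smult_one[of x] by simp
lemma ppow_distrib: "x \<in> carrier M ==> y \<in> carrier M ==> ppow n (x \<oplus> y) = ppow n x \<oplus> ppow n y"
 unfolding ppow_def by (rule smult_r_distr[OF pp_pow_closed])
lemma ppow_zero [simp]: "ppow n \<zero> = \<zero>" unfolding ppow_def by (rule smult_r_null[OF pp_pow_closed])
lemma zspan_ppow: "y \<in> zspan Y ==> ppow n y \<in> zspan Y" unfolding ppow_def by (rule zspan_smult[OF _ pp_pow_closed])

primrec psum :: "(nat => 'a) => nat => 'a" where
 "psum s 0 = \<zero>"
| "psum s (Suc n) = psum s n \<oplus> ppow n (s n)"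

lemma psum_closed: "(\<And>n. s n \<in> carrier M) ==> psum s n \<in> carrier M" by (induct n) auto

lemma Z_series:
 assumes z: "\<And>i::nat. z i \<in> carrier Z"
 obtains L S r where "L \<in> carrier Z" "S 0 = \<zero>\<^bsub>Z\<^esub>" "\<And>n. S n \<in> carrier Z" "\<And>n. r n \<in> carrier Z"
   "\<And>n. S (Suc n) = S n \<oplus>\<^bsub>Z\<^esub> pp [^]\<^bsub>Z\<^esub> n \<otimes>\<^bsub>Z\<^esub> z n" "\<And>n. L = S n \<oplus>\<^bsub>Z\<^esub> pp [^]\<^bsub>Z\<^esub> n \<otimes>\<^bsub>Z\<^esub> r n"
proof -
 define S where "S = rec_nat \<zero>\<^bsub>Z\<^esub> (\<lambda>n s. s \<oplus>\<^bsub>Z\<^esub> pp [^]\<^bsub>Z\<^esub> n \<otimes>\<^bsub>Z\<^esub> z n)"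
 have S0: "S 0 = \<zero>\<^bsub>Z\<^esub>" and SS: "S (Suc n) = S n \<oplus>\<^bsub>Z\<^esub> pp [^]\<^bsub>Z\<^esub> n \<otimes>\<^bsub>Z\<^esub> z n" for n by (simp_all add: S_def)
 have SZ: "S n \<in> carrier Z" for n
 proof (induct n)
  case 0 show ?case unfolding S0 by (rule Z.zero_closed)
 next
  case (Suc n) thus ?case unfolding SS by (intro Z.a_closed Z.m_closed z pp_pow_closed)
 qed
 have SQ: "S n \<in> carrier Q" and zQ: "z n \<in> carrier Q" "nrm (z n) \<le> 1" for n using SZ[of n] z[of n] by (auto simp: Z_carrier)
 have inc: "nrm (S (Suc n) \<^bold>- S n) \<le> q ^ n" for n
 proof -
  have pQ: "pp [^]\<^bsub>Z\<^esub> n \<in> carrier Q" using pp_pow_closed[of n] Z_closed by blast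
  have "S (Suc n) \<^bold>- S n = pp [^]\<^bsub>Z\<^esub> n \<^bold>* z n"
  proof -
   define t where "t = pp [^]\<^bsub>Z\<^esub> n \<^bold>* z n"
   have "t \<in> carrier Q" using pQ zQ by (simp add: t_def)
   hence "(S n \<^bold>+ t) \<^bold>- S n = t" using SQ[of n] by algebra
   thus ?thesis unfolding SS t_def by simp
  qed
  moreover have "q ^ n * nrm (z n) \<le> q ^ n * 1" using zQ[of n] by (intro mult_left_mono) auto
  ultimately show ?thesis using nrm_mult[OF pQ zQ(1)] nrm_pp_pow by simp
 qed
 obtain L where L: "Qlim S L" using Qlim_exists[OF SQ inc] by blast
 have LQ: "L \<in> carrier Q" using L by (simp add: Qlim_def)
 have tail: "nrm (S (n + k) \<^bold>- S n) \<le> q ^ n" for n k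
 proof (induct k)
  case (Suc k)
  have "nrm (S (Suc (n + k)) \<^bold>- S (n + k)) \<le> q ^ n" using inc[of "n+k"] q_pow_mono[of n "n+k"] by linarith
  thus ?case using Suc SQ by - (rule nrm_trans_le[of _ "S (n + k)"], auto)
 qed (use SQ in \<open>simp add: less_imp_le\<close>)
 have Ln: "nrm (L \<^bold>- S n) \<le> q ^ n" for n
 proof (rule Qlim_bound[OF _ Qlim_const[OF SQ]])
  show "Qlim (\<lambda>k. S (n + k)) L" unfolding Qlim_def
  proof (intro conjI allI impI LQ SQ)
   fix e :: real assume "e > 0"
   then obtain N where "\<forall>k\<ge>N. nrm (S k \<^bold>- L) < e" using L unfolding Qlim_def by blast
   thus "\<exists>N. \<forall>k\<ge>N. nrm (S (n + k) \<^bold>- L) < e" by (intro exI[of _ N]) auto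
  qed
 qed (rule tail)
 have LZ: "L \<in> carrier Z"
 proof -
  have "nrm (L \<^bold>- S 0) \<le> 1" using Ln[of 0] by simp
  moreover have "L \<^bold>- S 0 = L" unfolding S0 using LQ by (simp add: a_minus_def)
  ultimately show ?thesis using LQ by (simp add: Z_carrier)
 qed
 have "\<exists>r. r \<in> carrier Z \<and> L = S n \<oplus>\<^bsub>Z\<^esub> pp [^]\<^bsub>Z\<^esub> n \<otimes>\<^bsub>Z\<^esub> r" for n
 proof -
  have c: "L \<ominus>\<^bsub>Z\<^esub> S n \<in> carrier Z" using LZ SZ by (rule Z.minus_closed)
  moreover have "nrm (L \<ominus>\<^bsub>Z\<^esub> S n) \<le> nrm (pp [^]\<^bsub>Z\<^esub> n)" unfolding nrm_pp_pow Z_minus[OF LZ SZ] by (rule Ln)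
  ultimately obtain r where r: "r \<in> carrier Z" "L \<ominus>\<^bsub>Z\<^esub> S n = r \<otimes>\<^bsub>Z\<^esub> pp [^]\<^bsub>Z\<^esub> n" using Z_dvd pp_pow_closed by meson
  have "L = S n \<oplus>\<^bsub>Z\<^esub> (L \<ominus>\<^bsub>Z\<^esub> S n)" using LZ SZ[of n] by algebra
  also have "\<dots> = S n \<oplus>\<^bsub>Z\<^esub> pp [^]\<^bsub>Z\<^esub> n \<otimes>\<^bsub>Z\<^esub> r" unfolding r(2) using Z.m_comm[OF r(1) pp_pow_closed] by (rule arg_cong)
  finally show ?thesis using r(1) by blast
 qed
 then obtain r where "\<forall>n. r n \<in> carrier Z \<and> L = S n \<oplus>\<^bsub>Z\<^esub> pp [^]\<^bsub>Z\<^esub> n \<otimes>\<^bsub>Z\<^esub> r n" by metis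
 hence "L = S n \<oplus>\<^bsub>Z\<^esub> pp [^]\<^bsub>Z\<^esub> n \<otimes>\<^bsub>Z\<^esub> r n" "r n \<in> carrier Z" for n by simp_all
 thus ?thesis using that[of L S r] LZ S0 SZ SS by presburger
qed

theorem zspan_complete:
 assumes "finite E" "E \<subseteq> carrier M" "\<And>i::nat. s i \<in> zspan E"
 shows "\<exists>y\<in>zspan E. \<forall>n. \<exists>t\<in>zspan E. y = psum s n \<oplus> ppow n t"
 using assms
proof (induct E arbitrary: s rule: finite_induct)
 case empty
 have "x \<in> zspan {} \<longleftrightarrow> x = \<zero>" for x by (auto elim: zspan.cases intro: zspan_zero)
 hence s: "s i = \<zero>" for i using empty by blast
 have "psum s n = \<zero>" for n by (induct n) (simp_all add: s)
 thus ?case by (intro bexI[of _ "\<zero>"] allI) (auto intro: zspan_zero)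
next
 case (insert e E)
 have e: "e \<in> carrier M" using insert by blast
 have "\<forall>i. \<exists>a. a \<in> carrier Z \<and> (\<exists>y'\<in>zspan E. s i = a \<odot> e \<oplus> y')"
  using zspan_insertE[OF _ e, of _ E] insert(5) by blast
 then obtain z where z: "\<And>i. z i \<in> carrier Z" and "\<forall>i. \<exists>y'\<in>zspan E. s i = z i \<odot> e \<oplus> y'" by metis
 then obtain s' where s': "\<And>i. s' i \<in> zspan E" and ss: "\<And>i. s i = z i \<odot> e \<oplus> s' i" by metis
 have s'M: "s' i \<in> carrier M" and sM: "s i \<in> carrier M" for i using s' insert(5) zspan_carrier by blast+
 obtain L S r where L: "L \<in> carrier Z" "S 0 = \<zero>\<^bsub>Z\<^esub>" "\<And>n. S n \<in> carrier Z" "\<And>n. r n \<in> carrier Z"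
   "\<And>n. S (Suc n) = S n \<oplus>\<^bsub>Z\<^esub> pp [^]\<^bsub>Z\<^esub> n \<otimes>\<^bsub>Z\<^esub> z n" "\<And>n. L = S n \<oplus>\<^bsub>Z\<^esub> pp [^]\<^bsub>Z\<^esub> n \<otimes>\<^bsub>Z\<^esub> r n"
 proof (rule Z_series[of z, OF z], goal_cases)
  case (1 L S r)
  from 1(1)[of L S r, OF 1(2) 1(3) 1(4) 1(5) 1(6) 1(7)] show ?case .
 qed
 obtain y where y: "y \<in> zspan E" "\<forall>n. \<exists>t\<in>zspan E. y = psum s' n \<oplus> ppow n t"
 proof -
  have EM: "E \<subseteq> carrier M" using insert(4) by blast
  show ?thesis using insert(3)[of s', OF EM s'] by (elim bexE) (rule that)
 qed
 have sm: "(a \<oplus>\<^bsub>Z\<^esub> pp [^]\<^bsub>Z\<^esub> n \<otimes>\<^bsub>Z\<^esub> b) \<odot> e = a \<odot> e \<oplus> ppow n (b \<odot> e)"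
  if "a \<in> carrier Z" "b \<in> carrier Z" for a b n
  using smult_l_distr[OF that(1) Z.m_closed[OF pp_pow_closed[of n] that(2)] e] smult_assoc1[OF pp_pow_closed[of n] that(2) e]
  by (simp only: ppow_def)
 have pe: "psum s n = S n \<odot> e \<oplus> psum s' n" for n
 proof (induct n)
  case 0 show ?case unfolding L(2) using smult_l_null[OF e] by simp
 next
  case (Suc n)
  have c: "S n \<odot> e \<in> carrier M" "z n \<odot> e \<in> carrier M" "psum s' n \<in> carrier M"
   using L(3) z e psum_closed[OF s'M] by auto
  show ?case unfolding L(5) sm[OF L(3) z] psum.simps Suc ss[of n] ppow_distrib[OF c(2) s'M]
   using c s'M by (simp add: M.a_ac)
 qed
 show ?case
 proof (rule bexI[of _ "L \<odot> e \<oplus> y"], rule allI)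
  show "L \<odot> e \<oplus> y \<in> zspan (insert e E)"
   using zspan_step[OF L(1), of e "insert e E" y] e zspan_mono[of E "insert e E" y] y by blast
  fix n
  obtain t where t: "t \<in> zspan E" "y = psum s' n \<oplus> ppow n t" using y by blast
  have tM: "t \<in> carrier M" using t zspan_carrier by blast
  have c: "S n \<odot> e \<in> carrier M" "r n \<odot> e \<in> carrier M" "psum s' n \<in> carrier M"
   using L(3,4) e psum_closed[OF s'M] by auto
  have "L \<odot> e \<oplus> y = (S n \<odot> e \<oplus> ppow n (r n \<odot> e)) \<oplus> (psum s' n \<oplus> ppow n t)"
   unfolding t(2) by (subst L(6)[of n]) (simp only: sm[OF L(3,4)])
  also have "\<dots> = psum s n \<oplus> ppow n (r n \<odot> e \<oplus> t)"
   unfolding pe ppow_distrib[OF c(2) tM] using c tM by (simp add: M.a_ac)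
  finally have "L \<odot> e \<oplus> y = psum s n \<oplus> ppow n (r n \<odot> e \<oplus> t)" .
  moreover have "r n \<odot> e \<oplus> t \<in> zspan (insert e E)"
   using zspan_step[OF L(4), of e "insert e E" t n] e zspan_mono[of E "insert e E" t] t by blast
  ultimately show "\<exists>t\<in>zspan (insert e E). L \<odot> e \<oplus> y = psum s n \<oplus> ppow n t" by blast
 qed
qed

end

section \<open>The ring of integers of a finite extension\<close>

locale padic_ext = padic p for p +
 fixes K (structure) and \<iota> :: "padic => 'k"
 assumes ext: "Qp_finite_extension p K \<iota>"
begin

sublocale K: field K using ext by (simp add: Qp_finite_extension_def)

lemma iota_hom: "\<iota> \<in> ring_hom Q K" using ext by (simp add: Qp_finite_extension_def)
lemma iota_ring: "ring_hom_ring Q K \<iota>"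
 using iota_hom Q.ring_axioms K.ring_axioms by (simp add: ring_hom_ringI2)
sublocale I: ring_hom_ring Q K \<iota> by (rule iota_ring)

lemma iota_inj: "x \<in> carrier Q ==> y \<in> carrier Q ==> \<iota> x = \<iota> y ==> x = y"
proof -
 have "\<one> \<in> \<iota> ` carrier Q" using I.hom_one by (metis Q.one_closed imageI)
 hence "\<iota> ` carrier Q \<noteq> {\<zero>}" using K.one_not_zero by blast
 hence inj: "inj_on \<iota> (carrier Q)" by (rule I.non_trivial_field_hom_imp_inj[OF Q_field])
 assume "x \<in> carrier Q" "y \<in> carrier Q" "\<iota> x = \<iota> y"
 thus "x = y" using inj_onD[OF inj] by blast
qed

definition KM :: "(padic, 'k) module" where
 "KM = \<lparr>carrier = carrier K, monoid.mult = monoid.mult K, one = one K,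
   ring.zero = ring.zero K, add = add K, smult = (\<lambda>a x. \<iota> a \<otimes> x)\<rparr>"

lemma KM_simps [simp]: "carrier KM = carrier K" "\<zero>\<^bsub>KM\<^esub> = \<zero>" "x \<oplus>\<^bsub>KM\<^esub> y = x \<oplus> y" "a \<odot>\<^bsub>KM\<^esub> x = \<iota> a \<otimes> x"
 by (simp_all add: KM_def)
lemma KM_uminus [simp]: "\<ominus>\<^bsub>KM\<^esub> x = \<ominus> x" by (simp add: KM_def a_inv_def m_inv_def)
lemma KM_minus [simp]: "x \<ominus>\<^bsub>KM\<^esub> y = x \<ominus> y" by (simp add: a_minus_def)

lemma iota_closed [simp]: "a \<in> carrier Z ==> \<iota> a \<in> carrier K" using I.hom_closed Z_closed by blast

sublocale KM: zmod p KM
proof (intro zmod.intro module.intro padic_axioms module_axioms.intro)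
 show "cring Z" by (rule Z.is_cring)
 show "abelian_group KM" by (rule abelian_groupI) (auto simp: K.a_ac intro: bexI[of _ "\<ominus> x" for x] K.l_neg)
qed (auto simp: K.m_assoc K.l_distr K.r_distr Z_closed)

abbreviation \<O> where "\<O> \<equiv> ring_of_integers p K \<iota>"

lemma O_carrier: "x \<in> carrier \<O> \<longleftrightarrow> x \<in> carrier K \<and> (\<exists>f. f \<noteq> [] \<and> hd f = \<one> \<and>
    set f \<subseteq> \<iota> ` carrier Z \<and> K.eval f x = \<zero>)"
 by (simp add: ring_of_integers_def)

lemma iota_image_K: "set f \<subseteq> \<iota> ` carrier Z ==> set f \<subseteq> carrier K" using iota_closed by blast

lemma powers_Suc: "(\<lambda>i. x [^] (i::nat)) ` {..<Suc d} = insert (x [^] d) ((\<lambda>i. x [^] i) ` {..<d})"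
 by (simp add: lessThan_Suc)

lemma zspan_powers_eval:
 assumes "x \<in> carrier K"
 shows "y \<in> KM.zspan ((\<lambda>i. x [^] i) ` {..<d}) \<longleftrightarrow> (\<exists>f. length f = d \<and> set f \<subseteq> \<iota> ` carrier Z \<and> y = K.eval f x)"
proof (induct d arbitrary: y)
 case 0
 have "y \<in> KM.zspan {} \<longleftrightarrow> y = \<zero>" using KM.zspan_zero[of "{}"] by (auto elim: KM.zspan.cases)
 thus ?case by simp
next
 case (Suc d)
 show ?case
 proof
  assume "y \<in> KM.zspan ((\<lambda>i. x [^] i) ` {..<Suc d})"
  hence "y \<in> KM.zspan (insert (x [^] d) ((\<lambda>i. x [^] i) ` {..<d}))" unfolding powers_Suc .
  then obtain a y' where a: "a \<in> carrier Z" "y' \<in> KM.zspan ((\<lambda>i. x [^] i) ` {..<d})" "y = \<iota> a \<otimes> x [^] d \<oplus> y'"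
   using KM.zspan_insertE[of y "x [^] d" "(\<lambda>i. x [^] i) ` {..<d}"] assms by auto
  then obtain f where f: "length f = d" "set f \<subseteq> \<iota> ` carrier Z" "y' = K.eval f x" using Suc by blast
  have "length (\<iota> a # f) = Suc d \<and> set (\<iota> a # f) \<subseteq> \<iota> ` carrier Z \<and> y = K.eval (\<iota> a # f) x"
   using a f by simp
  thus "\<exists>f. length f = Suc d \<and> set f \<subseteq> \<iota> ` carrier Z \<and> y = K.eval f x" by blast
 next
  assume "\<exists>f. length f = Suc d \<and> set f \<subseteq> \<iota> ` carrier Z \<and> y = K.eval f x"
  then obtain f where f: "length f = Suc d" "set f \<subseteq> \<iota> ` carrier Z" "y = K.eval f x" by blast
  obtain b g where bg: "f = b # g" using f by (cases f) auto
  obtain a where a: "a \<in> carrier Z" "b = \<iota> a" using f bg by auto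
  have g: "K.eval g x \<in> KM.zspan ((\<lambda>i. x [^] i) ` {..<d})" using Suc f bg by auto
  have "\<iota> a \<otimes> x [^] d \<oplus> K.eval g x \<in> KM.zspan ((\<lambda>i. x [^] i) ` {..<Suc d})"
   unfolding powers_Suc using KM.zspan_step[OF a(1), of "x [^] d" "insert (x [^] d) ((\<lambda>i. x [^] i) ` {..<d})"]
    KM.zspan_mono[OF _ g, of "insert (x [^] d) ((\<lambda>i. x [^] i) ` {..<d})"] assms by auto
  thus "y \<in> KM.zspan ((\<lambda>i. x [^] i) ` {..<Suc d})" using f bg a by simp
 qed
qed

lemma integral_iff:
 "x \<in> carrier \<O> \<longleftrightarrow> x \<in> carrier K \<and> (\<exists>d. x [^] d \<in> KM.zspan ((\<lambda>i. x [^] i) ` {..<(d::nat)}))"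
proof
 assume x: "x \<in> carrier \<O>"
 then obtain f where f: "f \<noteq> []" "hd f = \<one>" "set f \<subseteq> \<iota> ` carrier Z" "K.eval f x = \<zero>" and xK: "x \<in> carrier K"
  unfolding O_carrier by blast
 obtain g where g: "f = \<one> # g" using f by (cases f) auto
 have gK: "K.eval g x \<in> carrier K" using f g iota_image_K[of g] xK by (intro K.eval_in_carrier) auto
 have "K.eval g x \<in> KM.zspan ((\<lambda>i. x [^] i) ` {..<length g})" using f g zspan_powers_eval[OF xK] by auto
 from KM.zspan_uminus[OF this] have "\<ominus> K.eval g x \<in> KM.zspan ((\<lambda>i. x [^] i) ` {..<length g})" by simp
 moreover have "x [^] length g = \<ominus> K.eval g x"
  using f(4) g gK xK K.minus_equality[of "x [^] length g" "K.eval g x"] by simp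
 ultimately show "x \<in> carrier K \<and> (\<exists>d. x [^] d \<in> KM.zspan ((\<lambda>i. x [^] i) ` {..<(d::nat)}))" using xK by metis
next
 assume "x \<in> carrier K \<and> (\<exists>d. x [^] d \<in> KM.zspan ((\<lambda>i. x [^] i) ` {..<(d::nat)}))"
 then obtain d :: nat where xK: "x \<in> carrier K" and d: "x [^] d \<in> KM.zspan ((\<lambda>i. x [^] i) ` {..<d})" by blast
 from KM.zspan_uminus[OF d] obtain g where g: "length g = d" "set g \<subseteq> \<iota> ` carrier Z" "\<ominus> (x [^] d) = K.eval g x"
  using zspan_powers_eval[OF xK] by auto
 have "\<iota> \<^bold>1 \<in> \<iota> ` carrier Z" by (rule imageI) simp
 hence "set (\<one> # g) \<subseteq> \<iota> ` carrier Z" using g(2) by simp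
 moreover have "K.eval (\<one> # g) x = \<zero>" using g xK by (simp add: g(3)[symmetric] K.r_neg)
 ultimately show "x \<in> carrier \<O>" unfolding O_carrier using xK by (intro conjI exI[of _ "\<one> # g"]) auto
qed

lemma zspan_mult:
 assumes "y \<in> KM.zspan Y" "w \<in> carrier K" "\<And>x. x \<in> Y ==> x \<in> carrier K ==> w \<otimes> x \<in> KM.zspan Y'"
 shows "w \<otimes> y \<in> KM.zspan Y'"
proof -
 have "y \<in> {y \<in> carrier K. w \<otimes> y \<in> KM.zspan Y'}"
  using assms(1)
 proof (rule KM.zspan_least)
  fix a x assume a: "a \<in> carrier Z" "x \<in> Y" "x \<in> carrier KM"
  have "w \<otimes> (\<iota> a \<otimes> x) = a \<odot>\<^bsub>KM\<^esub> (w \<otimes> x)" using a assms(2) by (simp add: K.m_lcomm)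
  thus "a \<odot>\<^bsub>KM\<^esub> x \<in> {y \<in> carrier K. w \<otimes> y \<in> KM.zspan Y'}" using a assms KM.zspan_smult[of "w \<otimes> x" Y' a] by simp
 next
  fix x y assume xy: "x \<in> {y \<in> carrier K. w \<otimes> y \<in> KM.zspan Y'}" "y \<in> {y \<in> carrier K. w \<otimes> y \<in> KM.zspan Y'}"
  thus "x \<oplus>\<^bsub>KM\<^esub> y \<in> {y \<in> carrier K. w \<otimes> y \<in> KM.zspan Y'}"
   using assms(2) KM.zspan_add[of "w \<otimes> x" Y' "w \<otimes> y"] by (simp add: K.r_distr)
 qed (use assms(2) KM.zspan_zero in simp)
 thus ?thesis by blast
qed

lemma integral_of_stable:
 assumes "finite Y" "Y \<subseteq> carrier K" "w \<in> carrier K" "\<one> \<in> KM.zspan Y" "\<And>x. x \<in> Y ==> w \<otimes> x \<in> KM.zspan Y"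
 shows "w \<in> carrier \<O>"
proof -
 have "w [^] (i::nat) \<in> KM.zspan Y" for i
 proof (induct i)
  case (Suc i)
  have "w \<otimes> w [^] i \<in> KM.zspan Y" using Suc assms(3,5) by (rule zspan_mult)
  thus ?case using assms(3) by (simp add: K.m_comm)
 qed (use assms in simp)
 hence "\<exists>d. w [^] d \<in> KM.zspan ((\<lambda>i. w [^] i) ` {..<(d::nat)} \<union> {})"
  using assms(1,2) by (intro KM.zspan_noetherian[of Y "{}"]) auto
 thus ?thesis unfolding integral_iff using assms(3) by simp
qed

lemma integral_add_mult:
 assumes "x \<in> carrier \<O>" "y \<in> carrier \<O>" shows "x \<oplus> y \<in> carrier \<O>" "x \<otimes> y \<in> carrier \<O>"
proof -
 obtain a :: nat where xK: "x \<in> carrier K" and a: "x [^] a \<in> KM.zspan ((\<lambda>i. x [^] i) ` {..<a})" using assms(1) integral_iff by blast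
 obtain b :: nat where yK: "y \<in> carrier K" and b: "y [^] b \<in> KM.zspan ((\<lambda>i. y [^] i) ` {..<b})" using assms(2) integral_iff by blast
 have e: "KM.zspan {} = {\<zero>}" using KM.zspan_zero[of "{}"] by (auto elim: KM.zspan.cases)
 have ab: "a > 0" "b > 0" using a b e by (auto intro!: Nat.gr0I)
 define Y where "Y = (\<lambda>(i, j). x [^] i \<otimes> y [^] j) ` ({..<a} \<times> {..<b})"
 have fin: "finite Y" "Y \<subseteq> carrier K" using xK yK by (auto simp: Y_def)
 have inY: "x [^] i \<otimes> y [^] j \<in> KM.zspan Y" if "i < a" "j < b" for i j
  using that fin KM.zspan_incl[of "x [^] i \<otimes> y [^] j" Y] xK yK by (force simp: Y_def)
 have one: "\<one> \<in> KM.zspan Y" using inY[OF ab] by simp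
 have xY: "x \<otimes> z \<in> KM.zspan Y" if z: "z \<in> Y" for z
 proof -
  obtain i j where ij: "i < a" "j < b" "z = x [^] i \<otimes> y [^] j" using z by (auto simp: Y_def)
  have z2: "x \<otimes> z = y [^] j \<otimes> x [^] Suc i" using ij xK yK by (simp add: K.m_ac)
  show ?thesis
  proof (cases "Suc i = a")
   case True
   have "y [^] j \<otimes> x [^] a \<in> KM.zspan Y"
    using a by (rule zspan_mult) (use inY ij xK yK in \<open>auto simp: K.m_comm\<close>)
   thus ?thesis using z2 True by simp
  next
   case False
   thus ?thesis unfolding z2 using inY[of "Suc i" j] ij xK yK by (simp add: K.m_comm del: K.nat_pow_Suc)
  qed
 qed
 have yY: "y \<otimes> z \<in> KM.zspan Y" if z: "z \<in> Y" for z
 proof -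
  obtain i j where ij: "i < a" "j < b" "z = x [^] i \<otimes> y [^] j" using z by (auto simp: Y_def)
  have z2: "y \<otimes> z = x [^] i \<otimes> y [^] Suc j" using ij xK yK by (simp add: K.m_ac)
  show ?thesis
  proof (cases "Suc j = b")
   case True
   have "x [^] i \<otimes> y [^] b \<in> KM.zspan Y"
    using b by (rule zspan_mult) (use inY ij xK yK in auto)
   thus ?thesis using z2 True by simp
  next
   case False
   thus ?thesis unfolding z2 using inY[of i "Suc j"] ij by simp
  qed
 qed
 show "x \<oplus> y \<in> carrier \<O>"
 proof (rule integral_of_stable[OF fin _ one])
  fix z assume z: "z \<in> Y"
  have "x \<otimes> z \<oplus>\<^bsub>KM\<^esub> y \<otimes> z \<in> KM.zspan Y" using xY yY z by (intro KM.zspan_add)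
  thus "(x \<oplus> y) \<otimes> z \<in> KM.zspan Y" using xK yK z fin K.l_distr[of x y z] by auto
 qed (use xK yK in simp)
 show "x \<otimes> y \<in> carrier \<O>"
 proof (rule integral_of_stable[OF fin _ one])
  fix z assume z: "z \<in> Y"
  have "x \<otimes> (y \<otimes> z) \<in> KM.zspan Y" using yY[OF z] xK xY by (rule zspan_mult)
  thus "(x \<otimes> y) \<otimes> z \<in> KM.zspan Y" using xK yK z fin K.m_assoc[of x y z] by auto
 qed (use xK yK in simp)
qed

lemma iota_integral: assumes "a \<in> carrier Z" shows "\<iota> a \<in> carrier \<O>"
proof -
 have "\<iota> a \<otimes> \<one> \<in> KM.zspan {\<one>}"
  using KM.zspan_smult[OF KM.zspan_incl[of "\<one>" "{\<one>}"] assms] by simp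
 hence "\<iota> a [^] (1::nat) \<in> KM.zspan ((\<lambda>i. \<iota> a [^] i) ` {..<(1::nat)})" using assms by (simp add: lessThan_Suc)
 thus ?thesis unfolding integral_iff using assms by (metis iota_closed)
qed

lemma O_K: "x \<in> carrier \<O> ==> x \<in> carrier K" by (simp add: O_carrier)

lemma O_subring: "subring (carrier \<O>) K"
proof (rule K.subringI)
 show "carrier \<O> \<subseteq> carrier K" using O_K by blast
 show "\<one> \<in> carrier \<O>" using iota_integral[of "\<^bold>1"] by simp
 fix x y assume xy: "x \<in> carrier \<O>" "y \<in> carrier \<O>"
 show "x \<oplus> y \<in> carrier \<O>" "x \<otimes> y \<in> carrier \<O>" using xy integral_add_mult by auto
next
 fix x assume x: "x \<in> carrier \<O>"
 have "\<ominus>\<^bsub>Z\<^esub> \<one>\<^bsub>Z\<^esub> \<in> carrier Z" by (rule Z.a_inv_closed[OF Z.one_closed])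
 hence "\<^bold>- \<^bold>1 \<in> carrier Z" using Z_uminus[OF Z.one_closed] by simp
 hence "\<iota> (\<^bold>- \<^bold>1) \<in> carrier \<O>" by (rule iota_integral)
 moreover have "\<iota> (\<^bold>- \<^bold>1) \<otimes> x = \<ominus> x" using O_K[OF x] by (simp add: K.l_minus)
 ultimately show "\<ominus> x \<in> carrier \<O>" using integral_add_mult(2)[OF _ x] by metis
qed

lemma O_eq: "\<O> = K\<lparr>carrier := carrier \<O>\<rparr>" by (simp add: ring_of_integers_def)

lemma O_domain: "domain \<O>" by (subst O_eq) (rule K.subring_is_domain[OF O_subring])

lemma O_simps [simp]: "\<zero>\<^bsub>\<O>\<^esub> = \<zero>" "\<one>\<^bsub>\<O>\<^esub> = \<one>" "x \<oplus>\<^bsub>\<O>\<^esub> y = x \<oplus> y" "x \<otimes>\<^bsub>\<O>\<^esub> y = x \<otimes> y"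
 by (simp_all add: ring_of_integers_def)

definition \<pi> :: "nat => 'k" where "\<pi> n = \<iota> (KM.pp [^]\<^bsub>Z\<^esub> n)"

lemma pi_closed [simp]: "\<pi> n \<in> carrier \<O>" "\<pi> n \<in> carrier K"
 unfolding \<pi>_def using iota_integral[OF KM.pp_pow_closed[of n]] iota_closed[OF KM.pp_pow_closed[of n]] by auto
lemma pi_0 [simp]: "\<pi> 0 = \<one>" by (simp add: \<pi>_def)
lemma pi_add: "\<pi> (m + n) = \<pi> m \<otimes> \<pi> n"
 unfolding \<pi>_def by (simp add: Q.nat_pow_mult[symmetric])
lemma pi_nonzero: "\<pi> n \<noteq> \<zero>"
proof
 assume "\<pi> n = \<zero>"
 hence "\<iota> (KM.pp [^]\<^bsub>Z\<^esub> n) = \<iota> \<^bold>0" by (simp add: \<pi>_def)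
 hence "KM.pp [^]\<^bsub>Z\<^esub> n = \<^bold>0" using iota_inj Z_closed[OF KM.pp_pow_closed[of n]] by blast
 thus False using KM.nrm_pp_pow[of n] q_pow_pos[of n] by (metis less_irrefl nrm_zero)
qed
lemma ppow_pi [simp]: "KM.ppow n x = \<pi> n \<otimes> x" by (simp add: KM.ppow_def \<pi>_def)

lemma scale_into_Z: assumes "c \<in> carrier Q" shows "\<exists>m0. \<forall>m\<ge>m0. KM.pp [^]\<^bsub>Q\<^esub> (m::nat) \<^bold>* c \<in> carrier Z"
proof -
 have "\<exists>k. q ^ k < inverse (nrm c + 1)" using nrm_nonneg[OF assms] by (intro q_pow_small) simp
 then obtain k where k: "q ^ k < inverse (nrm c + 1)" by blast
 have "KM.pp [^]\<^bsub>Q\<^esub> m \<^bold>* c \<in> carrier Z" if "m \<ge> k" for m :: nat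
 proof -
  have "q ^ m * nrm c \<le> q ^ k * (nrm c + 1)" using q_pow_mono[OF that] nrm_nonneg[OF assms] by (intro mult_mono) auto
  also have "\<dots> \<le> inverse (nrm c + 1) * (nrm c + 1)" using k nrm_nonneg[OF assms] by (intro mult_right_mono) auto
  also have "\<dots> = 1" using nrm_nonneg[OF assms] by simp
  finally have "nrm (KM.pp [^]\<^bsub>Z\<^esub> m \<^bold>* c) \<le> 1" using nrm_mult[OF Z_closed[OF KM.pp_pow_closed[of m]] assms] KM.nrm_pp_pow[of m] by simp
  thus ?thesis using assms Z_closed[OF KM.pp_pow_closed[of m]] by (simp add: Z_carrier)
 qed
 thus ?thesis by blast
qed

lemma pi_pow: "\<pi> m [^] (n::nat) = \<pi> (m * n)"
 by (induct n) (simp_all add: pi_add K.m_comm)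

lemma scaled_eval_zspan:
 assumes "x \<in> carrier K" "set f \<subseteq> \<iota> ` carrier Q"
 shows "\<exists>m0. \<forall>m\<ge>m0. \<pi> (m * length f) \<otimes> K.eval f x \<in> KM.zspan ((\<lambda>i. (\<pi> m \<otimes> x) [^] i) ` {..<length f})"
 using assms(2)
proof (induct f)
 case Nil show ?case using KM.zspan_zero[of "{}"] by simp
next
 case (Cons a f)
 then obtain m0 where m0: "\<And>m. m \<ge> m0 ==> \<pi> (m * length f) \<otimes> K.eval f x \<in> KM.zspan ((\<lambda>i. (\<pi> m \<otimes> x) [^] i) ` {..<length f})" by auto
 obtain c where c: "c \<in> carrier Q" "a = \<iota> c" using Cons by auto
 obtain m1 where m1: "\<And>m. m \<ge> m1 ==> KM.pp [^]\<^bsub>Q\<^esub> (m::nat) \<^bold>* c \<in> carrier Z" using scale_into_Z[OF c(1)] by blast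
 have "\<pi> (m * length (a # f)) \<otimes> K.eval (a # f) x \<in> KM.zspan ((\<lambda>i. (\<pi> m \<otimes> x) [^] i) ` {..<length (a # f)})"
  if m: "m \<ge> max m0 m1" for m
 proof -
  define L where "L = length f"
  define e where "e = K.eval f x"
  define y where "y = \<pi> m \<otimes> x"
  define S where "S = (\<lambda>i. y [^] i) ` {..<L}"
  have fK: "set f \<subseteq> carrier K" using Cons(2) I.hom_closed by auto
  have eK: "e \<in> carrier K" unfolding e_def using fK assms(1) by (rule K.eval_in_carrier)
  have aK: "a \<in> carrier K" using c I.hom_closed by simp
  have yK: "y \<in> carrier K" using assms(1) by (simp add: y_def)
  have yL: "y [^] L = \<pi> (m * L) \<otimes> x [^] L" unfolding y_def using assms(1) by (simp add: K.nat_pow_distrib pi_pow)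
  have 1: "\<iota> (KM.pp [^]\<^bsub>Q\<^esub> m \<^bold>* c) = \<pi> m \<otimes> a" using c I.hom_mult[OF Z_closed[OF KM.pp_pow_closed[of m]] c(1)] by (simp add: \<pi>_def)
  have 2: "\<pi> m \<otimes> (\<pi> (m * L) \<otimes> e) \<in> KM.zspan S"
   using KM.zspan_ppow[of "\<pi> (m * L) \<otimes> e" S m] m0[of m] m by (simp add: S_def y_def L_def e_def)
  have "\<pi> (m * Suc L) \<otimes> (a \<otimes> x [^] L \<oplus> e)
    = (\<pi> m \<otimes> a) \<otimes> y [^] L \<oplus> \<pi> m \<otimes> (\<pi> (m * L) \<otimes> e)"
   unfolding yL using aK eK assms(1) by (simp add: pi_add K.r_distr K.m_ac)
  also have "\<dots> = (KM.pp [^]\<^bsub>Q\<^esub> m \<^bold>* c) \<odot>\<^bsub>KM\<^esub> (y [^] L) \<oplus>\<^bsub>KM\<^esub> \<pi> m \<otimes> (\<pi> (m * L) \<otimes> e)" by (simp add: 1[symmetric])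
  also have "\<dots> \<in> KM.zspan (insert (y [^] L) S)"
   using m1[of m] m yK KM.zspan_mono[OF _ 2, of "insert (y [^] L) S"] by (intro KM.zspan_step) auto
  also have "insert (y [^] L) S = (\<lambda>i. y [^] i) ` {..<Suc L}" by (simp add: S_def lessThan_Suc)
  finally show ?thesis by (simp add: L_def y_def e_def)
 qed
 thus ?case by blast
qed

lemma subfield_Q: "subfield (\<iota> ` carrier Q) K"
 using I.img_is_subfield(2)[OF Q.carrier_is_subfield K.one_not_zero] by simp

lemma eval_scale:
 assumes "x \<in> carrier K" "b \<in> carrier K" "set f \<subseteq> carrier K"
 shows "K.eval (map (\<lambda>c. b \<otimes> c) f) x = b \<otimes> K.eval f x"
 using assms(3)
proof (induct f)
 case (Cons a f)
 hence "K.eval f x \<in> carrier K" using assms by (intro K.eval_in_carrier) auto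
 thus ?case using Cons assms by (simp add: K.r_distr K.m_assoc)
qed (use assms in simp)

lemma scale_integral: assumes "x \<in> carrier K" shows "\<exists>m. \<pi> m \<otimes> x \<in> carrier \<O>"
proof -
 have "K.finite_dimension (\<iota> ` carrier Q) (carrier K)" using ext by (simp add: Qp_finite_extension_def)
 hence "(K.algebraic over (\<iota> ` carrier Q)) x"
  using K.finite_dimension_imp_algebraic[OF subfield_Q K.carrier_is_subring] assms by blast
 then obtain f where f: "f \<in> carrier (univ_poly K (\<iota> ` carrier Q))" "f \<noteq> []" "K.eval f x = \<zero>"
  using K.algebraicE[OF subfieldE(1)[OF subfield_Q] assms] by blast
 have pf: "polynomial (\<iota> ` carrier Q) f" using f(1) by (simp add: univ_poly_def)
 obtain a g where ag: "f = a # g" using f(2) by (cases f) auto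
 have a: "a \<in> \<iota> ` carrier Q" "a \<noteq> \<zero>" "set g \<subseteq> \<iota> ` carrier Q" using pf ag by (auto simp: polynomial_def)
 have aK: "a \<in> carrier K" "set g \<subseteq> carrier K" using a I.hom_closed by auto
 define b where "b = inv a"
 have b: "b \<in> \<iota> ` carrier Q" "b \<otimes> a = \<one>" "b \<in> carrier K"
  using K.subfield_m_inv[OF subfield_Q, of a] a I.hom_closed unfolding b_def by auto
 define h where "h = map (\<lambda>c. b \<otimes> c) g"
 have hQ: "set h \<subseteq> \<iota> ` carrier Q"
  using a(3) b(1) subringE(6)[OF subfieldE(1)[OF subfield_Q]] by (auto simp: h_def)
 have hK: "K.eval h x \<in> carrier K" using hQ I.hom_closed assms by (intro K.eval_in_carrier) auto
 define d where "d = length h"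
 have "b \<otimes> K.eval f x = \<zero>" using f(3) b(3) by simp
 hence "x [^] d \<oplus> K.eval h x = \<zero>"
  using eval_scale[OF assms b(3) aK(2)] K.eval_in_carrier[OF aK(2) assms] aK b assms
  by (simp add: ag h_def d_def K.r_distr K.m_assoc[symmetric])
 hence xd: "x [^] d = \<ominus> K.eval h x" using hK assms K.minus_equality[of "x [^] d" "K.eval h x"] by simp
 obtain m where m: "\<pi> (m * d) \<otimes> K.eval h x \<in> KM.zspan ((\<lambda>i. (\<pi> m \<otimes> x) [^] i) ` {..<d})"
  using scaled_eval_zspan[OF assms hQ] unfolding d_def by blast
 have "(\<pi> m \<otimes> x) [^] d = \<ominus> (\<pi> (m * d) \<otimes> K.eval h x)"
  using assms hK xd by (simp add: K.nat_pow_distrib pi_pow K.r_minus)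
 hence "(\<pi> m \<otimes> x) [^] d \<in> KM.zspan ((\<lambda>i. (\<pi> m \<otimes> x) [^] i) ` {..<d})" using KM.zspan_uminus[OF m] by simp
 thus ?thesis unfolding integral_iff using assms by (intro exI[of _ m]) auto
qed

text \<open>An element divisible by every power of \<open>p\<close> would make \<open>1 / p\<close> integral.\<close>

lemma pi_separated:
 assumes "x \<in> carrier K" "\<And>n. \<exists>t\<in>carrier \<O>. x = \<pi> n \<otimes> t" shows "x = \<zero>"
proof (rule ccontr)
 assume x0: "x \<noteq> \<zero>"
 have xi: "inv x \<in> carrier K" "x \<otimes> inv x = \<one>" using x0 assms(1) K.field_Units by auto
 define c where "c = inv\<^bsub>Q\<^esub> KM.pp"
 have p0: "KM.pp \<in> carrier Q" "KM.pp \<noteq> \<^bold>0" using nrm_rc[of "of_nat p"] pabs_p q_pos by (auto, metis less_irrefl nrm_zero)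
 have c: "c \<in> carrier Q" "nrm c = inverse q" using nrm_inv[OF p0] pabs_p by (auto simp: c_def)
 have cK: "\<iota> c \<in> carrier K" using c by simp
 obtain m where m: "\<pi> m \<otimes> (\<iota> c \<otimes> inv x) \<in> carrier \<O>" using scale_integral[of "\<iota> c \<otimes> inv x"] cK xi by auto
 obtain t where t: "t \<in> carrier \<O>" "x = \<pi> m \<otimes> t" using assms(2) by blast
 have tK: "t \<in> carrier K" using t O_K by blast
 have "t \<otimes> (\<pi> m \<otimes> (\<iota> c \<otimes> inv x)) = \<iota> c \<otimes> ((\<pi> m \<otimes> t) \<otimes> inv x)"
  using tK cK xi by (simp add: K.m_ac)
 also have "\<dots> = \<iota> c" using t(2) xi cK by simp
 finally have "\<iota> c \<in> carrier \<O>" using integral_add_mult(2)[OF t(1) m] by simp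
 then obtain d :: nat where d: "\<iota> c [^] d \<in> KM.zspan ((\<lambda>i. \<iota> c [^] i) ` {..<d})" unfolding integral_iff by blast
 have cp: "\<iota> c [^] (i::nat) = \<iota> (c [^]\<^bsub>Q\<^esub> i)" for i using c by (simp add: I.hom_nat_pow)
 have nc: "nrm (c [^]\<^bsub>Q\<^esub> i) = inverse q ^ i" for i :: nat using c by (simp add: nrm_pow)
 have iq: "inverse q > 1" using q_pos q_less1 by (simp add: one_less_inverse)
 have "\<iota> c [^] d \<in> {\<iota> b | b. b \<in> carrier Q \<and> nrm b < inverse q ^ d}"
  using d
 proof (rule KM.zspan_least)
  show "\<zero>\<^bsub>KM\<^esub> \<in> {\<iota> b | b. b \<in> carrier Q \<and> nrm b < inverse q ^ d}"
   using q_pos by (auto intro!: exI[of _ "\<^bold>0"])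
  fix a y assume a: "a \<in> carrier Z" "y \<in> (\<lambda>i. \<iota> c [^] i) ` {..<d}"
  then obtain i where i: "i < d" "y = \<iota> (c [^]\<^bsub>Q\<^esub> i)" using cp by auto
  have aQ: "a \<in> carrier Q" "nrm a \<le> 1" using a by (auto simp: Z_carrier)
  have "nrm (a \<^bold>* c [^]\<^bsub>Q\<^esub> i) \<le> 1 * inverse q ^ i" using aQ c nc q_pos by (simp add: nrm_mult mult_right_mono)
  also have "\<dots> < inverse q ^ d" using iq i by simp
  finally show "a \<odot>\<^bsub>KM\<^esub> y \<in> {\<iota> b | b. b \<in> carrier Q \<and> nrm b < inverse q ^ d}"
   using aQ c i by (auto intro!: exI[of _ "a \<^bold>* c [^]\<^bsub>Q\<^esub> i"])
 next
  fix y z assume "y \<in> {\<iota> b | b. b \<in> carrier Q \<and> nrm b < inverse q ^ d}" "z \<in> {\<iota> b | b. b \<in> carrier Q \<and> nrm b < inverse q ^ d}"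
  then obtain b b' where "b \<in> carrier Q" "b' \<in> carrier Q" "nrm b < inverse q ^ d" "nrm b' < inverse q ^ d" "y = \<iota> b" "z = \<iota> b'" by blast
  thus "y \<oplus>\<^bsub>KM\<^esub> z \<in> {\<iota> b | b. b \<in> carrier Q \<and> nrm b < inverse q ^ d}"
   using nrm_add[of b b'] by (auto intro!: exI[of _ "b \<^bold>+ b'"])
 qed
 then obtain b where b: "\<iota> (c [^]\<^bsub>Q\<^esub> d) = \<iota> b" "b \<in> carrier Q" "nrm b < inverse q ^ d" unfolding cp by blast
 hence "c [^]\<^bsub>Q\<^esub> d = b" using iota_inj c by simp
 thus False using b nc[of d] by simp
qed

text \<open>Lists whose entries are linearly independent in \<open>\<O> / p \<O>\<close>.\<close>

primrec flag :: "'k list => bool" where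
 "flag [] = True"
| "flag (u # us) = (u \<in> carrier \<O> \<and> (\<forall>y\<in>KM.zspan (set us). \<forall>w\<in>carrier \<O>. u \<noteq> y \<oplus> \<pi> 1 \<otimes> w) \<and> flag us)"

lemma flag_carrier: "flag us ==> set us \<subseteq> carrier \<O>" by (induct us) auto

lemma zspan_O: assumes "y \<in> KM.zspan Y" "Y \<subseteq> carrier \<O>" shows "y \<in> carrier \<O>"
 using assms(1) by (rule KM.zspan_least) (use assms(2) subringE[OF O_subring] iota_integral in auto)

lemma O_diff: "x \<in> carrier \<O> ==> y \<in> carrier \<O> ==> x \<ominus> y \<in> carrier \<O>"
 using subringE[OF O_subring] by (auto simp: a_minus_def)

lemma flag_divide:
 assumes "flag us" "y \<in> KM.zspan (set us)" "w \<in> carrier \<O>" "y = \<pi> 1 \<otimes> w"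
 shows "\<exists>y'\<in>KM.zspan (set us). y = \<pi> 1 \<otimes> y'"
 using assms
proof (induct us arbitrary: y w)
 case Nil
 hence "y = \<zero>" by (auto elim: KM.zspan.cases)
 thus ?case using KM.zspan_zero[of "set []"] by (intro bexI[of _ "\<zero>"]) auto
next
 case (Cons u us)
 have uO: "u \<in> carrier \<O>" and uK: "u \<in> carrier K" and fus: "flag us" using Cons(2) O_K by auto
 obtain a y1 where a: "a \<in> carrier Z" "y1 \<in> KM.zspan (set us)" "y = \<iota> a \<otimes> u \<oplus> y1"
  using KM.zspan_insertE[of y u "set us"] Cons(3) uK by auto
 have y1K: "y1 \<in> carrier K" and wK: "w \<in> carrier K" and aK: "\<iota> a \<in> carrier K" using KM.zspan_carrier[OF a(2)] O_K[OF Cons(4)] a by auto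
 show ?case
 proof (cases "nrm a = 1")
  case True
  hence "a \<noteq> \<^bold>0" by auto
  note i = nrm_inv[OF Z_closed[OF a(1)] this]
  define c where "c = inv\<^bsub>Q\<^esub> a"
  have c: "c \<in> carrier Z" "c \<^bold>* a = \<^bold>1" using i True Q.m_comm[OF i(1) Z_closed[OF a(1)]] by (auto simp: c_def Z_carrier)
  have cK: "\<iota> c \<in> carrier K" using c by simp
  have ca: "\<iota> c \<otimes> \<iota> a = \<one>" using I.hom_mult[OF Z_closed[OF c(1)] Z_closed[OF a(1)]] c(2) by simp
  have "\<iota> c \<otimes> (\<pi> 1 \<otimes> w) = \<iota> c \<otimes> (\<iota> a \<otimes> u) \<oplus> \<iota> c \<otimes> y1"
   unfolding Cons(5)[symmetric] a(3) using cK aK uK y1K by (simp add: K.r_distr)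
  also have "\<iota> c \<otimes> (\<iota> a \<otimes> u) = u" using ca cK aK uK by (simp add: K.m_assoc[symmetric])
  finally have e1: "\<iota> c \<otimes> (\<pi> 1 \<otimes> w) = u \<oplus> \<iota> c \<otimes> y1" .
  define t where "t = \<iota> c \<otimes> y1"
  have tK: "t \<in> carrier K" using cK y1K by (simp add: t_def)
  have "u = \<ominus> t \<oplus> (u \<oplus> t)" using uK tK by algebra
  also have "u \<oplus> t = \<pi> 1 \<otimes> (\<iota> c \<otimes> w)" using e1 cK wK by (simp add: t_def K.m_lcomm)
  finally have "u = \<ominus> t \<oplus> \<pi> 1 \<otimes> (\<iota> c \<otimes> w)" .
  moreover have "\<ominus> t \<in> KM.zspan (set us)" using KM.zspan_uminus[OF KM.zspan_smult[OF a(2) c(1)]] by (simp add: t_def)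
  moreover have "\<iota> c \<otimes> w \<in> carrier \<O>" using integral_add_mult(2)[OF iota_integral[OF c(1)] Cons(4)] .
  ultimately show ?thesis using Cons(2) unfolding flag.simps by blast
 next
  case False
  hence "nrm a \<le> nrm KM.pp" using a(1) nrm_discrete1[of a] pabs_p by (auto simp: Z_carrier)
  then obtain b where b: "b \<in> carrier Z" "a = b \<^bold>* KM.pp" using KM.Z_dvd[OF a(1) KM.pp_closed] by auto
  have bK: "\<iota> b \<in> carrier K" using b by simp
  have ab: "\<iota> a = \<pi> 1 \<otimes> \<iota> b" unfolding b(2) \<pi>_def using I.hom_mult[OF Z_closed[OF b(1)] rc_closed] K.m_comm[OF bK] by simp
  have "y1 = y \<ominus> \<iota> a \<otimes> u" unfolding a(3) using aK uK y1K by algebra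
  also have "\<dots> = \<pi> 1 \<otimes> (w \<ominus> \<iota> b \<otimes> u)" unfolding Cons(5) ab using wK uK bK pi_closed(2)[of 1] by algebra
  finally have y1: "y1 = \<pi> 1 \<otimes> (w \<ominus> \<iota> b \<otimes> u)" .
  have "w \<ominus> \<iota> b \<otimes> u \<in> carrier \<O>" using Cons(4) integral_add_mult(2)[OF iota_integral[OF b(1)] uO] by (rule O_diff)
  then obtain y' where y': "y' \<in> KM.zspan (set us)" "y1 = \<pi> 1 \<otimes> y'" using Cons(1)[OF fus a(2) _ y1] by blast
  have y'K: "y' \<in> carrier K" using KM.zspan_carrier[OF y'(1)] by simp
  have "y = \<pi> 1 \<otimes> (\<iota> b \<otimes> u \<oplus> y')" unfolding a(3) ab y'(2) using bK uK y'K pi_closed(2)[of 1] by algebra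
  moreover have "\<iota> b \<otimes> u \<oplus> y' \<in> KM.zspan (set (u # us))"
   using KM.zspan_step[OF b(1), of u "set (u # us)" y'] uK KM.zspan_mono[OF _ y'(1), of "set (u # us)"] by auto
  ultimately show ?thesis by blast
 qed
qed

lemma Span_scale:
 assumes "set us \<subseteq> carrier K" "w \<in> K.Span (\<iota> ` carrier Q) us"
 shows "\<exists>m0. \<forall>m\<ge>m0. \<pi> m \<otimes> w \<in> KM.zspan (set us)"
 using assms
proof (induct us arbitrary: w)
 case Nil thus ?case using KM.zspan_zero[of "{}"] by simp
next
 case (Cons u us)
 have "w \<in> K.line_extension (\<iota> ` carrier Q) u (K.Span (\<iota> ` carrier Q) us)" using Cons(3) by simp
 then obtain c v where cv: "c \<in> carrier Q" "v \<in> K.Span (\<iota> ` carrier Q) us" "w = \<iota> c \<otimes> u \<oplus> v"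
  using K.line_extension_mem_iff by auto
 obtain m0 where m0: "\<forall>m\<ge>m0. \<pi> m \<otimes> v \<in> KM.zspan (set us)"
  using Cons(1)[OF _ cv(2)] Cons(2) by (auto simp del: K.Span.simps)
 obtain m1 where m1: "\<And>m. m \<ge> m1 ==> KM.pp [^]\<^bsub>Q\<^esub> (m::nat) \<^bold>* c \<in> carrier Z" using scale_into_Z[OF cv(1)] by blast
 have cK: "\<iota> c \<in> carrier K" "u \<in> carrier K" using cv Cons by auto
 have vK: "v \<in> carrier K" using K.Span_in_carrier[of "\<iota> ` carrier Q" us] subring.axioms subringE(1)[OF subfieldE(1)[OF subfield_Q]] cv Cons(2)
  by (auto simp del: K.Span.simps)
 have "\<pi> m \<otimes> w \<in> KM.zspan (set (u # us))" if m: "m \<ge> max m0 m1" for m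
 proof -
  have 1: "\<iota> (KM.pp [^]\<^bsub>Q\<^esub> m \<^bold>* c) = \<pi> m \<otimes> \<iota> c" using I.hom_mult[OF Z_closed[OF KM.pp_pow_closed[of m]] cv(1)] by (simp add: \<pi>_def)
  have "\<pi> m \<otimes> v \<in> KM.zspan (set (u # us))" using KM.zspan_mono[of "set us" "set (u # us)"] m0 m by auto
  hence "(KM.pp [^]\<^bsub>Q\<^esub> m \<^bold>* c) \<odot>\<^bsub>KM\<^esub> u \<oplus>\<^bsub>KM\<^esub> \<pi> m \<otimes> v \<in> KM.zspan (set (u # us))"
   using m1[of m] m cK by (intro KM.zspan_step) auto
  moreover have "(KM.pp [^]\<^bsub>Q\<^esub> m \<^bold>* c) \<odot>\<^bsub>KM\<^esub> u = \<pi> m \<otimes> \<iota> c \<otimes> u" by (simp only: KM_simps 1)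
  ultimately show ?thesis unfolding cv(3) using cK vK by (simp add: K.r_distr K.m_assoc)
 qed
 thus ?case by blast
qed

lemma flag_independent: "flag us ==> K.independent (\<iota> ` carrier Q) us"
proof (induct us)
 case (Cons u us)
 have uO: "u \<in> carrier \<O>" and uK: "u \<in> carrier K" and fus: "flag us" using Cons(2) O_K by auto
 have usK: "set us \<subseteq> carrier K" using flag_carrier[OF fus] O_K by blast
 have "u \<notin> K.Span (\<iota> ` carrier Q) us"
 proof
  assume "u \<in> K.Span (\<iota> ` carrier Q) us"
  then obtain k where "\<pi> k \<otimes> u \<in> KM.zspan (set us)" using Span_scale[OF usK] by blast
  thus False
  proof (induct k)
   case 0
   hence "u \<in> KM.zspan (set us)" using uK by simp
   moreover have "u = u \<oplus> \<pi> 1 \<otimes> \<zero>" using uK by simp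
   moreover have "\<zero> \<in> carrier \<O>" using subringE(2)[OF O_subring] .
   ultimately show False using Cons(2) unfolding flag.simps by blast
  next
   case (Suc k)
   have kO: "\<pi> k \<otimes> u \<in> carrier \<O>" using integral_add_mult(2)[OF pi_closed(1) uO] .
   have "\<pi> (Suc k) \<otimes> u = \<pi> 1 \<otimes> (\<pi> k \<otimes> u)" using pi_add[of 1 k] uK by (simp add: K.m_assoc)
   then obtain y' where y': "y' \<in> KM.zspan (set us)" "\<pi> 1 \<otimes> (\<pi> k \<otimes> u) = \<pi> 1 \<otimes> y'"
    using flag_divide[OF fus Suc(2) kO] by auto
   have "y' \<in> carrier K" using KM.zspan_carrier[OF y'(1)] by simp
   hence "\<pi> k \<otimes> u = y'" using y'(2) K.m_lcancel[OF pi_nonzero pi_closed(2)] O_K[OF kO] by blast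
   thus False using Suc(1) y'(1) by simp
  qed
 qed
 thus ?case using Cons(1)[OF fus] uK by (intro K.independent.li_Cons)
qed simp

theorem O_finitely_generated:
 "\<exists>E. finite E \<and> E \<subseteq> carrier \<O> \<and> carrier \<O> = KM.zspan E"
proof -
 obtain n where n: "K.dimension n (\<iota> ` carrier Q) (carrier K)"
  using ext unfolding Qp_finite_extension_def K.finite_dimension_def by blast
 have bound: "length us \<le> n" if "flag us" for us
  using K.independent_length_le_dimension[OF subfield_Q n flag_independent[OF that]] flag_carrier[OF that] O_K by blast
 have "\<exists>us. flag us \<and> (\<forall>vs. flag vs --> length vs \<le> length us)"
  using ex_has_greatest_nat[of flag "[]" length "Suc n"] bound by (auto simp: less_Suc_eq_le)
 then obtain us where us: "flag us" "\<And>vs. flag vs ==> length vs \<le> length us" by blast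
 define E where "E = set us"
 have EO: "E \<subseteq> carrier \<O>" using flag_carrier us by (simp add: E_def)
 have step: "\<exists>y\<in>KM.zspan E. \<exists>w\<in>carrier \<O>. x = y \<oplus> \<pi> 1 \<otimes> w" if x: "x \<in> carrier \<O>" for x
 proof (rule ccontr)
  assume "\<not> ?thesis"
  hence "flag (x # us)" using x us(1) by (auto simp: E_def)
  from us(2)[OF this] show False by simp
 qed
 have "x \<in> KM.zspan E" if x: "x \<in> carrier \<O>" for x
 proof -
  obtain ff gg where fg: "\<And>x. x \<in> carrier \<O> ==> ff x \<in> KM.zspan E \<and> gg x \<in> carrier \<O> \<and> x = ff x \<oplus> \<pi> 1 \<otimes> gg x"
   using step by metis
  define r where "r n = (gg ^^ n) x" for n
  have rO: "r n \<in> carrier \<O>" for n by (induct n) (use x fg in \<open>auto simp: r_def\<close>)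
  define s where "s n = ff (r n)" for n
  have s: "s n \<in> KM.zspan E" for n using fg rO by (simp add: s_def)
  have sK: "s n \<in> carrier K" and rK: "r n \<in> carrier K" for n using KM.zspan_carrier[OF s] O_K[OF rO] by auto
  have rS: "r n = s n \<oplus> \<pi> 1 \<otimes> r (Suc n)" for n using fg[OF rO[of n]] by (simp add: s_def r_def)
  have pK: "KM.psum s n \<in> carrier K" for n using KM.psum_closed[of s] sK by simp
  have xs: "x = KM.psum s n \<oplus> \<pi> n \<otimes> r n" for n
  proof (induct n)
   case 0 show ?case using x O_K by (simp add: r_def)
  next
   case (Suc n)
   have "\<pi> n \<otimes> r n = \<pi> n \<otimes> s n \<oplus> \<pi> (Suc n) \<otimes> r (Suc n)"
    using sK[of n] rK[of "Suc n"] pi_add[of n 1] by (subst rS) (simp add: K.r_distr K.m_assoc)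
   thus ?case using Suc pK[of n] sK[of n] rK[of "Suc n"] by (simp add: K.a_assoc)
  qed
  obtain y where y: "y \<in> KM.zspan E" "\<forall>n. \<exists>t\<in>KM.zspan E. y = KM.psum s n \<oplus>\<^bsub>KM\<^esub> KM.ppow n t"
  proof -
   have EK: "E \<subseteq> carrier KM" "finite E" using EO O_K by (auto simp: E_def)
   have "\<exists>y\<in>KM.zspan E. \<forall>n. \<exists>t\<in>KM.zspan E. y = KM.psum s n \<oplus>\<^bsub>KM\<^esub> KM.ppow n t"
    using s by (rule KM.zspan_complete[OF EK(2,1)])
   thus ?thesis using that by blast
  qed
  have yK: "y \<in> carrier K" using KM.zspan_carrier[OF y(1)] by simp
  have "x \<ominus> y = \<zero>"
  proof (rule pi_separated)
   show "x \<ominus> y \<in> carrier K" using x O_K yK by simp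
   fix n
   obtain t where t: "t \<in> KM.zspan E" "y = KM.psum s n \<oplus> \<pi> n \<otimes> t" using y by auto
   have tO: "t \<in> carrier \<O>" using zspan_O[OF t(1) EO] .
   have "x \<ominus> y = (KM.psum s n \<oplus> \<pi> n \<otimes> r n) \<ominus> (KM.psum s n \<oplus> \<pi> n \<otimes> t)" using xs[of n] t(2) by simp
   also have "\<dots> = \<pi> n \<otimes> (r n \<ominus> t)" using pK[of n] rK[of n] O_K[OF tO] pi_closed(2)[of n] by algebra
   finally show "\<exists>t\<in>carrier \<O>. x \<ominus> y = \<pi> n \<otimes> t" using O_diff[OF rO[of n] tO] by blast
  qed
  hence "x = y" using x O_K yK by (simp add: K.minus_unique K.r_right_minus_eq)
  thus ?thesis using y by simp
 qed
 thus ?thesis using zspan_O[OF _ EO] EO by (intro exI[of _ E]) (auto simp: E_def)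
qed

theorem O_complete:
 assumes f: "\<And>n. f n \<in> carrier \<O>" and C: "\<And>n::nat. \<exists>t\<in>carrier \<O>. f (Suc n) = f n \<oplus> \<pi> n \<otimes> t"
 shows "\<exists>y\<in>carrier \<O>. \<forall>n. \<exists>t\<in>carrier \<O>. y = f n \<oplus> \<pi> n \<otimes> t"
proof -
 obtain E where E: "finite E" "E \<subseteq> carrier \<O>" "carrier \<O> = KM.zspan E" using O_finitely_generated by blast
 obtain s where s: "\<And>n. s n \<in> carrier \<O>" "\<And>n. f (Suc n) = f n \<oplus> \<pi> n \<otimes> s n" using C by metis
 have sK: "s n \<in> carrier K" and fK: "f n \<in> carrier K" for n using s f O_K by auto
 have pK: "KM.psum s n \<in> carrier K" for n using KM.psum_closed[of s] sK by simp
 have fs: "f n = f 0 \<oplus> KM.psum s n" for n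
 proof (induct n)
  case (Suc n)
  show ?case unfolding s(2)[of n] using Suc fK[of 0] pK[of n] sK[of n] by (simp add: K.a_assoc)
 qed (use fK in simp)
 obtain y where y: "y \<in> KM.zspan E" "\<forall>n. \<exists>t\<in>KM.zspan E. y = KM.psum s n \<oplus>\<^bsub>KM\<^esub> KM.ppow n t"
 proof -
  have EK: "E \<subseteq> carrier KM" using E(2) O_K by auto
  have "s i \<in> KM.zspan E" for i using s(1) E(3) by simp
  hence "\<exists>y\<in>KM.zspan E. \<forall>n. \<exists>t\<in>KM.zspan E. y = KM.psum s n \<oplus>\<^bsub>KM\<^esub> KM.ppow n t"
   by (rule KM.zspan_complete[OF E(1) EK])
  thus ?thesis using that by blast
 qed
 have yK: "y \<in> carrier K" using KM.zspan_carrier[OF y(1)] by simp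
 have "\<exists>t\<in>carrier \<O>. f 0 \<oplus> y = f n \<oplus> \<pi> n \<otimes> t" for n
 proof -
  obtain t where t: "t \<in> carrier \<O>" "y = KM.psum s n \<oplus> \<pi> n \<otimes> t" using y E(3) by auto
  have "f 0 \<oplus> y = (f 0 \<oplus> KM.psum s n) \<oplus> \<pi> n \<otimes> t"
   unfolding t(2) using fK[of 0] pK[of n] O_K[OF t(1)] by (simp add: K.a_assoc)
  thus ?thesis using t(1) fs[of n] by auto
 qed
 moreover have "f 0 \<oplus> y \<in> carrier \<O>" using integral_add_mult(1)[OF f[of 0], of y] y(1) E(3) by simp
 ultimately show ?thesis by blast
qed

end

section \<open>Approximately additive charts\<close>

context padic begin

lemma additive_identities:
 assumes "x \<in> carrier Q" "y \<in> carrier Q" "z \<in> carrier Q" "b \<in> carrier Q"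
 shows "x \<^bold>- b = (x \<^bold>- (y \<^bold>+ z \<^bold>- b)) \<^bold>+ ((y \<^bold>- b) \<^bold>+ (z \<^bold>- b))"
  and "z \<^bold>- b = \<^bold>- ((b \<^bold>- (y \<^bold>+ z \<^bold>- b)) \<^bold>+ (y \<^bold>- b))"
  and "z \<^bold>- b = \<^bold>- ((x \<^bold>- (y \<^bold>+ z \<^bold>- b)) \<^bold>+ (y \<^bold>- x))"
  and "x \<^bold>- y = ((x \<^bold>- b) \<^bold>- z) \<^bold>- ((y \<^bold>- b) \<^bold>- z)"
  and "x \<^bold>- y = (x \<^bold>- b) \<^bold>- (y \<^bold>- b)"
 using assms by algebra+

end

locale additive_chart = padic p + group G for p and G (structure) +
 fixes n :: nat and W :: "'a set" and \<phi> :: "'a => nat => padic" and a :: "nat => padic" and c k0 k1 :: nat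
  and B :: "nat => 'a set"
 assumes B_def: "B k = {g \<in> W. \<forall>i<n. nrm (\<phi> g i \<^bold>- a i) \<le> q ^ k}"
  and W_sub: "W \<subseteq> carrier G" and one_W: "\<one> \<in> W"
  and phi_closed: "g \<in> W ==> i < n ==> \<phi> g i \<in> carrier Q"
  and phi_one: "i < n ==> \<phi> \<one> i = a i"
  and k0: "c + 2 \<le> k0" and k1: "k0 \<le> k1"
  and mult_W: "[|k0 \<le> j; k0 \<le> k; g \<in> B j; h \<in> B k|] ==> g \<otimes> h \<in> W"
  and mult_err: "[|k0 \<le> j; k0 \<le> k; g \<in> B j; h \<in> B k; i < n|] ==>
   nrm (\<phi> (g \<otimes> h) i \<^bold>- (\<phi> g i \<^bold>+ \<phi> h i \<^bold>- a i)) \<le> q ^ (j + k - c)"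
  and inv_k0: "g \<in> B k1 ==> inv g \<in> B k0"
begin

lemma a_closed: "i < n ==> a i \<in> carrier Q" using phi_closed[OF one_W] phi_one by simp
lemma B_W: "g \<in> B k ==> g \<in> W" and B_G: "g \<in> B k ==> g \<in> carrier G" using W_sub by (auto simp: B_def)
lemma B_phi: "g \<in> B k ==> i < n ==> \<phi> g i \<in> carrier Q" using B_W phi_closed by blast
lemma B_nrm: "g \<in> B k ==> i < n ==> nrm (\<phi> g i \<^bold>- a i) \<le> q ^ k" by (simp add: B_def)
lemma B_mono: "j \<le> k ==> B k \<subseteq> B j" using q_pow_mono[of j k] by (auto simp: B_def intro: order.trans)
lemma B_one: "\<one> \<in> B k" using one_W a_closed by (simp add: B_def phi_one less_imp_le)

lemma err_le: "k0 \<le> j ==> k0 \<le> k ==> m \<le> j + 2 ==> q ^ (j + k - c) \<le> q ^ m"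
 using k0 by (intro q_pow_mono) linarith

lemma B_mult: assumes "k0 \<le> k" "g \<in> B k" "h \<in> B k" shows "g \<otimes> h \<in> B k"
proof -
 have W: "g \<otimes> h \<in> W" using mult_W assms by blast
 have "nrm (\<phi> (g \<otimes> h) i \<^bold>- a i) \<le> q ^ k" if i: "i < n" for i
 proof -
  have cc: "\<phi> (g \<otimes> h) i \<in> carrier Q" "\<phi> g i \<in> carrier Q" "\<phi> h i \<in> carrier Q" "a i \<in> carrier Q"
   using phi_closed[OF W i] B_phi assms i a_closed by auto
  have e: "\<phi> (g \<otimes> h) i \<^bold>- a i = (\<phi> (g \<otimes> h) i \<^bold>- (\<phi> g i \<^bold>+ \<phi> h i \<^bold>- a i)) \<^bold>+
   ((\<phi> g i \<^bold>- a i) \<^bold>+ (\<phi> h i \<^bold>- a i))" by (rule additive_identities(1)[OF cc])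
  have "nrm (\<phi> (g \<otimes> h) i \<^bold>- (\<phi> g i \<^bold>+ \<phi> h i \<^bold>- a i)) \<le> q ^ k"
   using mult_err[OF assms(1,1,2,3) i] err_le[OF assms(1,1), of k] by linarith
  thus ?thesis unfolding e using cc B_nrm[OF assms(2) i] B_nrm[OF assms(3) i] by (intro nrm_add_le) auto
 qed
 thus ?thesis using W by (simp add: B_def)
qed

lemma inv_step: assumes "k0 \<le> l" "l \<le> k" "g \<in> B k" "inv g \<in> B l" shows "inv g \<in> B (min k (Suc l))"
proof -
 have W: "inv g \<in> W" using assms B_W by blast
 have "nrm (\<phi> (inv g) i \<^bold>- a i) \<le> q ^ min k (Suc l)" if i: "i < n" for i
 proof -
  have cc: "\<phi> (inv g) i \<in> carrier Q" "\<phi> g i \<in> carrier Q" "a i \<in> carrier Q"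
   using phi_closed[OF W i] B_phi assms i a_closed by auto
  have "g \<otimes> inv g = \<one>" using assms B_G by simp
  hence "nrm (a i \<^bold>- (\<phi> g i \<^bold>+ \<phi> (inv g) i \<^bold>- a i)) \<le> q ^ (k + l - c)"
   using mult_err[OF _ assms(1) assms(3,4) i] assms(1,2) phi_one[OF i] by simp
  also have "\<dots> \<le> q ^ min k (Suc l)" using assms(1,2) k0 by (intro q_pow_mono) linarith
  finally have 1: "nrm (a i \<^bold>- (\<phi> g i \<^bold>+ \<phi> (inv g) i \<^bold>- a i)) \<le> q ^ min k (Suc l)" .
  have 2: "nrm (\<phi> g i \<^bold>- a i) \<le> q ^ min k (Suc l)"
   using B_nrm[OF assms(3) i] q_pow_mono[OF min.cobounded1[of k "Suc l"]] by (rule order.trans)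
  have e: "\<phi> (inv g) i \<^bold>- a i = \<^bold>- ((a i \<^bold>- (\<phi> g i \<^bold>+ \<phi> (inv g) i \<^bold>- a i)) \<^bold>+ (\<phi> g i \<^bold>- a i))"
   by (rule additive_identities(2)[OF cc(3,2,1,3)])
  show ?thesis unfolding e using cc 1 2 by (subst nrm_uminus) (auto intro: nrm_add_le)
 qed
 thus ?thesis using W by (simp add: B_def)
qed

lemma B_inv: assumes "k1 \<le> k" "g \<in> B k" shows "inv g \<in> B k"
proof -
 have "inv g \<in> B (min k (k0 + m))" for m
 proof (induct m)
  case 0
  have "g \<in> B k1" using assms B_mono by blast
  thus ?case using inv_k0 B_mono[of "min k k0" k0] by auto
 next
  case (Suc m)
  have "inv g \<in> B (min k (Suc (min k (k0 + m))))"
   using Suc assms k1 by (intro inv_step) auto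
  moreover have "min k (Suc (min k (k0 + m))) = min k (k0 + Suc m)" by auto
  ultimately show ?case by simp
 qed
 from this[of k] show ?thesis by (simp add: min_absorb1)
qed

lemma B_subgroup: "k1 \<le> k ==> subgroup (B k) G"
 using B_mult[of k] B_inv[of k] B_one[of k] B_G[of _ k] k1 by (intro subgroup.intro) auto

definition near :: "nat => 'a => 'a => bool" where "near k g h \<longleftrightarrow> (\<forall>i<n. nrm (\<phi> g i \<^bold>- \<phi> h i) \<le> q ^ k)"

lemma near_quotient: assumes "k1 \<le> k" "g \<in> B k" "h \<in> B k" "near (Suc k) g h" shows "inv g \<otimes> h \<in> B (Suc k)"
proof -
 define w where "w = inv g \<otimes> h"
 have kk: "k0 \<le> k" using assms k1 by simp
 have w: "w \<in> B k" unfolding w_def using B_mult[OF kk B_inv[OF assms(1,2)] assms(3)] .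
 have gw: "g \<otimes> w = h" unfolding w_def using B_G assms(2,3) by (simp add: m_assoc[symmetric])
 have "nrm (\<phi> w i \<^bold>- a i) \<le> q ^ Suc k" if i: "i < n" for i
 proof -
  have cc: "\<phi> w i \<in> carrier Q" "\<phi> g i \<in> carrier Q" "\<phi> h i \<in> carrier Q" "a i \<in> carrier Q"
   using B_phi w assms i a_closed by auto
  have 1: "nrm (\<phi> h i \<^bold>- (\<phi> g i \<^bold>+ \<phi> w i \<^bold>- a i)) \<le> q ^ Suc k"
   using mult_err[OF kk kk assms(2) w i] err_le[OF kk kk, of "Suc k"] unfolding gw by linarith
  have 2: "nrm (\<phi> g i \<^bold>- \<phi> h i) \<le> q ^ Suc k" using assms(4) i unfolding near_def by blast
  have e: "\<phi> w i \<^bold>- a i = \<^bold>- ((\<phi> h i \<^bold>- (\<phi> g i \<^bold>+ \<phi> w i \<^bold>- a i)) \<^bold>+ (\<phi> g i \<^bold>- \<phi> h i))"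
   by (rule additive_identities(3)[OF cc(3,2,1,4)])
  show ?thesis unfolding e using cc 1 2 by (subst nrm_uminus) (auto simp del: power_Suc intro!: nrm_add_le)
 qed
 thus ?thesis using B_W[OF w] by (simp add: B_def w_def)
qed

lemma power_err:
 assumes "k0 \<le> k" "g \<in> B k"
 shows "g [^] m \<in> B k \<and> (\<forall>i<n. nrm ((\<phi> (g [^] m) i \<^bold>- a i) \<^bold>- rc (of_nat m) \<^bold>* (\<phi> g i \<^bold>- a i)) \<le> q ^ (k + 2))"
proof (induct m)
 case 0
 have "nrm ((a i \<^bold>- a i) \<^bold>- \<^bold>0 \<^bold>* (\<phi> g i \<^bold>- a i)) \<le> q ^ (k + 2)" if "i < n" for i
  using a_closed[OF that] B_phi[OF assms(2) that] by (simp add: less_imp_le)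
 thus ?case using B_one by (simp add: phi_one rc_0)
next
 case (Suc m)
 have gm: "g [^] m \<in> B k" using Suc by blast
 have B: "g [^] Suc m \<in> B k" using B_mult[OF assms(1) gm assms(2)] by simp
 have "nrm ((\<phi> (g [^] Suc m) i \<^bold>- a i) \<^bold>- rc (of_nat (Suc m)) \<^bold>* (\<phi> g i \<^bold>- a i)) \<le> q ^ (k + 2)" if i: "i < n" for i
 proof -
  define u where "u = rc (of_nat m)"
  define s where "s = \<phi> (g [^] Suc m) i"
  define t where "t = \<phi> (g [^] m) i"
  define x where "x = \<phi> g i"
  have cc: "s \<in> carrier Q" "t \<in> carrier Q" "x \<in> carrier Q" "a i \<in> carrier Q" "u \<in> carrier Q"
   using B_phi[OF B i] B_phi[OF gm i] B_phi[OF assms(2) i] a_closed[OF i] by (auto simp: s_def t_def x_def u_def)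
  have uS: "rc (of_nat (Suc m)) = \<^bold>1 \<^bold>+ u" by (simp add: u_def flip: rc_1 rc_add)
  have 1: "nrm (s \<^bold>- (t \<^bold>+ x \<^bold>- a i)) \<le> q ^ (k + 2)"
   using mult_err[OF assms(1,1) gm assms(2) i] err_le[OF assms(1,1), of "k + 2"] unfolding s_def t_def x_def by simp
  have 2: "nrm ((t \<^bold>- a i) \<^bold>- u \<^bold>* (x \<^bold>- a i)) \<le> q ^ (k + 2)" using Suc i unfolding t_def x_def u_def by blast
  have e: "(s \<^bold>- a i) \<^bold>- (\<^bold>1 \<^bold>+ u) \<^bold>* (x \<^bold>- a i) =
    (s \<^bold>- (t \<^bold>+ x \<^bold>- a i)) \<^bold>+ ((t \<^bold>- a i) \<^bold>- u \<^bold>* (x \<^bold>- a i))"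
  proof -
   define b where "b = a i"
   have b: "b \<in> carrier Q" using cc by (simp add: b_def)
   have "(\<^bold>1 \<^bold>+ u) \<^bold>* (x \<^bold>- b) = (x \<^bold>- b) \<^bold>+ u \<^bold>* (x \<^bold>- b)" using cc b by (simp add: Q.l_distr)
   thus ?thesis unfolding b_def[symmetric] using cc(1,2,3,5) b by (simp only:) algebra
  qed
  show ?thesis unfolding uS s_def[symmetric] x_def[symmetric] e using cc 1 2 by (intro nrm_add_le) auto
 qed
 thus ?case using B by blast
qed

lemma power_p_B: assumes "k0 \<le> k" "g \<in> B k" shows "g [^] p \<in> B (Suc k)"
proof -
 have gp: "g [^] p \<in> B k" using power_err[OF assms] by blast
 have "nrm (\<phi> (g [^] p) i \<^bold>- a i) \<le> q ^ Suc k" if i: "i < n" for i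
 proof -
  define x where "x = \<phi> g i \<^bold>- a i"
  define y where "y = \<phi> (g [^] p) i \<^bold>- a i"
  have cc: "x \<in> carrier Q" "y \<in> carrier Q" using B_phi[OF gp i] B_phi[OF assms(2) i] a_closed[OF i] by (auto simp: x_def y_def)
  have "nrm (y \<^bold>- rc (of_nat p) \<^bold>* x) \<le> q ^ (k + 2)" using power_err[OF assms] i unfolding x_def y_def by blast
  also have "\<dots> \<le> q ^ Suc k" by (rule q_pow_mono) simp
  finally have 1: "nrm (y \<^bold>- rc (of_nat p) \<^bold>* x) \<le> q ^ Suc k" .
  have 2: "nrm (rc (of_nat p) \<^bold>* x) \<le> q ^ Suc k" using B_nrm[OF assms(2) i] cc pabs_p by (simp add: nrm_mult x_def[symmetric])
  have e: "y = (y \<^bold>- rc (of_nat p) \<^bold>* x) \<^bold>+ rc (of_nat p) \<^bold>* x" using cc rc_closed[of "of_nat p"] by algebra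
  have "nrm y \<le> q ^ Suc k" by (subst e) (use cc 1 2 in \<open>intro nrm_add_le; simp del: power_Suc\<close>)
  thus ?thesis by (simp add: y_def)
 qed
 thus ?thesis using B_W[OF gp] by (simp add: B_def)
qed

lemma power_p_near: assumes "k0 \<le> k" "g \<in> B k" "h \<in> B k" "near (Suc (Suc k)) (g [^] p) (h [^] p)" shows "near (Suc k) g h"
 unfolding near_def
proof (intro allI impI)
 fix i assume i: "i < n"
 define x where "x = \<phi> g i \<^bold>- a i"
 define y where "y = \<phi> (g [^] p) i \<^bold>- a i"
 define x' where "x' = \<phi> h i \<^bold>- a i"
 define y' where "y' = \<phi> (h [^] p) i \<^bold>- a i"
 define r where "r = rc (of_nat p)"
 have gp: "g [^] p \<in> B k" "h [^] p \<in> B k" using power_err[OF assms(1)] assms(2,3) by blast+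
 have cp: "\<phi> g i \<in> carrier Q" "\<phi> h i \<in> carrier Q" "\<phi> (g [^] p) i \<in> carrier Q" "\<phi> (h [^] p) i \<in> carrier Q" "a i \<in> carrier Q"
  using B_phi gp assms(2,3) i a_closed by auto
 have cc: "x \<in> carrier Q" "y \<in> carrier Q" "x' \<in> carrier Q" "y' \<in> carrier Q" "r \<in> carrier Q"
  using cp by (auto simp: x_def y_def x'_def y'_def r_def)
 have 1: "nrm (y \<^bold>- r \<^bold>* x) \<le> q ^ (k + 2)" "nrm (y' \<^bold>- r \<^bold>* x') \<le> q ^ (k + 2)"
  using power_err[OF assms(1,2), of p] power_err[OF assms(1,3), of p] i unfolding x_def y_def x'_def y'_def r_def by blast+
 have "y \<^bold>- y' = \<phi> (g [^] p) i \<^bold>- \<phi> (h [^] p) i"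
  unfolding y_def y'_def by (rule additive_identities(5)[OF cp(3,4,5,5), symmetric])
 hence 2: "nrm (y \<^bold>- y') \<le> q ^ (k + 2)" using assms(4) i unfolding near_def by (simp del: power_Suc)
 have e: "r \<^bold>* (x \<^bold>- x') = (y \<^bold>- y') \<^bold>- ((y \<^bold>- r \<^bold>* x) \<^bold>- (y' \<^bold>- r \<^bold>* x'))" using cc by algebra
 have "nrm (r \<^bold>* (x \<^bold>- x')) \<le> q ^ (k + 2)" unfolding e using cc 1 2 by - (rule nrm_diff_le, simp, simp, simp, rule nrm_diff_le, auto)
 hence "q * nrm (x \<^bold>- x') \<le> q * q ^ Suc k" using cc pabs_p by (simp add: nrm_mult r_def)
 hence "nrm (x \<^bold>- x') \<le> q ^ Suc k" using q_pos by (simp only: mult_le_cancel_left_pos)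
 moreover have "x \<^bold>- x' = \<phi> g i \<^bold>- \<phi> h i" unfolding x_def x'_def by (rule additive_identities(5)[OF cp(1,2,5,5), symmetric])
 ultimately show "nrm (\<phi> g i \<^bold>- \<phi> h i) \<le> q ^ Suc k" by simp
qed

definition separated :: "nat => 'a set => bool" where
 "separated k F \<longleftrightarrow> finite F \<and> F \<subseteq> B k \<and> (\<forall>g\<in>F. \<forall>h\<in>F. near (Suc k) g h --> g = h)"

lemma digit: assumes "x \<in> carrier Q" "nrm x \<le> q ^ k" shows "\<exists>j<p. nrm (x \<^bold>- rc (of_nat p ^ k * of_nat j)) \<le> q ^ Suc k"
proof -
 define r where "r = rc (of_nat p ^ k)"
 have r: "r \<in> carrier Q" "nrm r = q ^ k"
 proof -
  have "r = rc (of_nat p) [^]\<^bsub>Q\<^esub> k" by (simp add: r_def rc_pow)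
  thus "r \<in> carrier Q" "nrm r = q ^ k" using nrm_pow[of "rc (of_nat p)" k] pabs_p by simp_all
 qed
 have "r \<noteq> \<^bold>0" using r q_pow_pos[of k] by (metis less_irrefl nrm_zero)
 note i = nrm_inv[OF r(1) this]
 define y where "y = x \<^bold>* inv\<^bsub>Q\<^esub> r"
 have y: "y \<in> carrier Q" "r \<^bold>* y = x" using assms(1) i(1,2) r(1) Q.m_lcomm[of r x "inv\<^bsub>Q\<^esub> r"] unfolding y_def by simp_all
 have "nrm r * nrm y \<le> q ^ k * 1" using assms(2) nrm_mult[OF r(1) y(1)] y(2) by simp
 hence "nrm y \<le> 1" unfolding r(2) using q_pow_pos[of k] by (simp only: mult_le_cancel_left_pos)
 then obtain j where j: "j < p" "nrm (y \<^bold>- rc (of_nat j)) \<le> q" using residue[OF y(1)] by blast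
 have "x \<^bold>- rc (of_nat p ^ k * of_nat j) = r \<^bold>* (y \<^bold>- rc (of_nat j))"
  unfolding rc_mult r_def[symmetric] y(2)[symmetric] using r(1) y(1) rc_closed[of "of_nat j"] by algebra
 hence "nrm (x \<^bold>- rc (of_nat p ^ k * of_nat j)) = q ^ k * nrm (y \<^bold>- rc (of_nat j))" using nrm_mult[OF r(1)] y(1) r(2) by simp
 also have "\<dots> \<le> q ^ k * q" using j(2) by (intro mult_left_mono) auto
 finally show ?thesis using j(1) by (auto simp: mult.commute)
qed

lemma separated_card: assumes "separated k F" shows "card F \<le> p ^ n"
proof -
 have "\<forall>g\<in>F. \<exists>f\<in>PiE {..<n} (\<lambda>_. {..<p}). \<forall>i<n. nrm ((\<phi> g i \<^bold>- a i) \<^bold>- rc (of_nat p ^ k * of_nat (f i))) \<le> q ^ Suc k"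
 proof
  fix g assume "g \<in> F"
  hence g: "g \<in> B k" using assms by (auto simp: separated_def)
  have "\<forall>i. \<exists>j. i < n --> j < p \<and> nrm ((\<phi> g i \<^bold>- a i) \<^bold>- rc (of_nat p ^ k * of_nat j)) \<le> q ^ Suc k"
   using digit[of "\<phi> g i \<^bold>- a i" k for i] B_phi[OF g] B_nrm[OF g] a_closed by (metis Q.minus_closed)
  then obtain f where "\<forall>i. i < n --> f i < p \<and> nrm ((\<phi> g i \<^bold>- a i) \<^bold>- rc (of_nat p ^ k * of_nat (f i))) \<le> q ^ Suc k" by metis
  thus "\<exists>f\<in>PiE {..<n} (\<lambda>_. {..<p}). \<forall>i<n. nrm ((\<phi> g i \<^bold>- a i) \<^bold>- rc (of_nat p ^ k * of_nat (f i))) \<le> q ^ Suc k"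
   by (intro bexI[of _ "restrict f {..<n}"]) auto
 qed
 then obtain D where D: "\<And>g. g \<in> F ==> D g \<in> PiE {..<n} (\<lambda>_. {..<p})"
  "\<And>g i. g \<in> F ==> i < n ==> nrm ((\<phi> g i \<^bold>- a i) \<^bold>- rc (of_nat p ^ k * of_nat (D g i))) \<le> q ^ Suc k" by metis
 have "inj_on D F"
 proof (rule inj_onI)
  fix g h assume gh: "g \<in> F" "h \<in> F" "D g = D h"
  have "near (Suc k) g h" unfolding near_def
  proof (intro allI impI)
   fix i assume i: "i < n"
   have cp: "\<phi> g i \<in> carrier Q" "\<phi> h i \<in> carrier Q" "a i \<in> carrier Q"
    using B_phi[of _ k] gh assms i a_closed by (auto simp: separated_def)
   define r where "r = rc (of_nat p ^ k * of_nat (D g i))"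
   have r: "r \<in> carrier Q" by (simp add: r_def)
   have e: "\<phi> g i \<^bold>- \<phi> h i = ((\<phi> g i \<^bold>- a i) \<^bold>- r) \<^bold>- ((\<phi> h i \<^bold>- a i) \<^bold>- r)" by (rule additive_identities(4)[OF cp(1,2) r cp(3)])
   show "nrm (\<phi> g i \<^bold>- \<phi> h i) \<le> q ^ Suc k" unfolding e using cp r D(2)[OF gh(1) i] D(2)[OF gh(2) i] gh(3)
    by - (rule nrm_diff_le, auto simp: r_def)
  qed
  thus "g = h" using assms gh by (auto simp: separated_def)
 qed
 moreover have "D ` F \<subseteq> PiE {..<n} (\<lambda>_. {..<p})" using D(1) by blast
 ultimately have "card F \<le> card (PiE {..<n} (\<lambda>_. {..<p}))" by (intro card_inj_on_le) (auto intro: finite_PiE)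
 thus ?thesis by (simp add: card_PiE)
qed

lemma separated_power: assumes "k0 \<le> k" "separated k F"
 shows "separated (k + j) ((\<lambda>g. g [^] (p ^ j)) ` F) \<and> card ((\<lambda>g. g [^] (p ^ j)) ` F) = card F"
proof (induct j)
 case 0
 have "(\<lambda>g. g [^] (p ^ 0)) ` F = F" using assms(2) B_G[of _ k] by (force simp: separated_def)
 thus ?case using assms by simp
next
 case (Suc j)
 define F' where "F' = (\<lambda>g. g [^] (p ^ j)) ` F"
 have F': "separated (k + j) F'" "card F' = card F" using Suc by (simp_all add: F'_def)
 have FG: "F \<subseteq> carrier G" using assms(2) B_G[of _ k] by (auto simp: separated_def)
 have im: "(\<lambda>g. g [^] (p ^ Suc j)) ` F = (\<lambda>g. g [^] p) ` F'"
  unfolding F'_def image_image using FG by (intro image_cong) (auto simp: nat_pow_pow mult.commute)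
 have kj: "k0 \<le> k + j" using assms by simp
 have nr: "g = h" if "g \<in> F'" "h \<in> F'" "near (Suc (Suc (k + j))) (g [^] p) (h [^] p)" for g h
  using power_p_near[OF kj _ _ that(3)] F'(1) that(1,2) unfolding separated_def by blast
 have F'B: "F' \<subseteq> B (k + j)" and fin: "finite F'" using F'(1) by (auto simp: separated_def)
 have nn: "near m g g" if "g \<in> F'" for m g
  using B_phi[of "g [^] p" "Suc (k + j)"] power_p_B[OF kj] F'B that B_phi unfolding near_def by (auto simp: less_imp_le)
 have inj: "inj_on (\<lambda>g. g [^] p) F'"
 proof (rule inj_onI)
  fix g h assume gh: "g \<in> F'" "h \<in> F'" "g [^] p = h [^] p"
  have "g [^] p \<in> B (Suc (k + j))" using power_p_B[OF kj] F'B gh by blast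
  hence "near (Suc (Suc (k + j))) (g [^] p) (h [^] p)"
   unfolding gh(3)[symmetric] near_def using B_phi by (simp add: less_imp_le)
  thus "g = h" using nr gh by blast
 qed
 have "separated (Suc (k + j)) ((\<lambda>g. g [^] p) ` F')"
  unfolding separated_def using fin power_p_B[OF kj] F'B nr by blast
 thus ?case unfolding im using card_image[OF inj] F'(2) by simp
qed

text \<open>A separated subset of \<open>H \<inter> B k\<close> of the largest size that occurs for any large \<open>k\<close> stays maximal under \<open>p\<close>-th
 powers, so its powers represent \<open>H \<inter> B (k + j)\<close> modulo \<open>B (k + j + 1)\<close> for every \<open>j\<close>.\<close>

theorem subgroup_power_representatives:
 assumes H: "subgroup H G"
 shows "\<exists>k\<ge>K. \<exists>S. k1 \<le> k \<and> finite S \<and> S \<subseteq> H \<inter> B k \<and>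
  (\<forall>j. \<forall>s\<in>S. s [^] (p ^ j) \<in> B (k + j)) \<and>
  (\<forall>j. \<forall>v\<in>H \<inter> B (k + j). \<exists>s\<in>S. inv (s [^] (p ^ j)) \<otimes> v \<in> B (Suc (k + j)))"
proof -
 define P where "P = (\<lambda>(k, F). K \<le> k \<and> k1 \<le> k \<and> separated k F \<and> F \<subseteq> H)"
 have ne: "P (max K k1, {})" by (simp add: P_def separated_def)
 have bnd: "\<forall>y. P y --> card (snd y) < Suc (p ^ n)"
 proof (intro allI impI)
  fix y assume "P y"
  thus "card (snd y) < Suc (p ^ n)" using separated_card[of "fst y" "snd y"] by (simp add: P_def case_prod_beta less_Suc_eq_le)
 qed
 have "\<exists>x. P x \<and> (\<forall>y. P y --> card (snd y) \<le> card (snd x))"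
  by (rule ex_has_greatest_nat[of P "(max K k1, {})", OF ne bnd])
 then obtain x where x: "P x" "\<And>y. P y ==> card (snd y) \<le> card (snd x)" by blast
 define k where "k = fst x"
 define F where "F = snd x"
 have kF: "P (k, F)" using x(1) by (simp add: k_def F_def)
 have max: "card F' \<le> card F" if "P (k', F')" for k' F' using x(2)[OF that] by (simp add: F_def)
 have k: "K \<le> k" "k1 \<le> k" "k0 \<le> k" and F: "separated k F" "F \<subseteq> H" using kF k1 by (auto simp: P_def)
 have pB: "s [^] (p ^ j) \<in> B (k + j)" if "s \<in> F" for s j
  using separated_power[OF k(3) F(1), of j] that by (auto simp: separated_def)
 have rep: "\<exists>s\<in>F. inv (s [^] (p ^ j)) \<otimes> v \<in> B (Suc (k + j))" if v: "v \<in> H \<inter> B (k + j)" for j v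
 proof (rule ccontr)
  assume no: "\<not> ?thesis"
  define F' where "F' = (\<lambda>g. g [^] (p ^ j)) ` F"
  have F': "separated (k + j) F'" "card F' = card F" using separated_power[OF k(3) F(1)] by (auto simp: F'_def)
  have far: "\<not> near (Suc (k + j)) g v" if g: "g \<in> F'" for g
   using near_quotient[of "k + j" g v] no g pB v k(2) by (auto simp: F'_def)
  have far': "\<not> near (Suc (k + j)) v g" if g: "g \<in> F'" for g
  proof
   assume nr: "near (Suc (k + j)) v g"
   have "near (Suc (k + j)) g v" unfolding near_def
   proof (intro allI impI)
    fix i assume i: "i < n"
    have "\<phi> g i \<in> carrier Q" "\<phi> v i \<in> carrier Q" using B_phi[OF _ i] v F'(1) g by (auto simp: separated_def)
    thus "nrm (\<phi> g i \<^bold>- \<phi> v i) \<le> q ^ Suc (k + j)" using nr i nrm_commute[of "\<phi> g i" "\<phi> v i"] unfolding near_def by simp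
   qed
   thus False using far[OF g] by blast
  qed
  have "near (Suc (k + j)) v v" using v B_phi[of v "k + j"] by (auto simp: near_def less_imp_le)
  hence vF': "v \<notin> F'" using far by blast
  have "separated (k + j) (insert v F')" using F'(1) v far far' unfolding separated_def by blast
  moreover have "F' \<subseteq> H"
  proof
   fix g assume "g \<in> F'"
   then obtain s where s: "s \<in> H" "g = s [^] (p ^ j)" using F(2) by (auto simp: F'_def)
   have "s [^] (m::nat) \<in> H" for m
    using subgroup.one_closed[OF H] subgroup.m_closed[OF H _ s(1)] by (induct m) simp_all
   thus "g \<in> H" using s by simp
  qed
  ultimately have "P (k + j, insert v F')" using k v by (auto simp: P_def)
  from max[OF this] show False using F' vF' by (simp add: separated_def)
 qed
 have "finite F" "F \<subseteq> H \<inter> B k" using F by (auto simp: separated_def)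
 thus ?thesis using k pB rep by (intro exI[of _ k] exI[of _ F] conjI allI ballI) simp_all
qed

end

section \<open>Charts of p-adic Lie groups\<close>

context padic begin

lemma limitin_finite_subsets:
 assumes "limitin (Qp_top p) S L (finite_subsets_at_top A)"
 shows "L \<in> carrier Q" "\<exists>F0. finite F0 \<and> F0 \<subseteq> A \<and> (\<forall>F. finite F \<and> F0 \<subseteq> F \<and> F \<subseteq> A --> S F \<in> carrier Q \<and> nrm (S F \<^bold>- L) \<le> q ^ k)"
proof -
 show L: "L \<in> carrier Q" using limitin_topspace[OF assms] by simp
 have "eventually (\<lambda>F. S F \<in> {x \<in> carrier Q. nrm (x \<^bold>- L) \<le> q ^ k}) (finite_subsets_at_top A)"
  using L by (intro limitinD[OF assms openin_ball[OF L]]) (simp add: less_imp_le)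
 thus "\<exists>F0. finite F0 \<and> F0 \<subseteq> A \<and> (\<forall>F. finite F \<and> F0 \<subseteq> F \<and> F \<subseteq> A --> S F \<in> carrier Q \<and> nrm (S F \<^bold>- L) \<le> q ^ k)"
  unfolding eventually_finite_subsets_at_top mem_Collect_eq .
qed

lemma nrm_monomial:
 assumes "\<And>i. i < N ==> x i \<in> carrier Q"
 shows "padic_monomial p N \<alpha> x \<in> carrier Q" "nrm (padic_monomial p N \<alpha> x) = (\<Prod>i<N. nrm (x i) ^ \<alpha> i)"
proof -
 have "padic_monomial p M \<alpha> x \<in> carrier Q \<and> nrm (padic_monomial p M \<alpha> x) = (\<Prod>i<M. nrm (x i) ^ \<alpha> i)" if "M \<le> N" for M
  using that
 proof (induct M)
  case 0 show ?case by (simp add: padic_monomial_def)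
 next
  case (Suc M)
  have c: "(\<lambda>i. x i [^]\<^bsub>Q\<^esub> \<alpha> i) \<in> {..<M} \<rightarrow> carrier Q" "x M \<in> carrier Q" using assms Suc(2) by auto
  have "padic_monomial p (Suc M) \<alpha> x = x M [^]\<^bsub>Q\<^esub> \<alpha> M \<^bold>* padic_monomial p M \<alpha> x"
   unfolding padic_monomial_def lessThan_Suc using c by (subst Q.finprod_insert) auto
  thus ?case using Suc c by (simp add: nrm_mult nrm_pow mult.commute)
 qed
 thus "padic_monomial p N \<alpha> x \<in> carrier Q" "nrm (padic_monomial p N \<alpha> x) = (\<Prod>i<N. nrm (x i) ^ \<alpha> i)" by auto
qed

lemma monomial_cong:
 assumes "\<And>i. i < N ==> y i \<in> carrier Q" "\<And>i. i < N ==> x i \<in> carrier Q" "\<And>i. i < N ==> \<alpha> i \<noteq> 0 ==> x i = y i"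
 shows "padic_monomial p N \<alpha> x = padic_monomial p N \<alpha> y"
 unfolding padic_monomial_def
proof (rule Q.finprod_cong')
 fix i assume "i \<in> {..<N}"
 thus "x i [^]\<^bsub>Q\<^esub> \<alpha> i = y i [^]\<^bsub>Q\<^esub> \<alpha> i" using assms(3)[of i] by (cases "\<alpha> i = 0") auto
qed (use assms in auto)

lemma monomial_zero:
 assumes "\<And>i. i < N ==> x i \<in> carrier Q" "i < N" "x i = \<^bold>0" "\<alpha> i \<noteq> 0"
 shows "padic_monomial p N \<alpha> x = \<^bold>0"
proof -
 have "(\<Prod>i<N. nrm (x i) ^ \<alpha> i) = 0" using assms(2-4) by (intro prod_zero) (auto intro!: bexI[of _ i])
 hence "nrm (padic_monomial p N \<alpha> x) = 0" using nrm_monomial(2)[of N x \<alpha>] assms(1) by simp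
 thus ?thesis using nrm_eq_0[OF nrm_monomial(1)[of N x \<alpha>]] assms(1) by blast
qed

lemma double_diff_add:
 assumes "a \<in> carrier Q" "a' \<in> carrier Q" "b \<in> carrier Q" "b' \<in> carrier Q" "c \<in> carrier Q" "c' \<in> carrier Q" "d \<in> carrier Q" "d' \<in> carrier Q"
 shows "((a \<^bold>+ a') \<^bold>- (b \<^bold>+ b')) \<^bold>- ((c \<^bold>+ c') \<^bold>- (d \<^bold>+ d')) =
   ((a \<^bold>- b) \<^bold>- (c \<^bold>- d)) \<^bold>+ ((a' \<^bold>- b') \<^bold>- (c' \<^bold>- d'))"
 using assms by algebra

lemma mixed_finsum_bound:
 assumes "finite F" "0 \<le> b"
  "\<And>\<alpha>. \<alpha> \<in> F ==> t1 \<alpha> \<in> carrier Q \<and> t2 \<alpha> \<in> carrier Q \<and> t3 \<alpha> \<in> carrier Q \<and> t4 \<alpha> \<in> carrier Q \<and>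
   nrm ((t1 \<alpha> \<^bold>- t2 \<alpha>) \<^bold>- (t3 \<alpha> \<^bold>- t4 \<alpha>)) \<le> b"
 shows "nrm ((finsum Q t1 F \<^bold>- finsum Q t2 F) \<^bold>- (finsum Q t3 F \<^bold>- finsum Q t4 F)) \<le> b"
 using assms(1,3)
proof (induct F rule: finite_induct)
 case empty show ?case using assms(2) by simp
next
 case (insert \<alpha> F)
 have fs: "finsum Q t (insert \<alpha> F) = t \<alpha> \<^bold>+ finsum Q t F" "finsum Q t F \<in> carrier Q" if "\<forall>\<beta>\<in>insert \<alpha> F. t \<beta> \<in> carrier Q" for t
  using insert(1,2) that by (auto intro!: Q.finsum_insert Q.finsum_closed)
 have cl: "\<forall>\<beta>\<in>insert \<alpha> F. t1 \<beta> \<in> carrier Q" "\<forall>\<beta>\<in>insert \<alpha> F. t2 \<beta> \<in> carrier Q" "\<forall>\<beta>\<in>insert \<alpha> F. t3 \<beta> \<in> carrier Q" "\<forall>\<beta>\<in>insert \<alpha> F. t4 \<beta> \<in> carrier Q"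
  using insert(4) by auto
 note f1 = fs[OF cl(1)] and f2 = fs[OF cl(2)] and f3 = fs[OF cl(3)] and f4 = fs[OF cl(4)]
 note id = double_diff_add
 have IH: "nrm ((finsum Q t1 F \<^bold>- finsum Q t2 F) \<^bold>- (finsum Q t3 F \<^bold>- finsum Q t4 F)) \<le> b" using insert by blast
 show ?case unfolding f1(1) f2(1) f3(1) f4(1) using cl IH insert(4)[of \<alpha>] f1(2) f2(2) f3(2) f4(2)
  by (subst id) (auto intro!: nrm_add_le)
qed

definition glue :: "nat => (nat => padic) => (nat => padic) => nat => padic" where
 "glue n x y = (\<lambda>i\<in>{..<2*n}. if i < n then x i else y (i - n))"

lemma glue_vec: assumes "x \<in> extensional {..<n}" "y \<in> extensional {..<n}"
 shows "vec_fst n (glue n x y) = x" "vec_snd n (glue n x y) = y"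
 using assms by (auto simp: vec_fst_def vec_snd_def glue_def extensional_def restrict_def fun_eq_iff)

lemma Qp_space_topspace: "topspace (Qp_space p n) = (\<Pi>\<^sub>E i\<in>{..<n}. carrier Q)"
 by (simp add: Qp_space_def)

lemma glue_topspace: "x \<in> topspace (Qp_space p n) ==> y \<in> topspace (Qp_space p n) ==> glue n x y \<in> topspace (Qp_space p (2 * n))"
 unfolding Qp_space_topspace by (auto simp: glue_def PiE_def Pi_def)

text \<open>In the mixed difference only the monomials that involve both groups of variables survive.\<close>

lemma analytic_mixed:
 assumes f: "padic_analytic p (2 * n) D f" and a: "a \<in> topspace (Qp_space p n)"
  and D: "\<And>x y. [|x \<in> topspace (Qp_space p n); y \<in> topspace (Qp_space p n);
    \<forall>i<n. nrm (x i \<^bold>- a i) \<le> q ^ k; \<forall>i<n. nrm (y i \<^bold>- a i) \<le> q ^ k|] ==> glue n x y \<in> D"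
 shows "\<exists>c\<ge>k. \<forall>x y s t. c \<le> s --> c \<le> t --> x \<in> topspace (Qp_space p n) --> y \<in> topspace (Qp_space p n) -->
   (\<forall>i<n. nrm (x i \<^bold>- a i) \<le> q ^ s) --> (\<forall>i<n. nrm (y i \<^bold>- a i) \<le> q ^ t) -->
   f (glue n x y) \<in> carrier Q \<and>
   nrm ((f (glue n x y) \<^bold>- f (glue n x a)) \<^bold>- (f (glue n a y) \<^bold>- f (glue n a a))) \<le> q ^ (s + t - c)"
proof -
 define z0 where "z0 = glue n a a"
 have aQ: "a i \<in> carrier Q" if "i < n" for i using a that by (auto simp: Qp_space_topspace)
 have xQ: "x i \<in> carrier Q" if "x \<in> topspace (Qp_space p n)" "i < n" for x i using that by (auto simp: Qp_space_topspace)
 have ga: "nrm (a i \<^bold>- a i) \<le> q ^ m" if "i < n" for i m using aQ[OF that] by (simp add: less_imp_le)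
 have "z0 \<in> D" unfolding z0_def using a ga by (intro D) auto
 then obtain r cf where r: "r > 0" and cf: "\<forall>\<alpha>\<in>multi_indices (2*n). cf \<alpha> \<in> carrier Q"
  and lim: "\<forall>x\<in>D. (\<forall>i<2*n. Qp_dist p (x i) (z0 i) < r) -->
      limitin (Qp_top p) (\<lambda>F. \<Oplus>\<^bsub>Q\<^esub>\<alpha>\<in>F. cf \<alpha> \<^bold>* padic_monomial p (2*n) \<alpha> (\<lambda>i. x i \<^bold>- z0 i)) (f x) (finite_subsets_at_top (multi_indices (2*n)))"
  using f unfolding padic_analytic_def by blast
 obtain k' where k': "q ^ k' < r" using q_pow_small r by blast
 define k2 where "k2 = max k k'"
 have "q ^ k2 \<le> q ^ k'" by (rule q_pow_mono) (simp add: k2_def)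
 moreover have "q ^ k2 \<le> q ^ k" by (rule q_pow_mono) (simp add: k2_def)
 ultimately have k2: "q ^ k2 < r" "q ^ k2 \<le> q ^ k" using k' by linarith+
 define mterm where "mterm x y \<alpha> = cf \<alpha> \<^bold>* padic_monomial p (2*n) \<alpha> (\<lambda>i. glue n x y i \<^bold>- z0 i)" for x y \<alpha>
 define MI where "MI = multi_indices (2*n)"
 have gz: "glue n x y i \<^bold>- z0 i = (if i < n then x i \<^bold>- a i else y (i - n) \<^bold>- a (i - n))" if "i < 2*n" for x y i
  using that by (auto simp: glue_def z0_def)
 have gQ: "glue n x y i \<^bold>- z0 i \<in> carrier Q" if "x \<in> topspace (Qp_space p n)" "y \<in> topspace (Qp_space p n)" "i < 2*n" for x y i
  unfolding gz[OF that(3)] using xQ[OF that(1)] xQ[OF that(2)] aQ that(3) by auto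
 have mterm_closed: "mterm x y \<alpha> \<in> carrier Q" if "x \<in> topspace (Qp_space p n)" "y \<in> topspace (Qp_space p n)" "\<alpha> \<in> MI" for x y \<alpha>
  unfolding mterm_def using cf that nrm_monomial(1)[of "2*n" "\<lambda>i. glue n x y i \<^bold>- z0 i" \<alpha>] gQ[OF that(1,2)] by (auto simp: MI_def)
 have lim': "limitin (Qp_top p) (\<lambda>F. finsum Q (mterm x y) F) (f (glue n x y)) (finite_subsets_at_top MI)"
  if x: "x \<in> topspace (Qp_space p n)" "\<forall>i<n. nrm (x i \<^bold>- a i) \<le> q ^ k2"
   and y: "y \<in> topspace (Qp_space p n)" "\<forall>i<n. nrm (y i \<^bold>- a i) \<le> q ^ k2" for x y
 proof -
  have gD: "glue n x y \<in> D" using x y k2(2) by (intro D) (auto intro: order.trans)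
  have dist: "Qp_dist p (glue n x y i) (z0 i) < r" if i: "i < 2*n" for i
  proof -
   have gi: "glue n x y i \<in> carrier Q" "z0 i \<in> carrier Q" using xQ[OF x(1)] xQ[OF y(1)] aQ i by (auto simp: glue_def z0_def)
   have "nrm (glue n x y i \<^bold>- z0 i) \<le> q ^ k2" unfolding gz[OF i] using x y i by auto
   thus ?thesis using gi k2(1) by (simp add: Qp_dist_def)
  qed
  show ?thesis using lim[rule_format, OF gD dist] unfolding mterm_def MI_def .
 qed
 have exe: "\<exists>e. \<forall>\<alpha>\<in>MI. nrm (cf \<alpha>) * (q ^ k2) ^ (\<Sum>i<2*n. \<alpha> i) * q ^ e \<le> 1"
 proof -
  define u where "u = rc (of_nat p ^ k2)"
  have u: "u \<in> carrier Q" "nrm u = q ^ k2"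
  proof -
   have "u = rc (of_nat p) [^]\<^bsub>Q\<^esub> k2" by (simp add: u_def rc_pow)
   thus "u \<in> carrier Q" "nrm u = q ^ k2" using nrm_pow[of "rc (of_nat p)" k2] pabs_p by simp_all
  qed
  define x where "x = (\<lambda>i\<in>{..<n}. a i \<^bold>+ u)"
  have x: "x \<in> topspace (Qp_space p n)" using aQ u by (auto simp: Qp_space_topspace x_def)
  have xa: "x i \<^bold>- a i = u" if "i < n" for i
  proof -
   define b where "b = a i"
   have "b \<in> carrier Q" using aQ[OF that] by (simp add: b_def)
   hence "(b \<^bold>+ u) \<^bold>- b = u" using u(1) by algebra
   thus ?thesis using that by (simp add: x_def b_def)
  qed
  have xk: "\<forall>i<n. nrm (x i \<^bold>- a i) \<le> q ^ k2" using xa u by simp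
  define L where "L = f (glue n x x)"
  obtain F0 where F0: "finite F0" "F0 \<subseteq> MI" "\<forall>F. finite F \<and> F0 \<subseteq> F \<and> F \<subseteq> MI --> finsum Q (mterm x x) F \<in> carrier Q \<and> nrm (finsum Q (mterm x x) F \<^bold>- L) \<le> q ^ 0"
   using limitin_finite_subsets(2)[OF lim'[OF x xk x xk], of 0] unfolding L_def by blast
  have LQ: "L \<in> carrier Q" using limitin_finite_subsets(1)[OF lim'[OF x xk x xk]] by (simp add: L_def)
  have tn: "nrm (mterm x x \<alpha>) = nrm (cf \<alpha>) * (q ^ k2) ^ (\<Sum>i<2*n. \<alpha> i)" if \<alpha>: "\<alpha> \<in> MI" for \<alpha>
  proof -
   have g: "glue n x x i \<^bold>- z0 i = u" if "i < 2*n" for i unfolding gz[OF that] using xa that by auto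
   have "nrm (padic_monomial p (2*n) \<alpha> (\<lambda>i. glue n x x i \<^bold>- z0 i)) = (\<Prod>i<2*n. nrm (glue n x x i \<^bold>- z0 i) ^ \<alpha> i)"
    by (rule nrm_monomial(2)) (use gQ[OF x x] in blast)
   also have "\<dots> = (\<Prod>i<2*n. (q ^ k2) ^ \<alpha> i)" using g u by (intro prod.cong) auto
   also have "\<dots> = (q ^ k2) ^ (\<Sum>i<2*n. \<alpha> i)" by (rule power_sum[symmetric])
   finally show ?thesis unfolding mterm_def using cf \<alpha> nrm_monomial(1)[of "2*n" "\<lambda>i. glue n x x i \<^bold>- z0 i" \<alpha>] gQ[OF x x]
    by (simp add: nrm_mult MI_def)
  qed
  have out: "nrm (mterm x x \<alpha>) \<le> 1" if \<alpha>: "\<alpha> \<in> MI" "\<alpha> \<notin> F0" for \<alpha>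
  proof -
   define S where "S = finsum Q (mterm x x) F0"
   define t where "t = mterm x x \<alpha>"
   have S: "S \<in> carrier Q" "nrm (S \<^bold>- L) \<le> 1" using F0(3)[rule_format, of F0] F0 by (auto simp: S_def)
   have tQ: "t \<in> carrier Q" using mterm_closed[OF x x \<alpha>(1)] by (simp add: t_def)
   have "finsum Q (mterm x x) (insert \<alpha> F0) = t \<^bold>+ S" unfolding S_def t_def
    using F0 \<alpha> mterm_closed[OF x x] by (intro Q.finsum_insert) auto
   hence S': "nrm ((t \<^bold>+ S) \<^bold>- L) \<le> 1" using F0(3)[rule_format, of "insert \<alpha> F0"] F0(1,2) \<alpha> by auto
   have "t = ((t \<^bold>+ S) \<^bold>- L) \<^bold>- (S \<^bold>- L)" using tQ S(1) LQ by algebra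
   hence "nrm t \<le> max (nrm ((t \<^bold>+ S) \<^bold>- L)) (nrm (S \<^bold>- L))" using nrm_diff[of "(t \<^bold>+ S) \<^bold>- L" "S \<^bold>- L"] tQ S(1) LQ by simp
   thus ?thesis using S S' by (simp add: t_def)
  qed
  define C where "C = 1 + (\<Sum>\<alpha>\<in>F0. nrm (mterm x x \<alpha>))"
  have nn: "nrm (mterm x x \<alpha>) \<ge> 0" if "\<alpha> \<in> MI" for \<alpha> using mterm_closed[OF x x that] nrm_nonneg by blast
  have sg: "(\<Sum>\<alpha>\<in>F0. nrm (mterm x x \<alpha>)) \<ge> 0" using F0(2) nn by (intro sum_nonneg) auto
  have C: "nrm (mterm x x \<alpha>) \<le> C" if \<alpha>: "\<alpha> \<in> MI" for \<alpha>
  proof (cases "\<alpha> \<in> F0")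
   case True
   have "nrm (mterm x x \<alpha>) \<le> (\<Sum>\<alpha>\<in>F0. nrm (mterm x x \<alpha>))" using True F0(1,2) nn by (intro member_le_sum) auto
   thus ?thesis by (simp add: C_def)
  next
   case False thus ?thesis using out[OF \<alpha>] sg by (simp add: C_def)
  qed
  have Cp: "C > 0" using sg by (simp add: C_def)
  hence "inverse C > 0" by simp
  then obtain e where e: "q ^ e < inverse C" using q_pow_small by blast
  have "nrm (cf \<alpha>) * (q ^ k2) ^ (\<Sum>i<2*n. \<alpha> i) * q ^ e \<le> 1" if \<alpha>: "\<alpha> \<in> MI" for \<alpha>
  proof -
   have "nrm (mterm x x \<alpha>) * q ^ e \<le> C * inverse C" using C[OF \<alpha>] e Cp by (intro mult_mono) auto
   thus ?thesis using tn[OF \<alpha>] Cp by simp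
  qed
  thus ?thesis by blast
 qed
 then obtain e where e: "\<And>\<alpha>. \<alpha> \<in> MI ==> nrm (cf \<alpha>) * (q ^ k2) ^ (\<Sum>i<2*n. \<alpha> i) * q ^ e \<le> 1" by blast
 define c where "c = 2 * k2 + e"
 have main: "f (glue n x y) \<in> carrier Q \<and>
   nrm ((f (glue n x y) \<^bold>- f (glue n x a)) \<^bold>- (f (glue n a y) \<^bold>- f (glue n a a))) \<le> q ^ (s + t - c)"
  if st: "c \<le> s" "c \<le> t" and x: "x \<in> topspace (Qp_space p n)" and y: "y \<in> topspace (Qp_space p n)"
   and xs: "\<forall>i<n. nrm (x i \<^bold>- a i) \<le> q ^ s" and yt: "\<forall>i<n. nrm (y i \<^bold>- a i) \<le> q ^ t" for x y s t
 proof -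
  obtain s' where s': "s = k2 + s'" using st by (metis c_def le_Suc_ex le_add1 mult_2 order.trans add.assoc)
  obtain t' where t': "t = k2 + t'" using st by (metis c_def le_Suc_ex le_add1 mult_2 order.trans add.assoc)
  define b where "b = q ^ (s + t - c)"
  have x2: "\<forall>i<n. nrm (x i \<^bold>- a i) \<le> q ^ k2" using xs q_pow_mono[of k2 s] s' by (auto intro: order.trans)
  have y2: "\<forall>i<n. nrm (y i \<^bold>- a i) \<le> q ^ k2" using yt q_pow_mono[of k2 t] t' by (auto intro: order.trans)
  have a2: "\<forall>i<n. nrm (a i \<^bold>- a i) \<le> q ^ k2" using ga by blast
  have mixed: "nrm ((mterm x y \<alpha> \<^bold>- mterm x a \<alpha>) \<^bold>- (mterm a y \<alpha> \<^bold>- mterm a a \<alpha>)) \<le> b" if \<alpha>: "\<alpha> \<in> MI" for \<alpha>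
  proof -
   have tc: "mterm x y \<alpha> \<in> carrier Q" "mterm x a \<alpha> \<in> carrier Q" "mterm a y \<alpha> \<in> carrier Q" "mterm a a \<alpha> \<in> carrier Q"
    using mterm_closed \<alpha> x y a by auto
   have cfQ: "cf \<alpha> \<in> carrier Q" using cf \<alpha> by (simp add: MI_def)
   have z0: "glue n v a i \<^bold>- z0 i = \<^bold>0" if "n \<le> i" "i < 2*n" for v i using gz[OF that(2), of v a] that aQ[of "i - n"] by simp
   have z1: "glue n a v i \<^bold>- z0 i = \<^bold>0" if "i < n" for v i using gz[of i a v] that aQ[of i] by simp
   show ?thesis
   proof (cases "(\<exists>i<n. \<alpha> i \<noteq> 0) \<and> (\<exists>i. n \<le> i \<and> i < 2*n \<and> \<alpha> i \<noteq> 0)")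
    case True
    then obtain i1 i2 where i: "i1 < n" "\<alpha> i1 \<noteq> 0" "n \<le> i2" "i2 < 2*n" "\<alpha> i2 \<noteq> 0" by blast
    have "mterm v a \<alpha> = \<^bold>0" if v: "v \<in> topspace (Qp_space p n)" for v
     unfolding mterm_def using monomial_zero[of "2*n" "\<lambda>i. glue n v a i \<^bold>- z0 i" i2 \<alpha>] gQ[OF v a] i z0 cfQ by simp
    moreover have "mterm a y \<alpha> = \<^bold>0"
     unfolding mterm_def using monomial_zero[of "2*n" "\<lambda>i. glue n a y i \<^bold>- z0 i" i1 \<alpha>] gQ[OF a y] i z1 cfQ by simp
    ultimately have eq: "(mterm x y \<alpha> \<^bold>- mterm x a \<alpha>) \<^bold>- (mterm a y \<alpha> \<^bold>- mterm a a \<alpha>) = mterm x y \<alpha>"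
     using x a tc(1) by (simp add: a_minus_def)
    define w where "w i = (if i < n then q ^ s' else q ^ t')" for i :: nat
    have w: "0 < w i" "w i \<le> 1" for i by (auto simp: w_def)
    have wp: "w i ^ m \<le> 1" "0 \<le> w i ^ m" for i m using w[of i] by (auto simp: power_le_one)
    have "nrm (padic_monomial p (2*n) \<alpha> (\<lambda>i. glue n x y i \<^bold>- z0 i)) = (\<Prod>i<2*n. nrm (glue n x y i \<^bold>- z0 i) ^ \<alpha> i)"
     by (rule nrm_monomial(2)) (use gQ[OF x y] in blast)
    also have "\<dots> \<le> (\<Prod>i<2*n. (q ^ k2 * w i) ^ \<alpha> i)"
    proof (intro prod_mono conjI)
     fix i assume i: "i \<in> {..<2*n}"
     have "nrm (glue n x y i \<^bold>- z0 i) \<le> q ^ k2 * w i"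
      using i xs yt gz[of i x y] by (auto simp: w_def s' t' power_add)
     thus "nrm (glue n x y i \<^bold>- z0 i) ^ \<alpha> i \<le> (q ^ k2 * w i) ^ \<alpha> i" "0 \<le> nrm (glue n x y i \<^bold>- z0 i) ^ \<alpha> i"
      using gQ[OF x y] i nrm_nonneg by (auto intro: power_mono)
    qed
    also have "\<dots> = (q ^ k2) ^ (\<Sum>i<2*n. \<alpha> i) * (\<Prod>i<2*n. w i ^ \<alpha> i)"
     by (simp add: power_mult_distrib prod.distrib power_sum)
    also have "(\<Prod>i<2*n. w i ^ \<alpha> i) \<le> q ^ s' * q ^ t'"
    proof -
     have "(\<Prod>i<2*n. w i ^ \<alpha> i) = w i1 ^ \<alpha> i1 * (w i2 ^ \<alpha> i2 * (\<Prod>i\<in>{..<2*n} - {i1} - {i2}. w i ^ \<alpha> i))"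
      using i by (subst prod.remove[of _ i1], simp, simp) (subst prod.remove[of _ i2], auto)
     also have "\<dots> \<le> w i1 ^ 1 * (w i2 ^ 1 * 1)"
      using i wp w by (intro mult_mono power_decreasing prod_le_1 mult_nonneg_nonneg prod_nonneg) (auto simp: less_imp_le)
     finally show ?thesis using i by (simp add: w_def)
    qed
    finally have mono_le: "nrm (padic_monomial p (2*n) \<alpha> (\<lambda>i. glue n x y i \<^bold>- z0 i)) \<le> (q ^ k2) ^ (\<Sum>i<2*n. \<alpha> i) * (q ^ s' * q ^ t')"
     by (simp add: mult_left_mono)
    have "nrm (mterm x y \<alpha>) * q ^ e \<le> nrm (cf \<alpha>) * ((q ^ k2) ^ (\<Sum>i<2*n. \<alpha> i) * (q ^ s' * q ^ t')) * q ^ e"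
     unfolding mterm_def using mono_le cfQ nrm_monomial(1)[of "2*n" "\<lambda>i. glue n x y i \<^bold>- z0 i" \<alpha>] gQ[OF x y] nrm_nonneg[OF cfQ]
     by (simp add: nrm_mult mult_left_mono mult_right_mono)
    also have "\<dots> = (nrm (cf \<alpha>) * (q ^ k2) ^ (\<Sum>i<2*n. \<alpha> i) * q ^ e) * (q ^ s' * q ^ t')" by (simp add: mult_ac)
    also have "\<dots> \<le> 1 * (q ^ s' * q ^ t')" using e[OF \<alpha>] by (intro mult_right_mono) auto
    also have "\<dots> = q ^ (s' + t')" by (simp add: power_add)
    also have "s' + t' = (s + t - c) + e" using st s' t' by (simp add: c_def)
    finally have "nrm (mterm x y \<alpha>) * q ^ e \<le> b * q ^ e" by (simp add: b_def power_add)
    hence "nrm (mterm x y \<alpha>) \<le> b" using q_pow_pos[of e] by (simp only: mult_le_cancel_right_pos)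
    thus ?thesis using eq by simp
   next
    case False
    then consider "\<forall>i<n. \<alpha> i = 0" | "\<forall>i. n \<le> i \<and> i < 2*n --> \<alpha> i = 0" by blast
    hence "(mterm x y \<alpha> \<^bold>- mterm x a \<alpha>) \<^bold>- (mterm a y \<alpha> \<^bold>- mterm a a \<alpha>) = \<^bold>0"
    proof cases
     case 1
     have "mterm x v \<alpha> = mterm a v \<alpha>" if v: "v \<in> topspace (Qp_space p n)" for v
      unfolding mterm_def by (rule arg_cong[where f = "\<lambda>z. cf \<alpha> \<^bold>* z"], rule monomial_cong)
       (use gQ[OF x v] gQ[OF a v] 1 gz[of _ x v] gz[of _ a v] in \<open>auto split: if_splits\<close>)
     thus ?thesis using y a tc by simp
    next
     case 2
     have "mterm v y \<alpha> = mterm v a \<alpha>" if v: "v \<in> topspace (Qp_space p n)" for v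
      unfolding mterm_def by (rule arg_cong[where f = "\<lambda>z. cf \<alpha> \<^bold>* z"], rule monomial_cong)
       (use gQ[OF v y] gQ[OF v a] 2 gz[of _ v y] gz[of _ v a] in \<open>auto split: if_splits\<close>)
     thus ?thesis using x a tc by simp
    qed
    thus ?thesis by (simp add: b_def less_imp_le)
   qed
  qed
  define fxy where "fxy = f (glue n x y)"
  define fxa where "fxa = f (glue n x a)"
  define fay where "fay = f (glue n a y)"
  define faa where "faa = f (glue n a a)"
  note l1 = limitin_finite_subsets[OF lim'[OF x x2 y y2]]
  note l2 = limitin_finite_subsets[OF lim'[OF x x2 a a2]]
  note l3 = limitin_finite_subsets[OF lim'[OF a a2 y y2]]
  note l4 = limitin_finite_subsets[OF lim'[OF a a2 a a2]]
  have fQ: "fxy \<in> carrier Q" "fxa \<in> carrier Q" "fay \<in> carrier Q" "faa \<in> carrier Q"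
   using l1(1) l2(1) l3(1) l4(1) by (simp_all add: fxy_def fxa_def fay_def faa_def)
  obtain F1 where F1: "finite F1" "F1 \<subseteq> MI" "\<forall>F. finite F \<and> F1 \<subseteq> F \<and> F \<subseteq> MI --> finsum Q (mterm x y) F \<in> carrier Q \<and> nrm (finsum Q (mterm x y) F \<^bold>- fxy) \<le> b"
   using l1(2)[of "s + t - c"] unfolding b_def fxy_def by blast
  obtain F2 where F2: "finite F2" "F2 \<subseteq> MI" "\<forall>F. finite F \<and> F2 \<subseteq> F \<and> F \<subseteq> MI --> finsum Q (mterm x a) F \<in> carrier Q \<and> nrm (finsum Q (mterm x a) F \<^bold>- fxa) \<le> b"
   using l2(2)[of "s + t - c"] unfolding b_def fxa_def by blast
  obtain F3 where F3: "finite F3" "F3 \<subseteq> MI" "\<forall>F. finite F \<and> F3 \<subseteq> F \<and> F \<subseteq> MI --> finsum Q (mterm a y) F \<in> carrier Q \<and> nrm (finsum Q (mterm a y) F \<^bold>- fay) \<le> b"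
   using l3(2)[of "s + t - c"] unfolding b_def fay_def by blast
  obtain F4 where F4: "finite F4" "F4 \<subseteq> MI" "\<forall>F. finite F \<and> F4 \<subseteq> F \<and> F \<subseteq> MI --> finsum Q (mterm a a) F \<in> carrier Q \<and> nrm (finsum Q (mterm a a) F \<^bold>- faa) \<le> b"
   using l4(2)[of "s + t - c"] unfolding b_def faa_def by blast
  define F where "F = F1 \<union> F2 \<union> F3 \<union> F4"
  have F: "finite F" "F \<subseteq> MI" using F1 F2 F3 F4 by (auto simp: F_def)
  define S1 where "S1 = finsum Q (mterm x y) F"
  define S2 where "S2 = finsum Q (mterm x a) F"
  define S3 where "S3 = finsum Q (mterm a y) F"
  define S4 where "S4 = finsum Q (mterm a a) F"
  have S: "S1 \<in> carrier Q" "nrm (S1 \<^bold>- fxy) \<le> b" "S2 \<in> carrier Q" "nrm (S2 \<^bold>- fxa) \<le> b"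
    "S3 \<in> carrier Q" "nrm (S3 \<^bold>- fay) \<le> b" "S4 \<in> carrier Q" "nrm (S4 \<^bold>- faa) \<le> b"
   using F1(3)[rule_format, of F] F2(3)[rule_format, of F] F3(3)[rule_format, of F] F4(3)[rule_format, of F] F
   by (auto simp: F_def S1_def S2_def S3_def S4_def)
  have b0: "b \<ge> 0" by (simp add: b_def less_imp_le)
  have main: "nrm ((S1 \<^bold>- S2) \<^bold>- (S3 \<^bold>- S4)) \<le> b" unfolding S1_def S2_def S3_def S4_def
   using F mixed mterm_closed x y a by (intro mixed_finsum_bound[OF F(1) b0]) auto
  have split: "u = v \<^bold>+ (u \<^bold>- v)" if "u \<in> carrier Q" "v \<in> carrier Q" for u v using that by algebra
  have cancel: "u = (u \<^bold>+ v) \<^bold>- v" if "u \<in> carrier Q" "v \<in> carrier Q" for u v using that by algebra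
  have dQ: "S1 \<^bold>- fxy \<in> carrier Q" "S2 \<^bold>- fxa \<in> carrier Q" "S3 \<^bold>- fay \<in> carrier Q" "S4 \<^bold>- faa \<in> carrier Q"
   using S fQ by auto
  have "(S1 \<^bold>- S2) \<^bold>- (S3 \<^bold>- S4) = ((fxy \<^bold>- fxa) \<^bold>- (fay \<^bold>- faa)) \<^bold>+
    (((S1 \<^bold>- fxy) \<^bold>- (S2 \<^bold>- fxa)) \<^bold>- ((S3 \<^bold>- fay) \<^bold>- (S4 \<^bold>- faa)))"
   using double_diff_add[OF fQ(1) dQ(1) fQ(2) dQ(2) fQ(3) dQ(3) fQ(4) dQ(4)]
   unfolding split[OF S(1) fQ(1), symmetric] split[OF S(3) fQ(2), symmetric] split[OF S(5) fQ(3), symmetric] split[OF S(7) fQ(4), symmetric] .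
  hence id: "(fxy \<^bold>- fxa) \<^bold>- (fay \<^bold>- faa) = ((S1 \<^bold>- S2) \<^bold>- (S3 \<^bold>- S4)) \<^bold>-
    (((S1 \<^bold>- fxy) \<^bold>- (S2 \<^bold>- fxa)) \<^bold>- ((S3 \<^bold>- fay) \<^bold>- (S4 \<^bold>- faa)))"
   using cancel[of "(fxy \<^bold>- fxa) \<^bold>- (fay \<^bold>- faa)" "((S1 \<^bold>- fxy) \<^bold>- (S2 \<^bold>- fxa)) \<^bold>- ((S3 \<^bold>- fay) \<^bold>- (S4 \<^bold>- faa))"]
    dQ fQ by simp
  have 1: "nrm ((S1 \<^bold>- fxy) \<^bold>- (S2 \<^bold>- fxa)) \<le> b" using S fQ by - (rule nrm_diff_le, auto)
  have 2: "nrm ((S3 \<^bold>- fay) \<^bold>- (S4 \<^bold>- faa)) \<le> b" using S fQ by - (rule nrm_diff_le, auto)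
  have 3: "nrm (((S1 \<^bold>- fxy) \<^bold>- (S2 \<^bold>- fxa)) \<^bold>- ((S3 \<^bold>- fay) \<^bold>- (S4 \<^bold>- faa))) \<le> b"
   using 1 2 S fQ by - (rule nrm_diff_le, auto)
  have "nrm ((fxy \<^bold>- fxa) \<^bold>- (fay \<^bold>- faa)) \<le> b" unfolding id using main 3 S fQ by - (rule nrm_diff_le, simp_all)
  thus ?thesis using fQ by (simp add: b_def fxy_def fxa_def fay_def faa_def)
 qed
 have "c \<ge> k" by (simp add: c_def k2_def)
 thus ?thesis by (intro exI[of _ c] conjI[of "c \<ge> k"] allI impI main) auto
qed

end

context padic begin

lemma Qp_space_box:
 assumes S: "openin (Qp_space p n) S" and a: "a \<in> S"
 shows "\<exists>k. \<forall>x\<in>topspace (Qp_space p n). (\<forall>i<n. nrm (x i \<^bold>- a i) \<le> q ^ k) --> x \<in> S"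
proof -
 obtain U where U: "\<And>i. i < n ==> openin (Qp_top p) (U i)" "a \<in> PiE {..<n} U" "PiE {..<n} U \<subseteq> S"
  using bspec[OF S[unfolded Qp_space_def openin_product_topology_alt] a] by (elim exE conjE) (rule that, auto)
 have "\<exists>k. \<forall>y\<in>carrier Q. nrm (y \<^bold>- a i) \<le> q ^ k --> y \<in> U i" if "i < n" for i
  using U(1)[OF that] U(2) that unfolding openin_Qp_top by (auto simp: PiE_def Pi_def)
 then obtain k where k: "\<And>i y. i < n ==> y \<in> carrier Q ==> nrm (y \<^bold>- a i) \<le> q ^ k i ==> y \<in> U i" by metis
 define K where "K = (\<Sum>i<n. k i)"
 have kK: "q ^ K \<le> q ^ k i" if "i < n" for i
  unfolding K_def using that by (intro q_pow_mono member_le_sum) auto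
 have "x \<in> S" if x: "x \<in> topspace (Qp_space p n)" "\<forall>i<n. nrm (x i \<^bold>- a i) \<le> q ^ K" for x
 proof -
  have "x \<in> PiE {..<n} U" unfolding PiE_iff
  proof (intro conjI ballI)
   fix i assume i: "i \<in> {..<n}"
   have "x i \<in> carrier Q" using x(1) i unfolding Qp_space_topspace by (rule PiE_mem)
   moreover have "nrm (x i \<^bold>- a i) \<le> q ^ k i" using x(2) kK[of i] i order.trans by blast
   ultimately show "x i \<in> U i" using k[of i "x i"] i by simp
  qed (use x in \<open>auto simp: Qp_space_topspace PiE_def\<close>)
  thus ?thesis using U(3) by blast
 qed
 thus ?thesis by blast
qed

theorem Lie_group_chart:
 fixes G :: "('g, 'y) monoid_scheme"
 assumes Lie: "padic_Lie_group p G T"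
 shows "\<exists>n W \<phi> a c k0 k1 B. additive_chart p G n W \<phi> a c k0 k1 B \<and> (\<forall>k. openin T (B k)) \<and>
  (\<forall>V. openin T V --> \<one>\<^bsub>G\<^esub> \<in> V --> (\<exists>k. B k \<subseteq> V))"
proof -
 have tg: "topological_group G T" using Lie by (simp add: padic_Lie_group_def)
 interpret G: group G using tg by (simp add: topological_group_def)
 have ts: "topspace T = carrier G" using tg by (simp add: topological_group_def)
 obtain n \<A> where atl: "padic_atlas p n T \<A>" and
  an: "\<forall>(W1, \<phi>1)\<in>\<A>. \<forall>(W2, \<phi>2)\<in>\<A>. \<forall>(W3, \<phi>3)\<in>\<A>.
      let m = (\<lambda>z. inv_into W1 \<phi>1 (vec_fst n z) \<otimes>\<^bsub>G\<^esub> inv_into W2 \<phi>2 (vec_snd n z))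
      in padic_analytic_map p (2 * n) n
        {z \<in> topspace (Qp_space p (2 * n)).
          vec_fst n z \<in> \<phi>1 ` W1 \<and> vec_snd n z \<in> \<phi>2 ` W2 \<and> m z \<in> W3}
        (\<lambda>z. \<phi>3 (m z))"
  using Lie unfolding padic_Lie_group_def by blast
 have "topspace T = (\<Union>(W, \<phi>)\<in>\<A>. W)" using atl unfolding padic_atlas_def by blast
 hence "\<one>\<^bsub>G\<^esub> \<in> (\<Union>(W, \<phi>)\<in>\<A>. W)" using ts G.one_closed by metis
 then obtain W \<phi> where W\<phi>: "(W, \<phi>) \<in> \<A>" "\<one>\<^bsub>G\<^esub> \<in> W" by auto
 have ch: "padic_chart p n T W \<phi>" using atl W\<phi> unfolding padic_atlas_def by blast
 have oW: "openin T W" and o\<phi>W: "openin (Qp_space p n) (\<phi> ` W)"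
  and hom: "homeomorphic_map (subtopology T W) (subtopology (Qp_space p n) (\<phi> ` W)) \<phi>"
  using ch by (auto simp: padic_chart_def)
 have WG: "W \<subseteq> carrier G" using oW openin_subset ts by blast
 have tsW: "topspace (subtopology T W) = W" using WG ts by auto
 have inj: "inj_on \<phi> W" using homeomorphic_imp_injective_map[OF hom] tsW by simp
 have \<phi>ts: "\<phi> ` W \<subseteq> topspace (Qp_space p n)" using o\<phi>W openin_subset by blast
 define a where "a = \<phi> \<one>\<^bsub>G\<^esub>"
 have aW: "a \<in> \<phi> ` W" using W\<phi> by (simp add: a_def)
 have ats: "a \<in> topspace (Qp_space p n)" using aW \<phi>ts by blast
 have phQ: "\<phi> g i \<in> carrier Q" if "g \<in> W" "i < n" for g i
  using \<phi>ts that unfolding Qp_space_topspace by (auto simp: PiE_def Pi_def)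
 define B where "B k = {g \<in> W. \<forall>i<n. nrm (\<phi> g i \<^bold>- a i) \<le> q ^ k}" for k
 have Bopen: "openin T (B k)" for k
 proof -
  define box where "box = PiE {..<n} (\<lambda>i. {x \<in> carrier Q. nrm (x \<^bold>- a i) \<le> q ^ k})"
  have "a i \<in> carrier Q" if "i < n" for i using phQ[OF W\<phi>(2) that] by (simp add: a_def)
  hence "openin (Qp_space p n) box" unfolding box_def Qp_space_def
   by (intro openin_PiE_gen[THEN iffD2] disjI2 conjI ballI openin_ball) auto
  hence "openin (subtopology (Qp_space p n) (\<phi> ` W)) (box \<inter> \<phi> ` W)" by (auto simp: openin_subtopology)
  hence "openin (subtopology T W) {g \<in> topspace (subtopology T W). \<phi> g \<in> box \<inter> \<phi> ` W}"
   using homeomorphic_imp_continuous_map[OF hom] unfolding continuous_map by blast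
  moreover have "{g \<in> topspace (subtopology T W). \<phi> g \<in> box \<inter> \<phi> ` W} = B k"
  proof -
   have "\<phi> g \<in> box \<longleftrightarrow> (\<forall>i<n. nrm (\<phi> g i \<^bold>- a i) \<le> q ^ k)" if "g \<in> W" for g
   proof -
    have "\<phi> g \<in> extensional {..<n}" using \<phi>ts that unfolding Qp_space_topspace by (auto simp: PiE_def)
    thus ?thesis using phQ[OF that] by (auto simp: box_def PiE_iff)
   qed
   thus ?thesis unfolding tsW B_def by auto
  qed
  ultimately have "openin (subtopology T W) (B k)" by simp
  thus ?thesis using oW openin_trans_full by blast
 qed
 have Bbase: "\<exists>k. B k \<subseteq> V" if V: "openin T V" "\<one>\<^bsub>G\<^esub> \<in> V" for V
 proof -
  have "openin (subtopology T W) (V \<inter> W)" using V by (auto simp: openin_subtopology)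
  hence "openin (subtopology (Qp_space p n) (\<phi> ` W)) (\<phi> ` (V \<inter> W))"
   using homeomorphic_imp_open_map[OF hom] unfolding open_map_def by blast
  hence "openin (Qp_space p n) (\<phi> ` (V \<inter> W))" using o\<phi>W openin_trans_full by blast
  moreover have "a \<in> \<phi> ` (V \<inter> W)" using V W\<phi> by (auto simp: a_def)
  ultimately obtain k where k: "\<forall>x\<in>topspace (Qp_space p n). (\<forall>i<n. nrm (x i \<^bold>- a i) \<le> q ^ k) --> x \<in> \<phi> ` (V \<inter> W)"
   using Qp_space_box by blast
  have "g \<in> V" if g: "g \<in> B k" for g
  proof -
   have gW: "g \<in> W" using g by (simp add: B_def)
   have "\<phi> g \<in> \<phi> ` (V \<inter> W)" using k g \<phi>ts gW by (auto simp: B_def)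
   then obtain h where "h \<in> V" "h \<in> W" "\<phi> g = \<phi> h" by blast
   thus ?thesis using inj gW by (auto dest: inj_onD)
  qed
  thus ?thesis by blast
 qed
 have Bmono: "B k \<subseteq> B j" if "j \<le> k" for j k using q_pow_mono[OF that] by (auto simp: B_def intro: order.trans)
 have one_B: "\<one>\<^bsub>G\<^esub> \<in> B k" for k using W\<phi>(2) phQ[OF W\<phi>(2)] by (auto simp: B_def a_def less_imp_le)
 obtain ka where ka: "\<forall>x\<in>topspace (Qp_space p n). (\<forall>i<n. nrm (x i \<^bold>- a i) \<le> q ^ ka) --> x \<in> \<phi> ` W"
  using Qp_space_box[OF o\<phi>W aW] by blast
 have "\<exists>k. \<forall>g\<in>B k. \<forall>h\<in>B k. g \<otimes>\<^bsub>G\<^esub> h \<in> W"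
 proof -
  have "continuous_map (prod_topology T T) T (\<lambda>(x, y). x \<otimes>\<^bsub>G\<^esub> y)" using tg by (simp add: topological_group_def)
  hence "openin (prod_topology T T) {z \<in> topspace (prod_topology T T). (\<lambda>(x, y). x \<otimes>\<^bsub>G\<^esub> y) z \<in> W}"
   using oW unfolding continuous_map by blast
  moreover have "(\<one>\<^bsub>G\<^esub>, \<one>\<^bsub>G\<^esub>) \<in> {z \<in> topspace (prod_topology T T). (\<lambda>(x, y). x \<otimes>\<^bsub>G\<^esub> y) z \<in> W}" using ts W\<phi> by simp
  ultimately obtain U1 U2 where U: "openin T U1" "openin T U2" "\<one>\<^bsub>G\<^esub> \<in> U1" "\<one>\<^bsub>G\<^esub> \<in> U2"
   "U1 \<times> U2 \<subseteq> {z \<in> topspace (prod_topology T T). (\<lambda>(x, y). x \<otimes>\<^bsub>G\<^esub> y) z \<in> W}"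
   unfolding openin_prod_topology_alt by meson
  obtain k where k: "B k \<subseteq> U1 \<inter> U2" using Bbase[of "U1 \<inter> U2"] U by blast
  have "g \<otimes>\<^bsub>G\<^esub> h \<in> W" if "g \<in> B k" "h \<in> B k" for g h
  proof -
   have "(g, h) \<in> U1 \<times> U2" using k that by blast
   thus ?thesis using U(5) by auto
  qed
  thus ?thesis by blast
 qed
 then obtain kb where kb: "\<And>g h. g \<in> B kb ==> h \<in> B kb ==> g \<otimes>\<^bsub>G\<^esub> h \<in> W" by blast
 define kD where "kD = max ka kb"
 define m where "m z = inv_into W \<phi> (vec_fst n z) \<otimes>\<^bsub>G\<^esub> inv_into W \<phi> (vec_snd n z)" for z
 define D where "D = {z \<in> topspace (Qp_space p (2 * n)). vec_fst n z \<in> \<phi> ` W \<and> vec_snd n z \<in> \<phi> ` W \<and> m z \<in> W}"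
 have fD: "padic_analytic p (2 * n) D (\<lambda>z. \<phi> (m z) i)" if "i < n" for i
  using an W\<phi>(1) that unfolding Let_def padic_analytic_map_def D_def m_def by fastforce
 have ext: "x \<in> extensional {..<n}" if "x \<in> topspace (Qp_space p n)" for x using that by (auto simp: Qp_space_topspace PiE_def)
 have m_glue: "m (glue n (\<phi> g) (\<phi> h)) = g \<otimes>\<^bsub>G\<^esub> h" if "g \<in> W" "h \<in> W" for g h
 proof -
  have "\<phi> g \<in> extensional {..<n}" "\<phi> h \<in> extensional {..<n}" using ext \<phi>ts that by blast+
  thus ?thesis unfolding m_def using that inj by (simp add: glue_vec)
 qed
 have box: "glue n x y \<in> D" if x: "x \<in> topspace (Qp_space p n)" and y: "y \<in> topspace (Qp_space p n)"
  and xs: "\<forall>i<n. nrm (x i \<^bold>- a i) \<le> q ^ kD" and ys: "\<forall>i<n. nrm (y i \<^bold>- a i) \<le> q ^ kD" for x y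
 proof -
  have qa: "q ^ kD \<le> q ^ ka" and qb: "q ^ kD \<le> q ^ kb" by (rule q_pow_mono, simp add: kD_def)+
  have xa: "\<forall>i<n. nrm (x i \<^bold>- a i) \<le> q ^ ka" "\<forall>i<n. nrm (y i \<^bold>- a i) \<le> q ^ ka" using xs ys qa by (auto intro: order.trans)
  obtain g where g: "g \<in> W" "x = \<phi> g" using ka x xa(1) by blast
  obtain h where h: "h \<in> W" "y = \<phi> h" using ka y xa(2) by blast
  have "g \<in> B kb" "h \<in> B kb" using g h xs ys qb by (auto simp: B_def intro: order.trans)
  hence "m (glue n x y) \<in> W" using kb m_glue[OF g(1) h(1)] g h by simp
  thus ?thesis unfolding D_def using glue_topspace[OF x y] glue_vec[OF ext[OF x] ext[OF y]] g h by simp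
 qed
 have "\<forall>i. \<exists>c. i < n --> kD \<le> c \<and> (\<forall>x y s t. c \<le> s --> c \<le> t --> x \<in> topspace (Qp_space p n) --> y \<in> topspace (Qp_space p n) -->
   (\<forall>i<n. nrm (x i \<^bold>- a i) \<le> q ^ s) --> (\<forall>i<n. nrm (y i \<^bold>- a i) \<le> q ^ t) -->
   \<phi> (m (glue n x y)) i \<in> carrier Q \<and>
   nrm ((\<phi> (m (glue n x y)) i \<^bold>- \<phi> (m (glue n x a)) i) \<^bold>- (\<phi> (m (glue n a y)) i \<^bold>- \<phi> (m (glue n a a)) i)) \<le> q ^ (s + t - c))"
  (is "\<forall>i. \<exists>c. i < n --> kD \<le> c \<and> ?P i c")
 proof
  fix i
  show "\<exists>c. i < n --> kD \<le> c \<and> ?P i c"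
  proof (cases "i < n")
   case True
   have "\<exists>c\<ge>kD. ?P i c" by (rule analytic_mixed[OF fD[OF True] ats box])
   then obtain c where c: "kD \<le> c \<and> ?P i c" by (elim exE) (rule that)
   show ?thesis by (rule exI[of _ c], rule impI, rule c)
  qed blast
 qed
 then obtain C where C: "\<And>i. i < n ==> kD \<le> C i \<and> ?P i (C i)" by metis
 define c where "c = kD + (\<Sum>i<n. C i)"
 have Cc: "C i \<le> c" if "i < n" for i
 proof -
  have "C i \<le> (\<Sum>i<n. C i)" using that by (intro member_le_sum) auto
  thus ?thesis by (simp add: c_def)
 qed
 define k0 where "k0 = c + 2"
 have "openin T {x \<in> topspace T. inv\<^bsub>G\<^esub> x \<in> B k0}"
 proof -
  have "continuous_map T T (\<lambda>x. inv\<^bsub>G\<^esub> x)" using tg by (simp add: topological_group_def)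
  thus ?thesis using Bopen[of k0] unfolding continuous_map by blast
 qed
 moreover have "\<one>\<^bsub>G\<^esub> \<in> {x \<in> topspace T. inv\<^bsub>G\<^esub> x \<in> B k0}" using one_B ts by simp
 ultimately obtain k1' where k1': "B k1' \<subseteq> {x \<in> topspace T. inv\<^bsub>G\<^esub> x \<in> B k0}" using Bbase by blast
 define k1 where "k1 = max k0 k1'"
 have W_prod: "g \<otimes>\<^bsub>G\<^esub> h \<in> W" if "k0 \<le> j" "k0 \<le> k" "g \<in> B j" "h \<in> B k" for g h j k
 proof -
  have "kb \<le> k0" using max.cobounded2[of kb ka] unfolding k0_def c_def kD_def by linarith
  thus ?thesis using kb[of g h] Bmono[of kb j] Bmono[of kb k] that by auto
 qed
 have "additive_chart p G n W \<phi> a c k0 k1 B"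
 proof (intro additive_chart.intro padic_axioms G.is_group additive_chart_axioms.intro)
  show "B k = {g \<in> W. \<forall>i<n. nrm (\<phi> g i \<^bold>- a i) \<le> q ^ k}" for k by (simp add: B_def)
  show "W \<subseteq> carrier G" by (rule WG)
  show "\<one>\<^bsub>G\<^esub> \<in> W" by (rule W\<phi>(2))
  show "\<phi> g i \<in> carrier Q" if "g \<in> W" "i < n" for g i using phQ that .
  show "\<phi> \<one>\<^bsub>G\<^esub> i = a i" for i by (simp add: a_def)
  show "c + 2 \<le> k0" "k0 \<le> k1" by (auto simp: k0_def k1_def)
  show "g \<otimes>\<^bsub>G\<^esub> h \<in> W" if "k0 \<le> j" "k0 \<le> k" "g \<in> B j" "h \<in> B k" for g h j k using W_prod that .
  show "inv\<^bsub>G\<^esub> g \<in> B k0" if "g \<in> B k1" for g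
  proof -
   have "B k1 \<subseteq> B k1'" by (rule Bmono) (simp add: k1_def)
   thus ?thesis using k1' that by blast
  qed
  show "nrm (\<phi> (g \<otimes>\<^bsub>G\<^esub> h) i \<^bold>- (\<phi> g i \<^bold>+ \<phi> h i \<^bold>- a i)) \<le> q ^ (j + k - c)"
   if jk: "k0 \<le> j" "k0 \<le> k" and g: "g \<in> B j" and h: "h \<in> B k" and i: "i < n" for g h i j k
  proof -
   have gW: "g \<in> W" "h \<in> W" using g h by (auto simp: B_def)
   have gt: "\<phi> g \<in> topspace (Qp_space p n)" "\<phi> h \<in> topspace (Qp_space p n)" using gW \<phi>ts by auto
   have jC: "C i \<le> j" "C i \<le> k" using jk Cc[OF i] by (auto simp: k0_def)
   have e: "m (glue n (\<phi> g) (\<phi> h)) = g \<otimes>\<^bsub>G\<^esub> h" "m (glue n (\<phi> g) a) = g" "m (glue n a (\<phi> h)) = h" "m (glue n a a) = \<one>\<^bsub>G\<^esub>"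
    using m_glue gW W\<phi>(2) WG by (auto simp: a_def)
   have "nrm ((\<phi> (g \<otimes>\<^bsub>G\<^esub> h) i \<^bold>- \<phi> g i) \<^bold>- (\<phi> h i \<^bold>- a i)) \<le> q ^ (j + k - C i)"
    using C[OF i, THEN conjunct2, rule_format, OF jC gt] g h unfolding e a_def[symmetric] by (simp add: B_def)
   also have "\<dots> \<le> q ^ (j + k - c)" using Cc[OF i] by (intro q_pow_mono) simp
   finally have 1: "nrm ((\<phi> (g \<otimes>\<^bsub>G\<^esub> h) i \<^bold>- \<phi> g i) \<^bold>- (\<phi> h i \<^bold>- a i)) \<le> q ^ (j + k - c)" .
   have id: "x \<^bold>- (y \<^bold>+ z \<^bold>- b) = (x \<^bold>- y) \<^bold>- (z \<^bold>- b)"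
    if "x \<in> carrier Q" "y \<in> carrier Q" "z \<in> carrier Q" "b \<in> carrier Q" for x y z b using that by algebra
   have "\<phi> (g \<otimes>\<^bsub>G\<^esub> h) i \<in> carrier Q" using phQ[OF W_prod[OF jk g h] i] .
   thus ?thesis using 1 id phQ gW i phQ[OF W\<phi>(2) i] by (simp add: a_def)
  qed
 qed
 note chart = this
 show ?thesis
  by (rule exI[of _ n], rule exI[of _ W], rule exI[of _ \<phi>], rule exI[of _ a], rule exI[of _ c],
    rule exI[of _ k0], rule exI[of _ k1], rule exI[of _ B], intro conjI allI impI chart Bopen Bbase)
qed

end

section \<open>Compact topological groups\<close>

lemma open_rcoset:
 assumes tg: "topological_group G T" and U: "openin T U" and g: "g \<in> carrier G"
 shows "openin T (U #>\<^bsub>G\<^esub> g)" "openin T (g <#\<^bsub>G\<^esub> U)"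
proof -
 interpret G: group G using tg by (simp add: topological_group_def)
 have ts: "topspace T = carrier G" using tg by (simp add: topological_group_def)
 have UG: "U \<subseteq> carrier G" using U openin_subset ts by blast
 have cm: "continuous_map (prod_topology T T) T (\<lambda>(x, y). x \<otimes>\<^bsub>G\<^esub> y)" using tg by (simp add: topological_group_def)
 have ig: "inv\<^bsub>G\<^esub> g \<in> carrier G" using g by simp
 have "continuous_map T T (\<lambda>x. x \<otimes>\<^bsub>G\<^esub> inv\<^bsub>G\<^esub> g)"
  using continuous_map_compose[OF _ cm, of T "\<lambda>x. (x, inv\<^bsub>G\<^esub> g)"] ig ts by (simp add: o_def continuous_map_pairwise)
 hence "openin T {x \<in> topspace T. x \<otimes>\<^bsub>G\<^esub> inv\<^bsub>G\<^esub> g \<in> U}" using U unfolding continuous_map by blast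
 moreover have "{x \<in> topspace T. x \<otimes>\<^bsub>G\<^esub> inv\<^bsub>G\<^esub> g \<in> U} = U #>\<^bsub>G\<^esub> g"
 proof (rule Set.set_eqI, rule iffI)
  fix x assume "x \<in> {x \<in> topspace T. x \<otimes>\<^bsub>G\<^esub> inv\<^bsub>G\<^esub> g \<in> U}"
  hence "x \<in> carrier G" "x \<otimes>\<^bsub>G\<^esub> inv\<^bsub>G\<^esub> g \<in> U" using ts by auto
  moreover have "x = (x \<otimes>\<^bsub>G\<^esub> inv\<^bsub>G\<^esub> g) \<otimes>\<^bsub>G\<^esub> g" using calculation(1) g by (simp add: G.m_assoc)
  ultimately show "x \<in> U #>\<^bsub>G\<^esub> g" unfolding r_coset_def by blast
 next
  fix x assume "x \<in> U #>\<^bsub>G\<^esub> g"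
  then obtain u where "u \<in> U" "x = u \<otimes>\<^bsub>G\<^esub> g" unfolding r_coset_def by blast
  thus "x \<in> {x \<in> topspace T. x \<otimes>\<^bsub>G\<^esub> inv\<^bsub>G\<^esub> g \<in> U}" using UG g ts by (auto simp: G.m_assoc)
 qed
 ultimately show "openin T (U #>\<^bsub>G\<^esub> g)" by simp
 have "continuous_map T T (\<lambda>x. inv\<^bsub>G\<^esub> g \<otimes>\<^bsub>G\<^esub> x)"
  using continuous_map_compose[OF _ cm, of T "\<lambda>x. (inv\<^bsub>G\<^esub> g, x)"] ig ts by (simp add: o_def continuous_map_pairwise)
 hence "openin T {x \<in> topspace T. inv\<^bsub>G\<^esub> g \<otimes>\<^bsub>G\<^esub> x \<in> U}" using U unfolding continuous_map by blast
 moreover have "{x \<in> topspace T. inv\<^bsub>G\<^esub> g \<otimes>\<^bsub>G\<^esub> x \<in> U} = g <#\<^bsub>G\<^esub> U"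
 proof (rule Set.set_eqI, rule iffI)
  fix x assume "x \<in> {x \<in> topspace T. inv\<^bsub>G\<^esub> g \<otimes>\<^bsub>G\<^esub> x \<in> U}"
  hence "x \<in> carrier G" "inv\<^bsub>G\<^esub> g \<otimes>\<^bsub>G\<^esub> x \<in> U" using ts by auto
  moreover have "x = g \<otimes>\<^bsub>G\<^esub> (inv\<^bsub>G\<^esub> g \<otimes>\<^bsub>G\<^esub> x)" using calculation(1) g by (simp add: G.m_assoc[symmetric])
  ultimately show "x \<in> g <#\<^bsub>G\<^esub> U" unfolding l_coset_def by blast
 next
  fix x assume "x \<in> g <#\<^bsub>G\<^esub> U"
  then obtain u where "u \<in> U" "x = g \<otimes>\<^bsub>G\<^esub> u" unfolding l_coset_def by blast
  thus "x \<in> {x \<in> topspace T. inv\<^bsub>G\<^esub> g \<otimes>\<^bsub>G\<^esub> x \<in> U}" using UG g ts by (auto simp: G.m_assoc[symmetric])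
 qed
 ultimately show "openin T (g <#\<^bsub>G\<^esub> U)" by simp
qed

lemma open_subgroup_finite_index:
 assumes tg: "topological_group G T" and cpt: "compact_space T" and U: "openin T U" "subgroup U G"
 shows "finite (rcosets\<^bsub>G\<^esub> U)"
proof -
 interpret G: group G using tg by (simp add: topological_group_def)
 have ts: "topspace T = carrier G" using tg by (simp add: topological_group_def)
 have part: "\<Union>(rcosets\<^bsub>G\<^esub> U) = carrier G" using G.rcosets_part_G[OF U(2)] .
 have op: "\<forall>C\<in>rcosets\<^bsub>G\<^esub> U. openin T C" using open_rcoset(1)[OF tg U(1)] by (auto simp: RCOSETS_def)
 have "carrier G \<subseteq> \<Union>(rcosets\<^bsub>G\<^esub> U)" using part by simp
 then obtain F where F: "finite F" "F \<subseteq> rcosets\<^bsub>G\<^esub> U" "carrier G \<subseteq> \<Union>F"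
  using cpt op unfolding compact_space_alt ts by metis
 have "rcosets\<^bsub>G\<^esub> U \<subseteq> F"
 proof
  fix C assume C: "C \<in> rcosets\<^bsub>G\<^esub> U"
  then obtain x where x: "x \<in> carrier G" "C = U #>\<^bsub>G\<^esub> x" by (auto simp: RCOSETS_def)
  have xC: "x \<in> C" using x G.rcos_self[OF x(1) U(2)] by simp
  obtain C' where C': "C' \<in> F" "x \<in> C'" using F(3) x by blast
  have "C = C'"
  proof (rule ccontr)
   assume "C \<noteq> C'"
   hence "C \<inter> C' = {}" using G.rcos_disjoint[OF U(2)] C C' F(2) by (auto simp: pairwise_def disjnt_def)
   thus False using xC C' by blast
  qed
  thus "C \<in> F" using C' by simp
 qed
 thus ?thesis using F(1) finite_subset by blast
qed

lemma open_subgroup_contains_normal: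
 assumes tg: "topological_group G T" and cpt: "compact_space T" and U: "openin T U" "subgroup U G"
 shows "\<exists>N\<in>open_normal G T. N \<subseteq> U"
proof -
 interpret G: group G using tg by (simp add: topological_group_def)
 have ts: "topspace T = carrier G" using tg by (simp add: topological_group_def)
 define cj where "cj C = {x \<in> carrier G. \<forall>c\<in>C. c \<otimes>\<^bsub>G\<^esub> x \<otimes>\<^bsub>G\<^esub> inv\<^bsub>G\<^esub> c \<in> U}" for C
 have UG: "U \<subseteq> carrier G" using subgroup.subset[OF U(2)] .
 have cj_coset: "cj (U #>\<^bsub>G\<^esub> g) = inv\<^bsub>G\<^esub> g <#\<^bsub>G\<^esub> (U #>\<^bsub>G\<^esub> g)" if g: "g \<in> carrier G" for g
 proof (rule Set.set_eqI, rule iffI)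
  fix x assume x: "x \<in> cj (U #>\<^bsub>G\<^esub> g)"
  hence xG: "x \<in> carrier G" by (simp add: cj_def)
  have "g \<in> U #>\<^bsub>G\<^esub> g" using G.rcos_self[OF g U(2)] .
  hence u: "g \<otimes>\<^bsub>G\<^esub> x \<otimes>\<^bsub>G\<^esub> inv\<^bsub>G\<^esub> g \<in> U" using x by (simp add: cj_def)
  have "x = inv\<^bsub>G\<^esub> g \<otimes>\<^bsub>G\<^esub> ((g \<otimes>\<^bsub>G\<^esub> x \<otimes>\<^bsub>G\<^esub> inv\<^bsub>G\<^esub> g) \<otimes>\<^bsub>G\<^esub> g)"
   using g xG by (simp add: G.m_assoc) (simp add: G.m_assoc[symmetric])
  thus "x \<in> inv\<^bsub>G\<^esub> g <#\<^bsub>G\<^esub> (U #>\<^bsub>G\<^esub> g)" using u unfolding l_coset_def r_coset_def by blast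
 next
  fix x assume "x \<in> inv\<^bsub>G\<^esub> g <#\<^bsub>G\<^esub> (U #>\<^bsub>G\<^esub> g)"
  then obtain u where u: "u \<in> U" "x = inv\<^bsub>G\<^esub> g \<otimes>\<^bsub>G\<^esub> (u \<otimes>\<^bsub>G\<^esub> g)" unfolding l_coset_def r_coset_def by blast
  have uG: "u \<in> carrier G" using u UG by blast
  have "c \<otimes>\<^bsub>G\<^esub> x \<otimes>\<^bsub>G\<^esub> inv\<^bsub>G\<^esub> c \<in> U" if c: "c \<in> U #>\<^bsub>G\<^esub> g" for c
  proof -
   obtain v where v: "v \<in> U" "c = v \<otimes>\<^bsub>G\<^esub> g" using c unfolding r_coset_def by blast
   have vG: "v \<in> carrier G" using v UG by blast
   have gg: "g \<otimes>\<^bsub>G\<^esub> (inv\<^bsub>G\<^esub> g \<otimes>\<^bsub>G\<^esub> z) = z" "g \<otimes>\<^bsub>G\<^esub> (inv\<^bsub>G\<^esub> g \<otimes>\<^bsub>G\<^esub> z) = z" if "z \<in> carrier G" for z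
    using that g by (simp_all add: G.m_assoc[symmetric])
   have "c \<otimes>\<^bsub>G\<^esub> x \<otimes>\<^bsub>G\<^esub> inv\<^bsub>G\<^esub> c = v \<otimes>\<^bsub>G\<^esub> u \<otimes>\<^bsub>G\<^esub> inv\<^bsub>G\<^esub> v"
    unfolding u(2) v(2) using g uG vG gg by (simp add: G.m_assoc G.inv_mult_group)
   thus ?thesis using u v U(2) by (simp add: subgroup.m_closed subgroup.m_inv_closed)
  qed
  thus "x \<in> cj (U #>\<^bsub>G\<^esub> g)" using u uG g by (simp add: cj_def)
 qed
 define N where "N = (\<Inter>C\<in>rcosets\<^bsub>G\<^esub> U. cj C)"
 have ne: "rcosets\<^bsub>G\<^esub> U \<noteq> {}" using G.rcosetsI[OF UG G.one_closed] by blast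
 have "openin T (cj C)" if "C \<in> rcosets\<^bsub>G\<^esub> U" for C
  using that cj_coset open_rcoset(2)[OF tg open_rcoset(1)[OF tg U(1)]] by (auto simp: RCOSETS_def)
 hence oN: "openin T N" unfolding N_def using open_subgroup_finite_index[OF tg cpt U] ne by (intro openin_INT2) auto
 have Niff: "x \<in> N \<longleftrightarrow> x \<in> carrier G \<and> (\<forall>c\<in>carrier G. c \<otimes>\<^bsub>G\<^esub> x \<otimes>\<^bsub>G\<^esub> inv\<^bsub>G\<^esub> c \<in> U)" for x
  unfolding N_def cj_def G.rcosets_part_G[OF U(2), symmetric] using ne by blast
 have "x \<in> U" if "x \<in> N" for x using Niff[of x] that by (auto dest!: bspec[of _ _ "\<one>\<^bsub>G\<^esub>"])
 hence NU: "N \<subseteq> U" by blast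
 have "N \<lhd> G" unfolding G.normal_inv_iff
 proof (intro conjI ballI)
  show "subgroup N G"
  proof
   show "N \<subseteq> carrier G" using Niff by blast
   show "\<one>\<^bsub>G\<^esub> \<in> N" using Niff subgroup.one_closed[OF U(2)] by simp
  next
   fix x y assume xy: "x \<in> N" "y \<in> N"
   hence c: "x \<in> carrier G" "y \<in> carrier G" using Niff by auto
   have "c \<otimes>\<^bsub>G\<^esub> (x \<otimes>\<^bsub>G\<^esub> y) \<otimes>\<^bsub>G\<^esub> inv\<^bsub>G\<^esub> c \<in> U" if cG: "c \<in> carrier G" for c
   proof -
    have "inv\<^bsub>G\<^esub> c \<otimes>\<^bsub>G\<^esub> (c \<otimes>\<^bsub>G\<^esub> z) = z" if "z \<in> carrier G" for z using that cG by (simp add: G.m_assoc[symmetric])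
    hence "(c \<otimes>\<^bsub>G\<^esub> x \<otimes>\<^bsub>G\<^esub> inv\<^bsub>G\<^esub> c) \<otimes>\<^bsub>G\<^esub> (c \<otimes>\<^bsub>G\<^esub> y \<otimes>\<^bsub>G\<^esub> inv\<^bsub>G\<^esub> c) = c \<otimes>\<^bsub>G\<^esub> (x \<otimes>\<^bsub>G\<^esub> y) \<otimes>\<^bsub>G\<^esub> inv\<^bsub>G\<^esub> c"
     using c cG by (simp add: G.m_assoc)
    thus ?thesis using xy Niff cG subgroup.m_closed[OF U(2)] by metis
   qed
   thus "x \<otimes>\<^bsub>G\<^esub> y \<in> N" using c Niff by simp
  next
   fix x assume x: "x \<in> N"
   hence xG: "x \<in> carrier G" using Niff by auto
   have "c \<otimes>\<^bsub>G\<^esub> inv\<^bsub>G\<^esub> x \<otimes>\<^bsub>G\<^esub> inv\<^bsub>G\<^esub> c \<in> U" if cG: "c \<in> carrier G" for c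
   proof -
    have "inv\<^bsub>G\<^esub> (c \<otimes>\<^bsub>G\<^esub> x \<otimes>\<^bsub>G\<^esub> inv\<^bsub>G\<^esub> c) = c \<otimes>\<^bsub>G\<^esub> inv\<^bsub>G\<^esub> x \<otimes>\<^bsub>G\<^esub> inv\<^bsub>G\<^esub> c"
     using xG cG by (simp add: G.inv_mult_group G.m_assoc)
    thus ?thesis using x Niff cG subgroup.m_inv_closed[OF U(2)] by metis
   qed
   thus "inv\<^bsub>G\<^esub> x \<in> N" using xG Niff by simp
  qed
  fix g x assume gx: "g \<in> carrier G" "x \<in> N"
  hence xG: "x \<in> carrier G" using Niff by auto
  have "c \<otimes>\<^bsub>G\<^esub> (g \<otimes>\<^bsub>G\<^esub> x \<otimes>\<^bsub>G\<^esub> inv\<^bsub>G\<^esub> g) \<otimes>\<^bsub>G\<^esub> inv\<^bsub>G\<^esub> c \<in> U" if cG: "c \<in> carrier G" for c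
  proof -
   have "c \<otimes>\<^bsub>G\<^esub> (g \<otimes>\<^bsub>G\<^esub> x \<otimes>\<^bsub>G\<^esub> inv\<^bsub>G\<^esub> g) \<otimes>\<^bsub>G\<^esub> inv\<^bsub>G\<^esub> c = (c \<otimes>\<^bsub>G\<^esub> g) \<otimes>\<^bsub>G\<^esub> x \<otimes>\<^bsub>G\<^esub> inv\<^bsub>G\<^esub> (c \<otimes>\<^bsub>G\<^esub> g)"
    using gx xG cG by (simp add: G.inv_mult_group G.m_assoc)
   thus ?thesis using gx Niff cG by (metis G.m_closed)
  qed
  thus "g \<otimes>\<^bsub>G\<^esub> x \<otimes>\<^bsub>G\<^esub> inv\<^bsub>G\<^esub> g \<in> N" using gx xG Niff by simp
 qed
 thus ?thesis using oN NU by (auto simp: open_normal_def)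
qed

section \<open>Iwasawa algebras\<close>

locale iwasawa = cring R + G: group G for R (structure) and G (structure) and T +
 assumes tg: "topological_group G T" and cpt: "compact_space T" and R_nontrivial: "\<one> \<noteq> \<zero>"
begin

abbreviation \<U> where "\<U> \<equiv> open_normal G T"
abbreviation \<Lambda> where "\<Lambda> \<equiv> Iwasawa_algebra R G T"

abbreviation G_mult (infixl "\<cdot>" 70) where "g \<cdot> h \<equiv> g \<otimes>\<^bsub>G\<^esub> h"
abbreviation G_coset (infixl "#>\<^sub>G" 60) where "U #>\<^sub>G g \<equiv> U #>\<^bsub>G\<^esub> g"
abbreviation G_inv ("inv\<^sub>G _" [81] 80) where "inv\<^sub>G g \<equiv> inv\<^bsub>G\<^esub> g"
abbreviation L_plus (infixl "\<oplus>\<^sub>\<Lambda>" 65) where "k \<oplus>\<^sub>\<Lambda> l \<equiv> k \<oplus>\<^bsub>\<Lambda>\<^esub> l"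
abbreviation L_minus (infixl "\<ominus>\<^sub>\<Lambda>" 65) where "k \<ominus>\<^sub>\<Lambda> l \<equiv> k \<ominus>\<^bsub>\<Lambda>\<^esub> l"
abbreviation L_zero' ("\<zero>\<^sub>\<Lambda>") where "\<zero>\<^sub>\<Lambda> \<equiv> \<zero>\<^bsub>\<Lambda>\<^esub>"

lemma U_normal: "U \<in> \<U> ==> U \<lhd> G" by (simp add: open_normal_def)
lemma U_subgroup: "U \<in> \<U> ==> subgroup U G" using U_normal normal_imp_subgroup by blast
lemma U_sub: "U \<in> \<U> ==> U \<subseteq> carrier G" using U_subgroup subgroup.subset by blast

lemma Mod_carrier: "carrier (G Mod U) = rcosets\<^bsub>G\<^esub> U" by (simp add: FactGroup_def)
lemma coset_in [simp]: "U \<in> \<U> ==> g \<in> carrier G ==> U #>\<^sub>G g \<in> carrier (G Mod U)"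
 unfolding Mod_carrier using U_sub by (intro G.rcosetsI)
lemma coset_ex: "A \<in> carrier (G Mod U) ==> \<exists>g\<in>carrier G. A = U #>\<^sub>G g"
 unfolding Mod_carrier by (auto simp: RCOSETS_def)
lemma Mod_finite: "U \<in> \<U> ==> finite (carrier (G Mod U))"
 unfolding Mod_carrier using open_subgroup_finite_index[OF tg cpt _ U_subgroup] by (simp add: open_normal_def)
lemma coset_mult: "[|U \<in> \<U>; g \<in> carrier G; h \<in> carrier G|] ==> (U #>\<^sub>G g) \<otimes>\<^bsub>G Mod U\<^esub> (U #>\<^sub>G h) = U #>\<^sub>G (g \<cdot> h)"
 using normal.rcos_sum[OF U_normal] by (simp add: FactGroup_def)
lemma coset_inv: "[|U \<in> \<U>; g \<in> carrier G|] ==> inv\<^bsub>G Mod U\<^esub> (U #>\<^sub>G g) = U #>\<^sub>G inv\<^sub>G g"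
 using normal.inv_FactGroup[OF U_normal coset_in] normal.rcos_inv[OF U_normal] by simp
lemma coset_smult: "[|U \<in> \<U>; g \<in> carrier G; h \<in> carrier G|] ==> (U #>\<^sub>G g) <#>\<^bsub>G\<^esub> (U #>\<^sub>G h) = U #>\<^sub>G (g \<cdot> h)"
 using normal.rcos_sum[OF U_normal] by simp
lemma coset_one [simp]: "U \<in> \<U> ==> U #>\<^sub>G \<one>\<^bsub>G\<^esub> = U"
 using U_sub by (simp add: G.coset_mult_one)

lemma coset_eq_iff:
 assumes "U \<in> \<U>" "g \<in> carrier G" "h \<in> carrier G" shows "U #>\<^sub>G g = U #>\<^sub>G h \<longleftrightarrow> g \<cdot> inv\<^sub>G h \<in> U"
proof
 assume e: "U #>\<^sub>G g = U #>\<^sub>G h"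
 have "g \<in> U #>\<^sub>G h" using G.rcos_self[OF assms(2) U_subgroup[OF assms(1)]] e by simp
 then obtain u where u: "u \<in> U" "g = u \<cdot> h" unfolding r_coset_def by blast
 have "u \<in> carrier G" using u U_sub assms(1) by blast
 hence "g \<cdot> inv\<^sub>G h = u" using u assms by (simp add: G.m_assoc)
 thus "g \<cdot> inv\<^sub>G h \<in> U" using u by simp
next
 assume u: "g \<cdot> inv\<^sub>G h \<in> U"
 have "g = (g \<cdot> inv\<^sub>G h) \<cdot> h" using assms by (simp add: G.m_assoc)
 hence "g \<in> U #>\<^sub>G h" using u unfolding r_coset_def by blast
 thus "U #>\<^sub>G g = U #>\<^sub>G h" using G.repr_independence[OF _ assms(3) U_subgroup[OF assms(1)]] by simp
qed

lemma coset_mem_eq: "[|U \<in> \<U>; g \<in> carrier G; h \<in> U #>\<^sub>G g|] ==> U #>\<^sub>G g = U #>\<^sub>G h"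
 using G.repr_independence U_subgroup by blast

lemma coset_set_mult:
 assumes "U \<in> \<U>" "V \<in> \<U>" "U \<subseteq> V" "g \<in> carrier G" shows "(U #>\<^sub>G g) <#>\<^bsub>G\<^esub> V = V #>\<^sub>G g"
proof -
 interpret V: normal V G using U_normal assms(2) .
 have "(U #>\<^sub>G g) <#>\<^bsub>G\<^esub> V = U <#>\<^bsub>G\<^esub> (g <#\<^bsub>G\<^esub> V)" using U_sub[OF assms(1)] V.subset assms(4) G.rcos_assoc_lcos by simp
 also have "g <#\<^bsub>G\<^esub> V = V #>\<^sub>G g" using V.coset_eq assms(4) by simp
 also have "U <#>\<^bsub>G\<^esub> (V #>\<^sub>G g) = (U <#>\<^bsub>G\<^esub> V) #>\<^sub>G g" using U_sub[OF assms(1)] V.subset assms(4) by (simp add: G.setmult_rcos_assoc)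
 also have "U <#>\<^bsub>G\<^esub> V = V"
 proof
  show "U <#>\<^bsub>G\<^esub> V \<subseteq> V" using assms(3) V.m_closed by (auto simp: set_mult_def)
  have "\<one>\<^bsub>G\<^esub> \<in> U" using subgroup.one_closed[OF U_subgroup[OF assms(1)]] .
  thus "V \<subseteq> U <#>\<^bsub>G\<^esub> V" using V.subset unfolding set_mult_def by force
 qed
 finally show ?thesis .
qed

definition fib :: "'c set => 'c set => 'c => 'c set set" where
 "fib U V g = {A \<in> carrier (G Mod U). A <#>\<^bsub>G\<^esub> V = V #>\<^sub>G g}"

lemma fib_finite: "U \<in> \<U> ==> finite (fib U V g)" using Mod_finite by (simp add: fib_def)

lemma fib_ex: assumes "U \<in> \<U>" "V \<in> \<U>" "U \<subseteq> V" "A \<in> fib U V g" shows "\<exists>h\<in>carrier G. A = U #>\<^sub>G h \<and> V #>\<^sub>G h = V #>\<^sub>G g"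
 using assms coset_ex[of A U] coset_set_mult[OF assms(1-3)] by (auto simp: fib_def)

lemma fib_iff: "[|U \<in> \<U>; V \<in> \<U>; U \<subseteq> V; h \<in> carrier G|] ==> U #>\<^sub>G h \<in> fib U V g \<longleftrightarrow> V #>\<^sub>G h = V #>\<^sub>G g"
 by (simp add: fib_def coset_set_mult)

lemma map_fib:
 assumes "U \<in> \<U>" "f \<in> carrier (G Mod U) \<rightarrow> carrier R"
 shows "group_ring_map R (G Mod U) (\<lambda>A. A <#>\<^bsub>G\<^esub> V) f (V #>\<^sub>G g) = (\<Oplus>A\<in>fib U V g. f A)"
 unfolding group_ring_map_def
proof (rule add.finprod_mono_neutral_cong_left)
 show "finite (fib U V g)" using fib_finite assms by blast
qed (use assms in \<open>auto simp: fib_def\<close>)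

lemma Lambda_iff:
 "l \<in> carrier \<Lambda> \<longleftrightarrow> l \<in> extensional \<U> \<and>
  (\<forall>U\<in>\<U>. (\<forall>g\<in>carrier G. l U (U #>\<^sub>G g) \<in> carrier R) \<and> (\<forall>A. A \<notin> carrier (G Mod U) --> l U A = \<zero>)) \<and>
  (\<forall>U\<in>\<U>. \<forall>V\<in>\<U>. U \<subseteq> V --> (\<forall>g\<in>carrier G. (\<Oplus>A\<in>fib U V g. l U A) = l V (V #>\<^sub>G g)))"
proof -
 have GR: "f \<in> carrier (group_ring R (G Mod U)) \<longleftrightarrow> (\<forall>g\<in>carrier G. f (U #>\<^sub>G g) \<in> carrier R) \<and> (\<forall>A. A \<notin> carrier (G Mod U) --> f A = \<zero>)"
  if "U \<in> \<U>" for f U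
 proof
  assume "f \<in> carrier (group_ring R (G Mod U))"
  thus "(\<forall>g\<in>carrier G. f (U #>\<^sub>G g) \<in> carrier R) \<and> (\<forall>A. A \<notin> carrier (G Mod U) --> f A = \<zero>)"
   using coset_in[OF that] by (auto simp: group_ring_def)
 next
  assume f: "(\<forall>g\<in>carrier G. f (U #>\<^sub>G g) \<in> carrier R) \<and> (\<forall>A. A \<notin> carrier (G Mod U) --> f A = \<zero>)"
  have "{A. f A \<noteq> \<zero>} \<subseteq> carrier (G Mod U)" using f by blast
  hence "finite {A. f A \<noteq> \<zero>}" using Mod_finite[OF that] finite_subset by blast
  moreover have "\<forall>A\<in>carrier (G Mod U). f A \<in> carrier R" using f coset_ex by metis
  ultimately show "f \<in> carrier (group_ring R (G Mod U))" using f by (simp add: group_ring_def)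
 qed
 have cp: "(group_ring_map R (G Mod U) (\<lambda>A. A <#>\<^bsub>G\<^esub> V) f = f') \<longleftrightarrow> (\<forall>g\<in>carrier G. (\<Oplus>A\<in>fib U V g. f A) = f' (V #>\<^sub>G g))"
  if U: "U \<in> \<U>" "V \<in> \<U>" "U \<subseteq> V" and f: "f \<in> carrier (group_ring R (G Mod U))" "f' \<in> carrier (group_ring R (G Mod V))" for U V f f'
 proof -
  have fc: "f \<in> carrier (G Mod U) \<rightarrow> carrier R" using f(1) by (auto simp: group_ring_def)
  have out: "group_ring_map R (G Mod U) (\<lambda>A. A <#>\<^bsub>G\<^esub> V) f A = \<zero>" if A: "A \<notin> carrier (G Mod V)" for A
  proof -
   have "{x \<in> carrier (G Mod U). f x \<noteq> \<zero> \<and> x <#>\<^bsub>G\<^esub> V = A} = {}"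
    using coset_ex[of _ U] coset_set_mult[OF U] coset_in[OF U(2)] A by fastforce
   thus ?thesis unfolding group_ring_map_def by (simp only: finsum_empty)
  qed
  show ?thesis
  proof
   assume "group_ring_map R (G Mod U) (\<lambda>A. A <#>\<^bsub>G\<^esub> V) f = f'"
   thus "\<forall>g\<in>carrier G. (\<Oplus>A\<in>fib U V g. f A) = f' (V #>\<^sub>G g)" using map_fib[OF U(1) fc] by metis
  next
   assume e: "\<forall>g\<in>carrier G. (\<Oplus>A\<in>fib U V g. f A) = f' (V #>\<^sub>G g)"
   show "group_ring_map R (G Mod U) (\<lambda>A. A <#>\<^bsub>G\<^esub> V) f = f'"
   proof
    fix A show "group_ring_map R (G Mod U) (\<lambda>A. A <#>\<^bsub>G\<^esub> V) f A = f' A"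
    proof (cases "A \<in> carrier (G Mod V)")
     case True
     then obtain g where "g \<in> carrier G" "A = V #>\<^sub>G g" using coset_ex by blast
     thus ?thesis using e map_fib[OF U(1) fc] by simp
    next
     case False thus ?thesis using out f(2) by (simp add: group_ring_def)
    qed
   qed
  qed
 qed
 show ?thesis
 proof
  assume l: "l \<in> carrier \<Lambda>"
  hence lG: "\<And>U. U \<in> \<U> ==> l U \<in> carrier (group_ring R (G Mod U))" and le: "l \<in> extensional \<U>"
   and lc: "\<And>U V. [|U \<in> \<U>; V \<in> \<U>; U \<subseteq> V|] ==> group_ring_map R (G Mod U) (\<lambda>A. A <#>\<^bsub>G\<^esub> V) (l U) = l V"
   by (auto simp: Iwasawa_algebra_def PiE_def Pi_def)
  show "l \<in> extensional \<U> \<and>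
  (\<forall>U\<in>\<U>. (\<forall>g\<in>carrier G. l U (U #>\<^sub>G g) \<in> carrier R) \<and> (\<forall>A. A \<notin> carrier (G Mod U) --> l U A = \<zero>)) \<and>
  (\<forall>U\<in>\<U>. \<forall>V\<in>\<U>. U \<subseteq> V --> (\<forall>g\<in>carrier G. (\<Oplus>A\<in>fib U V g. l U A) = l V (V #>\<^sub>G g)))"
  proof -
   have a: "(\<forall>g\<in>carrier G. l U (U #>\<^sub>G g) \<in> carrier R) \<and> (\<forall>A. A \<notin> carrier (G Mod U) --> l U A = \<zero>)" if "U \<in> \<U>" for U
    using GR[OF that] lG[OF that] by blast
   have b: "\<forall>g\<in>carrier G. (\<Oplus>A\<in>fib U V g. l U A) = l V (V #>\<^sub>G g)" if "U \<in> \<U>" "V \<in> \<U>" "U \<subseteq> V" for U V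
    using cp[OF that lG[OF that(1)] lG[OF that(2)]] lc[OF that] by blast
   show ?thesis using le a b by blast
  qed
 next
  assume r: "l \<in> extensional \<U> \<and>
  (\<forall>U\<in>\<U>. (\<forall>g\<in>carrier G. l U (U #>\<^sub>G g) \<in> carrier R) \<and> (\<forall>A. A \<notin> carrier (G Mod U) --> l U A = \<zero>)) \<and>
  (\<forall>U\<in>\<U>. \<forall>V\<in>\<U>. U \<subseteq> V --> (\<forall>g\<in>carrier G. (\<Oplus>A\<in>fib U V g. l U A) = l V (V #>\<^sub>G g)))"
  hence lG: "\<And>U. U \<in> \<U> ==> l U \<in> carrier (group_ring R (G Mod U))" using GR by blast
  have "group_ring_map R (G Mod U) (\<lambda>A. A <#>\<^bsub>G\<^esub> V) (l U) = l V" if "U \<in> \<U>" "V \<in> \<U>" "U \<subseteq> V" for U V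
   using cp[OF that lG[OF that(1)] lG[OF that(2)]] r that by blast
  thus "l \<in> carrier \<Lambda>" using r lG by (simp add: Iwasawa_algebra_def PiE_def Pi_def)
 qed
qed

lemma L_closed [simp]: "[|l \<in> carrier \<Lambda>; U \<in> \<U>; g \<in> carrier G|] ==> l U (U #>\<^sub>G g) \<in> carrier R"
 and L_zero: "[|l \<in> carrier \<Lambda>; U \<in> \<U>; A \<notin> carrier (G Mod U)|] ==> l U A = \<zero>"
 and L_compat: "[|l \<in> carrier \<Lambda>; U \<in> \<U>; V \<in> \<U>; U \<subseteq> V; g \<in> carrier G|] ==> (\<Oplus>A\<in>fib U V g. l U A) = l V (V #>\<^sub>G g)"
 and L_ext: "l \<in> carrier \<Lambda> ==> l \<in> extensional \<U>"
 unfolding Lambda_iff by blast+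

lemma L_closed': "[|l \<in> carrier \<Lambda>; U \<in> \<U>|] ==> l U A \<in> carrier R"
 using coset_ex[of A U] L_closed[of l U] L_zero[of l U A] by (cases "A \<in> carrier (G Mod U)") auto

lemma L_eqI:
 assumes "l \<in> carrier \<Lambda>" "k \<in> carrier \<Lambda>" "\<And>U g. [|U \<in> \<U>; g \<in> carrier G|] ==> l U (U #>\<^sub>G g) = k U (U #>\<^sub>G g)"
 shows "l = k"
proof (rule extensionalityI[OF L_ext[OF assms(1)] L_ext[OF assms(2)]])
 fix U assume U: "U \<in> \<U>"
 show "l U = k U"
 proof
  fix A show "l U A = k U A"
   using coset_ex[of A U] assms(3)[OF U] L_zero[OF assms(1) U, of A] L_zero[OF assms(2) U, of A] by (cases "A \<in> carrier (G Mod U)") auto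
 qed
qed

lemma ops [simp]:
 "U \<in> \<U> ==> (k \<oplus>\<^sub>\<Lambda> l) U A = k U A \<oplus> l U A" "U \<in> \<U> ==> \<zero>\<^sub>\<Lambda> U A = \<zero>"
 by (simp_all add: Iwasawa_algebra_def group_ring_def)

text \<open>\<open>dl c g\<close> is the element \<open>c g\<close> of the Iwasawa algebra and \<open>act c g\<close> the multiplication by it from the left.\<close>

definition act :: "'a => 'c => ('c set => 'c set => 'a) => 'c set => 'c set => 'a" where
 "act c g l = (\<lambda>U\<in>\<U>. \<lambda>A. if A \<in> carrier (G Mod U) then c \<otimes> l U ((U #>\<^sub>G inv\<^sub>G g) \<otimes>\<^bsub>G Mod U\<^esub> A) else \<zero>)"

definition dl :: "'a => 'c => 'c set => 'c set => 'a" where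
 "dl c g = (\<lambda>U\<in>\<U>. \<lambda>A. if A = U #>\<^sub>G g then c else \<zero>)"

lemma act_ev [simp]: "[|U \<in> \<U>; g \<in> carrier G; h \<in> carrier G|] ==> act c g l U (U #>\<^sub>G h) = c \<otimes> l U (U #>\<^sub>G (inv\<^sub>G g \<cdot> h))"
 by (simp add: act_def coset_smult)

lemma dl_ev [simp]: "U \<in> \<U> ==> dl c g U (U #>\<^sub>G h) = (if U #>\<^sub>G h = U #>\<^sub>G g then c else \<zero>)"
 by (simp add: dl_def)

lemma coset_left_cancel:
 "[|U \<in> \<U>; g \<in> carrier G; h \<in> carrier G; x \<in> carrier G|] ==> U #>\<^sub>G (x \<cdot> g) = U #>\<^sub>G (x \<cdot> h) \<longleftrightarrow> U #>\<^sub>G g = U #>\<^sub>G h"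
proof
 assume c: "U \<in> \<U>" "g \<in> carrier G" "h \<in> carrier G" "x \<in> carrier G"
 have i: "inv\<^sub>G x \<cdot> (x \<cdot> y) = y" if "y \<in> carrier G" for y using that c by (simp add: G.m_assoc[symmetric])
 assume "U #>\<^sub>G (x \<cdot> g) = U #>\<^sub>G (x \<cdot> h)"
 hence "(U #>\<^sub>G inv\<^sub>G x) <#>\<^bsub>G\<^esub> (U #>\<^sub>G (x \<cdot> g)) = (U #>\<^sub>G inv\<^sub>G x) <#>\<^bsub>G\<^esub> (U #>\<^sub>G (x \<cdot> h))" by simp
 thus "U #>\<^sub>G g = U #>\<^sub>G h" using c i by (simp add: coset_smult)
next
 assume c: "U \<in> \<U>" "g \<in> carrier G" "h \<in> carrier G" "x \<in> carrier G" and "U #>\<^sub>G g = U #>\<^sub>G h"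
 hence "(U #>\<^sub>G x) <#>\<^bsub>G\<^esub> (U #>\<^sub>G g) = (U #>\<^sub>G x) <#>\<^bsub>G\<^esub> (U #>\<^sub>G h)" by simp
 thus "U #>\<^sub>G (x \<cdot> g) = U #>\<^sub>G (x \<cdot> h)" using c by (simp add: coset_smult)
qed

lemma dl_closed [simp]: assumes "c \<in> carrier R" "g \<in> carrier G" shows "dl c g \<in> carrier \<Lambda>"
 unfolding Lambda_iff
proof (intro conjI ballI allI impI)
 show "dl c g \<in> extensional \<U>" by (simp add: dl_def)
 fix U assume U: "U \<in> \<U>"
 show "dl c g U (U #>\<^sub>G h) \<in> carrier R" for h using U assms by simp
 show "dl c g U A = \<zero>" if "A \<notin> carrier (G Mod U)" for A using U that coset_in[OF U assms(2)] by (auto simp: dl_def)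
 fix V h assume V: "V \<in> \<U>" "U \<subseteq> V" and h: "h \<in> carrier G"
 have e: "dl c g U A = (if U #>\<^sub>G g = A then c else \<zero>)" for A using U by (auto simp: dl_def)
 show "(\<Oplus>A\<in>fib U V h. dl c g U A) = dl c g V (V #>\<^sub>G h)"
 proof (cases "V #>\<^sub>G g = V #>\<^sub>G h")
  case True
  hence "U #>\<^sub>G g \<in> fib U V h" using fib_iff[OF U V assms(2)] by simp
  hence "(\<Oplus>A\<in>fib U V h. (if U #>\<^sub>G g = A then c else \<zero>)) = c"
   using add.finprod_singleton[of "U #>\<^sub>G g" "fib U V h" "\<lambda>_. c"] fib_finite[OF U] assms by simp
  thus ?thesis using True V(1) by (simp add: e)
 next
  case False
  hence "U #>\<^sub>G g \<notin> fib U V h" using fib_iff[OF U V assms(2)] by simp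
  hence "(\<Oplus>A\<in>fib U V h. (if U #>\<^sub>G g = A then c else \<zero>)) = (\<Oplus>A\<in>fib U V h. \<zero>)"
   by (intro add.finprod_cong') auto
  thus ?thesis using False V(1) by (auto simp: e)
 qed
qed

lemma act_closed [simp]: assumes "c \<in> carrier R" "g \<in> carrier G" "l \<in> carrier \<Lambda>" shows "act c g l \<in> carrier \<Lambda>"
 unfolding Lambda_iff
proof (intro conjI ballI allI impI)
 show "act c g l \<in> extensional \<U>" by (simp add: act_def)
 fix U assume U: "U \<in> \<U>"
 show "act c g l U (U #>\<^sub>G h) \<in> carrier R" if "h \<in> carrier G" for h using U assms that by simp
 show "act c g l U A = \<zero>" if "A \<notin> carrier (G Mod U)" for A using U that by (simp add: act_def)
 fix V h assume V: "V \<in> \<U>" "U \<subseteq> V" and h: "h \<in> carrier G"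
 define \<tau> where "\<tau> A = (U #>\<^sub>G inv\<^sub>G g) \<otimes>\<^bsub>G Mod U\<^esub> A" for A
 have ig: "inv\<^sub>G g \<in> carrier G" using assms by simp
 have ig1: "inv\<^sub>G g \<cdot> (g \<cdot> x) = x" if "x \<in> carrier G" for x using that assms by (simp add: G.m_assoc[symmetric])
 have \<tau>: "\<tau> (U #>\<^sub>G x) = U #>\<^sub>G (inv\<^sub>G g \<cdot> x)" if "x \<in> carrier G" for x unfolding \<tau>_def using coset_mult[OF U ig that] .
 have inj: "inj_on \<tau> (fib U V h)"
 proof (rule inj_onI)
  fix A A' assume A: "A \<in> fib U V h" "A' \<in> fib U V h" "\<tau> A = \<tau> A'"
  obtain x where x: "x \<in> carrier G" "A = U #>\<^sub>G x" using coset_ex[of A U] A(1) unfolding fib_def by blast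
  obtain y where y: "y \<in> carrier G" "A' = U #>\<^sub>G y" using coset_ex[of A' U] A(2) unfolding fib_def by blast
  show "A = A'" using A(3) unfolding x(2) y(2) \<tau>[OF x(1)] \<tau>[OF y(1)] using coset_left_cancel[OF U x(1) y(1) ig] by simp
 qed
 have img: "\<tau> ` fib U V h = fib U V (inv\<^sub>G g \<cdot> h)"
 proof
  show "\<tau> ` fib U V h \<subseteq> fib U V (inv\<^sub>G g \<cdot> h)"
  proof
   fix B assume "B \<in> \<tau> ` fib U V h"
   then obtain A where A: "A \<in> fib U V h" "B = \<tau> A" by blast
   obtain x where x: "x \<in> carrier G" "A = U #>\<^sub>G x" "V #>\<^sub>G x = V #>\<^sub>G h" using fib_ex[OF U V A(1)] by blast
   show "B \<in> fib U V (inv\<^sub>G g \<cdot> h)" unfolding A(2) x(2) \<tau>[OF x(1)]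
    using fib_iff[OF U V, of "inv\<^sub>G g \<cdot> x"] coset_left_cancel[OF V(1) x(1) h ig] x ig by simp
  qed
  show "fib U V (inv\<^sub>G g \<cdot> h) \<subseteq> \<tau> ` fib U V h"
  proof
   fix B assume B: "B \<in> fib U V (inv\<^sub>G g \<cdot> h)"
   obtain x where x: "x \<in> carrier G" "B = U #>\<^sub>G x" "V #>\<^sub>G x = V #>\<^sub>G (inv\<^sub>G g \<cdot> h)" using fib_ex[OF U V B] by blast
   have gx: "g \<cdot> x \<in> carrier G" using x assms by simp
   have "V #>\<^sub>G (g \<cdot> x) = V #>\<^sub>G h" using coset_left_cancel[OF V(1) gx h ig] x ig1[OF x(1)] by simp
   hence "U #>\<^sub>G (g \<cdot> x) \<in> fib U V h" using fib_iff[OF U V gx] by simp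
   moreover have "\<tau> (U #>\<^sub>G (g \<cdot> x)) = B" using \<tau>[OF gx] ig1[OF x(1)] x(2) by simp
   ultimately show "B \<in> \<tau> ` fib U V h" by (rule rev_image_eqI[OF _ sym])
  qed
 qed
 have "(\<Oplus>A\<in>fib U V h. act c g l U A) = (\<Oplus>A\<in>fib U V h. c \<otimes> l U (\<tau> A))"
  using U assms L_closed'[OF assms(3) U] by (intro add.finprod_cong') (auto simp: act_def \<tau>_def fib_def)
 also have "\<dots> = c \<otimes> (\<Oplus>A\<in>fib U V h. l U (\<tau> A))"
  using fib_finite[OF U] assms L_closed'[OF assms(3) U] by (intro finsum_rdistr[symmetric]) auto
 also have "(\<Oplus>A\<in>fib U V h. l U (\<tau> A)) = (\<Oplus>B\<in>\<tau> ` fib U V h. l U B)"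
  using inj L_closed'[OF assms(3) U] by (intro add.finprod_reindex[symmetric]) auto
 also have "\<dots> = l V (V #>\<^sub>G (inv\<^sub>G g \<cdot> h))" unfolding img using L_compat[OF assms(3) U V] ig h by simp
 also have "c \<otimes> \<dots> = act c g l V (V #>\<^sub>G h)" using V(1) assms h by simp
 finally show "(\<Oplus>A\<in>fib U V h. act c g l U A) = act c g l V (V #>\<^sub>G h)" .
qed

lemma dl_mult: assumes "c \<in> carrier R" "g \<in> carrier G" "l \<in> carrier \<Lambda>" shows "dl c g \<otimes>\<^bsub>\<Lambda>\<^esub> l = act c g l"
proof
 fix U
 show "(dl c g \<otimes>\<^bsub>\<Lambda>\<^esub> l) U = act c g l U"
 proof (cases "U \<in> \<U>")
  case U: True
  have "(dl c g U \<otimes>\<^bsub>group_ring R (G Mod U)\<^esub> l U) A = act c g l U A" for A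
  proof (cases "A \<in> carrier (G Mod U)")
   case True
   have lc: "l U B \<in> carrier R" for B using L_closed'[OF assms(3) U] .
   have "(\<Oplus>y\<in>{y \<in> carrier (G Mod U). dl c g U y \<noteq> \<zero>}. dl c g U y \<otimes> l U (inv\<^bsub>G Mod U\<^esub> y \<otimes>\<^bsub>G Mod U\<^esub> A))
     = c \<otimes> l U ((U #>\<^sub>G inv\<^sub>G g) \<otimes>\<^bsub>G Mod U\<^esub> A)"
   proof (cases "c = \<zero>")
    case True
    hence "{y \<in> carrier (G Mod U). dl c g U y \<noteq> \<zero>} = {}" using U by (auto simp: dl_def)
    hence "(\<Oplus>y\<in>{y \<in> carrier (G Mod U). dl c g U y \<noteq> \<zero>}. dl c g U y \<otimes> l U (inv\<^bsub>G Mod U\<^esub> y \<otimes>\<^bsub>G Mod U\<^esub> A)) = \<zero>"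
     by (simp only: finsum_empty)
    thus ?thesis using True lc by (simp only: l_null)
   next
    case False
    hence "{y \<in> carrier (G Mod U). dl c g U y \<noteq> \<zero>} = {U #>\<^sub>G g}" using U assms(2) by (auto simp: dl_def)
    thus ?thesis using U assms lc coset_inv[OF U assms(2)] by (simp add: dl_def)
   qed
   thus ?thesis using True U by (simp add: group_ring_def act_def)
  next
   case False thus ?thesis using U by (simp add: group_ring_def act_def)
  qed
  thus ?thesis using U by (simp add: Iwasawa_algebra_def fun_eq_iff)
 next
  case False thus ?thesis by (simp add: Iwasawa_algebra_def act_def)
 qed
qed

lemma of_elem_dl: "Iwasawa_of_elem R G T g = dl \<one> g"
 by (auto simp: Iwasawa_of_elem_def dl_def fun_eq_iff)
lemma of_scalar_dl: "Iwasawa_of_scalar R G T c = dl c \<one>\<^bsub>G\<^esub>"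
 by (rule ext) (simp add: Iwasawa_of_scalar_def dl_def fun_eq_iff restrict_def)

lemma act_dl: assumes "c \<in> carrier R" "d \<in> carrier R" "g \<in> carrier G" "h \<in> carrier G" shows "act c g (dl d h) = dl (c \<otimes> d) (g \<cdot> h)"
proof (rule L_eqI)
 fix U x assume U: "U \<in> \<U>" and x: "x \<in> carrier G"
 have ig: "inv\<^sub>G g \<in> carrier G" using assms by simp
 have "h = inv\<^sub>G g \<cdot> (g \<cdot> h)" using assms by (simp add: G.m_assoc[symmetric])
 hence "U #>\<^sub>G (inv\<^sub>G g \<cdot> x) = U #>\<^sub>G h \<longleftrightarrow> U #>\<^sub>G x = U #>\<^sub>G (g \<cdot> h)"
  using coset_left_cancel[OF U x _ ig, of "g \<cdot> h"] assms by simp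
 thus "act c g (dl d h) U (U #>\<^sub>G x) = dl (c \<otimes> d) (g \<cdot> h) U (U #>\<^sub>G x)" using U x assms by simp
qed (use assms in auto)

lemma Lambda_zero [simp]: "\<zero>\<^sub>\<Lambda> \<in> carrier \<Lambda>"
 unfolding Lambda_iff by (auto simp: Iwasawa_algebra_def group_ring_def)

lemma Lambda_add [simp]: assumes "k \<in> carrier \<Lambda>" "l \<in> carrier \<Lambda>" shows "k \<oplus>\<^sub>\<Lambda> l \<in> carrier \<Lambda>"
 unfolding Lambda_iff
proof (intro conjI ballI allI impI)
 show "k \<oplus>\<^sub>\<Lambda> l \<in> extensional \<U>" by (simp add: Iwasawa_algebra_def)
 fix U assume U: "U \<in> \<U>"
 show "(k \<oplus>\<^sub>\<Lambda> l) U (U #>\<^sub>G g) \<in> carrier R" if "g \<in> carrier G" for g using assms U that by simp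
 show "(k \<oplus>\<^sub>\<Lambda> l) U A = \<zero>" if "A \<notin> carrier (G Mod U)" for A
  using U L_zero[OF assms(1) U that] L_zero[OF assms(2) U that] by simp
 fix V g assume V: "V \<in> \<U>" "U \<subseteq> V" "g \<in> carrier G"
 have "(\<Oplus>A\<in>fib U V g. (k \<oplus>\<^sub>\<Lambda> l) U A) = (\<Oplus>A\<in>fib U V g. k U A) \<oplus> (\<Oplus>A\<in>fib U V g. l U A)"
  using U L_closed'[OF assms(1) U] L_closed'[OF assms(2) U] by (simp add: finsum_addf Pi_def)
 thus "(\<Oplus>A\<in>fib U V g. (k \<oplus>\<^sub>\<Lambda> l) U A) = (k \<oplus>\<^sub>\<Lambda> l) V (V #>\<^sub>G g)" using L_compat U V assms by simp
qed

lemma Lambda_abelian: "abelian_group \<Lambda>"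
proof (rule abelian_groupI)
 fix l assume l: "l \<in> carrier \<Lambda>"
 have "act (\<ominus> \<one>) \<one>\<^bsub>G\<^esub> l \<oplus>\<^sub>\<Lambda> l = \<zero>\<^sub>\<Lambda>"
  by (rule L_eqI) (use l in \<open>auto simp: l_minus l_neg\<close>)
 thus "\<exists>k\<in>carrier \<Lambda>. k \<oplus>\<^sub>\<Lambda> l = \<zero>\<^sub>\<Lambda>" using l by (intro bexI[of _ "act (\<ominus> \<one>) \<one>\<^bsub>G\<^esub> l"]) auto
next
 show "\<And>x y z. [|x \<in> carrier \<Lambda>; y \<in> carrier \<Lambda>; z \<in> carrier \<Lambda>|] ==> x \<oplus>\<^sub>\<Lambda> y \<oplus>\<^sub>\<Lambda> z = x \<oplus>\<^sub>\<Lambda> (y \<oplus>\<^sub>\<Lambda> z)"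
  by (rule L_eqI) (auto simp: a_assoc)
 show "\<And>x y. [|x \<in> carrier \<Lambda>; y \<in> carrier \<Lambda>|] ==> x \<oplus>\<^sub>\<Lambda> y = y \<oplus>\<^sub>\<Lambda> x"
  by (rule L_eqI) (auto simp: a_comm)
 show "\<And>x. x \<in> carrier \<Lambda> ==> \<zero>\<^sub>\<Lambda> \<oplus>\<^sub>\<Lambda> x = x" by (rule L_eqI) auto
qed auto

sublocale L: abelian_group \<Lambda> by (rule Lambda_abelian)

lemma minus_ev [simp]: assumes "l \<in> carrier \<Lambda>" "U \<in> \<U>" shows "(\<ominus>\<^bsub>\<Lambda>\<^esub> l) U A = \<ominus> l U A"
proof -
 have "(\<ominus>\<^bsub>\<Lambda>\<^esub> l) U A \<oplus> l U A = \<zero>" using assms(2) L.l_neg[OF assms(1)] by (metis ops)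
 thus ?thesis using minus_equality[of "(\<ominus>\<^bsub>\<Lambda>\<^esub> l) U A" "l U A"] L_closed'[OF assms] L_closed'[OF L.a_inv_closed[OF assms(1)] assms(2)] by simp
qed

lemma diff_ev [simp]: assumes "k \<in> carrier \<Lambda>" "l \<in> carrier \<Lambda>" "U \<in> \<U>" shows "(k \<ominus>\<^sub>\<Lambda> l) U A = k U A \<ominus> l U A"
 using assms by (simp add: a_minus_def)

lemma finsum_ev: assumes "finite S" "\<And>s. s \<in> S ==> f s \<in> carrier \<Lambda>" "U \<in> \<U>"
 shows "(\<Oplus>\<^bsub>\<Lambda>\<^esub>s\<in>S. f s) U A = (\<Oplus>s\<in>S. f s U A)"
 using assms(1,2)
proof (induct S rule: finite_induct)
 case (insert s S)
 thus ?case using assms(3) L_closed'[OF _ assms(3)] by (simp add: Pi_def)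
qed (use assms(3) in simp)

end

locale iwasawa_complete = iwasawa R G T for R (structure) and G (structure) and T +
 fixes \<omega> :: 'a and p :: nat
 assumes varpi: "\<omega> \<in> carrier R"
  and p_mult: "x \<in> carrier R ==> add_pow R p x = \<omega> \<otimes> x"
  and complete: "[|\<And>n::nat. f n \<in> carrier R; \<And>n. \<exists>t\<in>carrier R. f (Suc n) = f n \<oplus> \<omega> [^] n \<otimes> t|] ==>
   \<exists>y\<in>carrier R. \<forall>n. \<exists>t\<in>carrier R. y = f n \<oplus> \<omega> [^] n \<otimes> t"
  and separated: "[|x \<in> carrier R; \<And>n::nat. \<exists>t\<in>carrier R. x = \<omega> [^] n \<otimes> t|] ==> x = \<zero>"
begin

definition dv :: "nat => 'a => bool" where "dv n x \<longleftrightarrow> (\<exists>t\<in>carrier R. x = \<omega> [^] n \<otimes> t)"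

lemma dv_closed: "dv n x ==> x \<in> carrier R" using varpi by (auto simp: dv_def)
lemma dv_zero [simp]: "dv n \<zero>" using varpi by (auto simp: dv_def intro!: bexI[of _ "\<zero>"])
lemma dv_0 [simp]: "x \<in> carrier R ==> dv 0 x" by (auto simp: dv_def)
lemma dv_add: assumes "dv n x" "dv n y" shows "dv n (x \<oplus> y)"
proof -
 obtain s t where "s \<in> carrier R" "t \<in> carrier R" "x = \<omega> [^] n \<otimes> s" "y = \<omega> [^] n \<otimes> t"
  using assms unfolding dv_def by blast
 thus ?thesis unfolding dv_def using varpi by (intro bexI[of _ "s \<oplus> t"]) (auto simp: r_distr)
qed
lemma dv_mult: assumes "dv n x" "c \<in> carrier R" shows "dv n (c \<otimes> x)"
proof -
 obtain s where "s \<in> carrier R" "x = \<omega> [^] n \<otimes> s" using assms unfolding dv_def by blast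
 thus ?thesis unfolding dv_def using varpi assms(2) by (intro bexI[of _ "c \<otimes> s"]) (auto simp: m_lcomm)
qed
lemma dv_neg: assumes "dv n x" shows "dv n (\<ominus> x)"
 using dv_mult[OF assms, of "\<ominus> \<one>"] dv_closed[OF assms] by (simp add: l_minus)
lemma dv_diff: "dv n x ==> dv n y ==> dv n (x \<ominus> y)" unfolding a_minus_def by (intro dv_add dv_neg)
lemma dv_mono: assumes "dv n x" "m \<le> n" shows "dv m x"
proof -
 obtain s where s: "s \<in> carrier R" "x = \<omega> [^] n \<otimes> s" using assms unfolding dv_def by blast
 have "\<omega> [^] n = \<omega> [^] m \<otimes> \<omega> [^] (n - m)" using varpi assms(2) by (simp add: nat_pow_mult)
 thus ?thesis unfolding dv_def using s varpi by (intro bexI[of _ "\<omega> [^] (n - m) \<otimes> s"]) (auto simp: m_assoc)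
qed
lemma dv_all: "(\<And>n. dv n x) ==> x = \<zero>" using separated[of x] dv_closed[of 0 x] unfolding dv_def by blast
lemma dv_eq: assumes "x \<in> carrier R" "y \<in> carrier R" "\<And>n. dv n (x \<ominus> y)" shows "x = y"
 using dv_all[OF assms(3)] assms(1,2) by (simp add: r_right_minus_eq)

lemma diff_add_cancel: "x \<in> carrier R ==> y \<in> carrier R ==> x = y \<oplus> (x \<ominus> y)"
 by algebra
lemma minus_self: "x \<in> carrier R ==> x \<ominus> x = \<zero>" by (simp add: r_right_minus_eq)
lemma add_diff_self: "x \<in> carrier R ==> y \<in> carrier R ==> (y \<oplus> x) \<ominus> y = x"
 by algebra
lemma dv_trans: assumes "dv n (x \<ominus> y)" "dv n (z \<ominus> y)" "x \<in> carrier R" "y \<in> carrier R" "z \<in> carrier R" shows "dv n (x \<ominus> z)"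
proof -
 have "x \<ominus> z = (x \<ominus> y) \<ominus> (z \<ominus> y)" using assms(3-5) by algebra
 thus ?thesis using dv_diff[OF assms(1,2)] by simp
qed
lemma dv_finsum_diff:
 "finite F ==> (\<And>a. a \<in> F ==> f a \<in> carrier R \<and> f' a \<in> carrier R \<and> dv n (f a \<ominus> f' a)) ==>
  dv n ((\<Oplus>a\<in>F. f a) \<ominus> (\<Oplus>a\<in>F. f' a))"
proof (induct F rule: finite_induct)
 case empty thus ?case by (simp add: minus_self)
next
 case (insert x F)
 define a b a' b' where "a = f x" "b = (\<Oplus>a\<in>F. f a)" "a' = f' x" "b' = (\<Oplus>a\<in>F. f' a)"
 have c: "a \<in> carrier R" "b \<in> carrier R" "a' \<in> carrier R" "b' \<in> carrier R"
  unfolding a_b_a'_b'_def using insert by (auto intro!: finsum_closed)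
 have "(\<Oplus>a\<in>insert x F. f a) = a \<oplus> b" "(\<Oplus>a\<in>insert x F. f' a) = a' \<oplus> b'"
  unfolding a_b_a'_b'_def using insert by (auto intro!: finsum_insert)
 moreover have "(a \<oplus> b) \<ominus> (a' \<oplus> b') = (a \<ominus> a') \<oplus> (b \<ominus> b')" using c by algebra
 moreover have "dv n (a \<ominus> a')" "dv n (b \<ominus> b')" unfolding a_b_a'_b'_def using insert by auto
 ultimately show ?case using dv_add by simp
qed

lemma limit_exists:
 assumes f: "\<And>n. f n \<in> carrier R" and C: "\<And>n::nat. n \<ge> e ==> dv (n - e) (f (Suc n) \<ominus> f n)"
 shows "\<exists>y\<in>carrier R. \<forall>n\<ge>e. dv (n - e) (y \<ominus> f n)"
proof -
 have "\<exists>t\<in>carrier R. f (Suc n + e) = f (n + e) \<oplus> \<omega> [^] n \<otimes> t" for n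
 proof -
  obtain t where t: "t \<in> carrier R" "f (Suc (n + e)) \<ominus> f (n + e) = \<omega> [^] n \<otimes> t"
   using C[of "n + e"] by (auto simp: dv_def)
  have "f (Suc (n + e)) = f (n + e) \<oplus> (f (Suc (n + e)) \<ominus> f (n + e))" using f by (intro diff_add_cancel)
  thus ?thesis unfolding t(2) using t(1) by auto
 qed
 hence "\<exists>y\<in>carrier R. \<forall>n. \<exists>t\<in>carrier R. y = f (n + e) \<oplus> \<omega> [^] n \<otimes> t"
  using f by (intro complete[of "\<lambda>n. f (n + e)"]) auto
 then obtain y where y: "y \<in> carrier R" "\<And>n. \<exists>t\<in>carrier R. y = f (n + e) \<oplus> \<omega> [^] n \<otimes> t" by blast
 have "dv (n - e) (y \<ominus> f n)" if n: "n \<ge> e" for n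
 proof -
  obtain t where t: "t \<in> carrier R" "y = f n \<oplus> \<omega> [^] (n - e) \<otimes> t" using y(2)[of "n - e"] n by auto
  have "y \<ominus> f n = \<omega> [^] (n - e) \<otimes> t" unfolding t(2) using t(1) f varpi by (intro add_diff_self) auto
  thus ?thesis using t(1) unfolding dv_def by blast
 qed
 thus ?thesis using y(1) by blast
qed

end

locale iwasawa_filtration = iwasawa_complete R G T \<omega> p for R (structure) and G (structure) and T \<omega> p +
 fixes H S :: "'c set" and B W :: "nat => 'c set"
 assumes H: "subgroup H G" and S: "finite S" "S \<subseteq> H"
  and SB: "s \<in> S ==> s [^]\<^bsub>G\<^esub> (p ^ j) \<in> B j"
  and rep: "v \<in> H ==> v \<in> B j ==> \<exists>s\<in>S. inv\<^sub>G (s [^]\<^bsub>G\<^esub> (p ^ j)) \<cdot> v \<in> B (Suc j)"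
  and B_Suc: "B (Suc j) \<subseteq> B j"
  and W: "W n \<in> \<U>" "W n \<subseteq> B n" "W (Suc n) \<subseteq> W n"
  and base: "U \<in> \<U> ==> \<exists>j. B j \<subseteq> U"
begin

lemma HG: "h \<in> H ==> h \<in> carrier G" using subgroup.subset[OF H] by blast
lemma SG: "s \<in> S ==> s \<in> carrier G" using S HG by blast
lemma B_anti: "i \<le> j ==> B j \<subseteq> B i" by (rule lift_Suc_antimono_le) (use B_Suc in auto)

definition Hs :: "('c set => 'c set => 'a) => bool" where
 "Hs l \<longleftrightarrow> (\<forall>U\<in>\<U>. \<forall>g\<in>carrier G. l U (U #>\<^sub>G g) \<noteq> \<zero> --> (U #>\<^sub>G g) \<inter> H \<noteq> {})"

lemma Hs_zero: "Hs \<zero>\<^sub>\<Lambda>" by (simp add: Hs_def)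
lemma Hs_add: "[|Hs k; Hs l; k \<in> carrier \<Lambda>; l \<in> carrier \<Lambda>|] ==> Hs (k \<oplus>\<^sub>\<Lambda> l)" unfolding Hs_def by (metis ops(1) l_zero zero_closed)
lemma Hs_diff: "[|Hs k; Hs l; k \<in> carrier \<Lambda>; l \<in> carrier \<Lambda>|] ==> Hs (k \<ominus>\<^sub>\<Lambda> l)" unfolding Hs_def
 by (metis diff_ev r_right_minus_eq zero_closed)
lemma Hs_dl: "h \<in> H ==> Hs (dl c h)" unfolding Hs_def using G.rcos_self[OF HG U_subgroup] by (auto split: if_splits)
lemma Hs_act: assumes "h \<in> H" "Hs l" "c \<in> carrier R" "l \<in> carrier \<Lambda>" shows "Hs (act c h l)"
 unfolding Hs_def
proof (intro ballI impI)
 fix U g assume U: "U \<in> \<U>" and g: "g \<in> carrier G" and nz: "act c h l U (U #>\<^sub>G g) \<noteq> \<zero>"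
 have hG: "h \<in> carrier G" using assms HG by blast
 have "l U (U #>\<^sub>G (inv\<^sub>G h \<cdot> g)) \<noteq> \<zero>" using nz U g hG assms(3) by auto
 hence "(U #>\<^sub>G (inv\<^sub>G h \<cdot> g)) \<inter> H \<noteq> {}" using assms(2) U g hG unfolding Hs_def by simp
 then obtain x where x: "x \<in> U #>\<^sub>G (inv\<^sub>G h \<cdot> g)" "x \<in> H" by blast
 have xG: "x \<in> carrier G" using x HG by blast
 have "U #>\<^sub>G (inv\<^sub>G h \<cdot> g) = U #>\<^sub>G x" using coset_mem_eq[OF U _ x(1)] g hG by simp
 moreover have "x = inv\<^sub>G h \<cdot> (h \<cdot> x)" using xG hG by (simp add: G.m_assoc[symmetric])
 ultimately have "U #>\<^sub>G g = U #>\<^sub>G (h \<cdot> x)" using coset_left_cancel[OF U g, of "h \<cdot> x" "inv\<^sub>G h"] hG xG by simp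
 moreover have "h \<cdot> x \<in> H" using subgroup.m_closed[OF H assms(1) x(2)] .
 ultimately show "(U #>\<^sub>G g) \<inter> H \<noteq> {}" using G.rcos_self[OF _ U_subgroup[OF U], of "h \<cdot> x"] hG xG by auto
qed
lemma Hs_finsum: "finite F ==> (\<And>s. s \<in> F ==> f s \<in> carrier \<Lambda> \<and> Hs (f s)) ==> Hs (\<Oplus>\<^bsub>\<Lambda>\<^esub>s\<in>F. f s)"
proof (induct F rule: finite_induct)
 case (insert s F)
 have "(\<Oplus>\<^bsub>\<Lambda>\<^esub>s\<in>insert s F. f s) = f s \<oplus>\<^sub>\<Lambda> (\<Oplus>\<^bsub>\<Lambda>\<^esub>s\<in>F. f s)" using insert by (intro L.finsum_insert) auto
 thus ?case using insert by (auto intro!: Hs_add)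
qed (simp add: Hs_zero)

definition \<Delta> :: "('c => 'c set => 'c set => 'a) => 'c set => 'c set => 'a" where
 "\<Delta> D = (\<Oplus>\<^bsub>\<Lambda>\<^esub>s\<in>S. act \<one> s (D s) \<ominus>\<^sub>\<Lambda> D s)"

lemma Delta_closed [simp]: "(\<And>s. s \<in> S ==> D s \<in> carrier \<Lambda>) ==> \<Delta> D \<in> carrier \<Lambda>"
 unfolding \<Delta>_def using SG by (intro L.finsum_closed) auto

lemma Delta_ev: assumes "\<And>s. s \<in> S ==> D s \<in> carrier \<Lambda>" "U \<in> \<U>" "g \<in> carrier G"
 shows "\<Delta> D U (U #>\<^sub>G g) = (\<Oplus>s\<in>S. D s U (U #>\<^sub>G (inv\<^sub>G s \<cdot> g)) \<ominus> D s U (U #>\<^sub>G g))"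
proof -
 have "\<Delta> D U (U #>\<^sub>G g) = (\<Oplus>s\<in>S. (act \<one> s (D s) \<ominus>\<^sub>\<Lambda> D s) U (U #>\<^sub>G g))"
  unfolding \<Delta>_def using S SG assms by (intro finsum_ev) auto
 also have "\<dots> = (\<Oplus>s\<in>S. D s U (U #>\<^sub>G (inv\<^sub>G s \<cdot> g)) \<ominus> D s U (U #>\<^sub>G g))"
  using SG assms by (intro add.finprod_cong') auto
 finally show ?thesis .
qed

lemma act_add: assumes "c \<in> carrier R" "g \<in> carrier G" "k \<in> carrier \<Lambda>" "l \<in> carrier \<Lambda>"
 shows "act c g (k \<oplus>\<^sub>\<Lambda> l) = act c g k \<oplus>\<^sub>\<Lambda> act c g l"
 by (rule L_eqI) (use assms in \<open>auto simp: r_distr\<close>)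

lemma L_diff_add: "[|a \<in> carrier \<Lambda>; a' \<in> carrier \<Lambda>; b \<in> carrier \<Lambda>; b' \<in> carrier \<Lambda>|] ==>
  (a \<oplus>\<^sub>\<Lambda> a') \<ominus>\<^sub>\<Lambda> (b \<oplus>\<^sub>\<Lambda> b') = (a \<ominus>\<^sub>\<Lambda> b) \<oplus>\<^sub>\<Lambda> (a' \<ominus>\<^sub>\<Lambda> b')"
 by (simp add: a_minus_def L.minus_add L.a_ac)

lemma Delta_add: assumes "\<And>s. s \<in> S ==> D s \<in> carrier \<Lambda>" "\<And>s. s \<in> S ==> D' s \<in> carrier \<Lambda>"
 shows "\<Delta> (\<lambda>s. D s \<oplus>\<^sub>\<Lambda> D' s) = \<Delta> D \<oplus>\<^sub>\<Lambda> \<Delta> D'"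
proof -
 have "\<Delta> (\<lambda>s. D s \<oplus>\<^sub>\<Lambda> D' s) = (\<Oplus>\<^bsub>\<Lambda>\<^esub>s\<in>S. (act \<one> s (D s) \<ominus>\<^sub>\<Lambda> D s) \<oplus>\<^sub>\<Lambda> (act \<one> s (D' s) \<ominus>\<^sub>\<Lambda> D' s))"
  unfolding \<Delta>_def using assms SG by (intro L.add.finprod_cong') (auto simp: act_add L_diff_add)
 also have "\<dots> = \<Delta> D \<oplus>\<^sub>\<Lambda> \<Delta> D'" unfolding \<Delta>_def using assms SG by (intro L.finsum_addf) auto
 finally show ?thesis .
qed

lemma Hs_Delta: "(\<And>s. s \<in> S ==> D s \<in> carrier \<Lambda> \<and> Hs (D s)) ==> Hs (\<Delta> D)"
 unfolding \<Delta>_def using S SG by (intro Hs_finsum) (auto intro!: Hs_diff Hs_act)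

definition vz :: "'c set => ('c set => 'c set => 'a) => bool" where
 "vz U l \<longleftrightarrow> (\<forall>g\<in>carrier G. l U (U #>\<^sub>G g) = \<zero>)"

lemma vz_mono: assumes "l \<in> carrier \<Lambda>" "U \<in> \<U>" "V \<in> \<U>" "U \<subseteq> V" "vz U l" shows "vz V l"
 unfolding vz_def
proof
 fix g assume g: "g \<in> carrier G"
 have "(\<Oplus>A\<in>fib U V g. l U A) = (\<Oplus>A\<in>fib U V g. \<zero>)"
  using assms(5) coset_ex[of _ U] by (intro add.finprod_cong') (auto simp: fib_def vz_def)
 thus "l V (V #>\<^sub>G g) = \<zero>" using L_compat[OF assms(1-4) g] by simp
qed

text \<open>Coefficients of \<open>c (1 + s + ... + s ^ (p ^ n - 1)) g\<close> at a level \<open>U\<close> containing \<open>s ^ p ^ e\<close> are divisible by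
 \<open>p ^ (n - e)\<close>; this makes the infinite sum of the corrections below converge.\<close>

definition good :: "nat => ('c set => 'c set => 'a) => bool" where
 "good n \<delta> \<longleftrightarrow> \<delta> \<in> carrier \<Lambda> \<and> Hs \<delta> \<and>
  (\<forall>U\<in>\<U>. \<forall>e\<le>n. (\<forall>s\<in>S. s [^]\<^bsub>G\<^esub> (p ^ e) \<in> U) --> (\<forall>g\<in>carrier G. dv (n - e) (\<delta> U (U #>\<^sub>G g))))"

lemma good_zero: "good n \<zero>\<^sub>\<Lambda>" by (simp add: good_def Hs_zero)
lemma good_add: "good n k ==> good n l ==> good n (k \<oplus>\<^sub>\<Lambda> l)"
 unfolding good_def by (auto intro!: Hs_add dv_add)

definition P :: "nat => ('c set => 'c set => 'a) set" where
 "P n = {x \<in> carrier \<Lambda>. \<exists>\<delta>. (\<forall>s\<in>S. good n (\<delta> s)) \<and> vz (W (Suc n)) (x \<ominus>\<^sub>\<Lambda> \<Delta> \<delta>)}"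

lemma good_closed: "good n \<delta> ==> \<delta> \<in> carrier \<Lambda>" by (simp add: good_def)

lemma P_add: assumes "x \<in> P n" "y \<in> P n" shows "x \<oplus>\<^sub>\<Lambda> y \<in> P n"
proof -
 obtain \<delta> where d: "\<forall>s\<in>S. good n (\<delta> s)" "vz (W (Suc n)) (x \<ominus>\<^sub>\<Lambda> \<Delta> \<delta>)" "x \<in> carrier \<Lambda>" using assms by (auto simp: P_def)
 obtain \<delta>' where d': "\<forall>s\<in>S. good n (\<delta>' s)" "vz (W (Suc n)) (y \<ominus>\<^sub>\<Lambda> \<Delta> \<delta>')" "y \<in> carrier \<Lambda>" using assms by (auto simp: P_def)
 have c: "\<And>s. s \<in> S ==> \<delta> s \<in> carrier \<Lambda>" "\<And>s. s \<in> S ==> \<delta>' s \<in> carrier \<Lambda>" using d d' good_closed by blast+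
 have "(x \<oplus>\<^sub>\<Lambda> y) \<ominus>\<^sub>\<Lambda> \<Delta> (\<lambda>s. \<delta> s \<oplus>\<^sub>\<Lambda> \<delta>' s) = (x \<ominus>\<^sub>\<Lambda> \<Delta> \<delta>) \<oplus>\<^sub>\<Lambda> (y \<ominus>\<^sub>\<Lambda> \<Delta> \<delta>')"
  using d d' c by (subst Delta_add) (auto intro!: L_diff_add)
 hence "vz (W (Suc n)) ((x \<oplus>\<^sub>\<Lambda> y) \<ominus>\<^sub>\<Lambda> \<Delta> (\<lambda>s. \<delta> s \<oplus>\<^sub>\<Lambda> \<delta>' s))" using d(2) d'(2) W(1) by (simp add: vz_def)
 moreover have "\<forall>s\<in>S. good n (\<delta> s \<oplus>\<^sub>\<Lambda> \<delta>' s)" using d(1) d'(1) good_add by blast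
 moreover have "x \<oplus>\<^sub>\<Lambda> y \<in> carrier \<Lambda>" using d(3) d'(3) by simp
 ultimately show ?thesis unfolding P_def mem_Collect_eq by (intro conjI exI[of _ "\<lambda>s. \<delta> s \<oplus>\<^sub>\<Lambda> \<delta>' s"])
qed

lemma Delta_zero: "\<Delta> (\<lambda>s. \<zero>\<^sub>\<Lambda>) = \<zero>\<^sub>\<Lambda>"
proof -
 have "act \<one> s \<zero>\<^sub>\<Lambda> \<ominus>\<^sub>\<Lambda> \<zero>\<^sub>\<Lambda> = \<zero>\<^sub>\<Lambda>" if "s \<in> S" for s
  by (rule L_eqI) (use SG[OF that] in auto)
 hence "\<Delta> (\<lambda>s. \<zero>\<^sub>\<Lambda>) = (\<Oplus>\<^bsub>\<Lambda>\<^esub>s\<in>S. \<zero>\<^sub>\<Lambda>)" unfolding \<Delta>_def by (intro L.add.finprod_cong') auto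
 thus ?thesis by simp
qed

lemma P_vz: "x \<in> carrier \<Lambda> ==> vz (W (Suc n)) x ==> x \<in> P n"
 unfolding P_def using good_zero Delta_zero W(1) by (auto intro!: exI[of _ "\<lambda>s. \<zero>\<^sub>\<Lambda>"] simp: vz_def minus_self)

primrec Tl :: "'a => 'c => 'c => nat => 'c set => 'c set => 'a" where
 "Tl c s g 0 = \<zero>\<^sub>\<Lambda>"
| "Tl c s g (Suc m) = Tl c s g m \<oplus>\<^sub>\<Lambda> dl c (s [^]\<^bsub>G\<^esub> m \<cdot> g)"

lemma Tl_closed [simp]: "c \<in> carrier R ==> s \<in> carrier G ==> g \<in> carrier G ==> Tl c s g m \<in> carrier \<Lambda>"
 by (induct m) auto

lemma U_pow: "U \<in> \<U> ==> s \<in> U ==> s [^]\<^bsub>G\<^esub> (m::nat) \<in> U"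
 using subgroup.one_closed[OF U_subgroup] subgroup.m_closed[OF U_subgroup] by (induct m) auto

lemma H_pow: "s \<in> H ==> s [^]\<^bsub>G\<^esub> (m::nat) \<in> H"
 using subgroup.one_closed[OF H] subgroup.m_closed[OF H] by (induct m) auto

lemma Hs_Tl: "c \<in> carrier R ==> s \<in> H ==> g \<in> H ==> Hs (Tl c s g m)"
 using HG H_pow by (induct m) (auto intro!: Hs_add Hs_dl Hs_zero subgroup.m_closed[OF H])

lemma Tl_telescope:
 assumes "c \<in> carrier R" "s \<in> carrier G" "g \<in> carrier G"
 shows "act \<one> s (Tl c s g m) \<ominus>\<^sub>\<Lambda> Tl c s g m = dl c (s [^]\<^bsub>G\<^esub> m \<cdot> g) \<ominus>\<^sub>\<Lambda> dl c g"
proof (induct m)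
 case 0
 show ?case by (rule L_eqI) (use assms in \<open>auto simp: minus_self\<close>)
next
 case (Suc m)
 define a where "a = act \<one> s (Tl c s g m)"
 define t where "t = Tl c s g m"
 define u where "u = dl c (s [^]\<^bsub>G\<^esub> m \<cdot> g)"
 define w where "w = dl c g"
 define v where "v = dl c (s [^]\<^bsub>G\<^esub> Suc m \<cdot> g)"
 have cc: "a \<in> carrier \<Lambda>" "t \<in> carrier \<Lambda>" "u \<in> carrier \<Lambda>" "w \<in> carrier \<Lambda>" "v \<in> carrier \<Lambda>"
  using assms by (auto simp: a_def t_def u_def v_def w_def)
 have "s \<cdot> (s [^]\<^bsub>G\<^esub> m \<cdot> g) = s [^]\<^bsub>G\<^esub> Suc m \<cdot> g" using assms G.nat_pow_Suc2[of s m] by (simp add: G.m_assoc del: G.nat_pow_Suc)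
 hence "act \<one> s u = v" unfolding u_def v_def using assms by (simp add: act_dl del: G.nat_pow_Suc)
 hence "act \<one> s (Tl c s g (Suc m)) = a \<oplus>\<^sub>\<Lambda> v" using assms by (simp add: act_add a_def u_def)
 hence "act \<one> s (Tl c s g (Suc m)) \<ominus>\<^sub>\<Lambda> Tl c s g (Suc m) = (a \<oplus>\<^sub>\<Lambda> v) \<ominus>\<^sub>\<Lambda> (t \<oplus>\<^sub>\<Lambda> u)" by (simp add: t_def u_def)
 also have "\<dots> = (a \<ominus>\<^sub>\<Lambda> t) \<oplus>\<^sub>\<Lambda> (v \<ominus>\<^sub>\<Lambda> u)" using cc by (intro L_diff_add)
 also have "a \<ominus>\<^sub>\<Lambda> t = u \<ominus>\<^sub>\<Lambda> w" using Suc by (simp add: a_def t_def u_def w_def)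
 also have "(u \<ominus>\<^sub>\<Lambda> w) \<oplus>\<^sub>\<Lambda> (v \<ominus>\<^sub>\<Lambda> u) = v \<ominus>\<^sub>\<Lambda> w"
  by (rule L_eqI) (use cc in \<open>auto simp: a_minus_def a_ac r_neg2 r_neg1\<close>)
 finally show ?case by (simp add: v_def w_def)
qed

lemma Tl_add:
 assumes "c \<in> carrier R" "s \<in> carrier G" "g \<in> carrier G" "U \<in> \<U>" "s [^]\<^bsub>G\<^esub> m \<in> U" "x \<in> carrier G"
 shows "Tl c s g (m + t) U (U #>\<^sub>G x) = Tl c s g m U (U #>\<^sub>G x) \<oplus> Tl c s g t U (U #>\<^sub>G x)"
proof (induct t)
 case (Suc t)
 have "s [^]\<^bsub>G\<^esub> (m + t) \<cdot> g = s [^]\<^bsub>G\<^esub> m \<cdot> (s [^]\<^bsub>G\<^esub> t \<cdot> g)" using assms by (simp add: G.nat_pow_mult[symmetric] G.m_assoc)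
 moreover have "U #>\<^sub>G (s [^]\<^bsub>G\<^esub> m \<cdot> (s [^]\<^bsub>G\<^esub> t \<cdot> g)) = U #>\<^sub>G (s [^]\<^bsub>G\<^esub> t \<cdot> g)"
  using assms by (subst coset_eq_iff) (auto simp: G.m_assoc)
 ultimately show ?case using Suc assms by (simp add: a_assoc)
qed (use assms in simp)

lemma Tl_multiple:
 assumes "c \<in> carrier R" "s \<in> carrier G" "g \<in> carrier G" "U \<in> \<U>" "s [^]\<^bsub>G\<^esub> m \<in> U" "x \<in> carrier G"
 shows "Tl c s g (r * m) U (U #>\<^sub>G x) = add_pow R r (Tl c s g m U (U #>\<^sub>G x))"
proof (induct r)
 case (Suc r)
 have "Tl c s g (m + r * m) U (U #>\<^sub>G x) = Tl c s g m U (U #>\<^sub>G x) \<oplus> add_pow R r (Tl c s g m U (U #>\<^sub>G x))"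
  using Tl_add[OF assms, of "r * m"] Suc by simp
 thus ?case using assms by (simp add: a_comm)
qed (use assms in simp)

lemma Tl_good:
 assumes c: "c \<in> carrier R" and s: "s \<in> S" and g: "g \<in> H" and nj: "n \<le> j"
 shows "good n (Tl c s g (p ^ j))"
 unfolding good_def
proof (intro conjI ballI allI impI)
 have sG: "s \<in> carrier G" "s \<in> H" and gG: "g \<in> carrier G" using s g S HG by auto
 show "Tl c s g (p ^ j) \<in> carrier \<Lambda>" using c sG gG by simp
 show "Hs (Tl c s g (p ^ j))" using Hs_Tl c sG g by blast
 fix U e x assume U: "U \<in> \<U>" and e: "e \<le> n" "\<forall>s\<in>S. s [^]\<^bsub>G\<^esub> (p ^ e) \<in> U" and x: "x \<in> carrier G"
 have "dv i (Tl c s g (p ^ (e + i)) U (U #>\<^sub>G x))" for i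
 proof (induct i)
  case 0 show ?case using c sG gG U x by simp
 next
  case (Suc i)
  define y where "y = Tl c s g (p ^ (e + i)) U (U #>\<^sub>G x)"
  have yR: "y \<in> carrier R" using c sG gG U x by (simp add: y_def)
  have "s [^]\<^bsub>G\<^esub> (p ^ e) \<in> U" using e s by blast
  hence "(s [^]\<^bsub>G\<^esub> (p ^ e)) [^]\<^bsub>G\<^esub> (p ^ i) \<in> U" by (rule U_pow[OF U])
  hence "s [^]\<^bsub>G\<^esub> (p ^ (e + i)) \<in> U" using sG by (simp add: G.nat_pow_pow power_add)
  hence "Tl c s g (p * p ^ (e + i)) U (U #>\<^sub>G x) = \<omega> \<otimes> y"
   using Tl_multiple[OF c sG(1) gG U _ x, of "p ^ (e + i)" p] p_mult[OF yR] by (simp add: y_def)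
  moreover obtain t where t: "t \<in> carrier R" "y = \<omega> [^] i \<otimes> t" using Suc unfolding y_def dv_def by blast
  have "\<omega> \<otimes> y = \<omega> [^] Suc i \<otimes> t" unfolding t(2) using t(1) varpi by (simp add: m_ac)
  ultimately show ?case using t(1) unfolding dv_def by auto
 qed
 from this[of "j - e"] have "dv (j - e) (Tl c s g (p ^ j) U (U #>\<^sub>G x))" using e nj by simp
 thus "dv (n - e) (Tl c s g (p ^ j) U (U #>\<^sub>G x))" by (rule dv_mono) (use nj in simp)
qed

lemma translate_in_P:
 assumes c: "c \<in> carrier R" and g: "g \<in> H" and nj: "n \<le> j" and v: "v \<in> H" "v \<in> B j"
 shows "dl c (v \<cdot> g) \<ominus>\<^sub>\<Lambda> dl c g \<in> P n"
proof -
 obtain N where N: "B N \<subseteq> W (Suc n)" using base[OF W(1)] by blast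
 have gG: "g \<in> carrier G" using g HG by blast
 have "dl c (v \<cdot> g) \<ominus>\<^sub>\<Lambda> dl c g \<in> P n" if "N \<le> j + d" "n \<le> j" "v \<in> H" "v \<in> B j" for d j v
  using that
 proof (induct d arbitrary: j v)
  case 0
  have vG: "v \<in> carrier G" using 0 HG by blast
  have vW: "v \<in> W (Suc n)" using 0 N B_anti[of N j] by auto
  have "W (Suc n) #>\<^sub>G (v \<cdot> g) = W (Suc n) #>\<^sub>G g"
   using vW vG gG W(1) by (subst coset_eq_iff) (auto simp: G.m_assoc)
  hence "vz (W (Suc n)) (dl c (v \<cdot> g) \<ominus>\<^sub>\<Lambda> dl c g)"
   unfolding vz_def using W(1) c vG gG by (auto simp: r_right_minus_eq)
  thus ?case using c vG gG by (intro P_vz) auto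
 next
  case (Suc d)
  obtain s where s: "s \<in> S" "inv\<^sub>G (s [^]\<^bsub>G\<^esub> (p ^ j)) \<cdot> v \<in> B (Suc j)" using rep Suc by blast
  define r where "r = s [^]\<^bsub>G\<^esub> (p ^ j)"
  define w where "w = inv\<^sub>G r \<cdot> v"
  have sG: "s \<in> carrier G" "s \<in> H" and vG: "v \<in> carrier G" using s S Suc HG by auto
  have rH: "r \<in> H" "r \<in> carrier G" using H_pow sG by (auto simp: r_def)
  have w: "w \<in> H" "w \<in> B (Suc j)" "w \<in> carrier G"
   using s subgroup.m_closed[OF H subgroup.m_inv_closed[OF H rH(1)] Suc(4)] rH vG by (auto simp: w_def r_def)
  have vr: "v \<cdot> g = r \<cdot> (w \<cdot> g)" unfolding w_def using rH vG gG by (simp add: G.m_assoc[symmetric])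
  have wg: "w \<cdot> g \<in> H" "w \<cdot> g \<in> carrier G" using subgroup.m_closed[OF H w(1) g] w gG by auto
  have 1: "dl c (w \<cdot> g) \<ominus>\<^sub>\<Lambda> dl c g \<in> P n" using Suc w by (intro Suc(1)[of "Suc j"]) auto
  define \<delta> where "\<delta> s' = (if s' = s then Tl c s (w \<cdot> g) (p ^ j) else \<zero>\<^sub>\<Lambda>)" for s'
  have gd: "good n (\<delta> s')" for s' using Tl_good[OF c s(1) wg(1) Suc(3)] good_zero by (simp add: \<delta>_def)
  have z: "act \<one> s' \<zero>\<^sub>\<Lambda> \<ominus>\<^sub>\<Lambda> \<zero>\<^sub>\<Lambda> = \<zero>\<^sub>\<Lambda>" if "s' \<in> S" for s' by (rule L_eqI) (use SG[OF that] in auto)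
  define e where "e = act \<one> s (Tl c s (w \<cdot> g) (p ^ j)) \<ominus>\<^sub>\<Lambda> Tl c s (w \<cdot> g) (p ^ j)"
  have eL: "e \<in> carrier \<Lambda>" using c sG wg by (simp add: e_def)
  have "\<Delta> \<delta> = (\<Oplus>\<^bsub>\<Lambda>\<^esub>s'\<in>S. if s = s' then e else \<zero>\<^sub>\<Lambda>)"
   unfolding \<Delta>_def using z eL by (intro L.add.finprod_cong') (auto simp: \<delta>_def e_def)
  also have "\<dots> = e" using L.add.finprod_singleton[OF s(1) S(1), of "\<lambda>_. e"] eL by simp
  also have "e = dl c (v \<cdot> g) \<ominus>\<^sub>\<Lambda> dl c (w \<cdot> g)" unfolding e_def Tl_telescope[OF c sG(1) wg(2)] vr r_def ..
  finally have De: "\<Delta> \<delta> = dl c (v \<cdot> g) \<ominus>\<^sub>\<Lambda> dl c (w \<cdot> g)" .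
  have "dl c (v \<cdot> g) \<ominus>\<^sub>\<Lambda> dl c (w \<cdot> g) \<in> P n" unfolding P_def mem_Collect_eq
  proof (intro conjI exI[of _ \<delta>] ballI gd)
   show "dl c (v \<cdot> g) \<ominus>\<^sub>\<Lambda> dl c (w \<cdot> g) \<in> carrier \<Lambda>" using c vG gG wg by simp
   show "vz (W (Suc n)) ((dl c (v \<cdot> g) \<ominus>\<^sub>\<Lambda> dl c (w \<cdot> g)) \<ominus>\<^sub>\<Lambda> \<Delta> \<delta>)"
    unfolding De vz_def using W(1) c vG gG wg by (auto simp: r_right_minus_eq)
  qed
  from P_add[OF this 1] have "(dl c (v \<cdot> g) \<ominus>\<^sub>\<Lambda> dl c (w \<cdot> g)) \<oplus>\<^sub>\<Lambda> (dl c (w \<cdot> g) \<ominus>\<^sub>\<Lambda> dl c g) \<in> P n" .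
  moreover have "(dl c (v \<cdot> g) \<ominus>\<^sub>\<Lambda> dl c (w \<cdot> g)) \<oplus>\<^sub>\<Lambda> (dl c (w \<cdot> g) \<ominus>\<^sub>\<Lambda> dl c g) = dl c (v \<cdot> g) \<ominus>\<^sub>\<Lambda> dl c g"
   using c vG gG wg by (simp add: a_minus_def L.a_assoc L.r_neg1)
  ultimately show ?case by simp
 qed
 from this[of j N v] show ?thesis using nj v by simp
qed

lemma vanishing_in_P:
 assumes "x \<in> carrier \<Lambda>" "Hs x" "vz (W n) x" shows "x \<in> P n"
 using assms
proof (induct "card {A \<in> carrier (G Mod W (Suc n)). x (W (Suc n)) A \<noteq> \<zero>}" arbitrary: x rule: less_induct)
 case less
 define V U where "V = W (Suc n)" "U = W n"
 have VU: "V \<in> \<U>" "U \<in> \<U>" "V \<subseteq> U" using W by (auto simp: V_U_def)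
 define sp where "sp x = {A \<in> carrier (G Mod V). x V A \<noteq> \<zero>}" for x :: "'c set => 'c set => 'a"
 have sp_fin: "finite (sp x)" for x using Mod_finite[OF VU(1)] by (simp add: sp_def)
 show ?case
 proof (cases "vz V x")
  case True thus ?thesis using P_vz less V_U_def by simp
 next
  case False
  then obtain g where g: "g \<in> carrier G" "x V (V #>\<^sub>G g) \<noteq> \<zero>" unfolding vz_def by blast
  then obtain a where a: "a \<in> V #>\<^sub>G g" "a \<in> H" using less(3) VU(1) unfolding Hs_def by blast
  have aG: "a \<in> carrier G" using a HG by blast
  have ga: "V #>\<^sub>G g = V #>\<^sub>G a" using coset_mem_eq[OF VU(1) g(1) a(1)] .
  define c where "c = x V (V #>\<^sub>G a)"
  have cR: "c \<in> carrier R" "c \<noteq> \<zero>" using less(2) VU aG g(2) ga by (auto simp: c_def)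
  have "\<exists>A\<in>fib V U a. A \<noteq> V #>\<^sub>G a \<and> x V A \<noteq> \<zero>"
  proof (rule ccontr)
   assume n: "\<not> ?thesis"
   have "x U (U #>\<^sub>G a) = (\<Oplus>A\<in>fib V U a. x V A)" using L_compat[OF less(2) VU aG] by simp
   also have "\<dots> = (\<Oplus>A\<in>fib V U a. if V #>\<^sub>G a = A then x V A else \<zero>)"
    using n less(2) L_closed'[OF less(2) VU(1)] by (intro add.finprod_cong') auto
   also have "\<dots> = c" unfolding c_def
    using fib_finite[OF VU(1)] fib_iff[OF VU(1,2,3) aG] L_closed'[OF less(2) VU(1)]
    by (intro add.finprod_singleton) auto
   finally show False using cR(2) less(4) aG unfolding vz_def V_U_def by simp
  qed
  then obtain A where A: "A \<in> fib V U a" "A \<noteq> V #>\<^sub>G a" "x V A \<noteq> \<zero>" by blast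
  obtain h where h: "h \<in> carrier G" "A = V #>\<^sub>G h" "U #>\<^sub>G h = U #>\<^sub>G a" using fib_ex[OF VU A(1)] by blast
  obtain b where b: "b \<in> V #>\<^sub>G h" "b \<in> H" using less(3) VU(1) h(1) A(3) unfolding Hs_def h(2) by blast
  have bG: "b \<in> carrier G" using b HG by blast
  have hb: "V #>\<^sub>G h = V #>\<^sub>G b" using coset_mem_eq[OF VU(1) h(1) b(1)] .
  have "h \<cdot> inv\<^sub>G b \<in> U" using coset_eq_iff[OF VU(1) h(1) bG] hb VU(3) by blast
  hence Uab: "U #>\<^sub>G a = U #>\<^sub>G b" using coset_eq_iff[OF VU(2) h(1) bG] h(3) by simp
  define v where "v = a \<cdot> inv\<^sub>G b"
  have v: "v \<in> H" "v \<in> B n" "v \<cdot> b = a"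
   using subgroup.m_closed[OF H a(2) subgroup.m_inv_closed[OF H b(2)]] Uab coset_eq_iff[OF VU(2) aG bG] W(2)[of n] aG bG
   by (auto simp: v_def V_U_def G.m_assoc)
  define y where "y = dl c a \<ominus>\<^sub>\<Lambda> dl c b"
  have yP: "y \<in> P n" using translate_in_P[OF cR(1) b(2) order_refl v(1,2)] v(3) by (simp add: y_def)
  have yL: "y \<in> carrier \<Lambda>" using cR aG bG by (simp add: y_def)
  have yev: "y V' (V' #>\<^sub>G g) = (if V' #>\<^sub>G g = V' #>\<^sub>G a then c else \<zero>) \<ominus> (if V' #>\<^sub>G g = V' #>\<^sub>G b then c else \<zero>)" if "V' \<in> \<U>" for V' g
   unfolding y_def using cR aG bG that by simp
  define z where "z = x \<ominus>\<^sub>\<Lambda> y"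
  have zL: "z \<in> carrier \<Lambda>" using less(2) yL by (simp add: z_def)
  have zH: "Hs z" unfolding z_def y_def using less a b cR aG bG by (intro Hs_diff Hs_dl) auto
  have zU: "vz U z" unfolding vz_def
  proof
   fix k assume k: "k \<in> carrier G"
   have "y U (U #>\<^sub>G k) = \<zero>" unfolding yev[OF VU(2)] Uab using cR by (simp add: minus_self)
   moreover have "x U (U #>\<^sub>G k) = \<zero>" using less(4) k by (simp add: vz_def V_U_def)
   ultimately show "z U (U #>\<^sub>G k) = \<zero>" unfolding z_def using less(2) yL VU by (simp add: minus_self)
  qed
  have "V #>\<^sub>G a \<in> sp x" using aG VU cR by (simp add: sp_def c_def)
  moreover have "sp z \<subseteq> sp x - {V #>\<^sub>G a}"
  proof
   fix C assume C: "C \<in> sp z"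
   then obtain k where k: "k \<in> carrier G" "C = V #>\<^sub>G k" using coset_ex[of C V] by (auto simp: sp_def)
   have zk: "z V C = x V C \<ominus> y V C" unfolding z_def using less(2) yL VU by simp
   have nz: "z V C \<noteq> \<zero>" using C by (simp add: sp_def)
   have xR: "x V C \<in> carrier R" using L_closed'[OF less(2) VU(1)] .
   have ab: "V #>\<^sub>G a \<noteq> V #>\<^sub>G b" using A(2) h(2) hb by simp
   have "C \<noteq> V #>\<^sub>G a"
   proof
    assume e: "C = V #>\<^sub>G a"
    have "y V C = c" using yev[OF VU(1), of a] ab cR e by (simp add: a_minus_def)
    thus False using nz zk e cR by (simp add: c_def minus_self)
   qed
   moreover have "x V C \<noteq> \<zero>"
   proof (cases "C = V #>\<^sub>G b")
    case True thus ?thesis using A(3) h(2) hb by simp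
   next
    case False
    hence "y V C = \<zero>" using yev[OF VU(1), of k] k(2) calculation by (simp add: a_minus_def)
    thus ?thesis using nz zk xR by (auto simp: minus_self)
   qed
   ultimately show "C \<in> sp x - {V #>\<^sub>G a}" using C by (auto simp: sp_def)
  qed
  ultimately have "card (sp z) < card (sp x)" using sp_fin by (metis card_Diff1_less card_mono finite_Diff le_less_trans)
  hence "z \<in> P n" using less(1)[of z] zL zH zU by (simp add: sp_def V_U_def)
  from P_add[OF this yP] have "z \<oplus>\<^sub>\<Lambda> y \<in> P n" .
  moreover have "z \<oplus>\<^sub>\<Lambda> y = x" unfolding z_def using less(2) yL by (simp add: a_minus_def L.a_assoc L.l_neg)
  ultimately show ?thesis by simp
 qed
qed

lemma vanishing_eq_Delta:
 assumes "x \<in> carrier \<Lambda>" "Hs x" "vz (W 0) x" shows "\<exists>D. (\<forall>s\<in>S. D s \<in> carrier \<Lambda>) \<and> x = \<Delta> D"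
proof -
 define I where "I n y \<longleftrightarrow> y \<in> carrier \<Lambda> \<and> Hs y \<and> vz (W n) y" for n y
 have "\<exists>\<delta>. I n y --> (\<forall>s\<in>S. good n (\<delta> s)) \<and> I (Suc n) (y \<ominus>\<^sub>\<Lambda> \<Delta> \<delta>)" for n y
 proof (cases "I n y")
  case True
  then obtain \<delta> where d: "\<forall>s\<in>S. good n (\<delta> s)" "vz (W (Suc n)) (y \<ominus>\<^sub>\<Lambda> \<Delta> \<delta>)"
   using vanishing_in_P[of y n] unfolding I_def P_def by auto
  have c: "\<And>s. s \<in> S ==> \<delta> s \<in> carrier \<Lambda> \<and> Hs (\<delta> s)" using d(1) by (simp add: good_def)
  have "I (Suc n) (y \<ominus>\<^sub>\<Lambda> \<Delta> \<delta>)" using d(2) c True unfolding I_def by (auto intro!: Hs_diff Hs_Delta)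
  thus ?thesis using d(1) by blast
 qed simp
 then obtain F where F: "\<And>n y. I n y ==> (\<forall>s\<in>S. good n (F n y s)) \<and> I (Suc n) (y \<ominus>\<^sub>\<Lambda> \<Delta> (F n y))" by metis
 define Y where "Y = rec_nat x (\<lambda>n y. y \<ominus>\<^sub>\<Lambda> \<Delta> (F n y))"
 define \<delta> where "\<delta> n = F n (Y n)" for n
 have Y0: "Y 0 = x" and YS: "Y (Suc n) = Y n \<ominus>\<^sub>\<Lambda> \<Delta> (\<delta> n)" for n by (simp_all add: Y_def \<delta>_def)
 have YI: "I n (Y n)" for n
  by (induct n) (use assms F in \<open>auto simp: Y0 YS \<delta>_def I_def\<close>)
 have dg: "good n (\<delta> n s)" if "s \<in> S" for n s using F[OF YI] that by (simp add: \<delta>_def)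
 have dc: "\<delta> n s \<in> carrier \<Lambda>" if "s \<in> S" for n s using dg[OF that] good_closed by blast
 define Q where "Q s = rec_nat \<zero>\<^sub>\<Lambda> (\<lambda>n q. q \<oplus>\<^sub>\<Lambda> \<delta> n s)" for s
 have Q0: "Q s 0 = \<zero>\<^sub>\<Lambda>" and QS: "Q s (Suc n) = Q s n \<oplus>\<^sub>\<Lambda> \<delta> n s" for s n by (simp_all add: Q_def)
 have Qc: "Q s n \<in> carrier \<Lambda>" if "s \<in> S" for s n by (induct n) (use dc that in \<open>auto simp: Q0 QS\<close>)
 have xQ: "x = Y n \<oplus>\<^sub>\<Lambda> \<Delta> (\<lambda>s. Q s n)" for n
 proof (induct n)
  case 0 show ?case using assms(1) Delta_zero by (simp add: Q0 Y0)
 next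
  case (Suc n)
  have "\<Delta> (\<lambda>s. Q s (Suc n)) = \<Delta> (\<lambda>s. Q s n) \<oplus>\<^sub>\<Lambda> \<Delta> (\<delta> n)" unfolding QS using Qc dc by (intro Delta_add)
  moreover have "Y n \<in> carrier \<Lambda>" "\<Delta> (\<lambda>s. Q s n) \<in> carrier \<Lambda>" "\<Delta> (\<delta> n) \<in> carrier \<Lambda>" using YI Qc dc by (auto simp: I_def)
  ultimately have "Y (Suc n) \<oplus>\<^sub>\<Lambda> \<Delta> (\<lambda>s. Q s (Suc n)) = Y n \<oplus>\<^sub>\<Lambda> \<Delta> (\<lambda>s. Q s n)" unfolding YS
   by (simp add: a_minus_def L.a_assoc L.l_neg L.a_lcomm[of "\<ominus>\<^bsub>\<Lambda>\<^esub> \<Delta> (\<delta> n)" "\<Delta> (\<lambda>s. Q s n)" "\<Delta> (\<delta> n)"])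
  thus ?case using Suc by simp
 qed
 have "\<exists>j. U \<in> \<U> --> B j \<subseteq> U" for U using base by blast
 then obtain e where e: "\<And>U. U \<in> \<U> ==> B (e U) \<subseteq> U" by metis
 have es: "\<forall>s\<in>S. s [^]\<^bsub>G\<^esub> (p ^ e U) \<in> U" if "U \<in> \<U>" for U using SB e[OF that] by blast
 have lim: "\<exists>y. y \<in> carrier R \<and> (\<forall>n\<ge>e U. dv (n - e U) (y \<ominus> Q s n U A))" if s: "s \<in> S" and U: "U \<in> \<U>" and A: "A \<in> carrier (G Mod U)" for s U A
 proof -
  obtain g where g: "g \<in> carrier G" "A = U #>\<^sub>G g" using coset_ex[OF A] by blast
  have "\<exists>y\<in>carrier R. \<forall>n\<ge>e U. dv (n - e U) (y \<ominus> Q s n U A)"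
  proof (rule limit_exists)
   show "Q s n U A \<in> carrier R" for n using L_closed'[OF Qc[OF s] U] .
   fix n assume n: "e U \<le> n"
   have "Q s (Suc n) U A \<ominus> Q s n U A = \<delta> n s U A" unfolding QS using U L_closed'[OF Qc[OF s] U] L_closed'[OF dc[OF s] U]
    by (simp add: add_diff_self)
   thus "dv (n - e U) (Q s (Suc n) U A \<ominus> Q s n U A)" using dg[OF s, of n] es[OF U] n U g unfolding good_def by auto
  qed
  thus ?thesis by blast
 qed
 define D where "D s = (\<lambda>U\<in>\<U>. \<lambda>A. if A \<in> carrier (G Mod U) then SOME y. y \<in> carrier R \<and> (\<forall>n\<ge>e U. dv (n - e U) (y \<ominus> Q s n U A)) else \<zero>)" for s
 have D: "D s U A \<in> carrier R \<and> (\<forall>n\<ge>e U. dv (n - e U) (D s U A \<ominus> Q s n U A))" if "s \<in> S" "U \<in> \<U>" "A \<in> carrier (G Mod U)" for s U A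
  using someI_ex[OF lim[OF that]] that by (simp add: D_def)
 have DQ: "dv m (D s U A \<ominus> Q s n U A)" if "s \<in> S" "U \<in> \<U>" "A \<in> carrier (G Mod U)" "m + e U \<le> n" for s U A m n
  using D[OF that(1-3)] that(4) by (auto intro: dv_mono[of "n - e U"])
 have Dc: "D s \<in> carrier \<Lambda>" if s: "s \<in> S" for s
  unfolding Lambda_iff
 proof (intro conjI ballI allI impI)
  show "D s \<in> extensional \<U>" by (simp add: D_def)
  fix U assume U: "U \<in> \<U>"
  show "D s U (U #>\<^sub>G g) \<in> carrier R" if "g \<in> carrier G" for g using D s U that by simp
  show "D s U A = \<zero>" if "A \<notin> carrier (G Mod U)" for A using U that by (simp add: D_def)
  fix V g assume V: "V \<in> \<U>" "U \<subseteq> V" "g \<in> carrier G"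
  have fc: "A \<in> carrier (G Mod U)" if "A \<in> fib U V g" for A using that by (simp add: fib_def)
  show "(\<Oplus>A\<in>fib U V g. D s U A) = D s V (V #>\<^sub>G g)"
  proof (rule dv_eq)
   show "(\<Oplus>A\<in>fib U V g. D s U A) \<in> carrier R" using D[OF s U fc] by (intro finsum_closed) auto
   show DV: "D s V (V #>\<^sub>G g) \<in> carrier R" using D s V by simp
   fix m
   define n where "n = m + e U + e V"
   have 1: "dv m ((\<Oplus>A\<in>fib U V g. D s U A) \<ominus> (\<Oplus>A\<in>fib U V g. Q s n U A))"
    using D[OF s U fc] DQ[OF s U fc, of _ m n] L_closed'[OF Qc[OF s] U] fib_finite[OF U] by (intro dv_finsum_diff) (auto simp: n_def)
   have 2: "dv m (D s V (V #>\<^sub>G g) \<ominus> Q s n V (V #>\<^sub>G g))" using V s by (intro DQ) (auto simp: n_def)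
   have 3: "(\<Oplus>A\<in>fib U V g. D s U A) \<in> carrier R" using D[OF s U fc] by (intro finsum_closed) auto
   show "dv m ((\<Oplus>A\<in>fib U V g. D s U A) \<ominus> D s V (V #>\<^sub>G g))"
    by (rule dv_trans[OF 1[unfolded L_compat[OF Qc[OF s] U V]] 2 3 L_closed[OF Qc[OF s] V(1,3)] DV])
  qed
 qed
 have "x = \<Delta> D"
 proof (rule L_eqI[OF assms(1) Delta_closed[OF Dc]])
  fix U g assume U: "U \<in> \<U>" and g: "g \<in> carrier G"
  have xc: "x U (U #>\<^sub>G g) \<in> carrier R" "\<Delta> D U (U #>\<^sub>G g) \<in> carrier R" using assms(1) Dc U g by auto
  have "dv m (\<Delta> D U (U #>\<^sub>G g) \<ominus> x U (U #>\<^sub>G g))" for m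
  proof -
   define n where "n = m + e U"
   have "W n \<subseteq> U" using W(2)[of n] B_anti[of "e U" n] e[OF U] by (auto simp: n_def)
   hence "vz U (Y n)" using YI[of n] vz_mono[of "Y n" "W n" U] W(1) U by (auto simp: I_def)
   moreover have "Y n \<in> carrier \<Lambda>" "\<Delta> (\<lambda>s. Q s n) \<in> carrier \<Lambda>" using YI Qc by (auto simp: I_def)
   ultimately have "x U (U #>\<^sub>G g) = \<Delta> (\<lambda>s. Q s n) U (U #>\<^sub>G g)"
    using g U by (subst xQ[of n]) (auto simp: vz_def)
   also have "\<dots> = (\<Oplus>s\<in>S. Q s n U (U #>\<^sub>G (inv\<^sub>G s \<cdot> g)) \<ominus> Q s n U (U #>\<^sub>G g))"
    using Qc U g by (intro Delta_ev)
   finally have 1: "x U (U #>\<^sub>G g) = \<dots>" .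
   have 2: "\<Delta> D U (U #>\<^sub>G g) = (\<Oplus>s\<in>S. D s U (U #>\<^sub>G (inv\<^sub>G s \<cdot> g)) \<ominus> D s U (U #>\<^sub>G g))"
    using Dc U g by (intro Delta_ev)
   show ?thesis unfolding 1 2
   proof (rule dv_finsum_diff[OF S(1)])
    fix s assume s: "s \<in> S"
    have sg: "inv\<^sub>G s \<cdot> g \<in> carrier G" using SG[OF s] g by simp
    define a b a' b' where "a = D s U (U #>\<^sub>G (inv\<^sub>G s \<cdot> g))" "b = D s U (U #>\<^sub>G g)"
     "a' = Q s n U (U #>\<^sub>G (inv\<^sub>G s \<cdot> g))" "b' = Q s n U (U #>\<^sub>G g)"
    have c: "a \<in> carrier R" "b \<in> carrier R" "a' \<in> carrier R" "b' \<in> carrier R"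
     unfolding a_b_a'_b'_def using Dc[OF s] Qc[OF s] U g sg by auto
    have "dv m (a \<ominus> a')" "dv m (b \<ominus> b')" unfolding a_b_a'_b'_def using s U g sg by (auto intro!: DQ simp: n_def)
    from dv_diff[OF this] have "dv m ((a \<ominus> a') \<ominus> (b \<ominus> b'))" .
    moreover have "(a \<ominus> b) \<ominus> (a' \<ominus> b') = (a \<ominus> a') \<ominus> (b \<ominus> b')" using c by algebra
    ultimately have "a \<ominus> b \<in> carrier R \<and> a' \<ominus> b' \<in> carrier R \<and> dv m ((a \<ominus> b) \<ominus> (a' \<ominus> b'))" using c by simp
    thus "D s U (U #>\<^sub>G (inv\<^sub>G s \<cdot> g)) \<ominus> D s U (U #>\<^sub>G g) \<in> carrier R \<and> Q s n U (U #>\<^sub>G (inv\<^sub>G s \<cdot> g)) \<ominus> Q s n U (U #>\<^sub>G g) \<in> carrier R \<and>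
     dv m ((D s U (U #>\<^sub>G (inv\<^sub>G s \<cdot> g)) \<ominus> D s U (U #>\<^sub>G g)) \<ominus> (Q s n U (U #>\<^sub>G (inv\<^sub>G s \<cdot> g)) \<ominus> Q s n U (U #>\<^sub>G g)))"
     unfolding a_b_a'_b'_def .
   qed
  qed
  thus "x U (U #>\<^sub>G g) = \<Delta> D U (U #>\<^sub>G g)" using dv_eq[OF xc(2,1)] by simp
 qed
 thus ?thesis using Dc by blast
qed

theorem H_supported_decomposition:
 "\<exists>F. finite F \<and> F \<subseteq> H \<and> (\<forall>x\<in>carrier \<Lambda>. Hs x -->
   (\<exists>c\<in>F \<rightarrow> carrier R. \<exists>D\<in>S \<rightarrow> carrier \<Lambda>. x = (\<Oplus>\<^bsub>\<Lambda>\<^esub>h\<in>F. dl (c h) h) \<oplus>\<^sub>\<Lambda> \<Delta> D))"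
proof -
 define V where "V = W 0"
 have V: "V \<in> \<U>" using W by (simp add: V_def)
 define C where "C = {A \<in> carrier (G Mod V). A \<inter> H \<noteq> {}}"
 have "\<exists>h. A \<in> C --> h \<in> A \<inter> H" for A by (auto simp: C_def)
 then obtain r where r: "\<And>A. A \<in> C ==> r A \<in> A \<inter> H" by metis
 have rV: "V #>\<^sub>G r A = A" if A: "A \<in> C" for A
 proof -
  obtain g where g: "g \<in> carrier G" "A = V #>\<^sub>G g" using coset_ex[of A V] A by (auto simp: C_def)
  thus ?thesis using coset_mem_eq[OF V g(1), of "r A"] r[OF A] by auto
 qed
 define F where "F = r ` C"
 have F: "finite F" "F \<subseteq> H" using r Mod_finite[OF V] by (auto simp: F_def C_def)
 have FG: "h \<in> carrier G" if "h \<in> F" for h using that F HG by blast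
 have "\<exists>c\<in>F \<rightarrow> carrier R. \<exists>D\<in>S \<rightarrow> carrier \<Lambda>. x = (\<Oplus>\<^bsub>\<Lambda>\<^esub>h\<in>F. dl (c h) h) \<oplus>\<^sub>\<Lambda> \<Delta> D" if x: "x \<in> carrier \<Lambda>" "Hs x" for x
 proof -
  define c where "c h = x V (V #>\<^sub>G h)" for h
  have c: "c \<in> F \<rightarrow> carrier R" using FG x V by (auto simp: c_def)
  define y where "y = (\<Oplus>\<^bsub>\<Lambda>\<^esub>h\<in>F. dl (c h) h)"
  have yL: "y \<in> carrier \<Lambda>" unfolding y_def using c FG by (intro L.finsum_closed) (auto simp: Pi_iff)
  have yH: "Hs y" unfolding y_def using c FG F by (intro Hs_finsum) (auto intro!: Hs_dl simp: Pi_iff)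
  have "vz V (x \<ominus>\<^sub>\<Lambda> y)" unfolding vz_def
  proof
   fix g assume g: "g \<in> carrier G"
   have yg: "y V (V #>\<^sub>G g) = (\<Oplus>h\<in>F. dl (c h) h V (V #>\<^sub>G g))" unfolding y_def using F c FG V by (intro finsum_ev) (auto simp: Pi_iff)
   have "y V (V #>\<^sub>G g) = x V (V #>\<^sub>G g)"
   proof (cases "V #>\<^sub>G g \<in> C")
    case True
    have rr: "r (V #>\<^sub>G g) = h" if "h \<in> F" "V #>\<^sub>G g = V #>\<^sub>G h" for h
     using that rV unfolding F_def by auto
    have "(\<Oplus>h\<in>F. dl (c h) h V (V #>\<^sub>G g)) = (\<Oplus>h\<in>F. if r (V #>\<^sub>G g) = h then c h else \<zero>)"
     using rr rV[OF True] V c by (intro add.finprod_cong') auto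
    also have "\<dots> = c (r (V #>\<^sub>G g))" using True F c by (intro add.finprod_singleton) (auto simp: F_def)
    finally show ?thesis unfolding yg using rV[OF True] by (simp add: c_def)
   next
    case False
    have "V #>\<^sub>G g \<noteq> V #>\<^sub>G h" if h: "h \<in> F" for h
    proof
     assume e: "V #>\<^sub>G g = V #>\<^sub>G h"
     have "h \<in> V #>\<^sub>G g" unfolding e using G.rcos_self[OF FG[OF h] U_subgroup[OF V]] .
     hence "V #>\<^sub>G g \<in> C" using h F(2) g V by (auto simp: C_def)
     thus False using False by blast
    qed
    hence "(\<Oplus>h\<in>F. dl (c h) h V (V #>\<^sub>G g)) = (\<Oplus>h\<in>F. \<zero>)" using V by (intro add.finprod_cong') auto
    moreover have "x V (V #>\<^sub>G g) = \<zero>" using x(2) V g False unfolding Hs_def C_def by auto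
    ultimately show ?thesis unfolding yg by simp
   qed
   thus "(x \<ominus>\<^sub>\<Lambda> y) V (V #>\<^sub>G g) = \<zero>" using x yL V g by (simp add: minus_self)
  qed
  then obtain D where D: "\<forall>s\<in>S. D s \<in> carrier \<Lambda>" "x \<ominus>\<^sub>\<Lambda> y = \<Delta> D"
   using vanishing_eq_Delta[of "x \<ominus>\<^sub>\<Lambda> y"] x yL yH Hs_diff by (auto simp: V_def)
  have "x = y \<oplus>\<^sub>\<Lambda> (x \<ominus>\<^sub>\<Lambda> y)" using x(1) yL by (simp add: a_minus_def L.a_lcomm L.r_neg)
  thus ?thesis using c D by (intro bexI[of _ c] bexI[of _ D]) (auto simp: y_def)
 qed
 thus ?thesis using F by blast
qed

end

context padic
begin

lemma eval_replicate_zero: "b \<in> carrier Q ==> set as \<subseteq> carrier Q ==> Q.eval (replicate k \<^bold>0 @ as) b = Q.eval as b"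
 by (induct k) (auto simp: Q.eval_in_carrier)

lemma eval_zeros: "b \<in> carrier Q ==> Q.eval (replicate k \<^bold>0) b = \<^bold>0"
 by (induct k) auto

lemma eval_monomial: "b \<in> carrier Q ==> a \<in> carrier Q ==> Q.eval (replicate k \<^bold>0 @ a # replicate i \<^bold>0) b = a \<^bold>* b [^]\<^bsub>Q\<^esub> i"
 by (subst eval_replicate_zero) (auto simp: eval_zeros)

lemma eval_map2_add:
 "length as = length bs ==> set as \<subseteq> carrier Q ==> set bs \<subseteq> carrier Q ==> b \<in> carrier Q ==>
  Q.eval (map2 (\<^bold>+) as bs) b = Q.eval as b \<^bold>+ Q.eval bs b"
proof (induct as bs rule: list_induct2)
 case (Cons x xs y ys)
 have "Q.eval xs b \<in> carrier Q" "Q.eval ys b \<in> carrier Q" "b [^]\<^bsub>Q\<^esub> length ys \<in> carrier Q" using Cons by (auto simp: Q.eval_in_carrier)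
 thus ?case using Cons by (simp add: Q.l_distr Q.a_ac)
qed simp

lemma finite_roots_monic:
 assumes "set as \<subseteq> carrier Q" shows "finite {b \<in> carrier Q. Q.eval (\<^bold>1 # as) b = \<^bold>0}"
proof -
 have "polynomial\<^bsub>Q\<^esub> (carrier Q) (\<^bold>1 # as)" using assms by (simp add: polynomial_def)
 hence "\<^bold>1 # as \<in> carrier (poly_ring Q)" using univ_poly_carrier by blast
 from Q.finite_number_of_roots[OF this] show ?thesis unfolding Q.is_root_def by (rule rev_finite_subset) auto
qed

end

context zmod
begin

lemma eval_Z: "set as \<subseteq> carrier Z ==> b \<in> carrier Z ==> Q.eval as b \<in> carrier Z"
 by (induct as) auto

lemma recurrence_annihilator:
 assumes E: "finite E" "E \<subseteq> carrier M" and F: "F \<subseteq> carrier M" and gen: "\<And>y. y \<in> carrier M ==> y \<in> zspan (E \<union> F)"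
  and x: "\<And>i::nat. x i \<in> carrier M"
 shows "\<exists>Bad. finite Bad \<and> (\<forall>b\<in>carrier Z - Bad. \<forall>Y. F \<subseteq> zspan Y --> (\<forall>i. x i \<ominus> (b [^]\<^bsub>Q\<^esub> i) \<odot> x 0 \<in> zspan Y) -->
  (\<exists>a\<in>carrier Z. a \<noteq> \<^bold>0 \<and> a \<odot> x 0 \<in> zspan Y))"
proof -
 obtain d where d: "x d \<in> zspan (x ` {..<d} \<union> F)" using zspan_noetherian[OF E F, of x] gen x by blast
 define C where "C b Y \<longleftrightarrow> b \<in> carrier Z \<and> F \<subseteq> zspan Y \<and> (\<forall>i. x i \<ominus> (b [^]\<^bsub>Q\<^esub> i) \<odot> x 0 \<in> zspan Y)" for b Y
 define N where "N = {y \<in> carrier M. \<exists>as. length as = d \<and> set as \<subseteq> carrier Z \<and>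
  (\<forall>b Y. C b Y --> y \<ominus> Q.eval as b \<odot> x 0 \<in> zspan Y)}"
 have Cb: "b \<in> carrier Z" "b \<in> carrier Q" if "C b Y" for b Y using that by (auto simp: C_def)
 have NI: "y \<in> N" if "y \<in> carrier M" "length as = d" "set as \<subseteq> carrier Z" "\<And>b Y. C b Y ==> y \<ominus> Q.eval as b \<odot> x 0 \<in> zspan Y" for y as
  using that unfolding N_def mem_Collect_eq by (intro conjI exI[of _ as]) auto
 have ZQ: "set as \<subseteq> carrier Q" if "set as \<subseteq> carrier Z" for as using that by auto
 have "\<ominus> x d \<in> N" using zspan_uminus[OF d]
 proof (rule zspan_least)
  show "\<zero> \<in> N"
   by (rule NI[of _ "replicate d \<^bold>0"]) (use x Cb in \<open>auto simp: eval_zeros intro!: zspan_diff zspan_zero\<close>)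
 next
  fix a z assume a: "a \<in> carrier Z" and z: "z \<in> x ` {..<d} \<union> F" "z \<in> carrier M"
  show "a \<odot> z \<in> N"
  proof (cases "z \<in> F")
   case True
   have "a \<odot> z \<in> zspan Y" if "C b Y" for b Y using that True a zspan_smult by (auto simp: C_def)
   thus ?thesis
    by (intro NI[of _ "replicate d \<^bold>0"]) (use x Cb a z in \<open>auto simp: eval_zeros intro!: zspan_diff zspan_zero\<close>)
  next
   case False
   then obtain i where i: "i < d" "z = x i" using z by blast
   show ?thesis
   proof (rule NI[of _ "replicate (d - Suc i) \<^bold>0 @ a # replicate i \<^bold>0"])
    fix b Y assume C: "C b Y"
    have bi: "b [^]\<^bsub>Q\<^esub> i \<in> carrier Z" using Cb[OF C] by simp
    have "a \<odot> (x i \<ominus> (b [^]\<^bsub>Q\<^esub> i) \<odot> x 0) \<in> zspan Y" using C a zspan_smult by (auto simp: C_def)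
    moreover have "a \<odot> (x i \<ominus> (b [^]\<^bsub>Q\<^esub> i) \<odot> x 0) = a \<odot> x i \<ominus> (a \<^bold>* b [^]\<^bsub>Q\<^esub> i) \<odot> x 0"
     using a bi x by (simp add: a_minus_def smult_r_distr smult_r_minus smult_assoc_Q)
    ultimately show "a \<odot> z \<ominus> Q.eval (replicate (d - Suc i) \<^bold>0 @ a # replicate i \<^bold>0) b \<odot> x 0 \<in> zspan Y"
     using a Cb[OF C] i by (subst eval_monomial) auto
   qed (use a i x in auto)
  qed
 next
  fix y z assume "y \<in> N" "z \<in> N"
  then obtain as bs where as: "length as = d" "set as \<subseteq> carrier Z" "\<And>b Y. C b Y ==> y \<ominus> Q.eval as b \<odot> x 0 \<in> zspan Y"
   and bs: "length bs = d" "set bs \<subseteq> carrier Z" "\<And>b Y. C b Y ==> z \<ominus> Q.eval bs b \<odot> x 0 \<in> zspan Y" and yz: "y \<in> carrier M" "z \<in> carrier M"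
   unfolding N_def by auto
  show "y \<oplus> z \<in> N"
  proof (rule NI[of _ "map2 (\<^bold>+) as bs"])
   show "set (map2 (\<^bold>+) as bs) \<subseteq> carrier Z" using as(2) bs(2) by (auto intro!: Z_closed_simps(4) dest: set_zip_leftD set_zip_rightD)
   fix b Y assume C: "C b Y"
   define k l where "k = Q.eval as b" "l = Q.eval bs b"
   have kl: "k \<in> carrier Z" "l \<in> carrier Z" using eval_Z as(2) bs(2) Cb[OF C] by (auto simp: k_l_def)
   have "(y \<ominus> k \<odot> x 0) \<oplus> (z \<ominus> l \<odot> x 0) \<in> zspan Y" using zspan_add[OF as(3)[OF C] bs(3)[OF C]] by (simp add: k_l_def)
   moreover have "(y \<ominus> k \<odot> x 0) \<oplus> (z \<ominus> l \<odot> x 0) = (y \<oplus> z) \<ominus> (k \<^bold>+ l) \<odot> x 0"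
    using kl yz x by (simp add: a_minus_def smult_assoc_Q M.minus_add M.a_ac)
   moreover have "Q.eval (map2 (\<^bold>+) as bs) b = k \<^bold>+ l" unfolding k_l_def
    using as bs Cb[OF C] ZQ by (intro eval_map2_add) auto
   ultimately show "(y \<oplus> z) \<ominus> Q.eval (map2 (\<^bold>+) as bs) b \<odot> x 0 \<in> zspan Y" by simp
  qed (use as bs yz in auto)
 qed
 then obtain as where as: "length as = d" "set as \<subseteq> carrier Z" "\<And>b Y. C b Y ==> \<ominus> x d \<ominus> Q.eval as b \<odot> x 0 \<in> zspan Y"
  unfolding N_def by auto
 define Bad where "Bad = {b \<in> carrier Q. Q.eval (\<^bold>1 # as) b = \<^bold>0}"
 have "finite Bad" unfolding Bad_def by (rule finite_roots_monic[OF ZQ[OF as(2)]])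
 moreover have "\<exists>a\<in>carrier Z. a \<noteq> \<^bold>0 \<and> a \<odot> x 0 \<in> zspan Y" if b: "b \<in> carrier Z - Bad" and C: "C b Y" for b Y
 proof -
  define k l where "k = b [^]\<^bsub>Q\<^esub> d" "l = Q.eval as b"
  have kl: "k \<in> carrier Z" "l \<in> carrier Z" using eval_Z as(2) b by (auto simp: k_l_def)
  have kQ: "k \<in> carrier Q" using kl by auto
  have "x d \<ominus> k \<odot> x 0 \<in> zspan Y" using C by (simp add: C_def k_l_def)
  moreover have "\<ominus> x d \<ominus> l \<odot> x 0 \<in> zspan Y" using as(3)[OF C] by (simp add: k_l_def)
  ultimately have "(x d \<ominus> k \<odot> x 0) \<oplus> (\<ominus> x d \<ominus> l \<odot> x 0) \<in> zspan Y" by (rule zspan_add)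
  moreover have "(x d \<ominus> k \<odot> x 0) \<oplus> (\<ominus> x d \<ominus> l \<odot> x 0) = \<ominus> ((k \<^bold>+ l) \<odot> x 0)"
   using kl x[of d] x[of 0] by (simp add: a_minus_def smult_assoc_Q M.minus_add M.a_ac M.r_neg1 M.r_neg2)
  ultimately have "\<ominus> (\<ominus> ((k \<^bold>+ l) \<odot> x 0)) \<in> zspan Y" using zspan_uminus by metis
  hence "(k \<^bold>+ l) \<odot> x 0 \<in> zspan Y" using kl x by simp
  moreover have "k \<^bold>+ l = Q.eval (\<^bold>1 # as) b" using kQ as(1) by (simp add: k_l_def)
  hence "k \<^bold>+ l \<noteq> \<^bold>0" using b unfolding Bad_def by auto
  ultimately show ?thesis using kl by (intro bexI[of _ "k \<^bold>+ l"]) auto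
 qed
 ultimately show ?thesis by (intro exI[of _ Bad] conjI ballI allI impI) (auto simp: C_def)
qed

lemma Z_residues:
 "\<exists>L. finite L \<and> L \<subseteq> carrier Z \<and> (\<forall>a\<in>carrier Z. \<exists>r\<in>L. \<exists>t\<in>carrier Z. a = r \<^bold>+ pp [^]\<^bsub>Z\<^esub> (n::nat) \<^bold>* t)"
proof (induct n)
 case 0
 have "a = \<^bold>0 \<^bold>+ pp [^]\<^bsub>Z\<^esub> (0::nat) \<^bold>* a" if "a \<in> carrier Z" for a using Z_closed[OF that] by simp
 thus ?case by (intro exI[of _ "{\<^bold>0}"] conjI ballI bexI) simp_all
next
 case (Suc n)
 then obtain L where L0: "finite L \<and> L \<subseteq> carrier Z \<and> (\<forall>a\<in>carrier Z. \<exists>r\<in>L. \<exists>t\<in>carrier Z. a = r \<^bold>+ pp [^]\<^bsub>Z\<^esub> n \<^bold>* t)" ..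
 note L = L0[THEN conjunct1] L0[THEN conjunct2, THEN conjunct1] L0[THEN conjunct2, THEN conjunct2, THEN bspec]
 define P where "P = pp [^]\<^bsub>Z\<^esub> n"
 have P: "P \<in> carrier Z" "P \<in> carrier Q" using pp_pow_closed[of n] by (auto simp: P_def)
 define J where "J = (\<lambda>j. rc (of_nat j)) ` {..<p} \<inter> carrier Z"
 define L' where "L' = (\<lambda>(r, j). r \<^bold>+ P \<^bold>* j) ` (L \<times> J)"
 have J: "finite J" "J \<subseteq> carrier Z" by (auto simp: J_def)
 have "finite L'" using L J by (simp add: L'_def)
 moreover have "L' \<subseteq> carrier Z" using L(2) J P by (auto simp: L'_def subset_iff)
 moreover have "\<exists>r\<in>L'. \<exists>t\<in>carrier Z. a = r \<^bold>+ pp [^]\<^bsub>Z\<^esub> Suc n \<^bold>* t" if a: "a \<in> carrier Z" for a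
 proof -
  obtain r t where r: "r \<in> L" "t \<in> carrier Z" "a = r \<^bold>+ P \<^bold>* t" using L(3)[OF a, folded P_def] by (elim bexE) (rule that)
  have tQ: "t \<in> carrier Q" "nrm t \<le> 1" using r(2) by (auto simp: Z_carrier)
  obtain j where j: "j < p" "nrm (t \<^bold>- rc (of_nat j)) \<le> q" using residue[OF tQ] by blast
  define w where "w = rc (of_nat j)"
  have wQ: "w \<in> carrier Q" by (simp add: w_def)
  have q1: "q \<le> 1" using nrm_pp_pow[of 1] pp_closed by (simp add: Z_carrier)
  have tw: "t \<^bold>- w \<in> carrier Z" using tQ wQ order_trans[OF j(2) q1] by (simp add: Z_carrier w_def)
  have "w = t \<^bold>- (t \<^bold>- w)" using tQ(1) wQ by algebra
  moreover have "t \<ominus>\<^bsub>Z\<^esub> (t \<^bold>- w) \<in> carrier Z" using r(2) tw by (rule Z.minus_closed)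
  ultimately have wZ: "w \<in> carrier Z" using Z_minus[OF r(2) tw] by simp
  have "nrm (t \<^bold>- w) \<le> nrm pp" using j(2) nrm_pp_pow[of 1] pp_closed by (auto simp: w_def)
  then obtain s where s: "s \<in> carrier Z" "t \<^bold>- w = s \<otimes>\<^bsub>Z\<^esub> pp" using Z_dvd[OF tw pp_closed] by blast
  have rQ: "r \<in> carrier Q" "s \<in> carrier Q" "pp \<in> carrier Q" using r(1) L(2) s(1) pp_closed by auto
  have "t = w \<^bold>+ (t \<^bold>- w)" using tQ(1) wQ by algebra
  hence "t = w \<^bold>+ s \<^bold>* pp" using s(2) by simp
  hence "a = (r \<^bold>+ P \<^bold>* w) \<^bold>+ (P \<^bold>* pp) \<^bold>* s" unfolding r(3) using rQ wQ P(2) by (simp add: Q.r_distr Q.m_ac Q.a_ac)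
  moreover have "r \<^bold>+ P \<^bold>* w \<in> L'" using r(1) wZ j(1) by (auto simp: L'_def J_def w_def)
  moreover have "pp [^]\<^bsub>Z\<^esub> Suc n = P \<^bold>* pp" by (simp add: P_def)
  ultimately show ?thesis using s(1) by (intro bexI[of _ "r \<^bold>+ P \<^bold>* w"] bexI[of _ s]) simp_all
 qed
 ultimately show ?case by (intro exI[of _ L'] conjI ballI)
qed

lemma finite_quotient:
 assumes E: "finite E" "E \<subseteq> carrier M" and F: "F \<subseteq> zspan Y"
  and a: "\<And>e. e \<in> E ==> \<exists>a\<in>carrier Z. a \<noteq> \<^bold>0 \<and> a \<odot> e \<in> zspan Y"
 shows "\<exists>L. finite L \<and> L \<subseteq> carrier M \<and> (\<forall>y\<in>zspan (E \<union> F). \<exists>l\<in>L. y \<ominus> l \<in> zspan Y)"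
 using E a
proof (induct E rule: finite_induct)
 case empty
 have "y \<ominus> \<zero> \<in> zspan Y" if y: "y \<in> zspan F" for y
 proof -
  have "y \<in> zspan Y" using y F by (rule_tac zspan_zspan[OF y]) blast
  thus ?thesis using zspan_diff[OF _ zspan_zero] by blast
 qed
 thus ?case by (intro exI[of _ "{\<zero>}"]) auto
next
 case (insert e E)
 then obtain L where L: "finite L" "L \<subseteq> carrier M" "\<And>y. y \<in> zspan (E \<union> F) ==> \<exists>l\<in>L. y \<ominus> l \<in> zspan Y" by auto
 have eM: "e \<in> carrier M" using insert by blast
 obtain a where a: "a \<in> carrier Z" "a \<noteq> \<^bold>0" "a \<odot> e \<in> zspan Y" using insert.prems(2)[of e] by auto
 have "nrm a > 0" using a nrm_nonneg[of a] nrm_eq_0[of a] by (auto simp: less_le)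
 moreover have "q < 1" "q > 0" using prime_p prime_gt_1_nat[of p] by (auto simp: q_def)
 ultimately obtain n where n: "q ^ n < nrm a" using real_arch_pow_inv by blast
 have "nrm (pp [^]\<^bsub>Z\<^esub> n) \<le> nrm a" using n by (simp add: nrm_pp_pow del: Z_pow)
 then obtain t where t: "t \<in> carrier Z" "pp [^]\<^bsub>Z\<^esub> n = t \<otimes>\<^bsub>Z\<^esub> a" using Z_dvd[OF pp_pow_closed a(1)] by blast
 define P where "P = pp [^]\<^bsub>Z\<^esub> n"
 have P: "P \<in> carrier Z" using pp_pow_closed[of n] by (simp add: P_def)
 have Pe: "P \<odot> e \<in> zspan Y" unfolding P_def t(2) using zspan_smult[OF a(3) t(1)] smult_assoc_Q[OF t(1) a(1) eM] by simp
 from Z_residues[of n, folded P_def]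
 obtain J where J0: "finite J \<and> J \<subseteq> carrier Z \<and> (\<forall>a\<in>carrier Z. \<exists>r\<in>J. \<exists>t\<in>carrier Z. a = r \<^bold>+ P \<^bold>* t)" ..
 note J = J0[THEN conjunct1] J0[THEN conjunct2, THEN conjunct1] J0[THEN conjunct2, THEN conjunct2, THEN bspec]
 define L' where "L' = (\<lambda>(j, l). j \<odot> e \<oplus> l) ` (J \<times> L)"
 have "\<exists>l\<in>L'. y \<ominus> l \<in> zspan Y" if y: "y \<in> zspan (insert e (E \<union> F))" for y
 proof -
  obtain b z where b: "b \<in> carrier Z" "z \<in> zspan (E \<union> F)" "y = b \<odot> e \<oplus> z" using zspan_insertE[OF y eM] by (elim bexE) (rule that)
  obtain l where l: "l \<in> L" "z \<ominus> l \<in> zspan Y" using L(3)[OF b(2)] by (elim bexE) (rule that)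
  obtain j t where j: "j \<in> J" "t \<in> carrier Z" "b = j \<^bold>+ P \<^bold>* t" using J(3)[OF b(1)] by (elim bexE) (rule that)
  have c: "j \<in> carrier Z" "z \<in> carrier M" "l \<in> carrier M" using j(1) J(2) zspan_carrier[OF b(2)] l(1) L(2) by auto
  have "t \<odot> (P \<odot> e) \<oplus> (z \<ominus> l) \<in> zspan Y" using zspan_add[OF zspan_smult[OF Pe j(2)] l(2)] .
  moreover have "t \<odot> (P \<odot> e) = (P \<^bold>* t) \<odot> e" using smult_assoc_Q(1)[OF j(2) P eM] Q.m_comm[OF Z_closed[OF P] Z_closed[OF j(2)]] by simp
  moreover have "(P \<^bold>* t) \<odot> e \<oplus> (z \<ominus> l) = y \<ominus> (j \<odot> e \<oplus> l)"
  proof -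
   define g h where "g = j \<odot> e" "h = (P \<^bold>* t) \<odot> e"
   have gh: "g \<in> carrier M" "h \<in> carrier M" using c(1) P j(2) eM by (auto simp: g_h_def)
   have "y = (g \<oplus> h) \<oplus> z" unfolding b(3) j(3) g_h_def using c(1) P j(2) eM by (simp add: smult_assoc_Q)
   hence "y \<ominus> (g \<oplus> l) = (g \<oplus> \<ominus> g) \<oplus> (h \<oplus> (z \<oplus> \<ominus> l))"
    using gh c(2,3) by (simp add: a_minus_def M.minus_add M.a_ac)
   thus ?thesis unfolding g_h_def[symmetric] using gh c(2,3) by (simp add: a_minus_def M.r_neg)
  qed
  ultimately show ?thesis using j(1) l(1) by (intro bexI[of _ "j \<odot> e \<oplus> l"]) (auto simp: L'_def)
 qed
 moreover have "finite L'" using J L by (simp add: L'_def)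
 moreover have "L' \<subseteq> carrier M" using J L eM by (auto simp: L'_def)
 ultimately show ?case by auto
qed

theorem finite_quotient_for_almost_all:
 assumes E: "finite E" "E \<subseteq> carrier M" and F: "F \<subseteq> carrier M" and gen: "\<And>y. y \<in> carrier M ==> y \<in> zspan (E \<union> F)"
  and \<tau>: "\<And>m. m \<in> carrier M ==> \<tau> m \<in> carrier M"
 shows "\<exists>Bad. finite Bad \<and> (\<forall>b\<in>carrier Z - Bad. \<forall>Y. F \<subseteq> zspan Y --> (\<forall>m\<in>carrier M. \<tau> m \<ominus> b \<odot> m \<in> zspan Y) -->
  (\<exists>L. finite L \<and> L \<subseteq> carrier M \<and> (\<forall>m\<in>carrier M. \<exists>l\<in>L. m \<ominus> l \<in> zspan Y)))"
proof -
 define x where "x e i = (\<tau> ^^ i) e" for e and i :: nat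
 have xc: "x e i \<in> carrier M" if "e \<in> E" for e i by (induct i) (use that E \<tau> in \<open>auto simp: x_def\<close>)
 have "\<exists>Bad. e \<in> E --> finite Bad \<and> (\<forall>b\<in>carrier Z - Bad. \<forall>Y. F \<subseteq> zspan Y --> (\<forall>i. x e i \<ominus> (b [^]\<^bsub>Q\<^esub> i) \<odot> x e 0 \<in> zspan Y) -->
  (\<exists>a\<in>carrier Z. a \<noteq> \<^bold>0 \<and> a \<odot> x e 0 \<in> zspan Y))" for e
 proof (cases "e \<in> E")
  case True thus ?thesis using recurrence_annihilator[OF E F gen xc[OF True]] by simp
 qed simp
 then obtain Bad where Bad: "\<And>e. e \<in> E ==> finite (Bad e)"
  "\<And>e b Y. [|e \<in> E; b \<in> carrier Z - Bad e; F \<subseteq> zspan Y; \<forall>i. x e i \<ominus> (b [^]\<^bsub>Q\<^esub> i) \<odot> x e 0 \<in> zspan Y|] ==>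
    \<exists>a\<in>carrier Z. a \<noteq> \<^bold>0 \<and> a \<odot> x e 0 \<in> zspan Y" by metis
 show ?thesis
 proof (intro exI[of _ "\<Union>e\<in>E. Bad e"] conjI ballI allI impI)
  show "finite (\<Union>e\<in>E. Bad e)" using E Bad by blast
  fix b Y assume b: "b \<in> carrier Z - (\<Union>e\<in>E. Bad e)" and Y: "F \<subseteq> zspan Y" "\<forall>m\<in>carrier M. \<tau> m \<ominus> b \<odot> m \<in> zspan Y"
  have "\<exists>a\<in>carrier Z. a \<noteq> \<^bold>0 \<and> a \<odot> e \<in> zspan Y" if e: "e \<in> E" for e
  proof -
   have eM: "e \<in> carrier M" using e E by blast
   have "x e i \<ominus> (b [^]\<^bsub>Q\<^esub> i) \<odot> e \<in> zspan Y" for i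
   proof (induct i)
    case 0 show ?case using eM zspan_zero by (simp add: x_def a_minus_def M.r_neg)
   next
    case (Suc i)
    define k where "k = b [^]\<^bsub>Q\<^esub> i"
    have k: "k \<in> carrier Z" "b \<in> carrier Z" using b by (auto simp: k_def)
    define y where "y = x e i"
    have y: "y \<in> carrier M" "\<tau> y \<in> carrier M" using xc[OF e] \<tau> by (auto simp: y_def)
    have kb: "k \<^bold>* b = b \<^bold>* k" using k Z_closed Q.m_comm by blast
    have "\<tau> y \<ominus> b \<odot> y \<in> zspan Y" using Y(2) y by blast
    moreover have "b \<odot> (y \<ominus> k \<odot> e) \<in> zspan Y" using zspan_smult Suc k(2) by (simp add: y_def k_def)
    ultimately have "(\<tau> y \<ominus> b \<odot> y) \<oplus> b \<odot> (y \<ominus> k \<odot> e) \<in> zspan Y" by (rule zspan_add)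
    moreover have "(\<tau> y \<ominus> b \<odot> y) \<oplus> b \<odot> (y \<ominus> k \<odot> e) = \<tau> y \<ominus> (k \<^bold>* b) \<odot> e"
     unfolding kb using y k eM by (simp add: a_minus_def smult_r_distr smult_r_minus smult_assoc_Q M.a_ac M.r_neg1 M.r_neg2)
    ultimately show ?case by (simp add: x_def y_def k_def)
   qed
   thus ?thesis using Bad(2)[OF e _ Y(1), of b] b e by (auto simp: x_def)
  qed
  from finite_quotient[OF E Y(1) this] gen
  show "\<exists>L. finite L \<and> L \<subseteq> carrier M \<and> (\<forall>m\<in>carrier M. \<exists>l\<in>L. m \<ominus> l \<in> zspan Y)" by blast
 qed
qed

end

lemma topological_subgroup:
 assumes tg: "topological_group G T" and H: "subgroup H G"
 shows "topological_group (G\<lparr>carrier := H\<rparr>) (subtopology T H)"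
proof -
 interpret group G using tg by (simp add: topological_group_def)
 have top: "topspace T = carrier G" using tg by (simp add: topological_group_def)
 have HG: "H \<subseteq> carrier G" using subgroup.subset[OF H] .
 have "continuous_map (subtopology T H) T (\<lambda>x. inv\<^bsub>G\<^esub> x)"
  using tg by (simp add: topological_group_def continuous_map_from_subtopology)
 hence "continuous_map (subtopology T H) T (\<lambda>x. inv\<^bsub>G\<lparr>carrier := H\<rparr>\<^esub> x)"
  using HG top m_inv_consistent[OF H] by (rule_tac continuous_map_eq) auto
 hence 1: "continuous_map (subtopology T H) (subtopology T H) (\<lambda>x. inv\<^bsub>G\<lparr>carrier := H\<rparr>\<^esub> x)"
  unfolding continuous_map_in_subtopology using H m_inv_consistent[OF H] subgroup.m_inv_closed[OF H] by auto
 have "continuous_map (prod_topology (subtopology T H) (subtopology T H)) T (\<lambda>(x, y). x \<otimes>\<^bsub>G\<^esub> y)"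
  using tg unfolding subtopology_Times[symmetric] by (simp add: topological_group_def continuous_map_from_subtopology)
 hence 2: "continuous_map (prod_topology (subtopology T H) (subtopology T H)) (subtopology T H) (\<lambda>(x, y). x \<otimes>\<^bsub>G\<^esub> y)"
  unfolding continuous_map_in_subtopology using subgroup.m_closed[OF H] by auto
 show ?thesis unfolding topological_group_def
  using 1 2 HG top subgroup.subgroup_is_group[OF H is_group] by auto
qed

context iwasawa
begin

lemma subgroup_iwasawa:
 assumes "subgroup H G" "closedin T H" shows "iwasawa R (G\<lparr>carrier := H\<rparr>) (subtopology T H)"
proof (intro iwasawa.intro iwasawa_axioms.intro)
 show "group (G\<lparr>carrier := H\<rparr>)" using subgroup.subgroup_is_group[OF assms(1) G.is_group] .
 show "topological_group (G\<lparr>carrier := H\<rparr>) (subtopology T H)" using topological_subgroup[OF tg assms(1)] .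
 show "compact_space (subtopology T H)" using closedin_compact_space[OF cpt assms(2)] by (simp add: compact_space_subtopology)
qed (use R_nontrivial is_cring in auto)

lemma open_normal_subgroup:
 assumes "subgroup H G" "U \<in> \<U>" shows "H \<inter> U \<in> open_normal (G\<lparr>carrier := H\<rparr>) (subtopology T H)"
 using G.normal_Int_subgroup[OF assms(1) U_normal[OF assms(2)]] assms(2) openin_subtopology_Int2[of T U H]
 by (simp add: open_normal_def Int_commute)

lemma restrict_coset [simp]: "A #>\<^bsub>G\<lparr>carrier := H\<rparr>\<^esub> h = A #>\<^bsub>G\<^esub> h" "A <#>\<^bsub>G\<lparr>carrier := H\<rparr>\<^esub> A' = A <#>\<^bsub>G\<^esub> A'"
 by (simp_all add: r_coset_def set_mult_def)

lemma coset_Int_mult: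
 assumes H: "subgroup H G" and U: "U \<in> \<U>" and h: "h \<in> H" shows "((H \<inter> U) #>\<^bsub>G\<^esub> h) <#>\<^bsub>G\<^esub> U = U #>\<^bsub>G\<^esub> h"
proof -
 interpret U: normal U G using U_normal U .
 have hG: "h \<in> carrier G" and HU: "H \<inter> U \<subseteq> carrier G" using subgroup.subset[OF H] h by auto
 have "((H \<inter> U) #>\<^bsub>G\<^esub> h) <#>\<^bsub>G\<^esub> U = (H \<inter> U) <#>\<^bsub>G\<^esub> (h <#\<^bsub>G\<^esub> U)" using HU U.subset hG G.rcos_assoc_lcos by simp
 also have "h <#\<^bsub>G\<^esub> U = U #>\<^bsub>G\<^esub> h" using U.coset_eq hG by simp
 also have "(H \<inter> U) <#>\<^bsub>G\<^esub> (U #>\<^bsub>G\<^esub> h) = ((H \<inter> U) <#>\<^bsub>G\<^esub> U) #>\<^bsub>G\<^esub> h" using HU U.subset hG by (simp add: G.setmult_rcos_assoc)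
 also have "(H \<inter> U) <#>\<^bsub>G\<^esub> U = U"
 proof
  show "(H \<inter> U) <#>\<^bsub>G\<^esub> U \<subseteq> U" using U.m_closed by (auto simp: set_mult_def)
  have "\<one>\<^bsub>G\<^esub> \<in> H \<inter> U" using subgroup.one_closed[OF H] U.one_closed by simp
  thus "U \<subseteq> (H \<inter> U) <#>\<^bsub>G\<^esub> U" using U.subset unfolding set_mult_def by force
 qed
 finally show ?thesis .
qed

lemma of_subgroup_closed:
 assumes H: "subgroup H G" "closedin T H" and l: "l \<in> carrier (Iwasawa_algebra R (G\<lparr>carrier := H\<rparr>) (subtopology T H))"
 shows "Iwasawa_of_subgroup R G T H l \<in> carrier \<Lambda>"
  and "[|U \<in> \<U>; g \<in> carrier G; (U #>\<^bsub>G\<^esub> g) \<inter> H = {}|] ==> Iwasawa_of_subgroup R G T H l U (U #>\<^bsub>G\<^esub> g) = \<zero>"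
proof -
 interpret I: iwasawa R "G\<lparr>carrier := H\<rparr>" "subtopology T H" using subgroup_iwasawa[OF H] .
 define \<theta> where "\<theta> = Iwasawa_of_subgroup R G T H l"
 have HG: "h \<in> carrier G" if "h \<in> H" for h using that subgroup.subset[OF H(1)] by blast
 have N: "H \<inter> U \<in> open_normal (G\<lparr>carrier := H\<rparr>) (subtopology T H)" if "U \<in> \<U>" for U using open_normal_subgroup[OF H(1) that] .
 have cosN: "\<exists>h\<in>H. A = (H \<inter> U) #>\<^bsub>G\<^esub> h" if "A \<in> carrier (G\<lparr>carrier := H\<rparr> Mod (H \<inter> U))" for A U using I.coset_ex[OF that] by simp
 have eqN: "(H \<inter> U) #>\<^bsub>G\<^esub> h = (H \<inter> U) #>\<^bsub>G\<^esub> h' \<longleftrightarrow> U #>\<^bsub>G\<^esub> h = U #>\<^bsub>G\<^esub> h'" if "U \<in> \<U>" "h \<in> H" "h' \<in> H" for U h h'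
  using I.coset_eq_iff[OF N[OF that(1)], of h h'] coset_eq_iff[OF that(1), of h h'] that HG G.m_inv_consistent[OF H(1)]
   subgroup.m_closed[OF H(1)] subgroup.m_inv_closed[OF H(1)] by simp
 have lR: "l (H \<inter> U) A \<in> carrier R" if "U \<in> \<U>" for U A using I.L_closed'[OF l N[OF that]] .
 have ev: "\<theta> U (U #>\<^bsub>G\<^esub> h) = l (H \<inter> U) ((H \<inter> U) #>\<^bsub>G\<^esub> h)" if U: "U \<in> \<U>" and h: "h \<in> H" for U h
 proof -
  have NC: "(H \<inter> U) #>\<^bsub>G\<^esub> h \<in> carrier (G\<lparr>carrier := H\<rparr> Mod (H \<inter> U))" using I.coset_in[OF N[OF U], of h] h by simp
  have "\<theta> U (U #>\<^bsub>G\<^esub> h) = (\<Oplus>x\<in>{x \<in> carrier (G\<lparr>carrier := H\<rparr> Mod (H \<inter> U)). l (H \<inter> U) x \<noteq> \<zero> \<and> x <#>\<^bsub>G\<^esub> U = U #>\<^bsub>G\<^esub> h}. l (H \<inter> U) x)"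
   unfolding \<theta>_def Iwasawa_of_subgroup_def group_ring_map_def using U by simp
  also have "{x \<in> carrier (G\<lparr>carrier := H\<rparr> Mod (H \<inter> U)). l (H \<inter> U) x \<noteq> \<zero> \<and> x <#>\<^bsub>G\<^esub> U = U #>\<^bsub>G\<^esub> h} =
   (if l (H \<inter> U) ((H \<inter> U) #>\<^bsub>G\<^esub> h) = \<zero> then {} else {(H \<inter> U) #>\<^bsub>G\<^esub> h})"
   using NC coset_Int_mult[OF H(1) U] cosN eqN[OF U _ h] h by (auto split: if_splits) metis+
  also have "(\<Oplus>x\<in>\<dots>. l (H \<inter> U) x) = l (H \<inter> U) ((H \<inter> U) #>\<^bsub>G\<^esub> h)" using lR[OF U] by simp
  finally show ?thesis .
 qed
 have ev0: "\<theta> U A = \<zero>" if U: "U \<in> \<U>" and A: "\<And>h. h \<in> H ==> A \<noteq> U #>\<^bsub>G\<^esub> h" for U A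
 proof -
  have "{x \<in> carrier (G\<lparr>carrier := H\<rparr> Mod (H \<inter> U)). l (H \<inter> U) x \<noteq> \<zero> \<and> x <#>\<^bsub>G\<^esub> U = A} = {}"
   using coset_Int_mult[OF H(1) U] cosN A by fastforce
  hence "(\<Oplus>x\<in>{x \<in> carrier (G\<lparr>carrier := H\<rparr> Mod (H \<inter> U)). l (H \<inter> U) x \<noteq> \<zero> \<and> x <#>\<^bsub>G\<^esub> U = A}. l (H \<inter> U) x) = \<zero>"
   by (simp only: finsum_empty)
  thus ?thesis unfolding \<theta>_def Iwasawa_of_subgroup_def group_ring_map_def using U by simp
 qed
 have meets: "(U #>\<^bsub>G\<^esub> g) \<inter> H \<noteq> {}" if "U \<in> \<U>" "h \<in> H" "U #>\<^bsub>G\<^esub> g = U #>\<^bsub>G\<^esub> h" for U g h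
  using that G.rcos_self[OF HG[OF that(2)] U_subgroup[OF that(1)]] by blast
 have z: "\<theta> U (U #>\<^bsub>G\<^esub> g) = \<zero>" if "U \<in> \<U>" "g \<in> carrier G" "(U #>\<^bsub>G\<^esub> g) \<inter> H = {}" for U g
  by (rule ev0[OF that(1)]) (use meets that in blast)
 thus "[|U \<in> \<U>; g \<in> carrier G; (U #>\<^bsub>G\<^esub> g) \<inter> H = {}|] ==> Iwasawa_of_subgroup R G T H l U (U #>\<^bsub>G\<^esub> g) = \<zero>" by (simp add: \<theta>_def)
 have tR: "\<theta> U A \<in> carrier R" if U: "U \<in> \<U>" for U A
 proof (cases "\<exists>h\<in>H. A = U #>\<^bsub>G\<^esub> h")
  case True thus ?thesis using ev[OF U] lR[OF U] by auto
 next
  case False thus ?thesis using ev0[OF U, of A] by auto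
 qed
 have "\<theta> \<in> carrier \<Lambda>" unfolding Lambda_iff
 proof (intro conjI ballI allI impI)
  show "\<theta> \<in> extensional \<U>" by (simp add: \<theta>_def Iwasawa_of_subgroup_def)
  fix U assume U: "U \<in> \<U>"
  show "\<theta> U (U #>\<^bsub>G\<^esub> g) \<in> carrier R" for g using tR[OF U] .
  show "\<theta> U A = \<zero>" if "A \<notin> carrier (G Mod U)" for A using ev0[OF U, of A] that coset_in[OF U HG] by blast
  fix V g assume V: "V \<in> \<U>" "U \<subseteq> V" and g: "g \<in> carrier G"
  show "(\<Oplus>A\<in>fib U V g. \<theta> U A) = \<theta> V (V #>\<^bsub>G\<^esub> g)"
  proof (cases "\<exists>h\<in>H. V #>\<^bsub>G\<^esub> g = V #>\<^bsub>G\<^esub> h")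
   case False
   have "\<theta> U A = \<zero>" if A: "A \<in> fib U V g" for A
   proof (rule ev0[OF U])
    fix h assume h: "h \<in> H"
    show "A \<noteq> U #>\<^bsub>G\<^esub> h" using A False h fib_iff[OF U V HG[OF h], of g] by auto
   qed
   hence "(\<Oplus>A\<in>fib U V g. \<theta> U A) = (\<Oplus>A\<in>fib U V g. \<zero>)" by (intro add.finprod_cong') auto
   moreover have "\<theta> V (V #>\<^bsub>G\<^esub> g) = \<zero>" using ev0[OF V(1)] False by blast
   ultimately show ?thesis by simp
  next
   case True
   then obtain h where h: "h \<in> H" "V #>\<^bsub>G\<^esub> g = V #>\<^bsub>G\<^esub> h" by blast
   define F where "F = I.fib (H \<inter> U) (H \<inter> V) h"
   have NN: "H \<inter> U \<subseteq> H \<inter> V" using V by blast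
   have Fiff: "(H \<inter> U) #>\<^bsub>G\<^esub> k \<in> F \<longleftrightarrow> V #>\<^bsub>G\<^esub> k = V #>\<^bsub>G\<^esub> h" if "k \<in> H" for k
    using I.fib_iff[OF N[OF U] N[OF V(1)] NN, of k h] eqN[OF V(1) that h(1)] that unfolding F_def by simp
   have Fex: "\<exists>k\<in>H. A = (H \<inter> U) #>\<^bsub>G\<^esub> k" if "A \<in> F" for A using cosN that unfolding F_def I.fib_def by blast
   have inj: "inj_on (\<lambda>A. A <#>\<^bsub>G\<^esub> U) F"
   proof (rule inj_onI)
    fix A A' assume A: "A \<in> F" "A' \<in> F" "A <#>\<^bsub>G\<^esub> U = A' <#>\<^bsub>G\<^esub> U"
    obtain k k' where k: "k \<in> H" "A = (H \<inter> U) #>\<^bsub>G\<^esub> k" "k' \<in> H" "A' = (H \<inter> U) #>\<^bsub>G\<^esub> k'" using Fex A by blast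
    show "A = A'" using A(3) eqN[OF U k(1,3)] coset_Int_mult[OF H(1) U] k by simp
   qed
   have img: "(\<lambda>A. A <#>\<^bsub>G\<^esub> U) ` F \<subseteq> fib U V g"
   proof
    fix B assume "B \<in> (\<lambda>A. A <#>\<^bsub>G\<^esub> U) ` F"
    then obtain k where k: "k \<in> H" "(H \<inter> U) #>\<^bsub>G\<^esub> k \<in> F" "B = U #>\<^bsub>G\<^esub> k" using Fex coset_Int_mult[OF H(1) U] by fastforce
    thus "B \<in> fib U V g" using fib_iff[OF U V HG[OF k(1)]] Fiff[OF k(1)] h(2) by simp
   qed
   have "(\<Oplus>A\<in>fib U V g. \<theta> U A) = (\<Oplus>A\<in>(\<lambda>A. A <#>\<^bsub>G\<^esub> U) ` F. \<theta> U A)"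
   proof (rule add.finprod_mono_neutral_cong_right[OF fib_finite[OF U] img])
     fix A assume A: "A \<in> fib U V g - (\<lambda>A. A <#>\<^bsub>G\<^esub> U) ` F"
     show "\<theta> U A = \<zero>"
     proof (rule ev0[OF U])
      fix k assume k: "k \<in> H"
      show "A \<noteq> U #>\<^bsub>G\<^esub> k"
      proof
       assume e: "A = U #>\<^bsub>G\<^esub> k"
       hence "(H \<inter> U) #>\<^bsub>G\<^esub> k \<in> F" using A fib_iff[OF U V HG[OF k], of g] Fiff[OF k] h(2) by simp
       hence "A \<in> (\<lambda>A. A <#>\<^bsub>G\<^esub> U) ` F" using e coset_Int_mult[OF H(1) U k] by force
       thus False using A by blast
      qed
     qed
   qed (use tR[OF U] in auto)
   also have "\<dots> = (\<Oplus>A\<in>F. \<theta> U (A <#>\<^bsub>G\<^esub> U))" using inj tR[OF U] by (intro add.finprod_reindex) auto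
   also have "\<dots> = (\<Oplus>A\<in>F. l (H \<inter> U) A)"
   proof (rule add.finprod_cong')
    fix A assume "A \<in> F"
    then obtain k where k: "k \<in> H" "A = (H \<inter> U) #>\<^bsub>G\<^esub> k" using Fex by blast
    show "\<theta> U (A <#>\<^bsub>G\<^esub> U) = l (H \<inter> U) A" using ev[OF U k(1)] coset_Int_mult[OF H(1) U k(1)] k(2) by simp
   qed (use lR[OF U] in auto)
   also have "\<dots> = l (H \<inter> V) ((H \<inter> V) #>\<^bsub>G\<^esub> h)" using I.L_compat[OF l N[OF U] N[OF V(1)] NN, of h] h(1) by (simp add: F_def)
   also have "\<dots> = \<theta> V (V #>\<^bsub>G\<^esub> g)" using ev[OF V(1) h(1)] h(2) by simp
   finally show ?thesis .
  qed
 qed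
 thus "Iwasawa_of_subgroup R G T H l \<in> carrier \<Lambda>" by (simp add: \<theta>_def)
qed

lemma dl_one: "dl \<one> \<one>\<^bsub>G\<^esub> = \<one>\<^bsub>\<Lambda>\<^esub>"
 by (rule ext) (auto simp: dl_def Iwasawa_algebra_def group_ring_def)

lemma dl_add: assumes "c \<in> carrier R" "d \<in> carrier R" "g \<in> carrier G" shows "dl (c \<oplus> d) g = dl c g \<oplus>\<^bsub>\<Lambda>\<^esub> dl d g"
 by (rule L_eqI) (use assms in auto)

lemma dl_zero: assumes "g \<in> carrier G" shows "dl \<zero> g = \<zero>\<^bsub>\<Lambda>\<^esub>"
 by (rule L_eqI) (use assms in auto)

lemma dl_dl: "[|c \<in> carrier R; d \<in> carrier R; g \<in> carrier G; h \<in> carrier G|] ==> dl c g \<otimes>\<^bsub>\<Lambda>\<^esub> dl d h = dl (c \<otimes> d) (g \<otimes>\<^bsub>G\<^esub> h)"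
 by (simp add: dl_mult act_dl)

end

lemma restrict_scalars_simps [simp]: "carrier (restrict_scalars f M) = carrier M" "\<zero>\<^bsub>restrict_scalars f M\<^esub> = \<zero>\<^bsub>M\<^esub>"
 "x \<oplus>\<^bsub>restrict_scalars f M\<^esub> y = x \<oplus>\<^bsub>M\<^esub> y" "a \<odot>\<^bsub>restrict_scalars f M\<^esub> x = f a \<odot>\<^bsub>M\<^esub> x"
 by (simp_all add: restrict_scalars_def)

lemma abelian_group_restrict_scalars: assumes "abelian_group M" shows "abelian_group (restrict_scalars f M)"
proof -
 interpret abelian_group M by (rule assms)
 show ?thesis by (rule abelian_groupI) (auto simp: a_ac intro: l_neg)
qed

locale iwasawa_module = padic_ext p K \<iota> for p and K (structure) and \<iota> +
 fixes G :: "('g, 'y) monoid_scheme" and T :: "'g topology" and H :: "'g set" and M :: "('g set => 'g set => 'a, 'm) module"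
 assumes tgG: "topological_group G T" and cptG: "compact_space T" and H_normal: "H \<lhd> G" and H_closed: "closedin T H"
  and M: "left_module (Iwasawa_algebra (ring_of_integers p K \<iota>) G T) M"
  and fg: "finitely_generated_module (Iwasawa_algebra (ring_of_integers p K \<iota>) (G\<lparr>carrier := H\<rparr>) (subtopology T H))
      (restrict_scalars (Iwasawa_of_subgroup (ring_of_integers p K \<iota>) G T H) M)"
begin

abbreviation \<AA> where "\<AA> \<equiv> Iwasawa_algebra \<O> G T"
abbreviation \<theta> where "\<theta> \<equiv> Iwasawa_of_subgroup \<O> G T H"
abbreviation MH where "MH \<equiv> restrict_scalars \<theta> M"

lemma H_subgroup: "subgroup H G" using normal_imp_subgroup[OF H_normal] .
lemma HG: "h \<in> H ==> h \<in> carrier G" using subgroup.subset[OF H_subgroup] by blast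

sublocale \<Lambda>: iwasawa "ring_of_integers p K \<iota>" G T
proof (intro iwasawa.intro iwasawa_axioms.intro tgG cptG)
 interpret D: domain "ring_of_integers p K \<iota>" by (rule O_domain)
 show "cring (ring_of_integers p K \<iota>)" by (rule D.is_cring)
 show "group G" using tgG by (simp add: topological_group_def)
 show "\<one>\<^bsub>ring_of_integers p K \<iota>\<^esub> \<noteq> \<zero>\<^bsub>ring_of_integers p K \<iota>\<^esub>" using D.one_not_zero .
qed

sublocale Md: left_module "Iwasawa_algebra (ring_of_integers p K \<iota>) G T" M by (rule M)

abbreviation dl where "dl \<equiv> \<Lambda>.dl"

definition ZM :: "(padic, 'm) module" where "ZM = Zp_scalars (ring_of_integers p K \<iota>) \<iota> G T M"

lemma ZM_simps [simp]: "carrier ZM = carrier M" "\<zero>\<^bsub>ZM\<^esub> = \<zero>\<^bsub>M\<^esub>" "x \<oplus>\<^bsub>ZM\<^esub> y = x \<oplus>\<^bsub>M\<^esub> y"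
 "a \<odot>\<^bsub>ZM\<^esub> x = dl (\<iota> a) \<one>\<^bsub>G\<^esub> \<odot>\<^bsub>M\<^esub> x"
 by (simp_all add: ZM_def Zp_scalars_def \<Lambda>.of_scalar_dl)
lemma ZM_minus [simp]: "\<ominus>\<^bsub>ZM\<^esub> x = \<ominus>\<^bsub>M\<^esub> x" "x \<ominus>\<^bsub>ZM\<^esub> y = x \<ominus>\<^bsub>M\<^esub> y"
 by (simp_all add: a_minus_def a_inv_def m_inv_def)

lemma dlL: "c \<in> carrier \<O> ==> g \<in> carrier G ==> dl c g \<in> carrier \<AA>" by (rule \<Lambda>.dl_closed)
lemma dlM [simp]: "c \<in> carrier \<O> ==> g \<in> carrier G ==> m \<in> carrier M ==> dl c g \<odot>\<^bsub>M\<^esub> m \<in> carrier M"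
 by (rule Md.smult_closed[OF dlL])
lemma dl_smult: "[|c \<in> carrier \<O>; d \<in> carrier \<O>; g \<in> carrier G; h \<in> carrier G; m \<in> carrier M|] ==>
  dl c g \<odot>\<^bsub>M\<^esub> (dl d h \<odot>\<^bsub>M\<^esub> m) = dl (c \<otimes> d) (g \<otimes>\<^bsub>G\<^esub> h) \<odot>\<^bsub>M\<^esub> m"
 using Md.smult_assoc[OF dlL dlL, of c g d h m] \<Lambda>.dl_dl[of c d g h] by simp
lemma dl_r_distr: "[|c \<in> carrier \<O>; g \<in> carrier G; m \<in> carrier M; m' \<in> carrier M|] ==>
  dl c g \<odot>\<^bsub>M\<^esub> (m \<oplus>\<^bsub>M\<^esub> m') = dl c g \<odot>\<^bsub>M\<^esub> m \<oplus>\<^bsub>M\<^esub> dl c g \<odot>\<^bsub>M\<^esub> m'"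
 by (rule Md.smult_r_distr[OF dlL])
lemma dl_l_distr: "[|c \<in> carrier \<O>; d \<in> carrier \<O>; g \<in> carrier G; m \<in> carrier M|] ==>
  dl (c \<oplus> d) g \<odot>\<^bsub>M\<^esub> m = dl c g \<odot>\<^bsub>M\<^esub> m \<oplus>\<^bsub>M\<^esub> dl d g \<odot>\<^bsub>M\<^esub> m"
 using Md.smult_l_distr[OF dlL dlL, of c g d g m] \<Lambda>.dl_add[of c d g] by simp
lemma O_one: "\<one> \<in> carrier \<O>" using iota_integral[OF Z.one_closed] by simp
lemma dl_1 [simp]: "m \<in> carrier M ==> dl \<one> \<one>\<^bsub>G\<^esub> \<odot>\<^bsub>M\<^esub> m = m"
 using Md.smult_one[of m] \<Lambda>.dl_one by simp
lemma G1 [simp]: "\<one>\<^bsub>G\<^esub> \<in> carrier G" by (rule \<Lambda>.G.one_closed)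

sublocale ZM: zmod p ZM
proof (intro zmod.intro module.intro padic_axioms module_axioms.intro)
 show "cring (Zp p)" by (rule Z.is_cring)
 show "abelian_group ZM" unfolding ZM_def Zp_scalars_def by (rule abelian_group_restrict_scalars) (rule Md.M.abelian_group_axioms)
qed (auto simp: iota_integral dl_smult dl_r_distr dl_l_distr I.hom_add I.hom_mult Z_closed)

definition \<sigma> :: "'g => 'm => 'm" where "\<sigma> g m = dl \<one> g \<odot>\<^bsub>M\<^esub> m"

lemma sigma_closed [simp]: "g \<in> carrier G ==> m \<in> carrier M ==> \<sigma> g m \<in> carrier M"
 using O_one by (simp add: \<sigma>_def)
lemma sigma_add: "g \<in> carrier G ==> m \<in> carrier M ==> m' \<in> carrier M ==> \<sigma> g (m \<oplus>\<^bsub>M\<^esub> m') = \<sigma> g m \<oplus>\<^bsub>M\<^esub> \<sigma> g m'"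
 using O_one by (simp add: \<sigma>_def dl_r_distr)
lemma sigma_scalar: "g \<in> carrier G ==> m \<in> carrier M ==> a \<in> carrier Z ==> \<sigma> g (a \<odot>\<^bsub>ZM\<^esub> m) = a \<odot>\<^bsub>ZM\<^esub> \<sigma> g m"
 using O_one iota_integral[of a] O_K by (simp add: \<sigma>_def dl_smult)
lemma sigma_eq: "Iwasawa_of_elem \<O> G T g \<odot>\<^bsub>M\<^esub> m = \<sigma> g m" by (simp add: \<Lambda>.of_elem_dl \<sigma>_def)

lemma smult_zero: assumes "m \<in> carrier M" shows "\<zero>\<^bsub>\<AA>\<^esub> \<odot>\<^bsub>M\<^esub> m = \<zero>\<^bsub>M\<^esub>"
proof -
 have c: "\<zero>\<^bsub>\<AA>\<^esub> \<odot>\<^bsub>M\<^esub> m \<in> carrier M" using Md.smult_closed \<Lambda>.L.zero_closed assms by blast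
 have "\<zero>\<^bsub>\<AA>\<^esub> \<odot>\<^bsub>M\<^esub> m \<oplus>\<^bsub>M\<^esub> \<zero>\<^bsub>\<AA>\<^esub> \<odot>\<^bsub>M\<^esub> m = \<zero>\<^bsub>\<AA>\<^esub> \<odot>\<^bsub>M\<^esub> m"
  using Md.smult_l_distr[OF \<Lambda>.L.zero_closed \<Lambda>.L.zero_closed assms] by simp
 thus ?thesis using c Md.M.add.r_cancel_one by blast
qed

lemma smult_diff:
 assumes "a \<in> carrier \<AA>" "b \<in> carrier \<AA>" "m \<in> carrier M"
 shows "(a \<ominus>\<^bsub>\<AA>\<^esub> b) \<odot>\<^bsub>M\<^esub> m = a \<odot>\<^bsub>M\<^esub> m \<ominus>\<^bsub>M\<^esub> b \<odot>\<^bsub>M\<^esub> m"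
proof -
 define d where "d = a \<ominus>\<^bsub>\<AA>\<^esub> b"
 have d: "d \<in> carrier \<AA>" using assms by (simp add: d_def)
 have "a = d \<oplus>\<^bsub>\<AA>\<^esub> b" using assms by (simp add: d_def a_minus_def \<Lambda>.L.a_assoc \<Lambda>.L.l_neg)
 hence "a \<odot>\<^bsub>M\<^esub> m = d \<odot>\<^bsub>M\<^esub> m \<oplus>\<^bsub>M\<^esub> b \<odot>\<^bsub>M\<^esub> m" using Md.smult_l_distr[OF d assms(2,3)] by simp
 thus ?thesis unfolding d_def[symmetric] using Md.smult_closed[OF d assms(3)] Md.smult_closed[OF assms(2,3)]
  by (simp add: a_minus_def Md.M.a_assoc Md.M.r_neg)
qed

lemma finsum_zspan:
 assumes "finite F" "\<And>s. s \<in> F ==> f s \<in> carrier \<AA>" "\<And>s. s \<in> F ==> f s \<odot>\<^bsub>M\<^esub> m \<in> ZM.zspan Y" "m \<in> carrier M"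
 shows "(\<Oplus>\<^bsub>\<AA>\<^esub>s\<in>F. f s) \<odot>\<^bsub>M\<^esub> m \<in> ZM.zspan Y"
 using assms(1-3)
proof (induct F rule: finite_induct)
 case empty thus ?case using ZM.zspan_zero[of Y] smult_zero[OF assms(4)] by simp
next
 case (insert s F)
 have e: "(\<Oplus>\<^bsub>\<AA>\<^esub>s\<in>insert s F. f s) = f s \<oplus>\<^bsub>\<AA>\<^esub> (\<Oplus>\<^bsub>\<AA>\<^esub>s\<in>F. f s)"
  using insert by (intro \<Lambda>.L.finsum_insert) auto
 have c: "f s \<in> carrier \<AA>" "(\<Oplus>\<^bsub>\<AA>\<^esub>s\<in>F. f s) \<in> carrier \<AA>"
  using insert by (auto intro!: \<Lambda>.L.finsum_closed)
 show ?case unfolding e Md.smult_l_distr[OF c assms(4)]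
  using ZM.zspan_add[of "f s \<odot>\<^bsub>M\<^esub> m" Y "(\<Oplus>\<^bsub>\<AA>\<^esub>s\<in>F. f s) \<odot>\<^bsub>M\<^esub> m"] insert by auto
qed

lemma iwasawa_complete: "iwasawa_complete \<O> G T (\<pi> 1) p"
proof (intro iwasawa_complete.intro iwasawa_complete_axioms.intro \<Lambda>.iwasawa_axioms)
 have pw: "x [^]\<^bsub>\<O>\<^esub> n = x [^] n" for x and n :: nat by (induct n) simp_all
 have pin: "\<pi> 1 [^]\<^bsub>\<O>\<^esub> n = \<pi> n" for n using pi_pow[of 1 n] pw by simp
 show "\<pi> 1 \<in> carrier \<O>" by simp
 show "add_pow \<O> p x = \<pi> 1 \<otimes>\<^bsub>\<O>\<^esub> x" if x: "x \<in> carrier \<O>" for x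
 proof -
  have xK: "x \<in> carrier K" using x O_K by blast
  have "add_pow \<O> n x = \<iota> (rc (of_nat n)) \<otimes> x" for n
  proof (induct n)
   case 0 show ?case using xK by (simp add: rc_0 I.hom_zero)
  next
   case (Suc n)
   have "\<iota> (rc (of_nat (Suc n))) = \<iota> (rc (of_nat n)) \<oplus> \<one>" by (simp add: rc_add rc_1 I.hom_add add.commute[of 1])
   moreover have "\<iota> (rc (of_nat n)) \<in> carrier K" by simp
   ultimately show ?case using Suc xK by (simp add: K.l_distr)
  qed
  thus ?thesis by (simp add: \<pi>_def)
 qed
 show "\<exists>y\<in>carrier \<O>. \<forall>n. \<exists>t\<in>carrier \<O>. y = f n \<oplus>\<^bsub>\<O>\<^esub> \<pi> 1 [^]\<^bsub>\<O>\<^esub> n \<otimes>\<^bsub>\<O>\<^esub> t"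
  if "\<And>n::nat. f n \<in> carrier \<O>" "\<And>n. \<exists>t\<in>carrier \<O>. f (Suc n) = f n \<oplus>\<^bsub>\<O>\<^esub> \<pi> 1 [^]\<^bsub>\<O>\<^esub> n \<otimes>\<^bsub>\<O>\<^esub> t" for f
  using O_complete[of f] that unfolding pin by simp
 show "x = \<zero>\<^bsub>\<O>\<^esub>" if "x \<in> carrier \<O>" "\<And>n::nat. \<exists>t\<in>carrier \<O>. x = \<pi> 1 [^]\<^bsub>\<O>\<^esub> n \<otimes>\<^bsub>\<O>\<^esub> t" for x
  using pi_separated[of x] that O_K unfolding pin by simp
qed

definition aug :: "'g set => 'm set" where "aug U = {\<sigma> v m \<ominus>\<^bsub>M\<^esub> m | v m. v \<in> H \<inter> U \<and> m \<in> carrier M}"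

theorem generated_modulo_aug:
 assumes fil: "iwasawa_filtration \<O> G T (\<pi> 1) p H S B W" and SU: "S \<subseteq> U"
 shows "\<exists>E. finite E \<and> E \<subseteq> carrier M \<and> (\<forall>y\<in>carrier M. y \<in> ZM.zspan (E \<union> aug U))"
proof -
 interpret F: iwasawa_filtration "\<O>" G T "\<pi> 1" p H S B W by (rule fil)
 obtain F0 where F0: "finite F0" "F0 \<subseteq> H" "\<And>x. [|x \<in> carrier \<AA>; F.Hs x|] ==>
   \<exists>c\<in>F0 \<rightarrow> carrier \<O>. \<exists>D\<in>S \<rightarrow> carrier \<AA>. x = (\<Oplus>\<^bsub>\<AA>\<^esub>h\<in>F0. dl (c h) h) \<oplus>\<^bsub>\<AA>\<^esub> F.\<Delta> D"
  using F.H_supported_decomposition by blast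
 obtain EO where EO: "finite EO" "EO \<subseteq> carrier \<O>" "carrier \<O> = KM.zspan EO" using O_finitely_generated by blast
 define Em where "Em m = (\<lambda>(o', h). dl o' h \<odot>\<^bsub>M\<^esub> m) ` (EO \<times> F0)" for m
 have key: "x \<odot>\<^bsub>M\<^esub> m \<in> ZM.zspan (Em m \<union> aug U)" if x: "x \<in> carrier \<AA>" "F.Hs x" and m: "m \<in> carrier M" for x m
 proof -
  from F0(3)[OF x] obtain c D where c: "c \<in> F0 \<rightarrow> carrier \<O>" and D: "D \<in> S \<rightarrow> carrier \<AA>"
   and xe: "x = (\<Oplus>\<^bsub>\<AA>\<^esub>h\<in>F0. dl (c h) h) \<oplus>\<^bsub>\<AA>\<^esub> F.\<Delta> D" by (elim bexE) (rule that)
  have cO: "c h \<in> carrier \<O>" if "h \<in> F0" for h using c that by blast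
  have DL: "D s \<in> carrier \<AA>" if "s \<in> S" for s using D that by blast
  have FG: "h \<in> carrier G" if "h \<in> F0" for h using F0(2) HG that by blast
  have t1: "dl k h \<odot>\<^bsub>M\<^esub> m \<in> ZM.zspan (Em m \<union> aug U)" if k: "k \<in> carrier \<O>" and h: "h \<in> F0" for k h
  proof -
   have hG: "h \<in> carrier G" using FG[OF h] .
   have "k \<in> KM.zspan EO" using k EO by simp
   hence "k \<in> {k \<in> carrier \<O>. dl k h \<odot>\<^bsub>M\<^esub> m \<in> ZM.zspan (Em m \<union> aug U)}"
   proof (rule KM.zspan_least)
    show "\<zero>\<^bsub>KM\<^esub> \<in> {k \<in> carrier \<O>. dl k h \<odot>\<^bsub>M\<^esub> m \<in> ZM.zspan (Em m \<union> aug U)}"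
     using \<Lambda>.dl_zero[OF hG] smult_zero[OF m] ZM.zspan_zero[of "Em m \<union> aug U"] \<Lambda>.zero_closed by simp
   next
    fix a o' assume a: "a \<in> carrier Z" and o': "o' \<in> EO"
    have oO: "o' \<in> carrier \<O>" using o' EO by blast
    have "a \<odot>\<^bsub>ZM\<^esub> (dl o' h \<odot>\<^bsub>M\<^esub> m) \<in> ZM.zspan (Em m \<union> aug U)"
     using o' h dlM[OF oO hG m] by (intro ZM.zspan_smult ZM.zspan_incl a) (auto simp: Em_def)
    moreover have "a \<odot>\<^bsub>ZM\<^esub> (dl o' h \<odot>\<^bsub>M\<^esub> m) = dl (a \<odot>\<^bsub>KM\<^esub> o') h \<odot>\<^bsub>M\<^esub> m" using dl_smult[OF iota_integral[OF a] oO G1 hG m] hG by simp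
    moreover have "a \<odot>\<^bsub>KM\<^esub> o' \<in> carrier \<O>" using \<Lambda>.m_closed[OF iota_integral[OF a] oO] by simp
    ultimately show "a \<odot>\<^bsub>KM\<^esub> o' \<in> {k \<in> carrier \<O>. dl k h \<odot>\<^bsub>M\<^esub> m \<in> ZM.zspan (Em m \<union> aug U)}" by simp
   next
    fix x y assume "x \<in> {k \<in> carrier \<O>. dl k h \<odot>\<^bsub>M\<^esub> m \<in> ZM.zspan (Em m \<union> aug U)}" "y \<in> {k \<in> carrier \<O>. dl k h \<odot>\<^bsub>M\<^esub> m \<in> ZM.zspan (Em m \<union> aug U)}"
    hence xy: "x \<in> carrier \<O>" "y \<in> carrier \<O>" "dl x h \<odot>\<^bsub>M\<^esub> m \<in> ZM.zspan (Em m \<union> aug U)" "dl y h \<odot>\<^bsub>M\<^esub> m \<in> ZM.zspan (Em m \<union> aug U)" by auto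
    have "dl (x \<oplus> y) h \<odot>\<^bsub>M\<^esub> m \<in> ZM.zspan (Em m \<union> aug U)" using ZM.zspan_add[OF xy(3,4)] dl_l_distr[OF xy(1,2) hG m] by simp
    thus "x \<oplus>\<^bsub>KM\<^esub> y \<in> {k \<in> carrier \<O>. dl k h \<odot>\<^bsub>M\<^esub> m \<in> ZM.zspan (Em m \<union> aug U)}" using \<Lambda>.a_closed[OF xy(1,2)] by simp
   qed
   thus ?thesis by blast
  qed
  have s1: "(\<Oplus>\<^bsub>\<AA>\<^esub>h\<in>F0. dl (c h) h) \<odot>\<^bsub>M\<^esub> m \<in> ZM.zspan (Em m \<union> aug U)"
   using F0(1) dlL[OF cO FG] t1[OF cO] m by (intro finsum_zspan) auto
  have s2: "F.\<Delta> D \<odot>\<^bsub>M\<^esub> m \<in> ZM.zspan (Em m \<union> aug U)" unfolding F.\<Delta>_def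
  proof (rule finsum_zspan[OF F.S(1) _ _ m])
   fix s assume s: "s \<in> S"
   have sG: "s \<in> carrier G" using F.SG[OF s] .
   have ac: "\<Lambda>.act \<one>\<^bsub>\<O>\<^esub> s (D s) = dl \<one> s \<otimes>\<^bsub>\<AA>\<^esub> D s" using \<Lambda>.dl_mult[OF _ sG DL[OF s]] O_one by simp
   have aL: "\<Lambda>.act \<one>\<^bsub>\<O>\<^esub> s (D s) \<in> carrier \<AA>" using \<Lambda>.act_closed[OF _ sG DL[OF s]] O_one by simp
   show "\<Lambda>.act \<one>\<^bsub>\<O>\<^esub> s (D s) \<ominus>\<^bsub>\<AA>\<^esub> D s \<in> carrier \<AA>" using aL DL[OF s] by (rule \<Lambda>.L.minus_closed)
   have y: "D s \<odot>\<^bsub>M\<^esub> m \<in> carrier M" using Md.smult_closed[OF DL[OF s] m] .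
   have "(\<Lambda>.act \<one>\<^bsub>\<O>\<^esub> s (D s) \<ominus>\<^bsub>\<AA>\<^esub> D s) \<odot>\<^bsub>M\<^esub> m = \<sigma> s (D s \<odot>\<^bsub>M\<^esub> m) \<ominus>\<^bsub>M\<^esub> D s \<odot>\<^bsub>M\<^esub> m"
    unfolding smult_diff[OF aL DL[OF s] m] unfolding ac \<sigma>_def using Md.smult_assoc[OF dlL[OF O_one sG] DL[OF s] m] by simp
   moreover have "\<sigma> s (D s \<odot>\<^bsub>M\<^esub> m) \<ominus>\<^bsub>M\<^esub> D s \<odot>\<^bsub>M\<^esub> m \<in> Em m \<union> aug U" using s SU F.S(2) y by (auto simp: aug_def)
   moreover have "\<sigma> s (D s \<odot>\<^bsub>M\<^esub> m) \<ominus>\<^bsub>M\<^esub> D s \<odot>\<^bsub>M\<^esub> m \<in> carrier ZM" using y sG by simp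
   ultimately show "(\<Lambda>.act \<one>\<^bsub>\<O>\<^esub> s (D s) \<ominus>\<^bsub>\<AA>\<^esub> D s) \<odot>\<^bsub>M\<^esub> m \<in> ZM.zspan (Em m \<union> aug U)"
    using ZM.zspan_incl by metis
  qed
  have c1: "(\<Oplus>\<^bsub>\<AA>\<^esub>h\<in>F0. dl (c h) h) \<in> carrier \<AA>" using dlL[OF cO FG] by (intro \<Lambda>.L.finsum_closed) auto
  have c2: "F.\<Delta> D \<in> carrier \<AA>" using DL by (rule F.Delta_closed)
  show ?thesis unfolding xe Md.smult_l_distr[OF c1 c2 m] using ZM.zspan_add[OF s1 s2] by simp
 qed
 obtain S0 where S0: "finite S0" "S0 \<subseteq> carrier M" and gen: "\<And>y. y \<in> carrier M ==>
   \<exists>c\<in>S0 \<rightarrow> carrier (Iwasawa_algebra \<O> (G\<lparr>carrier := H\<rparr>) (subtopology T H)).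
    y = (\<Oplus>\<^bsub>MH\<^esub>s\<in>S0. c s \<odot>\<^bsub>MH\<^esub> s)"
  using fg unfolding finitely_generated_module_def by auto
 interpret FM: abelian_group MH
  by (rule abelian_group_restrict_scalars) (rule Md.M.abelian_group_axioms)
 define E where "E = (\<Union>m\<in>S0. Em m)"
 have Emc: "Em m \<subseteq> carrier M" if "m \<in> carrier M" for m using that EO(2) F0(2) HG by (auto simp: Em_def intro!: dlM)
 have "y \<in> ZM.zspan (E \<union> aug U)" if y: "y \<in> carrier M" for y
 proof -
  from gen[OF y] obtain c where c: "c \<in> S0 \<rightarrow> carrier (Iwasawa_algebra \<O> (G\<lparr>carrier := H\<rparr>) (subtopology T H))"
    and ye: "y = (\<Oplus>\<^bsub>MH\<^esub>s\<in>S0. c s \<odot>\<^bsub>MH\<^esub> s)" by (elim bexE) (rule that)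
  have tm: "c s \<odot>\<^bsub>MH\<^esub> s \<in> ZM.zspan (E \<union> aug U)" if s: "s \<in> S0" for s
  proof -
   have cs: "c s \<in> carrier (Iwasawa_algebra \<O> (G\<lparr>carrier := H\<rparr>) (subtopology T H))" using c s by blast
   have sM: "s \<in> carrier M" using s S0 by blast
   have "F.Hs (\<theta> (c s))" unfolding F.Hs_def using \<Lambda>.of_subgroup_closed(2)[OF H_subgroup H_closed cs] by blast
   from key[OF \<Lambda>.of_subgroup_closed(1)[OF H_subgroup H_closed cs] this sM]
   have "\<theta> (c s) \<odot>\<^bsub>M\<^esub> s \<in> ZM.zspan (E \<union> aug U)" by (rule ZM.zspan_mono[rotated]) (use s in \<open>auto simp: E_def\<close>)
   thus ?thesis by simp
  qed
  have "(\<Oplus>\<^bsub>MH\<^esub>s\<in>A. c s \<odot>\<^bsub>MH\<^esub> s) \<in> ZM.zspan (E \<union> aug U)"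
   if "finite A" "A \<subseteq> S0" for A using that
  proof (induct A rule: finite_induct)
   case empty thus ?case using ZM.zspan_zero by simp
  next
   case (insert s A)
   have cl: "c s \<odot>\<^bsub>MH\<^esub> s \<in> carrier M" if "s \<in> S0" for s using ZM.zspan_carrier[OF tm[OF that]] by simp
   have "(\<Oplus>\<^bsub>MH\<^esub>s\<in>insert s A. c s \<odot>\<^bsub>MH\<^esub> s) =
     c s \<odot>\<^bsub>MH\<^esub> s \<oplus>\<^bsub>MH\<^esub>
     (\<Oplus>\<^bsub>MH\<^esub>s\<in>A. c s \<odot>\<^bsub>MH\<^esub> s)"
    using insert cl by (intro FM.finsum_insert) (auto simp del: restrict_scalars_simps(4))
   moreover have "s \<in> S0" "A \<subseteq> S0" using insert by auto
   ultimately show ?case using ZM.zspan_add[OF tm insert(3)] by (simp del: restrict_scalars_simps(4))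
  qed
  from this[OF S0(1) order_refl] show ?thesis unfolding ye .
 qed
 moreover have "finite E" using S0(1) EO(1) F0(1) by (simp add: E_def Em_def)
 moreover have "E \<subseteq> carrier M" using Emc S0(2) by (auto simp: E_def)
 ultimately show ?thesis by blast
qed

end

section \<open>Twists and coinvariants\<close>

context iwasawa_module
begin

definition RZ :: "(padic, padic) module" where "RZ = regular_module (Zp p)"
definition FA :: "('m \<times> padic \<Rightarrow>\<^sub>0 int) monoid" where "FA = free_Abelian_group (carrier M \<times> carrier Z)"
definition TR :: "('m \<times> padic \<Rightarrow>\<^sub>0 int) set" where "TR = tensor_relations (Zp p) ZM RZ"
definition tens :: "'m => ('m \<times> padic \<Rightarrow>\<^sub>0 int) set" where "tens m = TR #>\<^bsub>FA\<^esub> frag_of (m, \<^bold>1)"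
abbreviation TW where "TW \<equiv> twist p \<O> \<iota> G T M"

lemma RZ_simps [simp]: "carrier RZ = carrier Z" "x \<oplus>\<^bsub>RZ\<^esub> y = x \<^bold>+ y" "x \<odot>\<^bsub>RZ\<^esub> y = x \<^bold>* y"
 by (simp_all add: RZ_def regular_module_def)

sublocale FA: comm_group FA unfolding FA_def by (rule abelian_free_Abelian_group)

lemma FA_simps [simp]: "x \<otimes>\<^bsub>FA\<^esub> y = x + y" "\<one>\<^bsub>FA\<^esub> = 0" by (simp_all add: FA_def)
lemma FA_minus: "x \<in> carrier FA ==> inv\<^bsub>FA\<^esub> x = - x" by (simp add: FA_def)
lemma FA_frag [simp]: "frag_of (m, a) \<in> carrier FA \<longleftrightarrow> m \<in> carrier M \<and> a \<in> carrier Z" by (simp add: FA_def)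
lemma FA_add: "x \<in> carrier FA ==> y \<in> carrier FA ==> x + y \<in> carrier FA" using FA.m_closed by fastforce
lemma FA_uminus: "x \<in> carrier FA ==> - x \<in> carrier FA" using FA.inv_closed FA_minus by metis
lemma FA_diff: "x \<in> carrier FA ==> y \<in> carrier FA ==> x - y \<in> carrier FA" using FA_add[OF _ FA_uminus] by fastforce

inductive_set rels :: "('m \<times> padic \<Rightarrow>\<^sub>0 int) set" where
 "[|x \<in> carrier M; x' \<in> carrier M; y \<in> carrier Z|] ==> frag_of (x \<oplus>\<^bsub>M\<^esub> x', y) - frag_of (x, y) - frag_of (x', y) \<in> rels"
| "[|x \<in> carrier M; y \<in> carrier Z; y' \<in> carrier Z|] ==> frag_of (x, y \<^bold>+ y') - frag_of (x, y) - frag_of (x, y') \<in> rels"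
| "[|a \<in> carrier Z; x \<in> carrier M; y \<in> carrier Z|] ==> frag_of (a \<odot>\<^bsub>ZM\<^esub> x, y) - frag_of (x, a \<^bold>* y) \<in> rels"

lemma TR_generate: "TR = generate FA rels"
proof -
 have "rels = {frag_of (x \<oplus>\<^bsub>ZM\<^esub> x', y) - frag_of (x, y) - frag_of (x', y) | x x' y.
     x \<in> carrier ZM \<and> x' \<in> carrier ZM \<and> y \<in> carrier RZ} \<union>
    {frag_of (x, y \<oplus>\<^bsub>RZ\<^esub> y') - frag_of (x, y) - frag_of (x, y') | x y y'.
     x \<in> carrier ZM \<and> y \<in> carrier RZ \<and> y' \<in> carrier RZ} \<union>
    {frag_of (a \<odot>\<^bsub>ZM\<^esub> x, y) - frag_of (x, a \<odot>\<^bsub>RZ\<^esub> y) | a x y.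
     a \<in> carrier Z \<and> x \<in> carrier ZM \<and> y \<in> carrier RZ}" (is "_ = ?r")
  by (rule Set.set_eqI) (simp only: rels.simps Un_iff mem_Collect_eq ZM_simps(1,3) RZ_simps, blast)
 thus ?thesis unfolding TR_def tensor_relations_def FA_def by simp
qed

lemma rels_FA: "rels \<subseteq> carrier FA"
 using ZM.smult_closed by (auto elim!: rels.cases intro!: FA_diff)

lemma TR_subgroup: "subgroup TR FA" unfolding TR_generate by (rule FA.generate_is_subgroup[OF rels_FA])

sublocale TR: normal TR FA by (rule FA.subgroup_imp_normal[OF TR_subgroup])

lemma TW_eq: "TW = FA Mod TR"
 by (simp add: twist_def tensor_product_def FA_def TR_def ZM_def[symmetric] RZ_def[symmetric])

sublocale TW: comm_group TW unfolding TW_eq by (rule FA.abelian_FactGroup[OF TR_subgroup])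

lemma TW_carrier: "carrier TW = (\<lambda>x. TR #>\<^bsub>FA\<^esub> x) ` carrier FA" by (auto simp: TW_eq FactGroup_def RCOSETS_def)
lemma TW_mult: "x \<in> carrier FA ==> y \<in> carrier FA ==> (TR #>\<^bsub>FA\<^esub> x) \<otimes>\<^bsub>TW\<^esub> (TR #>\<^bsub>FA\<^esub> y) = TR #>\<^bsub>FA\<^esub> (x + y)"
 using TR.rcos_sum[of x y] by (simp add: TW_eq FactGroup_def)
lemma TW_one: "\<one>\<^bsub>TW\<^esub> = TR #>\<^bsub>FA\<^esub> 0" using FA.coset_mult_one[OF TR.subset] by (simp add: TW_eq FactGroup_def)
lemma TW_inv: assumes x: "x \<in> carrier FA" shows "inv\<^bsub>TW\<^esub> (TR #>\<^bsub>FA\<^esub> x) = TR #>\<^bsub>FA\<^esub> (- x)"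
 using TW_mult[OF FA_uminus[OF x] x] FA_uminus[OF x] x by (intro TW.inv_equality) (auto simp: TW_one TW_carrier)

lemma TR_coset_eq: assumes "x - y \<in> TR" "y \<in> carrier FA" shows "TR #>\<^bsub>FA\<^esub> x = TR #>\<^bsub>FA\<^esub> y"
proof -
 have "x = (x - y) \<otimes>\<^bsub>FA\<^esub> y" by simp
 hence "x \<in> TR #>\<^bsub>FA\<^esub> y" using assms(1) unfolding r_coset_def by blast
 thus ?thesis using FA.repr_independence[OF _ assms(2) TR_subgroup] by simp
qed

lemma rels_TR: "x \<in> rels ==> x \<in> TR" unfolding TR_generate by (rule generate.incl)

lemma tens_closed [simp]: "m \<in> carrier M ==> tens m \<in> carrier TW" by (auto simp: TW_carrier tens_def)

lemma tens_add: assumes "m \<in> carrier M" "m' \<in> carrier M" shows "tens (m \<oplus>\<^bsub>M\<^esub> m') = tens m \<otimes>\<^bsub>TW\<^esub> tens m'"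
proof -
 have "frag_of (m \<oplus>\<^bsub>M\<^esub> m', \<^bold>1) - (frag_of (m, \<^bold>1) + frag_of (m', \<^bold>1)) \<in> TR"
  using rels_TR[OF rels.intros(1)[OF assms, of "\<^bold>1"]] by (simp add: diff_diff_eq)
 thus ?thesis unfolding tens_def using assms by (subst TW_mult) (auto intro!: TR_coset_eq FA_add)
qed

lemma tens_zero: "tens \<zero>\<^bsub>M\<^esub> = \<one>\<^bsub>TW\<^esub>"
 using tens_add[of "\<zero>\<^bsub>M\<^esub>" "\<zero>\<^bsub>M\<^esub>"] TW.r_cancel_one[of "tens \<zero>\<^bsub>M\<^esub>" "tens \<zero>\<^bsub>M\<^esub>"] by simp

lemma tens_diff: assumes "m \<in> carrier M" "m' \<in> carrier M" shows "tens (m \<ominus>\<^bsub>M\<^esub> m') = tens m \<otimes>\<^bsub>TW\<^esub> inv\<^bsub>TW\<^esub> tens m'"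
proof -
 have "tens (m \<ominus>\<^bsub>M\<^esub> m') \<otimes>\<^bsub>TW\<^esub> tens m' = tens m"
  using assms tens_add[of "m \<ominus>\<^bsub>M\<^esub> m'" m'] by (simp add: a_minus_def Md.M.a_assoc Md.M.l_neg)
 thus ?thesis using assms TW.inv_solve_right[of "tens (m \<ominus>\<^bsub>M\<^esub> m')" "tens m" "tens m'"] by simp
qed

lemma tens_scalar: assumes "m \<in> carrier M" "a \<in> carrier Z" shows "TR #>\<^bsub>FA\<^esub> frag_of (m, a) = tens (a \<odot>\<^bsub>ZM\<^esub> m)"
proof -
 have "frag_of (a \<odot>\<^bsub>ZM\<^esub> m, \<^bold>1) - frag_of (m, a) \<in> TR"
  using rels_TR[OF rels.intros(3)[OF assms(2,1), of "\<^bold>1"]] assms(2) Z_closed by simp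
 thus ?thesis unfolding tens_def using assms by (intro TR_coset_eq[symmetric]) auto
qed

lemma tens_surj: assumes "t \<in> carrier TW" shows "\<exists>m\<in>carrier M. t = tens m"
proof -
 obtain x where x: "x \<in> carrier FA" "t = TR #>\<^bsub>FA\<^esub> x" using assms by (auto simp: TW_carrier)
 have "Poly_Mapping.keys x \<subseteq> carrier M \<times> carrier Z" using x(1) by (simp add: FA_def)
 hence "x \<in> carrier FA \<and> (\<exists>m\<in>carrier M. TR #>\<^bsub>FA\<^esub> x = tens m)"
 proof (induct rule: frag_induction)
  case zero
  show ?case using tens_zero TW_one FA.one_closed by (auto intro!: bexI[of _ "\<zero>\<^bsub>M\<^esub>"])
 next
  case (one s)
  thus ?case using tens_scalar[of "fst s" "snd s"] ZM.smult_closed[of "snd s" "fst s"] by (cases s) auto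
 next
  case (diff a b)
  then obtain m m' where m: "m \<in> carrier M" "m' \<in> carrier M" "TR #>\<^bsub>FA\<^esub> a = tens m" "TR #>\<^bsub>FA\<^esub> b = tens m'" "a \<in> carrier FA" "b \<in> carrier FA" by blast
  have "TR #>\<^bsub>FA\<^esub> (a - b) = tens (m \<ominus>\<^bsub>M\<^esub> m')"
   unfolding tens_diff[OF m(1,2)] m(3,4)[symmetric] TW_inv[OF m(6)] using TW_mult[OF m(5) FA_uminus[OF m(6)]] by simp
  thus ?case using m FA_diff by (intro conjI bexI[of _ "m \<ominus>\<^bsub>M\<^esub> m'"]) auto
 qed
 thus ?thesis using x(2) by blast
qed

lemma twist_action_tens:
 assumes g: "g \<in> carrier G" and m: "m \<in> carrier M" and \<psi>: "\<psi> g \<in> carrier Z"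
 shows "twist_action p \<O> \<iota> G T M \<psi> g (tens m) = tens (\<psi> g \<odot>\<^bsub>ZM\<^esub> \<sigma> g m)"
proof -
 define F where "F = frag_extend (\<lambda>(x, y). frag_of (\<sigma> g x, \<psi> g \<^bold>* y))"
 have Fof: "F (frag_of (x, y)) = frag_of (\<sigma> g x, \<psi> g \<^bold>* y)" for x y by (simp add: F_def)
 have Fadd: "F (a + b) = F a + F b" and Fdiff: "F (a - b) = F a - F b" and Fminus: "F (- a) = - F a" and F0: "F 0 = 0" for a b
  by (simp_all add: F_def frag_extend_add frag_extend_diff frag_extend_minus)
 have \<psi>Q: "\<psi> g \<in> carrier Q" using \<psi> by auto
 have rel: "F t \<in> rels" if "t \<in> rels" for t using that
 proof cases
  case (1 x x' y)
  show ?thesis unfolding 1(1) Fdiff Fof sigma_add[OF g 1(2,3)] using 1 g \<psi> by (intro rels.intros) auto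
 next
  case (2 x y y')
  have "\<psi> g \<^bold>* (y \<^bold>+ y') = \<psi> g \<^bold>* y \<^bold>+ \<psi> g \<^bold>* y'" using 2 \<psi>Q Z_closed by (simp add: Q.r_distr)
  thus ?thesis unfolding 2(1) Fdiff Fof using 2 g \<psi> rels.intros(2)[of "\<sigma> g x" "\<psi> g \<^bold>* y" "\<psi> g \<^bold>* y'"] by simp
 next
  case (3 a x y)
  have "\<psi> g \<^bold>* (a \<^bold>* y) = a \<^bold>* (\<psi> g \<^bold>* y)" using 3 \<psi>Q Z_closed by (simp add: Q.m_lcomm)
  thus ?thesis unfolding 3(1) Fdiff Fof sigma_scalar[OF g 3(3,2)] using 3 g \<psi> rels.intros(3)[of a "\<sigma> g x" "\<psi> g \<^bold>* y"] by simp
 qed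
 have FTR: "F t \<in> TR" if "t \<in> TR" for t using that unfolding TR_generate
 proof (induct rule: generate.induct)
  case one show ?case using F0 generate.one[of FA rels] by simp
 next
  case (incl h) show ?case by (rule generate.incl[OF rel[OF incl]])
 next
  case (inv h)
  have "inv\<^bsub>FA\<^esub> F h \<in> generate FA rels" using rel[OF inv] by (rule generate.inv)
  moreover have "F h \<in> carrier FA" "h \<in> carrier FA" using rel[OF inv] inv rels_FA by auto
  ultimately show ?case using FA_minus Fminus by simp
 next
  case (eng h1 h2)
  thus ?case using generate.eng[of "F h1" FA rels "F h2"] Fadd by simp
 qed
 define r where "r = frag_of (m, \<^bold>1)"
 have Fr: "F r = frag_of (\<sigma> g m, \<psi> g)" unfolding r_def Fof using \<psi>Q by simp
 have "twist_action p \<O> \<iota> G T M \<psi> g (tens m) = TR <#>\<^bsub>FA\<^esub> F ` tens m"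
  by (simp add: twist_action_def tensor_map_def F_def FA_def TR_def ZM_def[symmetric] RZ_def[symmetric] sigma_eq)
 also have "\<dots> = TR #>\<^bsub>FA\<^esub> F r"
 proof
  show "TR <#>\<^bsub>FA\<^esub> F ` tens m \<subseteq> TR #>\<^bsub>FA\<^esub> F r"
  proof
   fix z assume "z \<in> TR <#>\<^bsub>FA\<^esub> F ` tens m"
   then obtain h t where ht: "h \<in> TR" "t \<in> TR" "z = h + F (t + r)" by (auto simp: set_mult_def tens_def r_coset_def r_def)
   hence "z = (h \<otimes>\<^bsub>FA\<^esub> F t) \<otimes>\<^bsub>FA\<^esub> F r" "h \<otimes>\<^bsub>FA\<^esub> F t \<in> TR" using Fadd TR.m_closed[OF ht(1) FTR[OF ht(2)]] by (auto simp: add.assoc)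
   thus "z \<in> TR #>\<^bsub>FA\<^esub> F r" unfolding r_coset_def by blast
  qed
  show "TR #>\<^bsub>FA\<^esub> F r \<subseteq> TR <#>\<^bsub>FA\<^esub> F ` tens m"
  proof
   fix z assume "z \<in> TR #>\<^bsub>FA\<^esub> F r"
   then obtain h where h: "h \<in> TR" "z = h \<otimes>\<^bsub>FA\<^esub> F r" unfolding r_coset_def by blast
   have "r = 0 \<otimes>\<^bsub>FA\<^esub> r" "0 \<in> TR" using TR.one_closed by auto
   hence "r \<in> tens m" unfolding tens_def r_coset_def r_def[symmetric] by blast
   thus "z \<in> TR <#>\<^bsub>FA\<^esub> F ` tens m" using h unfolding set_mult_def by blast
  qed
 qed
 also have "\<dots> = tens (\<psi> g \<odot>\<^bsub>ZM\<^esub> \<sigma> g m)" unfolding Fr using tens_scalar[OF sigma_closed[OF g m] \<psi>] .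
 finally show ?thesis .
qed

definition coinv_rels :: "('g => padic) => 'g set => 'm set" where
 "coinv_rels \<psi> U = {\<psi> w \<odot>\<^bsub>ZM\<^esub> \<sigma> w m \<ominus>\<^bsub>M\<^esub> m | w m. w \<in> U \<and> m \<in> carrier M}"

lemma finite_coinvariants:
 assumes \<psi>: "\<And>g. g \<in> carrier G ==> \<psi> g \<in> carrier Z" and U: "U \<subseteq> carrier G"
  and L: "finite L" "L \<subseteq> carrier M" "\<And>m. m \<in> carrier M ==> \<exists>l\<in>L. m \<ominus>\<^bsub>M\<^esub> l \<in> ZM.zspan (coinv_rels \<psi> U)"
 shows "finite (carrier (coinvariants G TW (twist_action p \<O> \<iota> G T M \<psi>) U))"
proof -
 define ac where "ac = twist_action p \<O> \<iota> G T M \<psi>"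
 have act: "ac g (tens m) = tens (\<psi> g \<odot>\<^bsub>ZM\<^esub> \<sigma> g m)" if "g \<in> carrier G" "m \<in> carrier M" for g m
  unfolding ac_def using that \<psi> by (intro twist_action_tens) auto
 define FF where "FF = {N. subgroup N TW \<and> (\<forall>g\<in>carrier G. \<forall>x\<in>N. ac g x \<in> N) \<and>
       (\<forall>u\<in>U. \<forall>x\<in>carrier TW. ac u x \<otimes>\<^bsub>TW\<^esub> inv\<^bsub>TW\<^esub> x \<in> N)}"
 define N where "N = \<Inter>FF"
 have acc: "ac g x \<in> carrier TW" if "g \<in> carrier G" "x \<in> carrier TW" for g x
  using tens_surj[OF that(2)] act[OF that(1)] ZM.smult_closed[OF \<psi>[OF that(1)]] sigma_closed[OF that(1)]
  by auto
 have "carrier TW \<in> FF" unfolding FF_def using TW.subgroup_self acc U by auto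
 moreover have "subgroup A TW" if "A \<in> FF" for A using that by (simp add: FF_def)
 ultimately have N: "subgroup N TW" unfolding N_def by (intro TW.subgroups_Inter) auto
 interpret N: normal N TW by (rule TW.subgroup_imp_normal[OF N])
 have NU: "ac u x \<otimes>\<^bsub>TW\<^esub> inv\<^bsub>TW\<^esub> x \<in> N" if "u \<in> U" "x \<in> carrier TW" for u x
  unfolding N_def by (rule InterI) (use that in \<open>simp add: FF_def\<close>)
 have sp: "tens y \<in> N" if y: "y \<in> ZM.zspan (coinv_rels \<psi> U)" for y
 proof -
  have "y \<in> {y \<in> carrier M. tens y \<in> N}" using y
  proof (rule ZM.zspan_least)
   show "\<zero>\<^bsub>ZM\<^esub> \<in> {y \<in> carrier M. tens y \<in> N}" using N.one_closed tens_zero by simp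
  next
   fix a x assume a: "a \<in> carrier Z" and "x \<in> coinv_rels \<psi> U"
   then obtain w m where w: "w \<in> U" "m \<in> carrier M" "x = \<psi> w \<odot>\<^bsub>ZM\<^esub> \<sigma> w m \<ominus>\<^bsub>M\<^esub> m" by (auto simp: coinv_rels_def)
   have wG: "w \<in> carrier G" using w U by blast
   have \<psi>w: "\<psi> w \<in> carrier Z" using \<psi>[OF wG] .
   define n where "n = a \<odot>\<^bsub>ZM\<^esub> m"
   have n: "n \<in> carrier M" using ZM.smult_closed[OF a, of m] w(2) by (simp add: n_def del: ZM_simps(4))
   have s: "\<sigma> w m \<in> carrier ZM" "m \<in> carrier ZM" using w wG by auto
   have am: "a \<^bold>* \<psi> w = \<psi> w \<^bold>* a" using a \<psi>w Z_closed Q.m_comm by blast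
   have "a \<odot>\<^bsub>ZM\<^esub> x = a \<odot>\<^bsub>ZM\<^esub> (\<psi> w \<odot>\<^bsub>ZM\<^esub> \<sigma> w m \<ominus>\<^bsub>ZM\<^esub> m)" by (simp add: w(3) del: ZM_simps(4))
   also have "\<dots> = (a \<^bold>* \<psi> w) \<odot>\<^bsub>ZM\<^esub> \<sigma> w m \<ominus>\<^bsub>ZM\<^esub> a \<odot>\<^bsub>ZM\<^esub> m"
    using a \<psi>w s ZM.smult_closed[OF \<psi>w s(1)] by (simp add: a_minus_def ZM.smult_r_distr ZM.smult_r_minus ZM.smult_assoc_Q del: ZM_simps ZM_minus)
   also have "(a \<^bold>* \<psi> w) \<odot>\<^bsub>ZM\<^esub> \<sigma> w m = \<psi> w \<odot>\<^bsub>ZM\<^esub> \<sigma> w n"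
    unfolding am n_def sigma_scalar[OF wG w(2) a] by (rule ZM.smult_assoc_Q(1)[OF \<psi>w a s(1)])
   finally have ax: "a \<odot>\<^bsub>ZM\<^esub> x = \<psi> w \<odot>\<^bsub>ZM\<^esub> \<sigma> w n \<ominus>\<^bsub>M\<^esub> n" by (simp add: n_def del: ZM_simps(4))
   have c: "\<psi> w \<odot>\<^bsub>ZM\<^esub> \<sigma> w n \<in> carrier M" using ZM.smult_closed[OF \<psi>w, of "\<sigma> w n"] n wG by (simp del: ZM_simps(4))
   have "tens (a \<odot>\<^bsub>ZM\<^esub> x) = ac w (tens n) \<otimes>\<^bsub>TW\<^esub> inv\<^bsub>TW\<^esub> tens n" unfolding ax tens_diff[OF c n] act[OF wG n] ..
   hence "tens (a \<odot>\<^bsub>ZM\<^esub> x) \<in> N" using NU[OF w(1) tens_closed[OF n]] by simp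
   moreover have "a \<odot>\<^bsub>ZM\<^esub> x \<in> carrier M" unfolding ax using c n by simp
   ultimately show "a \<odot>\<^bsub>ZM\<^esub> x \<in> {y \<in> carrier M. tens y \<in> N}" by blast
  next
   fix x y assume "x \<in> {y \<in> carrier M. tens y \<in> N}" "y \<in> {y \<in> carrier M. tens y \<in> N}"
   thus "x \<oplus>\<^bsub>ZM\<^esub> y \<in> {y \<in> carrier M. tens y \<in> N}" using tens_add N.m_closed by simp
  qed
  thus ?thesis by blast
 qed
 have "carrier (TW Mod N) \<subseteq> (\<lambda>l. N #>\<^bsub>TW\<^esub> tens l) ` L"
 proof
  fix C assume "C \<in> carrier (TW Mod N)"
  then obtain t where t: "t \<in> carrier TW" "C = N #>\<^bsub>TW\<^esub> t" by (auto simp: FactGroup_def RCOSETS_def)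
  obtain m where m: "m \<in> carrier M" "t = tens m" using tens_surj[OF t(1)] by blast
  obtain l where l: "l \<in> L" "m \<ominus>\<^bsub>M\<^esub> l \<in> ZM.zspan (coinv_rels \<psi> U)" using L(3)[OF m(1)] by blast
  have lM: "l \<in> carrier M" using l(1) L(2) by blast
  have "tens m \<otimes>\<^bsub>TW\<^esub> inv\<^bsub>TW\<^esub> tens l \<in> N" using sp[OF l(2)] tens_diff[OF m(1) lM] by simp
  moreover have "tens m = (tens m \<otimes>\<^bsub>TW\<^esub> inv\<^bsub>TW\<^esub> tens l) \<otimes>\<^bsub>TW\<^esub> tens l" using m(1) lM by (simp add: TW.m_assoc)
  ultimately have "tens m \<in> N #>\<^bsub>TW\<^esub> tens l" unfolding r_coset_def by blast
  hence "C = N #>\<^bsub>TW\<^esub> tens l" using TW.repr_independence[OF _ tens_closed[OF lM] N] t(2) m(2) by simp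
  thus "C \<in> (\<lambda>l. N #>\<^bsub>TW\<^esub> tens l) ` L" using l(1) by blast
 qed
 hence "finite (carrier (TW Mod N))" using L(1) finite_surj by blast
 thus ?thesis by (simp only: coinvariants_def N_def FF_def ac_def)
qed

theorem finitely_many_bad_values:
 assumes fil: "iwasawa_filtration \<O> G T (\<pi> 1) p H S B W" and SU: "S \<subseteq> U" and u: "u \<in> U" "u \<in> carrier G"
 shows "\<exists>Bad. finite Bad \<and> (\<forall>\<psi> U'. (\<forall>g\<in>carrier G. \<psi> g \<in> carrier UU) --> (\<forall>h\<in>H. \<psi> h = \<^bold>1) --> U \<subseteq> U' --> U' \<subseteq> carrier G -->
  \<psi> u \<notin> Bad --> finite (carrier (coinvariants G TW (twist_action p \<O> \<iota> G T M \<psi>) U')))"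
proof -
 from generated_modulo_aug[OF fil SU] obtain E where E0: "finite E \<and> E \<subseteq> carrier M \<and> (\<forall>y\<in>carrier M. y \<in> ZM.zspan (E \<union> aug U))" ..
 hence E: "finite E" "E \<subseteq> carrier M" "\<And>y. y \<in> carrier M ==> y \<in> ZM.zspan (E \<union> aug U)" by auto
 have augM: "aug U \<subseteq> carrier ZM" using HG by (auto simp: aug_def)
 have "\<exists>Bad. finite Bad \<and> (\<forall>b\<in>carrier Z - Bad. \<forall>Y. aug U \<subseteq> ZM.zspan Y --> (\<forall>m\<in>carrier ZM. \<sigma> u m \<ominus>\<^bsub>ZM\<^esub> b \<odot>\<^bsub>ZM\<^esub> m \<in> ZM.zspan Y) -->
  (\<exists>L. finite L \<and> L \<subseteq> carrier ZM \<and> (\<forall>m\<in>carrier ZM. \<exists>l\<in>L. m \<ominus>\<^bsub>ZM\<^esub> l \<in> ZM.zspan Y)))"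
  by (rule ZM.finite_quotient_for_almost_all[OF E(1) _ augM]) (use E u in auto)
 then obtain Bad where Bad: "finite Bad" "\<And>b Y. [|b \<in> carrier Z - Bad; aug U \<subseteq> ZM.zspan Y; \<forall>m\<in>carrier M. \<sigma> u m \<ominus>\<^bsub>M\<^esub> b \<odot>\<^bsub>ZM\<^esub> m \<in> ZM.zspan Y|] ==>
  \<exists>L. finite L \<and> L \<subseteq> carrier M \<and> (\<forall>m\<in>carrier M. \<exists>l\<in>L. m \<ominus>\<^bsub>M\<^esub> l \<in> ZM.zspan Y)" by (auto simp del: ZM_simps(4))
 show ?thesis
 proof (intro exI[of _ "(\<lambda>b. inv\<^bsub>Q\<^esub> b) ` Bad"] conjI allI impI)
  show "finite ((\<lambda>b. inv\<^bsub>Q\<^esub> b) ` Bad)" using Bad(1) by simp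
  fix \<psi> U' assume \<psi>: "\<forall>g\<in>carrier G. \<psi> g \<in> carrier UU" "\<forall>h\<in>H. \<psi> h = \<^bold>1" and U': "U \<subseteq> U'" "U' \<subseteq> carrier G"
   and nb: "\<psi> u \<notin> (\<lambda>b. inv\<^bsub>Q\<^esub> b) ` Bad"
  define c where "c = \<psi> u"
  have c: "c \<in> carrier Q" "nrm c = 1" using \<psi>(1) u(2) UU_carrier by (auto simp: c_def)
  have c0: "c \<noteq> \<^bold>0" using c(2) by auto
  define b where "b = inv\<^bsub>Q\<^esub> c"
  have b: "b \<in> carrier Q" "c \<^bold>* b = \<^bold>1" using nrm_inv(1,2)[OF c(1) c0] by (auto simp: b_def)
  have "nrm c * nrm b = 1" using nrm_mult[OF c(1) b(1)] b(2) nrm_one by simp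
  hence bZ: "b \<in> carrier Z" using b(1) c(2) by (simp add: Z_carrier)
  have b0: "b \<noteq> \<^bold>0" using b(2) c(1) by auto
  have "inv\<^bsub>Q\<^esub> b = c" using Q.inv_char[of b c] b c Q.m_comm[OF b(1) c(1)] by simp
  hence bb: "b \<in> carrier Z - Bad" using bZ nb by (auto simp: c_def)
  have \<psi>Z: "\<psi> g \<in> carrier Z" if "g \<in> carrier G" for g using \<psi>(1) that UU_Z by blast
  have 1: "aug U \<subseteq> ZM.zspan (coinv_rels \<psi> U')"
  proof
   fix x assume "x \<in> aug U"
   then obtain v m where v: "v \<in> H" "v \<in> U" "m \<in> carrier M" "x = \<sigma> v m \<ominus>\<^bsub>M\<^esub> m" by (auto simp: aug_def)
   have sv: "\<sigma> v m \<in> carrier M" using v HG by simp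
   hence "x = \<psi> v \<odot>\<^bsub>ZM\<^esub> \<sigma> v m \<ominus>\<^bsub>M\<^esub> m" using v(1,4) \<psi>(2) ZM.smult_one_Q(1)[of "\<sigma> v m"] by (simp del: ZM_simps(4))
   hence "x \<in> coinv_rels \<psi> U'" using v U' by (auto simp: coinv_rels_def simp del: ZM_simps(4))
   thus "x \<in> ZM.zspan (coinv_rels \<psi> U')" using sv v by (intro ZM.zspan_incl) auto
  qed
  have 2: "\<sigma> u m \<ominus>\<^bsub>M\<^esub> b \<odot>\<^bsub>ZM\<^esub> m \<in> ZM.zspan (coinv_rels \<psi> U')" if m: "m \<in> carrier M" for m
  proof -
   have s: "\<sigma> u m \<in> carrier ZM" "m \<in> carrier ZM" using m u by auto
   have cZ: "c \<in> carrier Z" using \<psi>Z[OF u(2)] by (simp add: c_def)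
   have cs: "c \<odot>\<^bsub>ZM\<^esub> \<sigma> u m \<in> carrier ZM" using ZM.smult_closed[OF cZ s(1)] .
   have "c \<odot>\<^bsub>ZM\<^esub> \<sigma> u m \<ominus>\<^bsub>M\<^esub> m \<in> coinv_rels \<psi> U'" using m u U' unfolding coinv_rels_def c_def by blast
   hence "c \<odot>\<^bsub>ZM\<^esub> \<sigma> u m \<ominus>\<^bsub>M\<^esub> m \<in> ZM.zspan (coinv_rels \<psi> U')" using cs m by (intro ZM.zspan_incl) (auto simp del: ZM_simps(4))
   hence "b \<odot>\<^bsub>ZM\<^esub> (c \<odot>\<^bsub>ZM\<^esub> \<sigma> u m \<ominus>\<^bsub>ZM\<^esub> m) \<in> ZM.zspan (coinv_rels \<psi> U')" using ZM.zspan_smult bZ by (simp del: ZM_simps(4))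
   moreover have "b \<odot>\<^bsub>ZM\<^esub> (c \<odot>\<^bsub>ZM\<^esub> \<sigma> u m \<ominus>\<^bsub>ZM\<^esub> m) = (b \<^bold>* c) \<odot>\<^bsub>ZM\<^esub> \<sigma> u m \<ominus>\<^bsub>ZM\<^esub> b \<odot>\<^bsub>ZM\<^esub> m"
    using bZ cZ s cs by (simp add: a_minus_def ZM.smult_r_distr ZM.smult_r_minus ZM.smult_assoc_Q del: ZM_simps ZM_minus)
   moreover have "b \<^bold>* c = \<^bold>1" using b c Q.m_comm by metis
   ultimately show ?thesis using ZM.smult_one_Q(1)[OF s(1)] by (simp del: ZM_simps(4))
  qed
  obtain L where "finite L" "L \<subseteq> carrier M" "\<forall>m\<in>carrier M. \<exists>l\<in>L. m \<ominus>\<^bsub>M\<^esub> l \<in> ZM.zspan (coinv_rels \<psi> U')" using Bad(2)[OF bb 1] 2 by blast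
  thus "finite (carrier (coinvariants G TW (twist_action p \<O> \<iota> G T M \<psi>) U'))" using \<psi>Z U'(2) by (intro finite_coinvariants) auto
 qed
qed

end

lemma openin_quotient_group_top:
 assumes top: "topspace T = carrier G"
 shows "openin (quotient_group_top G T H) W \<longleftrightarrow> W \<subseteq> carrier (G Mod H) \<and> openin T {g \<in> carrier G. H #>\<^bsub>G\<^esub> g \<in> W}"
proof -
 have "istopology (\<lambda>W. W \<subseteq> carrier (G Mod H) \<and> openin T {g \<in> carrier G. H #>\<^bsub>G\<^esub> g \<in> W})"
  unfolding istopology_def
 proof (intro conjI allI impI)
  fix A B assume A: "A \<subseteq> carrier (G Mod H) \<and> openin T {g \<in> carrier G. H #>\<^bsub>G\<^esub> g \<in> A}"
   and B: "B \<subseteq> carrier (G Mod H) \<and> openin T {g \<in> carrier G. H #>\<^bsub>G\<^esub> g \<in> B}"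
  show "A \<inter> B \<subseteq> carrier (G Mod H)" using A by blast
  have "{g \<in> carrier G. H #>\<^bsub>G\<^esub> g \<in> A \<inter> B} = {g \<in> carrier G. H #>\<^bsub>G\<^esub> g \<in> A} \<inter> {g \<in> carrier G. H #>\<^bsub>G\<^esub> g \<in> B}" by blast
  thus "openin T {g \<in> carrier G. H #>\<^bsub>G\<^esub> g \<in> A \<inter> B}" using A B by (simp only: openin_Int)
 next
  fix F assume F: "\<forall>A\<in>F. A \<subseteq> carrier (G Mod H) \<and> openin T {g \<in> carrier G. H #>\<^bsub>G\<^esub> g \<in> A}"
  show "\<Union>F \<subseteq> carrier (G Mod H)" using F by blast
  have "{g \<in> carrier G. H #>\<^bsub>G\<^esub> g \<in> \<Union>F} = (\<Union>A\<in>F. {g \<in> carrier G. H #>\<^bsub>G\<^esub> g \<in> A})" by blast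
  thus "openin T {g \<in> carrier G. H #>\<^bsub>G\<^esub> g \<in> \<Union>F}" using F by auto
 qed
 thus ?thesis unfolding quotient_group_top_def by (simp add: topology_inverse')
qed

lemma openin_image_quotient:
 assumes tg: "topological_group G T" and H: "subgroup H G" and U: "openin T U"
 shows "openin (quotient_group_top G T H) ((\<lambda>u. H #>\<^bsub>G\<^esub> u) ` U)"
proof -
 interpret G: group G using tg by (simp add: topological_group_def)
 have top: "topspace T = carrier G" using tg by (simp add: topological_group_def)
 have UG: "U \<subseteq> carrier G" using openin_subset[OF U] top by simp
 have HG: "H \<subseteq> carrier G" using subgroup.subset[OF H] .
 have "{g \<in> carrier G. H #>\<^bsub>G\<^esub> g \<in> (\<lambda>u. H #>\<^bsub>G\<^esub> u) ` U} = (\<Union>h\<in>H. h <#\<^bsub>G\<^esub> U)"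
 proof (intro Set.set_eqI iffI)
  fix g assume "g \<in> {g \<in> carrier G. H #>\<^bsub>G\<^esub> g \<in> (\<lambda>u. H #>\<^bsub>G\<^esub> u) ` U}"
  then obtain u where u: "g \<in> carrier G" "u \<in> U" "H #>\<^bsub>G\<^esub> g = H #>\<^bsub>G\<^esub> u" by blast
  hence "g \<in> H #>\<^bsub>G\<^esub> u" using G.rcos_self[OF u(1) H] by simp
  thus "g \<in> (\<Union>h\<in>H. h <#\<^bsub>G\<^esub> U)" using u(2) by (auto simp: r_coset_def l_coset_def)
 next
  fix g assume "g \<in> (\<Union>h\<in>H. h <#\<^bsub>G\<^esub> U)"
  then obtain h u where hu: "h \<in> H" "u \<in> U" "g = h \<otimes>\<^bsub>G\<^esub> u" by (auto simp: l_coset_def)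
  have c: "h \<in> carrier G" "u \<in> carrier G" using hu HG UG by auto
  have "g \<in> H #>\<^bsub>G\<^esub> u" using hu unfolding r_coset_def by blast
  hence "H #>\<^bsub>G\<^esub> u = H #>\<^bsub>G\<^esub> g" using G.repr_independence[OF _ c(2) H] by blast
  thus "g \<in> {g \<in> carrier G. H #>\<^bsub>G\<^esub> g \<in> (\<lambda>u. H #>\<^bsub>G\<^esub> u) ` U}" using hu c by auto
 qed
 moreover have "openin T (\<Union>h\<in>H. h <#\<^bsub>G\<^esub> U)" using open_rcoset(2)[OF tg U] HG by (intro openin_Union) auto
 moreover have "(\<lambda>u. H #>\<^bsub>G\<^esub> u) ` U \<subseteq> carrier (G Mod H)" using UG HG by (auto simp: FactGroup_def intro: G.rcosetsI)
 ultimately show ?thesis unfolding openin_quotient_group_top[OF top] by simp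
qed

context iwasawa_module
begin

lemma filtration_exists:
 assumes Lie: "padic_Lie_group p G T"
 shows "\<forall>U\<in>open_normal G T. \<exists>S B W. iwasawa_filtration \<O> G T (\<pi> 1) p H S B W \<and> S \<subseteq> U"
  and "\<exists>N :: nat => 'g set. (\<forall>j. N j \<in> open_normal G T) \<and> (\<forall>U\<in>open_normal G T. \<exists>j. N j \<subseteq> U)"
proof -
 from Lie_group_chart[OF Lie] obtain n W0 \<phi> a c k0 k1 B where ch: "additive_chart p G n W0 \<phi> a c k0 k1 B"
  and opB: "\<And>k. openin T (B k)" and base: "\<And>V. openin T V ==> \<one>\<^bsub>G\<^esub> \<in> V ==> \<exists>k. B k \<subseteq> V" by (elim exE conjE) (rule that, auto)
 interpret C: additive_chart p G n W0 \<phi> a c k0 k1 B by (rule ch)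
 have "\<exists>N. k1 \<le> j --> N \<in> open_normal G T \<and> N \<subseteq> B j" for j
  using open_subgroup_contains_normal[OF tgG cptG opB C.B_subgroup, of j] by blast
 then obtain core where core: "\<And>j. k1 \<le> j ==> core j \<in> open_normal G T \<and> core j \<subseteq> B j" by metis
 have baseU: "\<exists>k. B k \<subseteq> U" if "U \<in> open_normal G T" for U
  using base[of U] subgroup.one_closed[OF \<Lambda>.U_subgroup[OF that]] that by (simp add: open_normal_def)
 have cap: "U \<inter> V \<in> open_normal G T" if "U \<in> open_normal G T" "V \<in> open_normal G T" for U V
  using that \<Lambda>.G.normal_subgroup_intersect[of U V] openin_Int by (auto simp: open_normal_def)
 show "\<forall>U\<in>open_normal G T. \<exists>S B W. iwasawa_filtration \<O> G T (\<pi> 1) p H S B W \<and> S \<subseteq> U"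
 proof
  fix U assume U: "U \<in> open_normal G T"
  obtain k' where k': "B k' \<subseteq> U" using baseU[OF U] by blast
  from C.subgroup_power_representatives[OF H_subgroup, of k'] obtain k S where k: "k' \<le> k" "k1 \<le> k" and S: "finite S" "S \<subseteq> H \<inter> B k"
   and S1: "\<forall>j. \<forall>s\<in>S. s [^]\<^bsub>G\<^esub> (p ^ j) \<in> B (k + j)"
   and S2: "\<forall>j. \<forall>v\<in>H \<inter> B (k + j). \<exists>s\<in>S. inv\<^bsub>G\<^esub> (s [^]\<^bsub>G\<^esub> (p ^ j)) \<otimes>\<^bsub>G\<^esub> v \<in> B (Suc (k + j))" by (elim exE conjE) (rule that)
  define W where "W = rec_nat (core k) (\<lambda>n w. w \<inter> core (k + Suc n))"
  have W0: "W 0 = core k" and WS: "W (Suc n) = W n \<inter> core (k + Suc n)" for n by (simp_all add: W_def)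
  have Wo: "W n \<in> open_normal G T" for n by (induct n) (use core k cap in \<open>auto simp: W0 WS\<close>)
  have WB: "W n \<subseteq> B (k + n)" for n
  proof (cases n)
   case 0 thus ?thesis using core[of k] k by (simp add: W0)
  next
   case (Suc m) thus ?thesis using core[of "k + Suc m"] k by (auto simp: WS)
  qed
  have "iwasawa_filtration \<O> G T (\<pi> 1) p H S (\<lambda>j. B (k + j)) W"
  proof (intro iwasawa_filtration.intro iwasawa_complete iwasawa_filtration_axioms.intro H_subgroup)
   show "\<exists>j. B (k + j) \<subseteq> V" if V: "V \<in> open_normal G T" for V
   proof -
    obtain i where "B i \<subseteq> V" using baseU[OF V] by blast
    thus ?thesis using C.B_mono[of i "k + i"] by auto
   qed
   show "B (k + Suc j) \<subseteq> B (k + j)" for j by (rule C.B_mono) simp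
  qed (use S S1 S2 Wo WB in \<open>auto simp: WS\<close>)
  moreover have "S \<subseteq> U" using S(2) C.B_mono[OF k(1)] k' by blast
  ultimately show "\<exists>S B W. iwasawa_filtration \<O> G T (\<pi> 1) p H S B W \<and> S \<subseteq> U" by blast
 qed
 show "\<exists>N :: nat => 'g set. (\<forall>j. N j \<in> open_normal G T) \<and> (\<forall>U\<in>open_normal G T. \<exists>j. N j \<subseteq> U)"
 proof (intro exI[of _ "\<lambda>j. core (k1 + j)"] conjI allI ballI)
  show "core (k1 + j) \<in> open_normal G T" for j using core by simp
  fix U assume U: "U \<in> open_normal G T"
  obtain k where k: "B k \<subseteq> U" using baseU[OF U] by blast
  have "core (k1 + k) \<subseteq> B (k1 + k)" using core by simp
  thus "\<exists>j. core (k1 + j) \<subseteq> U" using C.B_mono[of k "k1 + k"] k by (intro exI[of _ k]) auto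
 qed
qed

lemma open_subgroup_moves:
 assumes odd: "odd p" and Syl: "profinite_Sylow p UU (Zp_units_top p) \<Gamma>"
  and iso: "top_group_iso (G Mod H) (quotient_group_top G T H) (UU\<lparr>carrier := \<Gamma>\<rparr>) (subtopology (Zp_units_top p) \<Gamma>) \<phi>"
  and U: "U \<in> open_normal G T"
 shows "\<exists>u\<in>U. \<phi> (H #>\<^bsub>G\<^esub> u) \<noteq> \<^bold>1"
proof -
 have sub: "subgroup \<Gamma> UU" using Syl by (simp add: profinite_Sylow_def)
 have hom: "\<phi> \<in> hom (G Mod H) (UU\<lparr>carrier := \<Gamma>\<rparr>)" using iso by (simp add: top_group_iso_def iso_def)
 interpret UG: group "UU\<lparr>carrier := \<Gamma>\<rparr>" using UU.subgroup_imp_group[OF sub] .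
 interpret GH: group "G Mod H" using normal.factorgroup_is_group[OF H_normal] .
 interpret h: group_hom "G Mod H" "UU\<lparr>carrier := \<Gamma>\<rparr>" \<phi> using hom by unfold_locales
 define V where "V = (\<lambda>u. H #>\<^bsub>G\<^esub> u) ` U"
 have "openin (quotient_group_top G T H) V" unfolding V_def using U by (intro openin_image_quotient[OF tgG H_subgroup]) (simp add: open_normal_def)
 hence "openin (subtopology (Zp_units_top p) \<Gamma>) (\<phi> ` V)"
  using iso homeomorphic_imp_open_map unfolding top_group_iso_def open_map_def by blast
 then obtain O' where O': "openin (Zp_units_top p) O'" "\<phi> ` V = O' \<inter> \<Gamma>" unfolding openin_subtopology by blast
 have "H #>\<^bsub>G\<^esub> \<one>\<^bsub>G\<^esub> = H" using \<Lambda>.G.coset_mult_one[OF subgroup.subset[OF H_subgroup]] .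
 hence "\<one>\<^bsub>G Mod H\<^esub> \<in> V" using subgroup.one_closed[OF \<Lambda>.U_subgroup[OF U]] unfolding V_def by (auto simp: FactGroup_def intro!: image_eqI[of _ _ "\<one>\<^bsub>G\<^esub>"])
 hence "\<^bold>1 \<in> O'" using h.hom_one O'(2) by (auto intro: rev_image_eqI)
 then obtain k where k: "\<forall>y\<in>carrier UU. nrm (y \<^bold>- \<^bold>1) \<le> q ^ k --> y \<in> O'" using O'(1) unfolding openin_UU by blast
 obtain g where g: "g \<in> \<Gamma>" "g \<noteq> \<^bold>1" "nrm (g \<^bold>- \<^bold>1) \<le> q ^ Suc k" using Sylow_accumulates[OF odd Syl] by blast
 have "q ^ Suc k \<le> q ^ k" using prime_p prime_gt_1_nat[of p] by (intro power_decreasing) (auto simp: q_def)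
 hence "nrm (g \<^bold>- \<^bold>1) \<le> q ^ k" using g(3) by linarith
 hence "g \<in> O'" using k g(1) subgroup.subset[OF sub] by blast
 hence "g \<in> \<phi> ` V" using g O'(2) by blast
 thus ?thesis using g(2) by (auto simp: V_def)
qed

theorem character_exists:
 assumes Lie: "padic_Lie_group p G T" and odd: "odd p" and Syl: "profinite_Sylow p UU (Zp_units_top p) \<Gamma>"
  and iso: "top_group_iso (G Mod H) (quotient_group_top G T H) (UU\<lparr>carrier := \<Gamma>\<rparr>) (subtopology (Zp_units_top p) \<Gamma>) \<phi>"
 shows "\<exists>\<rho>. continuous_character p \<Gamma> \<rho> \<and> (\<forall>U\<in>open_normal G T.
  finite (carrier (coinvariants G TW (twist_action p \<O> \<iota> G T M (\<lambda>g. \<rho> (\<phi> (H #>\<^bsub>G\<^esub> g)))) U)))"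
proof -
 have sub: "subgroup \<Gamma> UU" using Syl by (simp add: profinite_Sylow_def)
 have hom: "\<phi> \<in> hom (G Mod H) (UU\<lparr>carrier := \<Gamma>\<rparr>)" using iso by (simp add: top_group_iso_def iso_def)
 interpret UG: group "UU\<lparr>carrier := \<Gamma>\<rparr>" using UU.subgroup_imp_group[OF sub] .
 interpret GH: group "G Mod H" using normal.factorgroup_is_group[OF H_normal] .
 interpret h: group_hom "G Mod H" "UU\<lparr>carrier := \<Gamma>\<rparr>" \<phi> using hom by unfold_locales
 have cosH: "H #>\<^bsub>G\<^esub> g \<in> carrier (G Mod H)" if "g \<in> carrier G" for g
  using \<Lambda>.G.rcosetsI[OF subgroup.subset[OF H_subgroup] that] by (simp add: FactGroup_def)
 have \<phi>\<Gamma>: "\<phi> (H #>\<^bsub>G\<^esub> g) \<in> \<Gamma>" if "g \<in> carrier G" for g using h.hom_closed[OF cosH[OF that]] by simp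
 have \<Gamma>UK: "x \<in> UK 0" if "x \<in> \<Gamma>" for x using Sylow_close[OF Syl that] subgroup.subset[OF sub] that by (auto simp: UK_def)
 obtain N :: "nat => 'g set" where N: "\<And>j. N j \<in> open_normal G T" "\<And>U. U \<in> open_normal G T ==> \<exists>j. N j \<subseteq> U"
  using filtration_exists(2)[OF Lie] by blast
 have NG: "N j \<subseteq> carrier G" for j using \<Lambda>.U_sub[OF N(1)] .
 have "\<exists>u. u \<in> N j \<and> \<phi> (H #>\<^bsub>G\<^esub> u) \<noteq> \<^bold>1" for j using open_subgroup_moves[OF odd Syl iso N(1)] by blast
 then obtain u where u: "\<And>j. u j \<in> N j" "\<And>j. \<phi> (H #>\<^bsub>G\<^esub> u j) \<noteq> \<^bold>1" by metis
 have uG: "u j \<in> carrier G" for j using u(1) NG by blast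
 define good where "good j Bad \<longleftrightarrow> finite Bad \<and> (\<forall>\<psi> U'. (\<forall>g\<in>carrier G. \<psi> g \<in> carrier UU) --> (\<forall>h\<in>H. \<psi> h = \<^bold>1) --> N j \<subseteq> U' --> U' \<subseteq> carrier G -->
  \<psi> (u j) \<notin> Bad --> finite (carrier (coinvariants G TW (twist_action p \<O> \<iota> G T M \<psi>) U')))" for j Bad
 have "\<exists>Bad. good j Bad" for j
 proof -
  from filtration_exists(1)[OF Lie, THEN bspec, OF N(1), of j] obtain S B W where "iwasawa_filtration \<O> G T (\<pi> 1) p H S B W" "S \<subseteq> N j" by (elim exE conjE)
  thus ?thesis unfolding good_def using u(1) uG by (rule finitely_many_bad_values)
 qed
 then obtain Bad where "\<And>j. good j (Bad j)" by metis
 hence Bad: "\<And>j. finite (Bad j)" "\<And>j \<psi> U'. [|\<forall>g\<in>carrier G. \<psi> g \<in> carrier UU; \<forall>h\<in>H. \<psi> h = \<^bold>1; N j \<subseteq> U'; U' \<subseteq> carrier G; \<psi> (u j) \<notin> Bad j|] ==>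
   finite (carrier (coinvariants G TW (twist_action p \<O> \<iota> G T M \<psi>) U'))" unfolding good_def by simp_all
 define x where "x j = \<phi> (H #>\<^bsub>G\<^esub> u j)" for j
 have "inj (\<lambda>A. chr A (x j))" for j
  using chr_inj[OF odd \<Gamma>UK[OF \<phi>\<Gamma>[OF uG]] u(2)] unfolding x_def by (intro injI)
 hence "finite ((\<lambda>A. chr A (x j)) -` Bad j)" for j using Bad(1) by (intro finite_vimageI)
 hence "countable (\<Union>j. (\<lambda>A. chr A (x j)) -` Bad j)" by (intro countable_UN) (auto intro: countable_finite)
 moreover have "uncountable (UNIV :: nat set set)"
 proof
  assume "countable (UNIV :: nat set set)"
  then obtain f :: "nat => nat set" where "range f = UNIV" using uncountable_def[of "UNIV :: nat set set"] by blast
  thus False using Cantors_theorem[of "UNIV :: nat set"] by (simp add: Pow_UNIV)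
 qed
 ultimately have "(\<Union>j. (\<lambda>A. chr A (x j)) -` Bad j) \<noteq> UNIV" by metis
 then obtain A where A: "\<And>j. chr A (x j) \<notin> Bad j" by blast
 define \<rho> where "\<rho> = chr A"
 have \<rho>: "continuous_character p \<Gamma> \<rho>" unfolding \<rho>_def by (rule chr_continuous[OF odd Syl])
 hence \<rho>h: "\<rho> \<in> hom (UU\<lparr>carrier := \<Gamma>\<rparr>) UU" by (simp add: continuous_character_def)
 interpret r: group_hom "UU\<lparr>carrier := \<Gamma>\<rparr>" UU \<rho> using \<rho>h by unfold_locales
 define \<psi> where "\<psi> g = \<rho> (\<phi> (H #>\<^bsub>G\<^esub> g))" for g
 have \<psi>1: "\<forall>g\<in>carrier G. \<psi> g \<in> carrier UU" using r.hom_closed \<phi>\<Gamma> by (simp add: \<psi>_def)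
 have \<psi>2: "\<forall>h\<in>H. \<psi> h = \<^bold>1"
 proof
  fix h assume h: "h \<in> H"
  have "H #>\<^bsub>G\<^esub> h = \<one>\<^bsub>G Mod H\<^esub>" using subgroup.rcos_const[OF H_subgroup \<Lambda>.G.is_group h] by (simp add: FactGroup_def)
  thus "\<psi> h = \<^bold>1" using h.hom_one r.hom_one by (simp add: \<psi>_def)
 qed
 have "finite (carrier (coinvariants G TW (twist_action p \<O> \<iota> G T M \<psi>) U))" if U: "U \<in> open_normal G T" for U
 proof -
  obtain j where j: "N j \<subseteq> U" using N(2)[OF U] by blast
  have "\<psi> (u j) \<notin> Bad j" using A[of j] by (simp add: \<psi>_def x_def \<rho>_def)
  thus ?thesis using Bad(2)[OF \<psi>1 \<psi>2 j \<Lambda>.U_sub[OF U]] by blast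
 qed
 moreover have "\<psi> = (\<lambda>g. \<rho> (\<phi> (H #>\<^bsub>G\<^esub> g)))" by (simp add: fun_eq_iff \<psi>_def)
 ultimately show ?thesis using \<rho> by (intro exI[of _ \<rho>]) simp
qed

end

theorem mainTheorem1:
  fixes p :: nat
    and \<Gamma> :: "padic set"
    and K :: "('k, 'x) ring_scheme" and \<iota> :: "padic \<Rightarrow> 'k"
    and \<O> :: "('k, 'x) ring_scheme"
    and G :: "('g, 'y) monoid_scheme" and T :: "'g topology"
    and H :: "'g set"
    and \<phi> :: "'g set \<Rightarrow> padic"
    and M :: "('g set \<Rightarrow> 'g set \<Rightarrow> 'k, 'm) module"
  assumes "Factorial_Ring.prime p" and "odd p"
    and "profinite_Sylow p (Zp_units p) (Zp_units_top p) \<Gamma>"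
    and "Qp_finite_extension p K \<iota>"
    and "\<O> = ring_of_integers p K \<iota>"
    and "padic_Lie_group p G T" and "compact_space T"
    and "H \<lhd> G" and "closedin T H"
    and "top_group_iso (G Mod H) (quotient_group_top G T H)
           ((Zp_units p)\<lparr>carrier := \<Gamma>\<rparr>) (subtopology (Zp_units_top p) \<Gamma>) \<phi>"
    and "left_module (Iwasawa_algebra \<O> G T) M"
    and "finitely_generated_module
           (Iwasawa_algebra \<O> (G\<lparr>carrier := H\<rparr>) (subtopology T H))
           (restrict_scalars (Iwasawa_of_subgroup \<O> G T H) M)"
  shows "\<exists>\<rho>. continuous_character p \<Gamma> \<rho> \<and>
    (\<forall>U \<in> open_normal G T.
       finite (carrier (coinvariants G (twist p \<O> \<iota> G T M)
         (twist_action p \<O> \<iota> G T M (\<lambda>g. \<rho> (\<phi> (H #>\<^bsub>G\<^esub> g)))) U)))"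
proof -
  interpret padic p using assms(1) by unfold_locales
  interpret padic_ext p K \<iota> using assms(4) by unfold_locales
  have tg: "topological_group G T" using assms(6) by (simp add: padic_Lie_group_def)
  interpret iwasawa_module p K \<iota> G T H M
    using padic_ext_axioms tg assms(7-9,11,12) unfolding assms(5)
    by (intro iwasawa_module.intro iwasawa_module_axioms.intro)
  show ?thesis unfolding assms(5) by (rule character_exists[OF assms(6,2,3,10)])
qed

end
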